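(* Let $k\ge 1$. For all $v_h\in V_h$ and $\gamma_h\in W_h$, $$\sup_{0\neq(\tau_h,q_h)\in\Sigma_h^+\times Q_h}\frac{b_1(v_h,q_h)+b_2(\tau_h,(v_h,\gamma_h))}{\|\tau_h\|+\|q_h\|}\;\gtrsim\;\|(v_h,\gamma_h)\|_{U_h}.$$ Moreover, if $v_h$ lies in the divergence-free subspace $V_h^0:=\{z_h\in V_h:\operatorname{div}(z_h)=0\}$, then $$\sup_{0\ne\tau_h\in\Sigma_h^+}\frac{b_2(\tau_h,(v_h,\gamma_h))}{\|\tau_h\|}\;\gtrsim\;\|(v_h,\gamma_h)\|_{U_h}.$$
   Context: Setting: $d\in\{2,3\}$, $\Omega\subset\mathbb R^d$ is a bounded Lipschitz domain, $\mathcal T_h$ is a triangulation of $\Omega$ into simplices (triangles/tetrahedra) from a quasi-uniform family, $h$ is the maximal element diameter, $\mathcal F_h$ is the set of all facets (interior and boundary), $\nu>0$ is a constant. $A\gtrsim B$ means $A\ge CB$ with $C>0$ independent of $h$ and $\nu$ (it may depend on $\Omega,d,k$ and the quasi-uniformity constants). $\|\cdot\|$ is the $L^2(\Omega)$ norm (scalars, vectors, matrices); $\|\cdot\|_h^2=\sum_{T\in\mathcal T_h}\|\cdot\|_T^2$, with differential operators applied element by element. Matrices: $\mathbb M=\mathbb R^{d\times d}$, $\mathbb K$ = skew-symmetric matrices, $\operatorname{dev}(\sigma)=\sigma-\frac1d\operatorname{tr}(\sigma)\mathrm{Id}$. $[\nabla v]_{ij}=\partial_jv_i$, $\varepsilon(v)=\frac12(\nabla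 v+(\nabla v)^{T})$. For vector fields, $\operatorname{curl}(v)=-\partial_2v_1+\partial_1v_2$ if $d=2$, and the usual curl if $d=3$; for matrix fields $\operatorname{curl}$ and $\operatorname{div}$ act row-wise. $\kappa(\operatorname{curl}v)$ denotes the skew-symmetric part of $\nabla v$, i.e. $\kappa(\operatorname{curl} v)=\nabla v-\varepsilon(v)$. Traces: with $n$ a unit normal, $v_n=v\cdot n$, $v_t=v-v_nn$, $\tau_{nn}=n^T\tau n$, $\tau_{nt}=\tau n-\tau_{nn}n$. $[\![\cdot]\!]$ is the jump across a facet (the trace itself on boundary facets). Spaces: $\mathbb P^k(T,\mathbb V)$ are $\mathbb V$-valued polynomials of degree $\le k$; $\mathbb P^k(\mathcal T_h,\mathbb V)$ is the corresponding discontinuous piecewise polynomial space. $V_h=\{v\in H(\operatorname{div},\Omega): v\cdot n=0\text{ on }\partial\Omega,\ v|_T\in\mathbb P^k(T,\mathbb R^d)+x\,\mathbb P^k(T,\mathbb R)\ \forall T\}$ (Raviart–Thomas), $Q_h=\{q\in\mathbb P^k(\mathcal T_h,\mathbb R):\int_\Omega q=0\}$, $W_h=\mathbb P^k(\mathcal T_h,\mathbb K)$, $U_h=V_h\times W_h$. $\Sigma_h=\{\tau\in\mathbb P^k(\mathcal T_h,\mathbb M):\operatorname{tr}\tau=0,\ \tau_{nt}\text{ continuous across all interior facets}\}$. On a simplex $T$ with barycentric coordinates $\lambda_i$, the matrix bubble is $B=\sum_{i=0}^3\lambda_{i-3}\lambda_{i-2}\lambda_{i-1}\nabla\lambda_i\otimes\nabla\lambda_i$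 (indices mod 4) if $d=3$, and the scalar $B=\lambda_0\lambda_1\lambda_2$ if $d=2$. $\mathbb P^k_\perp(T,\mathbb K)$ is the $L^2(T)$-orthogonal complement of $\mathbb P^{k-1}(T,\mathbb K)$ in $\mathbb P^k(T,\mathbb K)$, $\mathbb P_\perp^k(\mathcal T_h,\mathbb K)=\prod_T\mathbb P_\perp^k(T,\mathbb K)$. $\delta\Sigma_h=\{\operatorname{dev}(\operatorname{curl}(\operatorname{curl}(r_h)B)):r_h\in\mathbb P_\perp^k(\mathcal T_h,\mathbb K)\}$ (elementwise), where for $d=2$ the inner curl is the row-wise curl giving a vector and the outer curl of a vector $\phi$ is the matrix with rows $(\partial_2\phi_i,-\partial_1\phi_i)$, $i=1,2$. $\Sigma_h^+=\Sigma_h\oplus\delta\Sigma_h$. Forms: $b_1(v,q)=(\operatorname{div}v,q)_{L^2(\Omega)}$ and, with $n$ the outward normal on $\partial T$, $$b_2(\tau,(v,\eta))=\sum_{T}\Big[\int_T\operatorname{div}(\tau)\cdot v+\int_T\tau:\eta-\int_{\partial T}\tau_{nn}v_n\Big]=\sum_T\Big[-\int_T\tau:(\nabla v-\eta)+\int_{\partial T}\tau_{nt}\cdot v_t\Big].$$ Norms: $\|v\|_{1,h,\varepsilon}^2=\|\varepsilon(v)\|_h^2+\sum_{F\in\mathcal F_h}h^{-1}\|[\![v_t]\!]\|_F^2$ and $\|(v_h,\eta_h)\|_{U_h}^2=\|v_h\|_{1,h,\varepsilon}^2+\|\kappa(\operatorname{curl}v_h)-\eta_h\|_h^2$. *)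

theory Defs
  imports "HOL-Analysis.Analysis"
begin

text \<open>Near every boundary point the domain is, up to a rotation, the strict epigraph of a Lipschitz
  function; \<open>x - (x \<bullet> e) *\<^sub>R e\<close> are the coordinates of \<open>x\<close> in the hyperplane orthogonal to \<open>e\<close>.\<close>

definition bounded_lipschitz_domain :: "(real^'n) set \<Rightarrow> bool" where
  "bounded_lipschitz_domain \<Omega> \<longleftrightarrow>
     open \<Omega> \<and> connected \<Omega> \<and> bounded \<Omega> \<and> \<Omega> \<noteq> {} \<and>
     (\<forall>p\<in>frontier \<Omega>. \<exists>e r L \<phi>. norm e = 1 \<and> 0 < r \<and> L-lipschitz_on {y. y \<bullet> e = 0} \<phi> \<and>
        (\<forall>x\<in>ball p r. x \<in> \<Omega> \<longleftrightarrow> \<phi> (x - (x \<bullet> e) *\<^sub>R e) < x \<bullet> e))"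

definition simplicial_mesh :: "(real^'n) set \<Rightarrow> (real^'n) set set \<Rightarrow> bool" where
  "simplicial_mesh \<Omega> \<T> \<longleftrightarrow>
     triangulation \<T> \<and> (\<forall>T\<in>\<T>. int CARD('n) simplex T) \<and> \<Union>\<T> = closure \<Omega>"

definition mesh_size :: "(real^'n) set set \<Rightarrow> real" where
  "mesh_size \<T> = Max (diameter ` \<T>)"

text \<open>A family of meshes is quasi-uniform iff all its members satisfy this condition with one
  common \<open>\<rho> > 0\<close>.\<close>

definition quasi_uniform :: "real \<Rightarrow> (real^'n) set set \<Rightarrow> bool" where
  "quasi_uniform \<rho> \<T> \<longleftrightarrow> (\<forall>T\<in>\<T>. \<exists>z. cball z (\<rho> * mesh_size \<T>) \<subseteq> T)"

definition mesh_facets :: "(real^'n) set set \<Rightarrow> (real^'n) set set" where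
  "mesh_facets \<T> = {F. \<exists>T\<in>\<T>. F facet_of T}"

definition outer_normal :: "(real^'n) set \<Rightarrow> (real^'n) set \<Rightarrow> real^'n" where
  "outer_normal T F =
     (THE n. norm n = 1 \<and> (\<exists>c. (\<forall>x\<in>F. n \<bullet> x = c) \<and> (\<forall>x\<in>T. n \<bullet> x \<le> c)))"

text \<open>The integral over a facet with respect to the surface measure: the facet is thickened
  symmetrically in its normal direction to a prism of height one, and the integrand is extended
  constantly in that direction (\<open>closest_point (affine hull F)\<close> is the orthogonal projection onto the
  hyperplane of \<open>F\<close>), so that by Fubini the volume integral is the surface integral.\<close>

definition facet_integral :: "(real^'n) set \<Rightarrow> (real^'n \<Rightarrow> real) \<Rightarrow> real" where
  "facet_integral F f =
     integral {x. closest_point (affine hull F) x \<in> F \<and> infdist x (affine hull F) \<le> 1/2}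
       (\<lambda>x. f (closest_point (affine hull F) x))"

definition vertices :: "(real^'n) set \<Rightarrow> (real^'n) set" where
  "vertices T = {a. a extreme_point_of T}"

definition bary :: "(real^'n) set \<Rightarrow> real^'n \<Rightarrow> real^'n \<Rightarrow> real" where
  "bary T a x =
     (THE u. (\<forall>b. b \<notin> vertices T \<longrightarrow> u b = 0) \<and> (\<Sum>b\<in>vertices T. u b) = 1 \<and>
             (\<Sum>b\<in>vertices T. u b *\<^sub>R b) = x) a"

text \<open>Matrices carry the Frobenius inner product and norm, which are those of the type
  \<open>real^'n^'n\<close>.  For \<open>v :: real^'n \<Rightarrow> real^'n\<close>, entry \<open>(i, j)\<close> of \<open>jacobian v (at x)\<close> is the
  derivative of \<open>v\<^sub>i\<close> in direction \<open>j\<close>.\<close>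

definition skew :: "(real^'n^'n) set" where
  "skew = {A. transpose A = - A}"

definition dev :: "real^'n^'n \<Rightarrow> real^'n^'n" where
  "dev \<sigma> = \<sigma> - (trace \<sigma> / real CARD('n)) *\<^sub>R mat 1"

definition outer_prod :: "real^'n \<Rightarrow> real^'n \<Rightarrow> real^'n^'n" where
  "outer_prod a b = (\<chi> i j. a$i * b$j)"

definition grad :: "(real^'n \<Rightarrow> real) \<Rightarrow> real^'n \<Rightarrow> real^'n" where
  "grad f x = (\<chi> j. frechet_derivative f (at x) (axis j 1))"

definition div_vec :: "(real^'n \<Rightarrow> real^'n) \<Rightarrow> real^'n \<Rightarrow> real" where
  "div_vec v x = trace (jacobian v (at x))"

definition div_mat :: "(real^'n \<Rightarrow> real^'n^'n) \<Rightarrow> real^'n \<Rightarrow> real^'n" where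
  "div_mat \<tau> x = (\<chi> i. div_vec (\<lambda>y. \<tau> y $ i) x)"

definition sym_grad :: "(real^'n \<Rightarrow> real^'n) \<Rightarrow> real^'n \<Rightarrow> real^'n^'n" where
  "sym_grad v x = (1/2) *\<^sub>R (jacobian v (at x) + transpose (jacobian v (at x)))"

definition kappa_curl :: "(real^'n \<Rightarrow> real^'n) \<Rightarrow> real^'n \<Rightarrow> real^'n^'n" where
  "kappa_curl v x = jacobian v (at x) - sym_grad v x"

definition curl2 :: "(real^2 \<Rightarrow> real^2) \<Rightarrow> real^2 \<Rightarrow> real" where
  "curl2 v x = (let J = jacobian v (at x) in - J$1$2 + J$2$1)"

definition curl2_mat :: "(real^2 \<Rightarrow> real^2^2) \<Rightarrow> real^2 \<Rightarrow> real^2" where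
  "curl2_mat r x = (\<chi> i. curl2 (\<lambda>y. r y $ i) x)"

definition rot2 :: "(real^2 \<Rightarrow> real^2) \<Rightarrow> real^2 \<Rightarrow> real^2^2" where
  "rot2 \<phi> x = (let J = jacobian \<phi> (at x) in \<chi> i. vector [J$i$2, - J$i$1])"

definition curl3 :: "(real^3 \<Rightarrow> real^3) \<Rightarrow> real^3 \<Rightarrow> real^3" where
  "curl3 v x = (let J = jacobian v (at x) in
     vector [J$3$2 - J$2$3, J$1$3 - J$3$1, J$2$1 - J$1$2])"

definition curl3_mat :: "(real^3 \<Rightarrow> real^3^3) \<Rightarrow> real^3 \<Rightarrow> real^3^3" where
  "curl3_mat r x = (\<chi> i. curl3 (\<lambda>y. r y $ i) x)"

definition tang :: "real^'n \<Rightarrow> real^'n \<Rightarrow> real^'n" where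
  "tang n v = v - (v \<bullet> n) *\<^sub>R n"

definition nn_trace :: "real^'n \<Rightarrow> real^'n^'n \<Rightarrow> real" where
  "nn_trace n \<tau> = n \<bullet> (\<tau> *v n)"

definition nt_trace :: "real^'n \<Rightarrow> real^'n^'n \<Rightarrow> real^'n" where
  "nt_trace n \<tau> = \<tau> *v n - nn_trace n \<tau> *\<^sub>R n"

text \<open>A piecewise polynomial assigns to each element \<open>T\<close> of the mesh a polynomial function.  The
  latter is defined on the whole space, but determined by its values on \<open>T\<close>, so traces from either
  side and elementwise derivatives are those of this polynomial.  The value is fixed to zero
  for sets that are not elements, so that a broken function is zero iff it is zero on
  every element.\<close>

type_synonym ('n, 'v) broken = "(real^'n) set \<Rightarrow> real^'n \<Rightarrow> 'v"

definition broken_space ::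
  "(real^'n) set set \<Rightarrow> ((real^'n) set \<Rightarrow> (real^'n \<Rightarrow> 'v::zero) set) \<Rightarrow> ('n, 'v) broken set" where
  "broken_space \<T> P = {u. (\<forall>T\<in>\<T>. u T \<in> P T) \<and> (\<forall>T. T \<notin> \<T> \<longrightarrow> u T = (\<lambda>_. 0))}"

text \<open>The function on the domain given by a broken function, set to zero on the mesh skeleton.\<close>

definition glue :: "(real^'n) set set \<Rightarrow> ('n, 'v::real_vector) broken \<Rightarrow> real^'n \<Rightarrow> 'v" where
  "glue \<T> u x = (\<Sum>T\<in>\<T>. indicat_real (interior T) x *\<^sub>R u T x)"

definition l2_inner ::
  "(real^'n) set set \<Rightarrow> ('n, 'v::euclidean_space) broken \<Rightarrow> ('n, 'v) broken \<Rightarrow> real" where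
  "l2_inner \<T> u w = (\<Sum>T\<in>\<T>. integral T (\<lambda>x. u T x \<bullet> w T x))"

definition l2_norm :: "(real^'n) set set \<Rightarrow> ('n, 'v::euclidean_space) broken \<Rightarrow> real" where
  "l2_norm \<T> u = sqrt (l2_inner \<T> u u)"

text \<open>The tangential jump across an interior facet, and the tangential trace on a boundary facet,
  where the sum is empty.  Its sign depends on the choice of \<open>T\<close>, its norm does not.\<close>

definition tang_jump ::
  "(real^'n) set set \<Rightarrow> (real^'n) set \<Rightarrow> ('n, real^'n) broken \<Rightarrow> real^'n \<Rightarrow> real^'n" where
  "tang_jump \<T> F v x =
     (let T = (SOME T. T \<in> \<T> \<and> F facet_of T); n = outer_normal T F in
      tang n (v T x) - (\<Sum>T'\<in>{T'\<in>\<T>. F facet_of T' \<and> T' \<noteq> T}. tang n (v T' x)))"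

definition l2_fun :: "(real^'n) set \<Rightarrow> (real^'n \<Rightarrow> 'v::euclidean_space) \<Rightarrow> bool" where
  "l2_fun \<Omega> f \<longleftrightarrow> f \<in> borel_measurable (lebesgue_on \<Omega>) \<and>
     integrable (lebesgue_on \<Omega>) (\<lambda>x. (norm (f x))\<^sup>2)"

primrec cont_diff :: "nat \<Rightarrow> (real^'n \<Rightarrow> real) \<Rightarrow> bool" where
  "cont_diff 0 f \<longleftrightarrow> continuous_on UNIV f"
| "cont_diff (Suc m) f \<longleftrightarrow>
     (\<forall>x. f differentiable (at x)) \<and>
     (\<forall>j. cont_diff m (\<lambda>x. frechet_derivative f (at x) (axis j 1)))"

definition test_fun :: "(real^'n) set \<Rightarrow> (real^'n \<Rightarrow> real) \<Rightarrow> bool" where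
  "test_fun \<Omega> \<phi> \<longleftrightarrow> (\<forall>m. cont_diff m \<phi>) \<and>
     (\<exists>K. compact K \<and> K \<subseteq> \<Omega> \<and> (\<forall>x. x \<notin> K \<longrightarrow> \<phi> x = 0))"

definition H_div :: "(real^'n) set \<Rightarrow> (real^'n \<Rightarrow> real^'n) set" where
  "H_div \<Omega> = {u. l2_fun \<Omega> u \<and>
     (\<exists>g. l2_fun \<Omega> g \<and>
       (\<forall>\<phi>. test_fun \<Omega> \<phi> \<longrightarrow>
          integral \<Omega> (\<lambda>x. u x \<bullet> grad \<phi> x) = - integral \<Omega> (\<lambda>x. g x * \<phi> x)))}"

text \<open>Polynomials of degree at most \<open>k\<close> with coefficients in the linear subspace \<open>V\<close>; these are the
  \<open>V\<close>-valued polynomials.  \<open>\<alpha>\<close> ranges over multi-indices.\<close>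

definition polys :: "nat \<Rightarrow> 'v::real_vector set \<Rightarrow> (real^'n \<Rightarrow> 'v) set" where
  "polys k V = {p. \<exists>c :: ('n \<Rightarrow> nat) \<Rightarrow> 'v. range c \<subseteq> V \<and>
     p = (\<lambda>x. \<Sum>\<alpha>\<in>{\<alpha>. sum \<alpha> UNIV \<le> k}. (\<Prod>i\<in>UNIV. (x$i) ^ \<alpha> i) *\<^sub>R c \<alpha>)}"

definition raviart_thomas :: "nat \<Rightarrow> (real^'n \<Rightarrow> real^'n) set" where
  "raviart_thomas k = {\<lambda>x. p x + q x *\<^sub>R x |p q. p \<in> polys k UNIV \<and> q \<in> polys k UNIV}"

definition V_h :: "nat \<Rightarrow> (real^'n) set \<Rightarrow> (real^'n) set set \<Rightarrow> ('n, real^'n) broken set" where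
  "V_h k \<Omega> \<T> = {v \<in> broken_space \<T> (\<lambda>T. raviart_thomas k).
     glue \<T> v \<in> H_div \<Omega> \<and>
     (\<forall>T\<in>\<T>. \<forall>F. F facet_of T \<and> F \<subseteq> frontier \<Omega> \<longrightarrow> (\<forall>x\<in>F. v T x \<bullet> outer_normal T F = 0))}"

text \<open>For a piecewise polynomial field in H(div) the weak divergence is the elementwise one.\<close>

definition V0_h :: "nat \<Rightarrow> (real^'n) set \<Rightarrow> (real^'n) set set \<Rightarrow> ('n, real^'n) broken set" where
  "V0_h k \<Omega> \<T> = {z \<in> V_h k \<Omega> \<T>. \<forall>T\<in>\<T>. \<forall>x\<in>T. div_vec (z T) x = 0}"

definition Q_h :: "nat \<Rightarrow> (real^'n) set set \<Rightarrow> ('n, real) broken set" where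
  "Q_h k \<T> = {q \<in> broken_space \<T> (\<lambda>T. polys k UNIV). (\<Sum>T\<in>\<T>. integral T (q T)) = 0}"

definition W_h :: "nat \<Rightarrow> (real^'n) set set \<Rightarrow> ('n, real^'n^'n) broken set" where
  "W_h k \<T> = broken_space \<T> (\<lambda>T. polys k skew)"

definition Sigma_h :: "nat \<Rightarrow> (real^'n) set set \<Rightarrow> ('n, real^'n^'n) broken set" where
  "Sigma_h k \<T> = {\<tau> \<in> broken_space \<T> (\<lambda>T. polys k UNIV).
     (\<forall>T\<in>\<T>. \<forall>x\<in>T. trace (\<tau> T x) = 0) \<and>
     (\<forall>T\<in>\<T>. \<forall>T'\<in>\<T>. \<forall>F. T \<noteq> T' \<and> F facet_of T \<and> F facet_of T' \<longrightarrow>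
        (\<forall>x\<in>F. nt_trace (outer_normal T F) (\<tau> T x) = nt_trace (outer_normal T F) (\<tau> T' x)))}"

definition skew_polys_perp :: "nat \<Rightarrow> (real^'n) set \<Rightarrow> (real^'n \<Rightarrow> real^'n^'n) set" where
  "skew_polys_perp k T =
     {r \<in> polys k skew. \<forall>s\<in>polys (k - 1) skew. integral T (\<lambda>x. r x \<bullet> s x) = 0}"

definition bubble2 :: "(real^2) set \<Rightarrow> real^2 \<Rightarrow> real" where
  "bubble2 T x = (\<Prod>a\<in>vertices T. bary T a x)"

text \<open>With the four vertices numbered modulo 4, the indices \<open>i - 3\<close>, \<open>i - 2\<close>, \<open>i - 1\<close> are the three
  indices different from \<open>i\<close>.\<close>

definition bubble3 :: "(real^3) set \<Rightarrow> real^3 \<Rightarrow> real^3^3" where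
  "bubble3 T x =
     (\<Sum>a\<in>vertices T. (\<Prod>b\<in>vertices T - {a}. bary T b x) *\<^sub>R
        outer_prod (grad (bary T a) x) (grad (bary T a) x))"

definition delta_Sigma2 :: "nat \<Rightarrow> (real^2) set set \<Rightarrow> (2, real^2^2) broken set" where
  "delta_Sigma2 k \<T> = broken_space \<T> (\<lambda>T.
     {\<lambda>x. dev (rot2 (\<lambda>y. bubble2 T y *\<^sub>R curl2_mat r y) x) |r. r \<in> skew_polys_perp k T})"

definition delta_Sigma3 :: "nat \<Rightarrow> (real^3) set set \<Rightarrow> (3, real^3^3) broken set" where
  "delta_Sigma3 k \<T> = broken_space \<T> (\<lambda>T.
     {\<lambda>x. dev (curl3_mat (\<lambda>y. curl3_mat r y ** bubble3 T y) x) |r. r \<in> skew_polys_perp k T})"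

definition broken_sum ::
  "('n, 'v::plus) broken set \<Rightarrow> ('n, 'v) broken set \<Rightarrow> ('n, 'v) broken set" where
  "broken_sum A B = {\<lambda>T x. \<sigma> T x + \<delta> T x |\<sigma> \<delta>. \<sigma> \<in> A \<and> \<delta> \<in> B}"

definition Sigma_plus2 :: "nat \<Rightarrow> (real^2) set set \<Rightarrow> (2, real^2^2) broken set" where
  "Sigma_plus2 k \<T> = broken_sum (Sigma_h k \<T>) (delta_Sigma2 k \<T>)"

definition Sigma_plus3 :: "nat \<Rightarrow> (real^3) set set \<Rightarrow> (3, real^3^3) broken set" where
  "Sigma_plus3 k \<T> = broken_sum (Sigma_h k \<T>) (delta_Sigma3 k \<T>)"

definition b1 :: "(real^'n) set set \<Rightarrow> ('n, real^'n) broken \<Rightarrow> ('n, real) broken \<Rightarrow> real" where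
  "b1 \<T> v q = l2_inner \<T> (\<lambda>T. div_vec (v T)) q"

definition b2 ::
  "(real^'n) set set \<Rightarrow> ('n, real^'n^'n) broken \<Rightarrow>
     ('n, real^'n) broken \<times> ('n, real^'n^'n) broken \<Rightarrow> real" where
  "b2 \<T> \<tau> = (\<lambda>(v, \<eta>). \<Sum>T\<in>\<T>.
     integral T (\<lambda>x. div_mat (\<tau> T) x \<bullet> v T x) + integral T (\<lambda>x. \<tau> T x \<bullet> \<eta> T x)
     - (\<Sum>F\<in>{F. F facet_of T}. facet_integral F
          (\<lambda>x. nn_trace (outer_normal T F) (\<tau> T x) * (v T x \<bullet> outer_normal T F))))"

definition norm_1h_eps :: "(real^'n) set set \<Rightarrow> ('n, real^'n) broken \<Rightarrow> real" where
  "norm_1h_eps \<T> v = sqrt ((l2_norm \<T> (\<lambda>T. sym_grad (v T)))\<^sup>2 +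
     (\<Sum>F\<in>mesh_facets \<T>. inverse (mesh_size \<T>) *
        facet_integral F (\<lambda>x. (norm (tang_jump \<T> F v x))\<^sup>2)))"

definition norm_U ::
  "(real^'n) set set \<Rightarrow> ('n, real^'n) broken \<times> ('n, real^'n^'n) broken \<Rightarrow> real" where
  "norm_U \<T> = (\<lambda>(v, \<eta>). sqrt ((norm_1h_eps \<T> v)\<^sup>2 +
     (l2_norm \<T> (\<lambda>T x. kappa_curl (v T) x - \<eta> T x))\<^sup>2))"

end

theory Submission
 imports Defs "HOL-Computational_Algebra.Polynomial"
begin

text \<open>The supremum is bounded below by one explicit test pair.  On each element, \<open>v\<close> is split into a
  polynomial of degree \<open>k\<close> and a remainder controlled by \<open>div v\<close>.  Four quantities then bound the norm:
  the divergence, the oscillation of \<open>\<gamma>\<close> about its value at the element centre, the deviatoric part of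
  \<open>\<nabla>v - \<gamma>\<close> with that value in place of \<open>\<gamma>\<close>, and the tangential jumps.  Each of them is the leading term of
  the form for one test function: a multiple of \<open>div v\<close>, the bubble \<open>dev (curl (curl \<gamma> B))\<close> (whose part
  coming from the lower-order component of \<open>\<gamma>\<close> already lies in \<open>\<Sigma>\<^sub>h\<close>), bubbles with barycentric weights, and
  a lifting of the jumps.  The error terms of each test function involve only quantities that occur
  earlier in this order, except that the last two may be weighted by small constants, so a weighted
  sum of the four controls everything.\<close>

text \<open>Uniformity in the mesh is obtained without a reference element: every element contains a
  ball of radius \<open>\<rho> * h\<close> and lies in one of radius \<open>h\<close>, and
  polynomials of bounded degree have comparable sup norms on concentric balls, with a constant
  traced back to \<open>poly_coeff_bound\<close>. So all constants depend on the degree, the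
  dimension and \<open>\<rho>\<close>; not even the domain enters. Two obstacles shape the rest. The
  facet integral is a volume integral over a prism, so the divergence theorem has to come from
  Fubini along the edges of a simplex. And membership in H(div) is weak, whereas the multiple of
  \<open>div v\<close> must have mean zero to lie in \<open>Q_h\<close>; this forces a proof that
  normal components match across every facet with two neighbours, where the Lipschitz property
  excludes slits, and that facets with one neighbour lie on the boundary. Both dimensions are
  treated at once: what distinguishes them is the curl bubble, and \<open>bubble_property\<close>
  states what is required of it.\<close>

notation scaleR (infixr "*R" 75)
abbreviation (input) "FI \<equiv> facet_integral"
lemmas sU = subspace_UNIV

section \<open>Polynomials\<close>

lemma finite_multi_indices: "finite {\<alpha> :: 'n::finite => nat. sum \<alpha> UNIV <= k}"
proof (rule finite_subset)
 show "{\<alpha> :: 'n => nat. sum \<alpha> UNIV <= k} \<subseteq> PiE UNIV (%_. {..k})"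
 proof
 fix \<alpha> :: "'n => nat" assume "\<alpha> : {\<alpha>. sum \<alpha> UNIV <= k}"
 then have "\<alpha> i <= k" for i using member_le_sum[of i UNIV \<alpha>] by simp
 then show "\<alpha> : PiE UNIV (%_. {..k})" by (simp add: PiE_def Pi_def)
 qed
qed (simp add: finite_PiE)

lemma polys_monomial:
 assumes "subspace V" "v : V" "sum \<alpha> UNIV <= k"
 shows "(%x. (PROD i:UNIV. (x$i) ^ \<alpha> i) *R v) : polys k V"
 unfolding polys_def
proof (intro CollectI exI conjI ext)
 let ?c = "%\<beta>. if \<beta> = \<alpha> then v else 0"
 show "range ?c \<subseteq> V" using assms subspace_0 by auto
 show "(PROD i:UNIV. (x$i) ^ \<alpha> i) *R v =
 (SUM \<beta>:{\<alpha>. sum \<alpha> UNIV <= k}. (PROD i:UNIV. (x$i) ^ \<beta> i) *R ?c \<beta>)" for x :: "real^'b"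
 using assms(3) by (subst sum.remove[OF finite_multi_indices, of \<alpha>]) (auto intro: sum.neutral)
qed

lemma polys_add:
 assumes "subspace V" "f : polys k V" "g : polys k V"
 shows "(%x. f x + g x) : polys k V"
proof -
 obtain c d where "range c \<subseteq> V" "range d \<subseteq> V"
 "f = (%x. SUM \<alpha>:{\<alpha>. sum \<alpha> UNIV <= k}. (PROD i:UNIV. (x$i) ^ \<alpha> i) *R c \<alpha>)"
 "g = (%x. SUM \<alpha>:{\<alpha>. sum \<alpha> UNIV <= k}. (PROD i:UNIV. (x$i) ^ \<alpha> i) *R d \<alpha>)"
 using assms unfolding polys_def by auto
 then show ?thesis unfolding polys_def
 using subspace_add[OF assms(1)]
 by (intro CollectI exI[of _ "%\<alpha>. c \<alpha> + d \<alpha>"]) (auto simp: algebra_simps sum.distrib range_subsetD)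
qed

lemma polys_const: "subspace V ==> v : V ==> (%_. v) : polys k V"
 using polys_monomial[of V v "%_. 0" k] by simp

lemma polys_zero: "subspace V ==> (%_. 0) : polys k V"
 by (simp add: polys_const subspace_0)

lemma polys_sum:
 assumes "subspace V" "!!i. i : I ==> f i : polys k V"
 shows "(%x. SUM i:I. f i x) : polys k V"
 using assms(2)
 by (induction I rule: infinite_finite_induct) (auto intro: polys_zero polys_add assms(1))

lemma polys_lin_image:
 assumes "linear L" "p : polys k V" "L ` V \<subseteq> W"
 shows "(%x. L (p x)) : polys k W"
proof -
 obtain c where "range c \<subseteq> V"
 "p = (%x. SUM \<alpha>:{\<alpha>. sum \<alpha> UNIV <= k}. (PROD i:UNIV. (x$i) ^ \<alpha> i) *R c \<alpha>)"
 using assms unfolding polys_def by auto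
 then show ?thesis unfolding polys_def using assms(3)
 by (intro CollectI exI[of _ "%\<alpha>. L (c \<alpha>)"])
 (auto simp: linear_sum[OF assms(1)] linear_scale[OF assms(1)])
qed

lemma polys_UNIV: "p : polys k V ==> p : polys k UNIV"
 using polys_lin_image[of "%x. x" p k V UNIV] linear_id by (simp add: id_def)

lemma polys_coord_mult:
 assumes V: "subspace V" and p: "p : polys k V"
 shows "(%x. x$j *R p x) : polys (Suc k) V"
proof -
 obtain c where c: "range c \<subseteq> V" and p:
 "p = (%x. SUM \<alpha>:{\<alpha>. sum \<alpha> UNIV <= k}. (PROD i:UNIV. (x$i) ^ \<alpha> i) *R c \<alpha>)"
 using p unfolding polys_def by auto
 have mono: "x$j * (PROD i:UNIV. (x$i) ^ \<alpha> i) = (PROD i:UNIV. (x$i) ^ (\<alpha>(j := Suc (\<alpha> j))) i)"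
 for x :: "real^'b" and \<alpha>
 proof -
 have "(PROD i:UNIV - {j}. (x$i) ^ (\<alpha>(j := Suc (\<alpha> j))) i) = (PROD i:UNIV - {j}. (x$i) ^ \<alpha> i)"
 by (intro prod.cong) auto
 then show ?thesis by (simp add: prod.remove[of UNIV j] del: fun_upd_apply) simp
 qed
 have deg: "sum (\<alpha>(j := Suc (\<alpha> j))) UNIV = Suc (sum \<alpha> UNIV)" for \<alpha> :: "'b => nat"
 proof -
 have "sum (\<alpha>(j := Suc (\<alpha> j))) (UNIV - {j}) = sum \<alpha> (UNIV - {j})"
 by (intro sum.cong) auto
 then show ?thesis by (simp add: sum.remove[of UNIV j] del: fun_upd_apply) simp
 qed
 have "(%x. x$j *R p x) = (%x. SUM \<alpha>:{\<alpha>. sum \<alpha> UNIV <= k}.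
 (PROD i:UNIV. (x$i) ^ (\<alpha>(j := Suc (\<alpha> j))) i) *R c \<alpha>)"
 unfolding p scaleR_sum_right scaleR_scaleR mono ..
 also have "\<dots> : polys (Suc k) V"
 using c by (intro polys_sum polys_monomial V) (auto simp: deg simp del: fun_upd_apply)
 finally show ?thesis .
qed

text \<open>Polynomials arise from constants by addition and multiplication by a coordinate.
  Carrying the degree bound as an argument of \<open>P\<close> lets facts about degrees be proved
  without touching multi-indices; only \<open>coord\<close> raises the bound.\<close>

lemma polys_induct [consumes 2, case_names const coord add]:
 assumes V: "subspace V" and p: "p : polys k V"
 and const: "!!k v. v : V ==> P k (%_. v)"
 and coord: "!!k f j. f : polys k V ==> P k f ==> P (Suc k) (%x. x$j *R f x)"
 and add: "!!k f g. f : polys k V ==> g : polys k V ==> P k f ==> P k g ==> P k (%x. f x + g x)"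
 shows "P k p"
proof -
 have mono: "v : V ==> sum \<alpha> UNIV = m ==> m <= l ==> P l (%x. (PROD i:UNIV. (x$i) ^ \<alpha> i) *R v)"
 for \<alpha> v m l
 proof (induction m arbitrary: \<alpha> l)
 case 0
 then show ?case using const by simp
 next
 case (Suc m)
 then obtain j where j: "\<alpha> j > 0" by (metis gr0I sum.neutral nat.distinct(1))
 obtain l' where l: "l = Suc l'" using Suc by (cases l) auto
 define \<beta> where "\<beta> = \<alpha>(j := \<alpha> j - 1)"
 have "sum \<beta> (UNIV - {j}) = sum \<alpha> (UNIV - {j})" by (intro sum.cong) (auto simp: \<beta>_def)
 then have "Suc (sum \<beta> UNIV) = sum \<alpha> UNIV"
 using j by (simp add: sum.remove[of UNIV j]) (simp add: \<beta>_def)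
 then have IH: "P l' (%x. (PROD i:UNIV. (x$i) ^ \<beta> i) *R v)"
 and in_l: "(%x. (PROD i:UNIV. (x$i) ^ \<beta> i) *R v) : polys l' V"
 using Suc l by (auto intro!: polys_monomial V)
 have "x$j * (PROD i:UNIV. (x$i) ^ \<beta> i) = (PROD i:UNIV. (x$i) ^ \<alpha> i)" for x :: "real^'b"
 proof -
 have "(PROD i:UNIV - {j}. (x$i) ^ \<beta> i) = (PROD i:UNIV - {j}. (x$i) ^ \<alpha> i)"
 by (intro prod.cong) (auto simp: \<beta>_def)
 moreover have "x$j * (x$j) ^ \<beta> j = (x$j) ^ \<alpha> j"
 using j by (cases "\<alpha> j") (auto simp: \<beta>_def)
 ultimately show ?thesis by (simp add: prod.remove[of UNIV j] mult.assoc[symmetric])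
 qed
 then show ?case using coord[OF in_l IH, of j] l by simp
 qed
 obtain c where c: "range c \<subseteq> V" and p:
 "p = (%x. SUM \<alpha>:{\<alpha>. sum \<alpha> UNIV <= k}. (PROD i:UNIV. (x$i) ^ \<alpha> i) *R c \<alpha>)"
 using p unfolding polys_def by auto
 have "finite A ==> A \<subseteq> {\<alpha>. sum \<alpha> UNIV <= k} ==>
 P k (%x. SUM \<alpha>:A. (PROD i:UNIV. (x$i) ^ \<alpha> i) *R c \<alpha>)" for A
 proof (induction A rule: finite_induct)
 case empty
 then show ?case using const[of 0] subspace_0[OF V] by simp
 next
 case (insert \<alpha> A)
 have m: "c \<beta> : V" "(%x. (PROD i:UNIV. (x$i) ^ \<beta> i) *R c \<beta>) : polys k V" if "\<beta> : insert \<alpha> A" for \<beta>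
 using c that insert.prems polys_monomial[OF V, of "c \<beta>" \<beta> k] by blast+
 have "P k (%x. (PROD i:UNIV. (x$i) ^ \<alpha> i) *R c \<alpha> + (SUM \<alpha>:A. (PROD i:UNIV. (x$i) ^ \<alpha> i) *R c \<alpha>))"
 proof (rule add)
 show "(%x. (PROD i:UNIV. (x$i) ^ \<alpha> i) *R c \<alpha>) : polys k V" using m by blast
 show "(%x. SUM \<alpha>:A. (PROD i:UNIV. (x$i) ^ \<alpha> i) *R c \<alpha>) : polys k V"
 using m by (intro polys_sum V) blast
 show "P k (%x. (PROD i:UNIV. (x$i) ^ \<alpha> i) *R c \<alpha>)"
 using m insert.prems by (intro mono[OF _ refl]) blast+
 show "P k (%x. SUM \<alpha>:A. (PROD i:UNIV. (x$i) ^ \<alpha> i) *R c \<alpha>)"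
 using insert.IH insert.prems by blast
 qed
 then show ?case by (simp add: insert.hyps)
 qed
 from this[OF finite_multi_indices order_refl] show ?thesis unfolding p .
qed

lemma polys_mono:
 assumes "subspace V" "p : polys j V" "j <= k"
 shows "p : polys k V"
proof -
 have "\<forall>k\<ge>j. p : polys k V" using assms(1,2)
 proof (induction rule: polys_induct)
 case (coord k f j)
 show ?case
 proof (intro allI impI)
 fix l assume "Suc k <= l"
 then obtain l' where "l = Suc l'" "k <= l'" by (cases l) auto
 with coord(2) show "(%x. x$j *R f x) : polys l V" by (simp add: polys_coord_mult assms(1))
 qed
 next
 case (const k v)
 then show ?case by (simp add: polys_const assms(1))
 next
 case (add k f g)
 then show ?case by (simp add: polys_add assms(1))
 qed
 then show ?thesis using assms(3) by simp
qed

lemma polys_mult: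
 assumes V: "subspace V" and a: "a : polys j (UNIV :: real set)" and p: "p : polys k V"
 shows "(%x. a x *R p x) : polys (j + k) V"
 using sU a
proof (induction rule: polys_induct)
 case (const j v)
 have "(%x. v *R p x) : polys k V"
 using p by (rule polys_lin_image[OF linear_scaleR]) (auto intro: subspace_scale[OF V])
 then show ?case by (rule polys_mono[OF V]) simp
next
 case (coord j f i)
 from polys_coord_mult[OF V coord(2), of i] show ?case by simp
next
 case (add j f g)
 from polys_add[OF V add(3,4)] show ?case by (simp add: scaleR_add_left)
qed

lemma polys_scaleR: "subspace V ==> p : polys k V ==> (%x. c *R p x) : polys k V"
 using polys_mult[OF _ polys_const[OF sU UNIV_I, of c 0]] by simp

lemma polys_uminus: "subspace V ==> p : polys k V ==> (%x. - p x) : polys k V"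
 using polys_scaleR[of V p k "-1"] by simp

lemma polys_diff:
 "subspace V ==> f : polys k V ==> g : polys k V ==> (%x. f x - g x) : polys k V"
 using polys_add[of V f k "%x. - g x"] polys_uminus[of V g k] by simp

lemma polys_coord: "(%x. x$i) : polys 1 (UNIV :: real set)"
 using polys_coord_mult[OF sU polys_const[OF sU UNIV_I, of "1::real" 0]] by simp

lemma polys_linear:
 assumes "linear L"
 shows "(L :: real^'n => 'v::real_vector) : polys 1 UNIV"
proof -
 have "L x = (SUM i:UNIV. x$i *R L (axis i 1))" for x
 proof -
 have "x = (SUM i:UNIV. x$i *R axis i 1)"
 using basis_expansion[of x] by (simp add: scalar_mult_eq_scaleR)
 then have "L x = L (SUM i:UNIV. x$i *R axis i 1)" by (rule arg_cong)
 then show ?thesis by (simp add: linear_sum[OF assms] linear_scale[OF assms])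
 qed
 then have "L = (%x. SUM i:UNIV. x$i *R L (axis i 1))" by blast
 also have "\<dots> : polys 1 UNIV"
 using polys_mult[OF sU polys_coord polys_const[OF sU UNIV_I, of _ 0]]
 by (intro polys_sum) simp_all
 finally show ?thesis .
qed

lemma polys_id: "(%x. x :: real^'n) : polys 1 UNIV"
 using polys_linear[OF linear_id] by (simp add: id_def)

lemma polys_affine_compose:
 assumes V: "subspace V" and p: "p : polys k V" and A: "A : polys 1 (UNIV :: (real^'m) set)"
 shows "(%x :: real^'n. p (A x)) : polys k V"
 using V p
proof (induction rule: polys_induct)
 case (coord k f j)
 have "(%x. A x $ j) : polys 1 UNIV"
 by (rule polys_lin_image[OF _ A]) (auto simp: linear_iff)
 from polys_mult[OF V this coord(2)] show ?case by simp
next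
 case (const k v)
 then show ?case by (rule polys_const[OF V])
next
 case (add k f g)
 show ?case by (rule polys_add[OF V add(3,4)])
qed

lemma polys_inner:
 assumes "p : polys j (UNIV :: 'v::euclidean_space set)" "q : polys k (UNIV :: 'v set)"
 shows "(%x. p x \<bullet> q x) : polys (j + k) UNIV"
proof -
 have "(%x. (p x \<bullet> b) *R (q x \<bullet> b)) : polys (j + k) UNIV" for b
 by (intro polys_mult polys_lin_image[OF _ assms(1)] polys_lin_image[OF _ assms(2)] sU)
 (auto simp: linear_iff inner_add_left)
 from polys_sum[OF sU this] have "(%x. SUM b:Basis. (p x \<bullet> b) *R (q x \<bullet> b)) : polys (j + k) UNIV" .
 moreover have "p x \<bullet> q x = (SUM b:Basis. (p x \<bullet> b) *R (q x \<bullet> b))" for x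
 by (subst euclidean_inner) simp
 ultimately show ?thesis by simp
qed

text \<open>Truncated subtraction makes \<open>k - 1\<close> equal to 0 at \<open>k = 0\<close>, so
  the degree bound alone would not say that constants have derivative zero. The last conjunct
  records it for the \<open>coord\<close> case: a coordinate times \<open>f'\<close> has degree
  \<open>k\<close> at \<open>k = 0\<close> only because \<open>f'\<close> vanishes there.\<close>

lemma polys_has_derivative:
 fixes p :: "real^'n => 'v::real_normed_vector"
 assumes V: "subspace V" and p: "p : polys k V"
 shows "EX p'. (ALL x. (p has_derivative p' x) (at x)) & (ALL \<xi>. (%x. p' x \<xi>) : polys (k - 1) V) &
 (k = 0 --> p' = (%_ _. 0))"
 using V p
 proof (induction rule: polys_induct)
 case (const k v)
 then show ?case by (intro exI[of _ "%_ _. 0"]) (auto intro!: polys_zero V)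
 next
 case (coord k f j)
 from coord(2) obtain f' where "(ALL x. (f has_derivative f' x) (at x)) &
 (ALL \<xi>. (%x. f' x \<xi>) : polys (k - 1) V) & (k = 0 --> f' = (%_ _. 0))" ..
 then have f': "!!x. (f has_derivative f' x) (at x)"
 "!!\<xi>. (%x. f' x \<xi>) : polys (k - 1) V" "k = 0 ==> f' = (%_ _. 0)" by auto
 have "(%x. x$j *R f' x \<xi>) : polys k V" for \<xi>
 proof (cases k)
 case 0
 then show ?thesis using f'(3) by (simp add: polys_zero V)
 next
 case (Suc m)
 then show ?thesis using polys_coord_mult[OF V f'(2)] by simp
 qed
 have "((%x. x$j *R f x) has_derivative (%\<xi>. x$j *R f' x \<xi> + \<xi>$j *R f x)) (at x)" for x
 by (intro has_derivative_scaleR f'(1) bounded_linear_imp_has_derivative bounded_linear_vec_nth)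
 moreover have "(%x. x$j *R f' x \<xi> + \<xi>$j *R f x) : polys k V" for \<xi>
 by (intro polys_add polys_scaleR V coord(1)) fact
 ultimately show ?case
 by (intro exI[of _ "%x \<xi>. x$j *R f' x \<xi> + \<xi>$j *R f x"]) simp
 next
 case (add k f g)
 from add(3) obtain f' where f': "(ALL x. (f has_derivative f' x) (at x)) &
 (ALL \<xi>. (%x. f' x \<xi>) : polys (k - 1) V) & (k = 0 --> f' = (%_ _. 0))" ..
 from add(4) obtain g' where g': "(ALL x. (g has_derivative g' x) (at x)) &
 (ALL \<xi>. (%x. g' x \<xi>) : polys (k - 1) V) & (k = 0 --> g' = (%_ _. 0))" ..
 have "((%x. f x + g x) has_derivative (%\<xi>. f' x \<xi> + g' x \<xi>)) (at x)" for x
 using f' g' by (intro has_derivative_add) auto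
 moreover have "(%x. f' x \<xi> + g' x \<xi>) : polys (k - 1) V" for \<xi>
 using f' g' by (intro polys_add V) auto
 ultimately show ?case using f' g'
 by (intro exI[of _ "%x \<xi>. f' x \<xi> + g' x \<xi>"] conjI allI impI) auto
 qed

lemma
 fixes p :: "real^'n => 'v::real_normed_vector"
 assumes "p : polys k V" "subspace V"
 shows polys_differentiable: "p differentiable (at x)"
 and polys_derivative: "(%x. frechet_derivative p (at x) \<xi>) : polys (k - 1) V"
 and polys_derivative_0: "k = 0 ==> frechet_derivative p (at x) \<xi> = 0"
proof -
 obtain p' where "(ALL x. (p has_derivative p' x) (at x)) & (ALL \<xi>. (%x. p' x \<xi>) : polys (k - 1) V) &
 (k = 0 --> p' = (%_ _. 0))" using polys_has_derivative[OF assms(2,1)] ..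
 then have p': "!!x. (p has_derivative p' x) (at x)" "!!\<xi>. (%x. p' x \<xi>) : polys (k - 1) V"
 "k = 0 ==> p' = (%_ _. 0)" by auto
 have "p' x = frechet_derivative p (at x)" for x using p'(1) by (rule frechet_derivative_at)
 then have *: "p' = (%x. frechet_derivative p (at x))" by (rule ext)
 show "p differentiable (at x)" using p'(1) by (auto simp: differentiable_def)
 show "(%x. frechet_derivative p (at x) \<xi>) : polys (k - 1) V" using p'(2) unfolding * .
 show "frechet_derivative p (at x) \<xi> = 0" if "k = 0" using fun_cong[OF fun_cong[OF p'(3)[OF that]]] unfolding * .
qed

lemma polys_cont:
 fixes p :: "real^'n => 'v::real_normed_vector"
 assumes "p : polys k V"
 shows "continuous_on S p"
proof (rule continuous_at_imp_continuous_on, rule ballI)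
 show "isCont p x" for x
 using polys_differentiable[OF polys_UNIV[OF assms] sU] by (rule differentiable_imp_continuous_within)
qed

section \<open>Restriction to lines and estimates for polynomials on balls\<close>

lemma polys_line:
 assumes "p : polys k (UNIV :: real set)"
 obtains q where "degree q <= k" "!!t. p (z + t *R \<xi>) = poly q t"
proof -
 have "EX q. degree q <= k & (ALL t. p (z + t *R \<xi>) = poly q t)"
 using sU assms
 proof (induction rule: polys_induct)
 case (const k v)
 then show ?case by (intro exI[of _ "[:v:]"]) auto
 next
 case (coord k f j)
 then obtain q where "degree q <= k" "ALL t. f (z + t *R \<xi>) = poly q t" by blast
 moreover have "degree ([:z$j, \<xi>$j:] * q) <= 1 + degree q"
 by (rule order_trans[OF degree_mult_le]) auto
 ultimately show ?case by (intro exI[of _ "[:z$j, \<xi>$j:] * q"]) (auto simp: algebra_simps)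
 next
 case (add k f g)
 then obtain q r where "degree q <= k" "ALL t. f (z + t *R \<xi>) = poly q t"
 "degree r <= k" "ALL t. g (z + t *R \<xi>) = poly r t" by blast
 then show ?case by (intro exI[of _ "q + r"]) (auto intro: degree_add_le)
 qed
 then obtain q where "degree q <= k & (ALL t. p (z + t *R \<xi>) = poly q t)" ..
 then show thesis by (intro that[of q]) auto
qed

text \<open>Norm equivalence on univariate polynomials. Dividing \<open>q - [:poly q a:]\<close> by
  \<open>[:-a, 1:]\<close> lowers the degree. On the right half \<open>{m..b}\<close> of the
  interval the divisor is at least \<open>m - a\<close>, so the quotient is bounded there by
  \<open>2 / (m - a)\<close> times the bound on \<open>q\<close>, and the induction hypothesis
  applies to it.\<close>

lemma poly_coeff_bound:
 fixes a b :: real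
 assumes "a < b"
 shows "\<exists>C\<ge>0. ALL q A. degree q <= K --> (ALL t:{a..b}. \<bar>poly q t\<bar> <= A) --> (ALL i. \<bar>coeff q i\<bar> <= C * A)"
 using assms
proof (induction K arbitrary: a b)
 case 0
 show ?case
 proof (intro exI[of _ 1] conjI allI impI)
 fix q :: "real poly" and A i
 assume q: "degree q <= 0" "ALL t:{a..b}. \<bar>poly q t\<bar> <= A"
 then obtain c where "q = [:c:]" by (metis degree_eq_zeroE le_zero_eq)
 then show "\<bar>coeff q i\<bar> <= 1 * A" using q 0 bspec[OF q(2), of a] by (cases i) (auto simp: coeff_pCons)
 qed auto
next
 case (Suc K)
 define m where "m = (a + b) / 2"
 have m: "a < m" "m < b" using Suc.prems by (auto simp: m_def)
 from Suc.IH[OF m(2)] obtain C where C: "C >= 0" "!!q A i. degree q <= K ==>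
 (ALL t:{m..b}. \<bar>poly q t\<bar> <= A) ==> \<bar>coeff q i\<bar> <= C * A" by blast
 define D where "D = 2 / (m - a)"
 have D: "D >= 0" using m by (simp add: D_def)
 show ?case
 proof (intro exI[of _ "1 + C * D + \<bar>a\<bar> * (C * D)"] conjI allI impI)
 fix q :: "real poly" and A i
 assume q: "degree q <= Suc K" and A: "ALL t:{a..b}. \<bar>poly q t\<bar> <= A"
 have A0: "0 <= A" using bspec[OF A, of a] Suc.prems by auto
 have "poly (q - [:poly q a:]) a = 0" by simp
 then obtain r where r: "q - [:poly q a:] = [:-a, 1:] * r" by (metis poly_eq_0_iff_dvd dvdE)
 then have qr: "q = [:poly q a:] + [:-a, 1:] * r" by (simp add: algebra_simps)
 have "degree r <= K"
 proof (cases "r = 0")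
 case False
 then have "degree ([:-a, 1:] * r) = Suc (degree r)" by (subst degree_mult_eq) auto
 moreover have "degree (q - [:poly q a:]) <= Suc K" by (rule degree_diff_le) (use q in auto)
 ultimately show ?thesis using r by simp
 qed auto
 moreover have "\<bar>poly r t\<bar> <= D * A" if "t : {m..b}" for t
 proof -
 have t: "t - a >= m - a" "t : {a..b}" using that m by auto
 have "poly q t - poly q a = (t - a) * poly r t"
 using arg_cong[OF r, of "%p. poly p t"] by (simp add: algebra_simps)
 moreover have "\<bar>poly q t - poly q a\<bar> <= 2 * A"
 using bspec[OF A t(2)] bspec[OF A, of a] Suc.prems by simp
 ultimately have "(t - a) * \<bar>poly r t\<bar> <= 2 * A" using t m by (simp add: abs_mult)
 moreover have "(m - a) * \<bar>poly r t\<bar> <= (t - a) * \<bar>poly r t\<bar>"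
 using t by (intro mult_right_mono) auto
 ultimately show ?thesis using m by (simp add: D_def field_simps)
 qed
 ultimately have r_le: "\<bar>coeff r i\<bar> <= C * (D * A)" for i using C(2) by blast
 have "coeff q i = (if i = 0 then poly q a else 0) + (if i = 0 then 0 else coeff r (i - 1)) - a * coeff r i"
 by (subst qr) (cases i; simp add: coeff_pCons algebra_simps)
 then have "\<bar>coeff q i\<bar> <= \<bar>if i = 0 then poly q a else 0\<bar> + \<bar>if i = 0 then 0 else coeff r (i - 1)\<bar> + \<bar>a\<bar> * \<bar>coeff r i\<bar>"
 by (auto simp: abs_mult[symmetric])
 also have "\<dots> <= A + C * (D * A) + \<bar>a\<bar> * (C * (D * A))"
 using r_le[of i] r_le[of "i - 1"] bspec[OF A, of a] Suc.prems A0 C(1) D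
 by (intro add_mono mult_left_mono) auto
 finally show "\<bar>coeff q i\<bar> <= (1 + C * D + \<bar>a\<bar> * (C * D)) * A" by (simp add: algebra_simps)
 qed (use C D in auto)
qed

text \<open>Transfers bounds on scalar components, for which univariate polynomials are available,
  to vector values without a dimension factor.\<close>

lemma norm_le_via_unit:
 fixes y :: "'v::euclidean_space"
 assumes "!!u. norm u = 1 ==> y \<bullet> u <= A" "0 <= A"
 shows "norm y <= A"
proof (cases "y = 0")
 case False
 then show ?thesis using assms(1)[of "y /\<^sub>R norm y"]
 by (simp add: dot_square_norm power2_eq_square mult.assoc[symmetric])
qed (use assms in auto)

lemma polys_component:
 fixes p :: "real^'n => 'v::euclidean_space"
 shows "p : polys K V ==> (%x. p x \<bullet> u) : polys K (UNIV :: real set)"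
 by (erule polys_lin_image[rotated]) (auto simp: linear_iff inner_add_left)

text \<open>Each component is a univariate polynomial on the ray from \<open>z\<close> through
  \<open>x\<close>; its coefficients are bounded by its values on the part inside the small ball,
  and evaluation at the parameter \<open>R\<close> gives the claim. The direction \<open>w\<close>
  is \<open>x - z\<close> divided by \<open>R\<close>, so the parameter range is always
  \<open>{0..1}\<close>, which makes \<open>C\<close> independent of \<open>z\<close> and
  \<open>r\<close>.\<close>

lemma polys_sup_extend:
 fixes R :: real
 assumes "R >= 1"
 shows "\<exists>C\<ge>1. ALL p z r A x. p : polys K (UNIV :: 'v::euclidean_space set) --> r > 0 -->
 (ALL x:cball (z :: real^'n) r. norm (p x) <= A) --> x : cball z (R * r) --> norm (p x) <= C * A"
proof -
 obtain C where "C >= 0 & (ALL q A. degree q <= K -->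
 (ALL t:{0..1::real}. \<bar>poly q t\<bar> <= A) --> (ALL i. \<bar>coeff q i\<bar> <= C * A))"
 using poly_coeff_bound[OF zero_less_one, of K] ..
 then have C: "C >= 0" "!!q A i. degree q <= K ==>
 (ALL t:{0..1::real}. \<bar>poly q t\<bar> <= A) ==> \<bar>coeff q i\<bar> <= C * A"
 by blast+
 define C' where "C' = 1 + (\<Sum>i\<le>K. C * R ^ i)"
 have C'1: "C' >= 1" unfolding C'_def using C(1) assms by (simp add: sum_nonneg)
 have "norm (p x) <= C' * A"
 if p: "p : polys K (UNIV :: 'v set)" and r: "r > 0"
 and A: "ALL x:cball (z :: real^'n) r. norm (p x) <= A" and x: "x : cball z (R * r)" for p z r A x
 proof -
 have A0: "A >= 0" using order_trans[OF norm_ge_zero bspec[OF A, of z]] r by simp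
 show ?thesis
 proof (rule norm_le_via_unit)
 fix u :: 'v assume u: "norm u = 1"
 define w where "w = (x - z) /\<^sub>R R"
 have "norm (x - z) <= R * r" using x by (simp add: dist_norm norm_minus_commute)
 then have nw: "norm w <= r" unfolding w_def norm_scaleR using assms by (simp add: field_simps)
 obtain q where q: "degree q <= K" "!!t. p (z + t *R w) \<bullet> u = poly q t"
 using polys_line[OF polys_component[OF p]] by blast
 have "\<bar>poly q t\<bar> <= A" if "t : {0..1}" for t
 proof -
 have "norm (t *R w) <= 1 * r" unfolding norm_scaleR using that nw by (intro mult_mono) auto
 then have "norm (p (z + t *R w)) <= A" using bspec[OF A, of "z + t *R w"] by (simp add: dist_norm)
 then show ?thesis using Cauchy_Schwarz_ineq2[of "p (z + t *R w)" u] u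
 by (simp flip: q(2))
 qed
 then have co: "\<bar>coeff q i\<bar> <= C * A" for i using C(2)[OF q(1)] by blast
 have "p x \<bullet> u = poly q R" using q(2)[of R] assms by (simp add: w_def)
 also have "\<dots> = (\<Sum>i\<le>degree q. coeff q i * R ^ i)" by (rule poly_altdef)
 also have "\<dots> <= (\<Sum>i\<le>degree q. C * A * R ^ i)"
 using co assms by (intro sum_mono mult_right_mono) (auto simp: abs_le_iff)
 also have "\<dots> <= (\<Sum>i\<le>K. C * A * R ^ i)"
 using q(1) C(1) A0 assms by (intro sum_mono2) auto
 also have "\<dots> <= C' * A" unfolding C'_def using A0
 by (simp add: algebra_simps sum_distrib_left)
 finally show "p x \<bullet> u <= C' * A" .
 qed (use A0 C'1 in auto)
 qed
 then show ?thesis using C'1 by blast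
qed

text \<open>A Markov inequality: up to scaling, the directional derivative is the linear coefficient
  of the restriction to a segment of length \<open>r\<close>. That segment starts in the ball but
  may leave it, hence the extension of the bound to radius \<open>2 * r\<close>.\<close>

lemma polys_inverse_estimate:
 "\<exists>C\<ge>1. ALL p z r A x \<xi>. p : polys K (UNIV :: 'v::euclidean_space set) --> r > 0 -->
 (ALL x:cball (z :: real^'n) r. norm (p x) <= A) --> x : cball z r -->
 norm (frechet_derivative p (at x) \<xi>) <= C * A * norm \<xi> / r"
proof -
 obtain C where "C >= 0 & (ALL q A. degree q <= K -->
 (ALL t:{0..1::real}. \<bar>poly q t\<bar> <= A) --> (ALL i. \<bar>coeff q i\<bar> <= C * A))"
 using poly_coeff_bound[OF zero_less_one, of K] ..
 then have C: "C >= 0" "!!q A i. degree q <= K ==>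
 (ALL t:{0..1::real}. \<bar>poly q t\<bar> <= A) ==> \<bar>coeff q i\<bar> <= C * A"
 by blast+
 obtain D where D: "D >= 1" "!!p z r A x. p : polys K (UNIV :: 'v set) ==> r > 0 ==>
 (ALL x:cball (z :: real^'n) r. norm (p x) <= A) ==> x : cball z (2 * r) ==> norm (p x) <= D * A"
 using polys_sup_extend[of 2 K, where 'v='v and 'n='n] by (metis one_le_numeral)
 have "norm (frechet_derivative p (at x) \<xi>) <= ((1 + C) * D) * A * norm \<xi> / r"
 if p: "p : polys K (UNIV :: 'v set)" and r: "r > 0"
 and A: "ALL x:cball (z :: real^'n) r. norm (p x) <= A" and x: "x : cball z r" for p z r A x \<xi>
 proof (cases "\<xi> = 0")
 case True
 have "linear (frechet_derivative p (at x))"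
 using polys_differentiable[OF p sU] by (rule linear_frechet_derivative)
 then show ?thesis using True by (simp add: linear_0)
 next
 case False
 have A0: "A >= 0" using order_trans[OF norm_ge_zero bspec[OF A, of z]] r by simp
 show ?thesis
 proof (rule norm_le_via_unit)
 fix u :: 'v assume u: "norm u = 1"
 define w where "w = (r / norm \<xi>) *R \<xi>"
 have nw: "norm w = r" using r False by (simp add: w_def)
 obtain q where q: "degree q <= K" "!!t. p (x + t *R w) \<bullet> u = poly q t"
 using polys_line[OF polys_component[OF p]] by blast
 have "\<bar>poly q t\<bar> <= D * A" if "t : {0..1}" for t
 proof -
 have "norm (t *R w) <= 1 * r" unfolding norm_scaleR using that nw r by (intro mult_mono) auto
 then have "dist z (x + t *R w) <= 2 * r" using x
 by (smt (verit, best) dist_commute dist_norm dist_triangle mem_cball add_diff_cancel_left')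
 then have "norm (p (x + t *R w)) <= D * A" using D(2)[OF p r A] by simp
 then show ?thesis using Cauchy_Schwarz_ineq2[of "p (x + t *R w)" u] u
 by (simp flip: q(2))
 qed
 then have co: "\<bar>coeff q 1\<bar> <= C * (D * A)" using C(2)[OF q(1)] by blast
 have pd: "(p has_derivative frechet_derivative p (at x)) (at x)"
 using polys_differentiable[OF p sU] frechet_derivative_works by blast
 have "((%t. p (x + t *R w) \<bullet> u) has_derivative (%t. frechet_derivative p (at x) (t *R w) \<bullet> u)) (at 0)"
 by (rule has_derivative_inner_left, rule has_derivative_compose[where g=p])
 (use pd in \<open>auto intro!: derivative_eq_intros\<close>)
 moreover have "((%t. p (x + t *R w) \<bullet> u) has_derivative (%t. poly (pderiv q) 0 * t)) (at 0)"
 unfolding q(2) using poly_DERIV[of q 0] by (simp add: has_field_derivative_def)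
 ultimately have "(%t. frechet_derivative p (at x) (t *R w) \<bullet> u) = (%t. poly (pderiv q) 0 * t)"
 by (rule has_derivative_unique)
 from fun_cong[OF this, of 1] have e: "frechet_derivative p (at x) w \<bullet> u = coeff q 1"
 by (simp add: poly_0_coeff_0 coeff_pderiv)
 have "frechet_derivative p (at x) w = (r / norm \<xi>) *R frechet_derivative p (at x) \<xi>"
 using linear_frechet_derivative[OF polys_differentiable[OF p sU], of x] unfolding w_def
 by (simp add: linear_scale)
 with e have "(r / norm \<xi>) * (frechet_derivative p (at x) \<xi> \<bullet> u) <= C * (D * A)" using abs_le_D1[OF co] by simp
 then have "frechet_derivative p (at x) \<xi> \<bullet> u <= C * (D * A) * norm \<xi> / r"
 using r False by (simp add: field_simps)
 also have "\<dots> <= ((1 + C) * D) * A * norm \<xi> / r"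
 using A0 D(1) r by (intro divide_right_mono) (auto simp: algebra_simps)
 finally show "frechet_derivative p (at x) \<xi> \<bullet> u <= ((1 + C) * D) * A * norm \<xi> / r" .
 qed (use A0 D(1) C(1) r in auto)
 qed
 moreover have "(1 + C) * D >= 1" using C(1) D(1) mult_mono[of 1 "1 + C" 1 D] by simp
 ultimately show ?thesis by blast
qed

section \<open>Integrals of continuous functions over compact sets\<close>

lemma absolutely_integrable_continuous_compact:
 fixes f :: "'a::euclidean_space => 'b::euclidean_space"
 assumes "compact S" "continuous_on S f"
 shows "f absolutely_integrable_on S"
proof -
 have "integrable lborel (%x. indicator S x *R f x)"
 using assms by (rule borel_integrable_compact)
 then have "integrable lebesgue (%x. indicator S x *R f x)"
 by (simp add: integrable_completion)
 then show ?thesis by (simp add: set_integrable_def)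
qed

lemma integrable_compact:
 fixes f :: "'a::euclidean_space => 'b::euclidean_space"
 shows "compact S ==> continuous_on S f ==> f integrable_on S"
 using absolutely_integrable_continuous_compact set_lebesgue_integral_eq_integral(1) by blast

lemma integral_const_compact:
 fixes c :: real
 assumes "compact (S :: 'a::euclidean_space set)"
 shows "integral S (%_. c) = c * measure lebesgue S"
 using lmeasure_integral[OF lmeasurable_compact[OF assms]] integral_mult_right[of S c "%_. 1"] by simp

lemma integral_le_const_compact:
 fixes f :: "'a::euclidean_space => real"
 assumes "compact S" "continuous_on S f" "!!x. x : S ==> f x <= c"
 shows "integral S f <= c * measure lebesgue S"
 unfolding integral_const_compact[OF assms(1), symmetric]
 using assms by (intro integral_le integrable_compact) auto

lemma integral_ge_const_compact:
 fixes f :: "'a::euclidean_space => real"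
 assumes "compact S" "continuous_on S f" "!!x. x : S ==> c <= f x"
 shows "c * measure lebesgue S <= integral S f"
 unfolding integral_const_compact[OF assms(1), symmetric]
 using assms by (intro integral_le integrable_compact) auto

text \<open>Near a maximum point over the half ball a polynomial cannot decay fast: by the inverse
  estimate it keeps half of its size \<open>A\<close> on a ball of radius
  \<open>\<delta> * r\<close>, which bounds the integral below in terms of \<open>A\<close>, while
  \<open>polys_sup_extend\<close> bounds the value at \<open>x\<close> by a multiple of
  \<open>A\<close>.\<close>

lemma polys_L2_lower:
 fixes R :: real
 assumes R: "R >= 1"
 shows "\<exists>c>0. ALL p z r x. p : polys K (UNIV :: 'v::euclidean_space set) --> r > 0 --> x : cball z (R * r) -->
 c * r ^ CARD('n) * (norm (p (x :: real^'n)))^2 <= integral (cball z r) (%x. (norm (p x))^2)"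
proof -
 obtain C1 where "C1 >= 1 & (ALL p z r A x. p : polys K (UNIV :: 'v set) --> r > 0 -->
 (ALL x:cball (z :: real^'n) r. norm (p x) <= A) --> x : cball z (2 * r) --> norm (p x) <= C1 * A)"
 using polys_sup_extend[OF one_le_numeral, where 'v='v and 'n='n] ..
 then have C1: "C1 >= 1" "!!p z r A x. p : polys K (UNIV :: 'v set) ==> r > 0 ==>
 (ALL x:cball (z :: real^'n) r. norm (p x) <= A) ==> x : cball z (2 * r) ==> norm (p x) <= C1 * A"
 by blast+
 have R2: "1 <= 2 * R" using R by simp
 obtain C3 where "C3 >= 1 & (ALL p z r A x. p : polys K (UNIV :: 'v set) --> r > 0 -->
 (ALL x:cball (z :: real^'n) r. norm (p x) <= A) --> x : cball z (2 * R * r) --> norm (p x) <= C3 * A)"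
 using polys_sup_extend[OF R2, where 'v='v and 'n='n] ..
 then have C3: "C3 >= 1" "!!p z r A x. p : polys K (UNIV :: 'v set) ==> r > 0 ==>
 (ALL x:cball (z :: real^'n) r. norm (p x) <= A) ==> x : cball z (2 * R * r) ==> norm (p x) <= C3 * A"
 by blast+
 obtain C2 where "C2 >= 1 & (ALL p z r A x \<xi>. p : polys K (UNIV :: 'v set) --> r > 0 -->
 (ALL x:cball (z :: real^'n) r. norm (p x) <= A) --> x : cball z r -->
 norm (frechet_derivative p (at x) \<xi>) <= C2 * A * norm \<xi> / r)"
 using polys_inverse_estimate[where 'v='v and 'n='n] ..
 then have C2: "C2 >= 1" "!!p z r A x \<xi>. p : polys K (UNIV :: 'v set) ==> r > 0 ==>
 (ALL x:cball (z :: real^'n) r. norm (p x) <= A) ==> x : cball z r ==>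
 norm (frechet_derivative p (at x) \<xi>) <= C2 * A * norm \<xi> / r"
 by blast+
 \<comment> \<open>The derivative on the ball of radius \<open>r\<close> is at most
   \<open>C1 * C2 * A / r\<close>, so over the distance \<open>\<delta> * r\<close> the value
   changes by at most \<open>A / 2\<close>. As \<open>\<delta>\<close> is at most 1/2, a small ball
   around a point of the half ball stays in the full one.\<close>
 define \<delta> where "\<delta> = 1 / (2 * (C1 * C2))"
 have C12: "C1 * C2 >= 1" using C1(1) C2(1) mult_mono[of 1 C1 1 C2] by simp
 have \<delta>: "\<delta> > 0" "\<delta> <= 1/2" using C12 by (simp_all add: \<delta>_def)
 define m where "m = measure lebesgue (cball (0 :: real^'n) 1)"
 have m: "m > 0" unfolding m_def using content_cball_pos[of 1 "0::real^'n"] by simp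
 define c where "c = \<delta> ^ CARD('n) * m / (4 * C3^2)"
 have c: "c > 0" using \<delta> m C3(1) by (simp add: c_def)
 have "c * r ^ CARD('n) * (norm (p x))^2 <= integral (cball z r) (%x. (norm (p x))^2)"
 if p: "p : polys K (UNIV :: 'v set)" and r: "r > 0" and x: "x : cball z (R * r)"
 for p and z x :: "real^'n" and r
 proof -
 have cont: "continuous_on S (%x. (norm (p x))^2)" for S
 by (intro continuous_intros polys_cont[OF p])
 have "continuous_on (cball z (r/2)) (%x. norm (p x))"
 by (intro continuous_intros polys_cont[OF p])
 then obtain x0 where x0: "x0 : cball z (r/2)" "!!y. y : cball z (r/2) ==> norm (p y) <= norm (p x0)"
 using continuous_attains_sup[of "cball z (r/2)" "%x. norm (p x)"] r by auto
 define A where "A = norm (p x0)"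
 have bd: "ALL y:cball z r. norm (p y) <= C1 * A"
 using C1(2)[OF p, of "r/2" z A] x0(2) r by (auto simp: A_def)
 have sub: "cball x0 (\<delta> * r) \<subseteq> cball z r"
 proof
 fix y assume "y : cball x0 (\<delta> * r)"
 moreover have "\<delta> * r <= 1/2 * r" using \<delta> r by (intro mult_right_mono) auto
 ultimately show "y : cball z r" using x0(1) dist_triangle[of z y x0] by simp
 qed
 have ge: "(A/2)^2 <= (norm (p y))^2" if y: "y : cball x0 (\<delta> * r)" for y
 proof -
 have "norm (p y - p x0) <= (C2 * (C1 * A) / r) * norm (y - x0)"
 proof (rule differentiable_bound[OF convex_cball[of x0 "\<delta> * r"]])
 fix w assume w: "w : cball x0 (\<delta> * r)"
 show "(p has_derivative frechet_derivative p (at w)) (at w within cball x0 (\<delta> * r))"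
 using polys_differentiable[OF p sU] frechet_derivative_works
 by (blast intro: has_derivative_at_withinI)
 show "onorm (frechet_derivative p (at w)) <= C2 * (C1 * A) / r"
 using C2(2)[OF p r bd] w sub by (intro onorm_le) (auto simp: field_simps)
 qed (use y \<delta> r in auto)
 also have "\<dots> <= (C2 * (C1 * A) / r) * (\<delta> * r)"
 using y C2(1) C1(1) r by (intro mult_left_mono) (auto simp: dist_norm norm_minus_commute A_def)
 also have "\<dots> = A / 2" using r C1(1) C2(1) by (simp add: \<delta>_def)
 finally have "A / 2 <= norm (p y)" using norm_triangle_sub[of "p x0" "p y"]
 by (simp add: A_def norm_minus_commute)
 then show ?thesis by (intro power_mono) (auto simp: A_def)
 qed
 have "x : cball z (2 * R * (r/2))" using x by simp
 then have "norm (p x) <= C3 * A" using C3(2)[OF p, of "r/2" z A x] x0(2) r by (auto simp: A_def)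
 then have "(norm (p x))^2 <= (C3 * A)^2" by (intro power_mono) auto
 then have "c * r ^ CARD('n) * (norm (p x))^2 <= c * r ^ CARD('n) * (C3 * A)^2"
 using c r by (intro mult_left_mono) auto
 also have "\<dots> = (A/2)^2 * ((\<delta> * r) ^ CARD('n) * m)"
 using C3(1) by (simp add: c_def field_simps power_mult_distrib power2_eq_square)
 also have "(\<delta> * r) ^ CARD('n) * m = measure lebesgue (cball x0 (\<delta> * r))"
 using content_cball[of "\<delta> * r" x0] content_cball[of 1 "0::real^'n"] \<delta> r by (simp add: m_def)
 also have "(A/2)^2 * measure lebesgue (cball x0 (\<delta> * r)) <= integral (cball x0 (\<delta> * r)) (%x. (norm (p x))^2)"
 using ge by (intro integral_ge_const_compact cont) auto
 also have "\<dots> <= integral (cball z r) (%x. (norm (p x))^2)"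
 using sub by (intro integral_subset_le integrable_compact cont) auto
 finally show ?thesis .
 qed
 then show ?thesis using c by blast
qed

section \<open>Simplices\<close>

text \<open>The vertex set, not the simplex, is the parameter, so that facets can be addressed by
  the vertex opposite to them. The well-order on the index type comes from the change of variables
  formula in \<open>integral_image_rank_one\<close>.\<close>

locale full_simplex =
 fixes C :: "(real^'n::{finite,wellorder}) set"
 assumes indep: "\<not> affine_dependent C" and card_C: "card C = Suc CARD('n)"
begin

abbreviation "T \<equiv> convex hull C"
abbreviation "bc \<equiv> bary T"
abbreviation "fac a \<equiv> convex hull (C - {a})"

text \<open>Barycentric coordinates are affine, so the point 0 at which the gradient is taken is
  immaterial (\<open>grad_bary\<close>).\<close>

definition g :: "real^'n::_ => real^'n::_" where "g a = grad (bc a) 0"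

lemma finite_C: "finite C"
 using indep by (rule aff_independent_finite)

lemma C_nonempty: "C ~= {}"
 using card_C by auto

lemma vertices_T: "vertices T = C"
 using extreme_point_of_convex_hull_affine_independent[OF indep] by (auto simp: vertices_def)

lemma bary_unique_aux:
 assumes "sum u C = 1" "sum w C = 1" "(SUM b:C. u b *R b) = (SUM b:C. w b *R b)" "a : C"
 shows "u a = w a"
proof (rule ccontr)
 assume "u a ~= w a"
 then have "EX v:C. u v - w v ~= 0" using assms(4) by auto
 moreover have "(SUM b:C. u b - w b) = 0" using assms by (simp add: sum_subtractf)
 moreover have "(SUM b:C. (u b - w b) *R b) = 0"
 using assms by (simp add: sum_subtractf scaleR_left_diff_distrib)
 ultimately have "affine_dependent C"
 unfolding affine_dependent_explicit_finite[OF finite_C] by (intro exI[of _ "%b. u b - w b"] conjI)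
 then show False using indep by simp
qed

text \<open>The affine hull of \<open>C\<close> is the whole space, so coordinates exist for every
  point, also outside the simplex; together with uniqueness this makes the definite description in
  \<open>bary\<close> proper.\<close>

lemma bary_props:
 shows bary_outside: "a \<notin> C ==> bc a x = 0"
 and bary_sum: "(SUM b:C. bc b x) = 1"
 and bary_point: "(SUM b:C. bc b x *R b) = x"
proof -
 have "x : affine hull C" using affine_independent_span_eq[OF indep] card_C by simp
 then obtain u where u: "sum u C = 1" "(SUM b:C. u b *R b) = x"
 unfolding affine_hull_finite[OF finite_C] by blast
 define w where "w b = (if b : C then u b else 0)" for b
 let ?P = "%u. (ALL b. b \<notin> C --> u b = 0) & (SUM b:C. u b) = 1 & (SUM b:C. u b *R b) = x"
 have w: "?P w" using u by (simp add: w_def cong: sum.cong)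
 have "?P (THE u. ?P u)"
 proof (rule theI[of ?P, OF w])
 fix v assume v: "?P v"
 show "v = w"
 proof
 fix b show "v b = w b"
 using bary_unique_aux[of v w b] v w by (cases "b : C") auto
 qed
 qed
 moreover have "(THE u. ?P u) = (%b. bc b x)" unfolding bary_def vertices_T by (rule ext) simp
 ultimately have "?P (%b. bc b x)" by simp
 then show "a \<notin> C ==> bc a x = 0" "(SUM b:C. bc b x) = 1" "(SUM b:C. bc b x *R b) = x" by auto
qed

lemma bary_unique:
 assumes "sum u C = 1" "(SUM b:C. u b *R b) = x" "a : C"
 shows "bc a x = u a"
 using bary_unique_aux[of "%b. bc b x" u a] assms bary_sum bary_point by simp

lemma bary_vertex: "a : C ==> b : C ==> bc a b = (if a = b then 1 else 0)"
 by (rule bary_unique) (use finite_C in \<open>simp_all add: sum.delta' if_distrib[of "%c. c *R _"] cong: if_cong\<close>)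

lemma bary_linear_part:
 assumes "a : C"
 shows "linear (%\<xi>. bc a \<xi> - bc a 0)"
proof (rule linearI)
 fix x y :: "real^'n::_" and t
 have "bc a (x + y) = bc a x + bc a y - bc a 0"
 by (rule bary_unique)
 (use assms in \<open>simp_all add: sum.distrib sum_subtractf bary_sum bary_point algebra_simps\<close>)
 then show "bc a (x + y) - bc a 0 = (bc a x - bc a 0) + (bc a y - bc a 0)" by simp
 have "bc a (t *R x) = t * bc a x + (1 - t) * bc a 0"
 proof (rule bary_unique)
 show "(SUM b:C. t * bc b x + (1 - t) * bc b 0) = 1"
 by (simp add: sum.distrib sum_distrib_left[symmetric] bary_sum)
 have "(SUM b:C. (t * bc b x + (1 - t) * bc b 0) *R b)
 = t *R (SUM b:C. bc b x *R b) + (1 - t) *R (SUM b:C. bc b 0 *R b)"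
 by (simp add: scaleR_left.add sum.distrib scaleR_sum_right)
 then show "(SUM b:C. (t * bc b x + (1 - t) * bc b 0) *R b) = t *R x" by (simp add: bary_point)
 qed (use assms in auto)
 then show "bc a (t *R x) - bc a 0 = t *R (bc a x - bc a 0)" by (simp add: algebra_simps)
qed

lemma bary_has_derivative_linear_part:
 assumes "a : C"
 shows "(bc a has_derivative (%\<xi>. bc a \<xi> - bc a 0)) (at x)"
proof -
 have "((%x. (bc a x - bc a 0) + bc a 0) has_derivative (%\<xi>. bc a \<xi> - bc a 0)) (at x)"
 by (intro has_derivative_add_const linear_imp_has_derivative bary_linear_part assms)
 then show ?thesis by simp
qed

lemma grad_bary: assumes "a : C" shows "grad (bc a) x = g a"
proof -
 have "frechet_derivative (bc a) (at x) = (%\<xi>. bc a \<xi> - bc a 0)" for x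
 using frechet_derivative_at[OF bary_has_derivative_linear_part[OF assms]] by simp
 then show ?thesis by (simp add: grad_def g_def)
qed

lemma inner_g: assumes "a : C" shows "g a \<bullet> \<xi> = bc a \<xi> - bc a 0"
proof -
 let ?L = "%\<xi>. bc a \<xi> - bc a 0"
 have fd: "frechet_derivative (bc a) (at 0) = ?L"
 using frechet_derivative_at[OF bary_has_derivative_linear_part[OF assms]] by simp
 have "?L \<xi> = ?L (SUM i:UNIV. \<xi>$i *R axis i 1)"
 using basis_expansion[of \<xi>] by (simp add: scalar_mult_eq_scaleR)
 also have "\<dots> = (SUM i:UNIV. \<xi>$i *R ?L (axis i 1))"
 by (simp only: linear_sum[OF bary_linear_part[OF assms]] linear_scale[OF bary_linear_part[OF assms]])
 also have "\<dots> = g a \<bullet> \<xi>" by (simp add: g_def grad_def fd inner_vec_def mult.commute)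
 finally show ?thesis by simp
qed

lemma bary_affine: "a : C ==> bc a x = bc a z + g a \<bullet> (x - z)"
 by (simp add: inner_diff_right inner_g)

lemma bary_add: "a : C ==> bc a (x + \<xi>) = bc a x + g a \<bullet> \<xi>"
 using bary_affine[of a "x + \<xi>" x] by simp

lemma bary_has_derivative:
 "a : C ==> (bc a has_derivative (%\<xi>. g a \<bullet> \<xi>)) (at x)"
 using bary_has_derivative_linear_part by (simp add: inner_g)

lemma g_vertex: "a : C ==> b : C ==> c : C ==>
 g a \<bullet> (b - c) = (if a = b then 1 else 0) - (if a = c then 1 else 0)"
 by (simp add: inner_diff_right inner_g bary_vertex)

lemma sum_g: "(SUM a:C. g a) = 0"
proof -
 have "(SUM a:C. g a) \<bullet> \<xi> = 0" for \<xi>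
 by (simp add: inner_sum_left inner_g sum_subtractf bary_sum)
 then show ?thesis by (metis inner_eq_zero_iff)
qed

text \<open>The vectors \<open>a - z\<close> and the gradients \<open>g a\<close> are dual frames:
  the sum of their tensor products is the identity. The base point \<open>z\<close> is arbitrary
  because the gradients add up to zero. This and its transpose \<open>g_reconstruct_dual\<close>
  serve as coordinates adapted to the simplex.\<close>

lemma g_reconstruct: "(SUM a:C. (g a \<bullet> \<xi>) *R (a - z)) = \<xi>"
proof -
 have "(SUM a:C. (g a \<bullet> \<xi>) *R (a - z)) = (SUM a:C. (bc a \<xi> - bc a 0) *R a) - (SUM a:C. (g a \<bullet> \<xi>)) *R z"
 unfolding scaleR_sum_left by (simp add: scaleR_right_diff_distrib sum_subtractf inner_g)
 also have "(SUM a:C. (bc a \<xi> - bc a 0) *R a) = \<xi>"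
 by (simp add: scaleR_left_diff_distrib sum_subtractf bary_point)
 also have "(SUM a:C. (g a \<bullet> \<xi>)) = 0" by (simp add: inner_sum_left[symmetric] sum_g)
 finally show ?thesis by simp
qed

lemma g_reconstruct_dual: "(SUM a:C. ((a - z) \<bullet> u) *R g a) = u"
proof -
 have "((SUM a:C. ((a - z) \<bullet> u) *R g a) - u) \<bullet> \<xi> = 0" for \<xi>
 proof -
 have "u \<bullet> \<xi> = u \<bullet> (SUM a:C. (g a \<bullet> \<xi>) *R (a - z))" by (simp only: g_reconstruct)
 also have "\<dots> = (SUM a:C. ((a - z) \<bullet> u) *R g a) \<bullet> \<xi>"
 by (simp add: inner_sum_left inner_sum_right inner_commute mult.commute)
 finally show ?thesis by (simp add: inner_diff_left)
 qed
 from this[of "(SUM a:C. ((a - z) \<bullet> u) *R g a) - u"] show ?thesis by simp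
qed

lemma g_nonzero: assumes "a : C" shows "g a ~= 0"
proof -
 obtain b where b: "b : C" "b ~= a"
 proof -
 have "card (C - {a}) > 0" using card_C assms finite_C by (simp add: card_Diff_singleton)
 then have "C - {a} ~= {}" by (metis card.empty less_irrefl)
 then show thesis using that by auto
 qed
 have "g a \<bullet> (a - b) = 1" using g_vertex[OF assms assms b(1)] b by simp
 then show ?thesis by auto
qed

lemma mem_T: "x : T \<longleftrightarrow> (ALL a:C. 0 <= bc a x)"
proof
 assume "x : T"
 then obtain u where "ALL a:C. 0 <= u a" "sum u C = 1" "(SUM a:C. u a *R a) = x"
 unfolding convex_hull_finite[OF finite_C] by blast
 then show "ALL a:C. 0 <= bc a x" using bary_unique by auto
next
 assume "ALL a:C. 0 <= bc a x"
 then show "x : T" using bary_sum[of x] bary_point[of x]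
 by (subst convex_hull_finite[OF finite_C], intro CollectI exI[of _ "%a. bc a x"] conjI)
qed

lemma mem_fac: assumes "a : C" shows "x : fac a \<longleftrightarrow> x : T & bc a x = 0"
proof
 assume "x : fac a"
 then obtain u where u: "ALL b:C - {a}. 0 <= u b" "sum u (C - {a}) = 1" "(SUM b:C - {a}. u b *R b) = x"
 unfolding convex_hull_finite[OF finite_Diff[OF finite_C]] by blast
 define w where "w b = (if b = a then 0 else u b)" for b
 have "sum w (C - {a}) = 1" "(SUM b:C - {a}. w b *R b) = x"
 unfolding u(3)[symmetric] u(2)[symmetric] by (auto simp: w_def intro!: sum.cong)
 then have w: "sum w C = 1" "(SUM b:C. w b *R b) = x"
 using sum.remove[OF finite_C assms, of w] sum.remove[OF finite_C assms, of "%b. w b *R b"]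
 by (simp_all add: w_def)
 have "bc b x = w b" if "b : C" for b using bary_unique[OF w that] .
 then show "x : T & bc a x = 0" unfolding mem_T using u(1) assms by (simp add: w_def)
next
 assume x: "x : T & bc a x = 0"
 have "(SUM b:C - {a}. bc b x) = 1" "(SUM b:C - {a}. bc b x *R b) = x"
 using bary_sum[of x] bary_point[of x] x sum.remove[OF finite_C assms, of "%b. bc b x"]
 sum.remove[OF finite_C assms, of "%b. bc b x *R b"] by simp_all
 then show "x : fac a" using x
 by (subst convex_hull_finite[OF finite_Diff[OF finite_C]], intro CollectI exI[of _ "%a. bc a x"] conjI) (auto simp: mem_T)
qed

lemma affine_hull_fac: assumes "a : C" shows "affine hull fac a = {x. bc a x = 0}"
proof -
 have fin: "finite (C - {a})" using finite_C by simp
 have "affine hull fac a = affine hull (C - {a})" by (rule affine_hull_convex_hull)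
 also have "\<dots> = {x. bc a x = 0}"
 proof (intro set_eqI iffI)
 fix x assume "x : affine hull (C - {a})"
 then obtain u where u: "sum u (C - {a}) = 1" "(SUM b:C - {a}. u b *R b) = x"
 unfolding affine_hull_finite[OF fin] by blast
 define w where "w b = (if b = a then 0 else u b)" for b
 have "sum w (C - {a}) = 1" "(SUM b:C - {a}. w b *R b) = x"
 unfolding u(2)[symmetric] u(1)[symmetric] by (auto simp: w_def intro!: sum.cong)
 then have w: "sum w C = 1" "(SUM b:C. w b *R b) = x"
 using sum.remove[OF finite_C assms, of w] sum.remove[OF finite_C assms, of "%b. w b *R b"]
 by (simp_all add: w_def)
 show "x : {x. bc a x = 0}" using bary_unique[OF w assms] by (simp add: w_def)
 next
 fix x assume x: "x : {x. bc a x = 0}"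
 have "(SUM b:C - {a}. bc b x) = 1" "(SUM b:C - {a}. bc b x *R b) = x"
 using bary_sum[of x] bary_point[of x] x sum.remove[OF finite_C assms, of "%b. bc b x"]
 sum.remove[OF finite_C assms, of "%b. bc b x *R b"] by simp_all
 then show "x : affine hull (C - {a})"
 by (subst affine_hull_finite[OF fin], intro CollectI exI[of _ "%a. bc a x"] conjI)
 qed
 finally show ?thesis .
qed

lemma facet_iff: "F facet_of T \<longleftrightarrow> (EX a:C. F = fac a)"
 using facet_of_convex_hull_affine_independent_alt[OF indep, of F] card_C by auto

lemma fac_inj: "a : C ==> b : C ==> fac a = fac b ==> a = b"
proof (rule ccontr)
 assume a: "a : C" "b : C" "fac a = fac b" "a ~= b"
 then have "b : fac a" by (intro hull_inc) simp
 then have "b : fac b" unfolding a(3) .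
 then show False using a mem_fac[of b b] bary_vertex[of b b] by simp
qed

lemma facets_T: "{F. F facet_of T} = fac ` C"
 by (auto simp: facet_iff)

text \<open>The coordinate of \<open>a\<close> grows from the facet opposite to \<open>a\<close>
  towards \<open>a\<close>, so the outward direction is minus its gradient.\<close>

definition nu :: "real^'n::_ => real^'n::_" where "nu a = - (g a /\<^sub>R norm (g a))"

lemma norm_nu: "a : C ==> norm (nu a) = 1"
 using g_nonzero by (simp add: nu_def)

lemma g_nu: "g a = - (norm (g a) *R nu a)"
 by (cases "g a = 0") (simp_all add: nu_def)

text \<open>A candidate normal has equal products with all vertices but \<open>a\<close>. Expanding
  it in the gradients by \<open>g_reconstruct_dual\<close> and using that they sum to zero leaves a
  multiple of \<open>g a\<close>; norm and sign are then forced.\<close>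

lemma outer_normal_fac: assumes a: "a : C" shows "outer_normal T (fac a) = nu a"
 unfolding outer_normal_def
proof (rule the_equality)
 define c0 where "c0 = nu a \<bullet> a + inverse (norm (g a))"
 have e: "nu a \<bullet> x = c0 - inverse (norm (g a)) * bc a x" for x
 unfolding c0_def using bary_affine[OF a, of x a] bary_vertex[OF a a]
 by (simp add: nu_def inner_diff_right ring_distribs)
 then show "norm (nu a) = 1 & (EX c. (ALL x:fac a. nu a \<bullet> x = c) & (ALL x:T. nu a \<bullet> x <= c))"
 using a norm_nu[OF a] mem_fac[OF a] mem_T
 by (intro conjI exI[of _ c0] ballI) (simp_all add: e)
next
 fix n assume "norm n = 1 & (EX c. (ALL x:fac a. n \<bullet> x = c) & (ALL x:T. n \<bullet> x <= c))"
 then obtain c where n: "norm n = 1" "ALL x:fac a. n \<bullet> x = c" "ALL x:T. n \<bullet> x <= c" by blast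
 have nb: "b \<bullet> n = c" if "b : C - {a}" for b using n(2) hull_inc[OF that, of convex] by (simp add: inner_commute)
 have na: "a \<bullet> n <= c" using n(3) hull_inc[OF a, of convex] by (simp add: inner_commute)
 have nbs: "(SUM b:C - {a}. (b \<bullet> n) *R g b) = (SUM b:C - {a}. c *R g b)"
 by (rule sum.cong) (simp_all only: nb)
 have "n = (SUM b:C. (b \<bullet> n) *R g b)" using g_reconstruct_dual[of 0 n] by simp
 also have "\<dots> = (a \<bullet> n) *R g a + (SUM b:C - {a}. c *R g b)"
 unfolding nbs[symmetric] by (rule sum.remove[OF finite_C a])
 also have "(SUM b:C - {a}. c *R g b) = - (c *R g a)"
 using sum.remove[OF finite_C a, of g] sum_g by (simp add: scaleR_sum_right[symmetric] eq_neg_iff_add_eq_0 scaleR_right_distrib[symmetric] add.commute)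
 finally have e: "n = - ((c - a \<bullet> n) *R g a)" by (simp add: scaleR_left_diff_distrib)
 then have "norm n = (c - a \<bullet> n) * norm (g a)" using na by (metis abs_of_nonneg diff_ge_0_iff_ge norm_minus_cancel norm_scaleR)
 then have "c - a \<bullet> n = inverse (norm (g a))" using n(1) g_nonzero[OF a] by (simp add: field_simps)
 with e show "n = nu a" by (simp add: nu_def)
qed

end

section \<open>Shears, prisms and facet integrals\<close>

lemma det_rank_one:
 fixes u w :: "real^'n"
 shows "det (\<chi> i. axis i 1 + u$i *s w) = 1 + u \<bullet> w"
proof -
 \<comment> \<open>The rank-one part is inserted row by row. Multilinearity splits off the
   determinant in which one row is replaced by \<open>w\<close>, and that one, \<open>B\<close>, is
   unaffected by the rows already inserted.\<close>
 define A where "A S = (\<chi> i. if i : S then axis i 1 + u$i *s w else axis i 1)" for S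
 define B where "B S j = (\<chi> i. if i = j then w else A S $ i)" for S j
 have detB: "finite S ==> j \<notin> S ==> det (B S j) = w$j" for S j
 proof (induction S rule: finite_induct)
 case empty
 have row: "row i (mat 1) = axis i (1::real)" for i :: 'n
 by (simp add: row_def mat_def vec_eq_iff axis_def)
 have "B {} j = (\<chi> i. if i = j then SUM i:UNIV. w$i *s row i (mat 1) else row i (mat 1))"
 by (simp add: B_def A_def vec_eq_iff row basis_expansion)
 then show ?case using cramer_lemma_transpose[of j w "mat 1"] by simp
 next
 case (insert l S)
 then have lj: "l ~= j" by auto
 have "B (insert l S) j =
 (\<chi> k. if k = l then row l (B S j) + u$l *s row j (B S j) else row k (B S j))"
 using insert.hyps lj by (auto simp: B_def A_def vec_eq_iff row_def)
 then have "det (B (insert l S) j) = det (B S j)" using det_row_operation[OF lj] by simp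
 then show ?case using insert by simp
 qed
 have "finite S ==> det (A S) = 1 + (SUM i:S. u$i * w$i)" for S
 proof (induction S rule: finite_induct)
 case empty
 have "A {} = mat 1" by (auto simp: A_def vec_eq_iff mat_def axis_def)
 then show ?case by simp
 next
 case (insert l S)
 have 1: "A (insert l S) = (\<chi> i. if i = l then axis l 1 + u$l *s w else A S $ i)"
 by (auto simp: A_def vec_eq_iff)
 have 2: "(\<chi> i. if i = l then axis l 1 else A S $ i) = A S"
 using insert.hyps by (auto simp: A_def vec_eq_iff)
 have 3: "det (\<chi> i. if i = l then u$l *s w else A S $ i) = u$l * det (B S l)"
 using det_row_mul[of l "u$l" "%_. w" "%i. A S $ i"] by (simp add: B_def)
 show ?case
 unfolding 1 det_row_add[of l "%_. axis l 1" "%_. u$l *s w" "%i. A S $ i"] 2 3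
 using insert by (simp add: detB)
 qed
 from this[of UNIV] show ?thesis by (simp add: A_def inner_vec_def)
qed

lemma matrix_rank_one:
 "matrix (%\<xi> :: real^'n. \<xi> + (m \<bullet> \<xi>) *R w) = (\<chi> i. axis i 1 + w$i *s m)"
proof -
 have "m \<bullet> axis j 1 = m$j" for j by (simp add: inner_axis)
 then show ?thesis by (auto simp: matrix_def vec_eq_iff axis_def)
qed

text \<open>The maps between prisms below are the identity plus a rank-one linear map plus a
  translation, for which the determinant is explicit.\<close>

lemma integral_image_rank_one:
 fixes m w x0 :: "real^'n::{finite,wellorder}" and F :: "real^'n::_ => real"
 assumes S: "compact S" and F: "continuous_on (A ` S) F"
 and A: "!!x. A x = x + (m \<bullet> (x - x0)) *R w + c" and nz: "1 + m \<bullet> w ~= 0"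
 shows "integral (A ` S) F = \<bar>1 + m \<bullet> w\<bar> * integral S (%x. F (A x))"
proof -
 let ?A' = "%\<xi>. \<xi> + (m \<bullet> \<xi>) *R w"
 have der: "(A has_derivative ?A') (at x within S)" for x
 unfolding A[abs_def] by (auto intro!: derivative_eq_intros)
 have det: "det (matrix ?A') = 1 + m \<bullet> w"
 unfolding matrix_rank_one det_rank_one by (simp add: inner_commute)
 have inj: "inj_on A S"
 proof (rule inj_onI)
 fix x y assume "A x = A y"
 then have e: "(x - y) + (m \<bullet> (x - y)) *R w = 0"
 unfolding A by (simp add: algebra_simps inner_diff_right)
 then have "m \<bullet> (x - y) + (m \<bullet> (x - y)) * (m \<bullet> w) = 0"
 by (metis inner_add_right inner_scaleR_right inner_zero_right)
 then have "(m \<bullet> (x - y)) * (1 + m \<bullet> w) = 0" by (simp add: algebra_simps)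
 then have "m \<bullet> (x - y) = 0" using nz by simp
 then show "x = y" using e by simp
 qed
 have contA: "continuous_on S A" by (rule has_derivative_continuous_on[OF der])
 have int: "F absolutely_integrable_on (A ` S)"
 using F by (intro absolutely_integrable_continuous_compact compact_continuous_image contA S)
 \<comment> \<open>The formula is applied to values in \<open>real^1\<close>, hence the embedding of
   the scalar integrand.\<close>
 have "integral (A ` S) (%x. vec (F x) :: real^1)
 = integral S (%x. \<bar>det (matrix ?A')\<bar> *R (vec (F (A x)) :: real^1))"
 proof (rule integral_change_of_variables[OF fmeasurableD[OF lmeasurable_compact[OF S]] der inj disjI1])
 show "(%x. vec (F x) :: real^1) absolutely_integrable_on A ` S"
 using int by (simp only: absolutely_integrable_on_1_iff vec_component)
 qed
 then show ?thesis unfolding integral_on_1_eq det by (simp add: vec_eq_iff)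
qed

context full_simplex begin

text \<open>Orthogonal projection onto the hyperplane of the facet opposite to \<open>a\<close>. The
  sign is positive because \<open>nu a\<close> points in the direction of decreasing
  \<open>bc a\<close>.\<close>

definition pr :: "real^'n::_ => real^'n::_ => real^'n::_" where
 "pr a x = x + (bc a x / norm (g a)) *R nu a"

lemma g_dot_nu: "a : C ==> g a \<bullet> nu a = - norm (g a)"
 using g_nonzero by (simp add: nu_def dot_square_norm power2_eq_square)

lemma bc_pr: "a : C ==> bc a (pr a x) = 0"
 using g_nonzero by (simp add: pr_def bary_add g_dot_nu)

lemma pr_fixed: "bc a x = 0 ==> pr a x = x"
 by (simp add: pr_def)

lemma closest_point_fac: assumes a: "a : C" shows "closest_point (affine hull fac a) x = pr a x"
proof -
 have "dist x (pr a x) <= dist x y" if "bc a y = 0" for y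
 proof -
 have "\<bar>bc a x\<bar> = \<bar>g a \<bullet> (x - y)\<bar>" using bary_affine[OF a, of x y] that by simp
 also have "\<dots> <= norm (g a) * norm (x - y)" by (rule Cauchy_Schwarz_ineq2)
 finally show ?thesis using g_nonzero[OF a] norm_nu[OF a]
 by (simp add: dist_norm pr_def field_simps)
 qed
 then show ?thesis
 using bc_pr[OF a]
 by (intro closest_point_unique[symmetric] convex_affine_hull closed_affine_hull)
 (auto simp del: affine_hull_convex_hull simp: affine_hull_fac[OF a])
qed

lemma infdist_fac: assumes a: "a : C" shows "infdist x (affine hull fac a) = \<bar>bc a x\<bar> / norm (g a)"
proof -
 have "pr a x : affine hull fac a" using bc_pr[OF a] affine_hull_fac[OF a] by simp
 then have "affine hull fac a ~= {}" by blast
 then show ?thesis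
 unfolding infdist_eq_setdist using closest_point_fac[OF a] norm_nu[OF a]
 by (subst setdist_closest_point) (auto simp: closed_affine_hull pr_def dist_norm)
qed

text \<open>The oblique prism over a facet in direction \<open>w\<close>: for \<open>w = nu a\<close> and \<open>t = 0\<close> it is the one
  in the definition of the facet integral.\<close>

definition slab :: "real^'n::_ => real^'n::_ => real => (real^'n::_) set" where
 "slab a w t = {x. bc a x / (g a \<bullet> w) : {t - 1/2..t + 1/2} & x - (bc a x / (g a \<bullet> w)) *R w : fac a}"

lemma FI_slab:
 assumes a: "a : C"
 shows "FI (fac a) f = integral (slab a (nu a) 0) (%x. f (pr a x))"
proof -
 have "{x. closest_point (affine hull fac a) x : fac a & infdist x (affine hull fac a) <= 1/2} = slab a (nu a) 0"
 proof -
 have "\<bar>bc a x\<bar> / norm (g a) <= 1/2 \<longleftrightarrow> bc a x / (g a \<bullet> nu a) : {0 - 1/2..0 + 1/2}" for x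
 proof -
 have "\<bar>bc a x\<bar> / norm (g a) = \<bar>bc a x / norm (g a)\<bar>" by simp
 then show ?thesis unfolding g_dot_nu[OF a] by (auto simp only: abs_le_iff divide_minus_right atLeastAtMost_iff)
 qed
 moreover have "pr a x = x - (bc a x / (g a \<bullet> nu a)) *R nu a" for x by (simp add: g_dot_nu[OF a] pr_def)
 ultimately show ?thesis unfolding closest_point_fac[OF a] infdist_fac[OF a] slab_def by auto
 qed
 then show ?thesis unfolding facet_integral_def closest_point_fac[OF a] by simp
qed

lemma continuous_bc: "a : C ==> continuous_on S (bc a)"
 by (rule has_derivative_continuous_on[OF has_derivative_at_withinI[OF bary_has_derivative]])

lemma compact_T: "compact T" and compact_fac: "compact (fac a)"
 using finite_C by (simp_all add: finite_imp_compact_convex_hull)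

lemma slab_eq_image:
 assumes a: "a : C" and w: "g a \<bullet> w ~= 0"
 shows "slab a w t = (%(y, s). y + s *R w) ` (fac a \<times> {t - 1/2..t + 1/2})"
proof (intro set_eqI iffI)
 fix x assume x: "x : slab a w t"
 let ?s = "bc a x / (g a \<bullet> w)"
 have "x = (%(y, s). y + s *R w) (x - ?s *R w, ?s)" by simp
 moreover have "(x - ?s *R w, ?s) : fac a \<times> {t - 1/2..t + 1/2}" using x by (simp add: slab_def)
 ultimately show "x : (%(y, s). y + s *R w) ` (fac a \<times> {t - 1/2..t + 1/2})" by (rule image_eqI)
next
 fix x assume "x : (%(y, s). y + s *R w) ` (fac a \<times> {t - 1/2..t + 1/2})"
 then obtain y s where x: "x = y + s *R w" "y : fac a" "s : {t - 1/2..t + 1/2}" by auto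
 then have "bc a x = s * (g a \<bullet> w)" using mem_fac[OF a] by (simp add: bary_add a)
 then show "x : slab a w t" using x w by (simp add: slab_def)
qed

lemma compact_slab: "a : C ==> g a \<bullet> w ~= 0 ==> compact (slab a w t)"
 unfolding slab_eq_image
 by (intro compact_continuous_image compact_Times compact_fac)
 (auto intro!: continuous_intros simp: case_prod_beta)

lemma continuous_pr: "a : C ==> continuous_on S (pr a)"
 unfolding pr_def[abs_def] by (intro continuous_intros continuous_bc) (auto simp: g_nonzero)

lemma continuous_slab_proj: "a : C ==> continuous_on S (%x. x - (bc a x / (g a \<bullet> w)) *R w)"
proof (cases "g a \<bullet> w = 0")
 case False
 then show "a : C ==> continuous_on S (%x. x - (bc a x / (g a \<bullet> w)) *R w)"
 by (intro continuous_intros continuous_bc) auto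
qed simp

text \<open>Cavalieri's principle: \<open>A\<close> carries the point \<open>y + s *R nu a\<close>
  over the facet to \<open>y + (s + t) *R w\<close>. So it maps the orthogonal prism onto the
  oblique one, preserves foot points, and has determinant \<open>nu a \<bullet> w\<close>.\<close>

lemma integral_slab:
 assumes a: "a : C" and w: "g a \<bullet> w ~= 0" and f: "continuous_on UNIV f"
 shows "integral (slab a w t) (%x. f (x - (bc a x / (g a \<bullet> w)) *R w)) = \<bar>nu a \<bullet> w\<bar> * FI (fac a) f"
proof -
 define A where "A x = x + ((g a /\<^sub>R norm (g a)) \<bullet> (x - a)) *R (nu a - w) + (t *R w + (inverse (norm (g a))) *R (nu a - w))" for x
 have A: "A x = pr a x + (t - bc a x / norm (g a)) *R w" for x
 proof -
 have gx: "g a \<bullet> (x - a) = bc a x - 1" using bary_affine[OF a, of x a] bary_vertex[OF a a] by simp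
 show ?thesis unfolding A_def inner_scaleR_left gx by (simp add: pr_def algebra_simps divide_inverse)
 qed
 have dt: "1 + (g a /\<^sub>R norm (g a)) \<bullet> (nu a - w) = nu a \<bullet> w"
 using g_nonzero[OF a] by (simp add: inner_diff_right g_dot_nu[OF a]) (simp add: nu_def)
 have nz: "nu a \<bullet> w ~= 0" using w g_nonzero[OF a] by (simp add: nu_def)
 have bcA: "bc a (A x) = (t - bc a x / norm (g a)) * (g a \<bullet> w)" for x
 unfolding A by (simp add: bary_add a bc_pr)
 have im: "A ` slab a (nu a) 0 = slab a w t"
 proof (intro set_eqI iffI)
 fix x assume "x : A ` slab a (nu a) 0"
 then obtain y where y: "x = A y" "y : slab a (nu a) 0" by auto
 have "pr a y : fac a" using y(2) by (simp add: slab_def g_dot_nu[OF a] pr_def)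
 moreover have "bc a y / - norm (g a) : {0 - 1/2..0 + 1/2}"
 using y(2) unfolding slab_def g_dot_nu[OF a] mem_Collect_eq by blast
 ultimately show "x : slab a w t" using w unfolding slab_def y(1) mem_Collect_eq bcA
 by (simp add: A)
 next
 fix x assume x: "x : slab a w t"
 let ?s = "bc a x / (g a \<bullet> w)"
 define y where "y = x - ?s *R w + (?s - t) *R nu a"
 have xf: "x - ?s *R w : fac a" and s: "?s : {t - 1/2..t + 1/2}" using x by (simp_all add: slab_def)
 then have e0: "bc a (x - ?s *R w) = 0" using mem_fac[OF a] by blast
 have bcy: "bc a y = (?s - t) * (- norm (g a))"
 unfolding y_def bary_add[OF a] e0 inner_scaleR_right g_dot_nu[OF a] by (rule add_0)
 then have q: "bc a y / norm (g a) = t - ?s" using g_nonzero[OF a] by simp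
 have pry: "pr a y = x - ?s *R w" unfolding pr_def q unfolding y_def by (simp add: algebra_simps)
 have "A y = x" unfolding A pry q by simp
 moreover have "y : slab a (nu a) 0"
 proof -
 have e: "bc a y / (g a \<bullet> nu a) = - (t - ?s)" unfolding g_dot_nu[OF a] divide_minus_right q ..
 have "- (t - ?s) : {0 - 1/2..0 + 1/2}" using s by (simp only: atLeastAtMost_iff) linarith
 moreover have "y - (- (t - ?s)) *R nu a = x - ?s *R w" unfolding y_def by (simp add: algebra_simps)
 ultimately show ?thesis unfolding slab_def mem_Collect_eq e using xf by (simp only:)
 qed
 ultimately show "x : A ` slab a (nu a) 0" by blast
 qed
 let ?F = "%x. f (x - (bc a x / (g a \<bullet> w)) *R w)"
 have "integral (A ` slab a (nu a) 0) ?F =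
 \<bar>1 + (g a /\<^sub>R norm (g a)) \<bullet> (nu a - w)\<bar> * integral (slab a (nu a) 0) (%x. ?F (A x))"
 proof (rule integral_image_rank_one[OF _ _ A_def])
 show "compact (slab a (nu a) 0)" using a g_nonzero by (intro compact_slab) (simp_all add: g_dot_nu)
 show "continuous_on (A ` slab a (nu a) 0) ?F"
 using continuous_on_compose2[OF f continuous_slab_proj[OF a]] by simp
 show "1 + (g a /\<^sub>R norm (g a)) \<bullet> (nu a - w) ~= 0" unfolding dt by (rule nz)
 qed
 moreover have "?F (A x) = f (pr a x)" for x unfolding bcA using w by (simp add: A)
 ultimately show ?thesis unfolding im dt FI_slab[OF a] by simp
qed

end

section \<open>The divergence theorem on a simplex\<close>

lemma lborel_integral_compact:
 fixes f :: "'a::euclidean_space => 'b::euclidean_space"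
 assumes "compact S" "continuous_on S f"
 shows "(\<integral>x. indicat_real S x *R f x \<partial>lborel) = integral S f"
proof -
 have "set_integrable lborel S f"
 unfolding set_integrable_def by (rule borel_integrable_compact[OF assms])
 then show ?thesis using set_borel_integral_eq_integral(2)[of S f] by (simp add: set_lebesgue_integral_def)
qed

lemma lborel_integral_shift:
 fixes F :: "'a::euclidean_space => real"
 assumes "F : borel_measurable borel"
 shows "(\<integral>x. F (x + c) \<partial>lborel) = (\<integral>x. F x \<partial>lborel)"
proof -
 have "(\<integral>x. F x \<partial>lborel) = (\<integral>x. F x \<partial>(distr lborel borel ((+) c)))" by (simp only: lborel_distr_plus)
 also have "\<dots> = (\<integral>x. F (c + x) \<partial>lborel)" by (rule integral_distr) (use assms in simp_all)
 finally show ?thesis by (simp add: add.commute)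
qed

lemma lborel_Fubini_compact:
 fixes h :: "'a::euclidean_space => real => real"
 assumes K: "compact K" and h: "continuous_on K (%(x, r). h x r)"
 shows "(\<integral>r. (\<integral>x. indicat_real K (x, r) * h x r \<partial>lborel) \<partial>lborel)
 = (\<integral>x. (\<integral>r. indicat_real K (x, r) * h x r \<partial>lborel) \<partial>lborel)"
proof (rule lborel_pair.Fubini_integral)
 have "integrable lborel (%p. indicat_real K p *R (%(x, r). h x r) p)"
 by (rule borel_integrable_compact[OF K h])
 then show "integrable (lborel \<Otimes>\<^sub>M lborel) (%(x, r). indicat_real K (x, r) * h x r)"
 unfolding lborel_prod by (simp add: case_prod_unfold)
qed

text \<open>By \<open>one\<close>, each point of \<open>S\<close> is met from base points in
  \<open>P\<close> for parameters filling an interval of length one, so integrating over the base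
  points and along their lines counts \<open>S\<close> exactly once. A prism \<open>P\<close> in
  place of a facet keeps all integrals in full dimension.\<close>

lemma line_fubini:
 fixes S P :: "'a::euclidean_space set" and h :: "'a => real"
 assumes S: "compact S" and P: "compact P" and h: "continuous_on UNIV h" and M: "!!x r. x : P ==> x + r *R \<xi> : S ==> \<bar>r\<bar> <= M"
 and one: "!!x. x : S ==> EX c. {r. x - r *R \<xi> : P} = {c..c+1}"
 shows "(\<integral>x. (\<integral>r. indicat_real {(x, r). x : P & x + r *R \<xi> : S} (x, r) * h (x + r *R \<xi>) \<partial>lborel) \<partial>lborel) = integral S h"
proof -
 let ?K = "{(x, r). x : P & x + r *R \<xi> : S}"
 let ?K' = "{(x, r). x - r *R \<xi> : P & x : S}"
 have K: "compact ?K"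
 proof -
 have "?K = (P \<times> {-M..M}) \<inter> (%p. fst p + snd p *R \<xi>) -` S"
 using M by (force simp: abs_le_iff)
 moreover have "closed ((%p. fst p + snd p *R \<xi>) -` S)"
 by (intro closed_vimage compact_imp_closed S continuous_intros)
 ultimately show ?thesis using P by (simp add: compact_Times compact_Int_closed)
 qed
 have K': "compact ?K'"
 proof -
 have "?K' = (S \<times> {-M..M}) \<inter> (%p. fst p - snd p *R \<xi>) -` P"
 using M[of "x - r *R \<xi>" r for x r] by (force simp: abs_le_iff)
 moreover have "closed ((%p. fst p - snd p *R \<xi>) -` P)"
 by (intro closed_vimage compact_imp_closed P continuous_intros)
 ultimately show ?thesis using S by (simp add: compact_Times compact_Int_closed)
 qed
 have c1: "continuous_on ?K (%(x, r). h (x + r *R \<xi>))"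
 unfolding case_prod_beta by (rule continuous_on_compose2[OF h]) (auto intro!: continuous_intros)
 have c2: "continuous_on ?K' (%(x, r). h x)"
 unfolding case_prod_beta by (rule continuous_on_compose2[OF h]) (auto intro!: continuous_intros)
 have "(\<integral>x. (\<integral>r. indicat_real ?K (x, r) * h (x + r *R \<xi>) \<partial>lborel) \<partial>lborel)
 = (\<integral>r. (\<integral>x. indicat_real ?K (x, r) * h (x + r *R \<xi>) \<partial>lborel) \<partial>lborel)"
 by (rule lborel_Fubini_compact[OF K c1, symmetric])
 also have "\<dots> = (\<integral>r. (\<integral>x. indicat_real ?K' (x, r) * h x \<partial>lborel) \<partial>lborel)"
 proof (rule Bochner_Integration.integral_cong[OF refl])
 fix r :: real
 have "h : borel_measurable borel" using h by (rule borel_measurable_continuous_onI)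
 moreover have "S : sets borel" using compact_imp_closed[OF S] by simp
 moreover have "(%x. x - r *R \<xi>) -` P : sets borel"
 by (intro borel_closed closed_vimage compact_imp_closed P continuous_intros)
 ultimately have m: "(%x. indicat_real ((%x. x - r *R \<xi>) -` P) x * (indicat_real S x * h x)) : borel_measurable borel"
 by measurable
 have e: "(%x. indicat_real ((%x. x - r *R \<xi>) -` P) x * (indicat_real S x * h x)) = (%x. indicat_real ?K' (x, r) * h x)"
 by (auto simp: indicator_def fun_eq_iff)
 have "indicat_real ?K (x, r) = indicat_real ?K' (x + r *R \<xi>, r)" for x
 by (auto simp: indicator_def)
 then show "(\<integral>x. indicat_real ?K (x, r) * h (x + r *R \<xi>) \<partial>lborel) = (\<integral>x. indicat_real ?K' (x, r) * h x \<partial>lborel)"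
 using lborel_integral_shift[OF m[unfolded e], of "r *R \<xi>"] by simp
 qed
 also have "\<dots> = (\<integral>x. (\<integral>r. indicat_real ?K' (x, r) * h x \<partial>lborel) \<partial>lborel)"
 by (rule lborel_Fubini_compact[OF K' c2])
 also have "\<dots> = (\<integral>x. indicat_real S x *R h x \<partial>lborel)"
 proof (intro Bochner_Integration.integral_cong refl)
 fix x
 show "(\<integral>r. indicat_real ?K' (x, r) * h x \<partial>lborel) = indicat_real S x *R h x"
 proof (cases "x : S")
 case True
 then obtain c where c: "{r. x - r *R \<xi> : P} = {c..c+1}" using one by blast
 have "indicat_real ?K' (x, r) = indicat_real {c..c+1} r" for r
 unfolding c[symmetric] using True by (auto simp: indicator_def)
 then show ?thesis using True by simp
 qed simp
 qed
 also have "\<dots> = integral S h"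
 by (rule lborel_integral_compact[OF S continuous_on_subset[OF h]]) simp
 finally show ?thesis .
qed

context full_simplex begin

text \<open>Lines parallel to the edge from \<open>a\<close> to \<open>b\<close> enter the simplex
  through the facet opposite to \<open>b\<close> and leave it through the facet opposite to
  \<open>a\<close>; all other facets are parallel to them. Fubini and the fundamental theorem of
  calculus therefore leave two facet terms.\<close>

lemma divergence_edge:
 assumes a: "a : C" and b: "b : C" and ab: "a ~= b"
 and f: "!!x. (f has_derivative f' x) (at x)" and f': "continuous_on UNIV (%x. f' x (b - a))"
 shows "integral T (%x. f' x (b - a)) =
 (nu a \<bullet> (b - a)) * FI (fac a) f + (nu b \<bullet> (b - a)) * FI (fac b) f"
proof -
 define \<xi> where "\<xi> = b - a"
 have ga: "g a \<bullet> \<xi> = -1" and gb: "g b \<bullet> \<xi> = 1" and gc: "!!c. c : C ==> c ~= a ==> c ~= b ==> g c \<bullet> \<xi> = 0"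
 using ab a b by (simp_all add: \<xi>_def g_vertex)
 \<comment> \<open>The prism over the entry facet, one edge long. The offset 1/2 makes
   \<open>bc b\<close> run through \<open>{0..1}\<close> in it; \<open>en\<close> and
   \<open>ex\<close> are the points where the line through \<open>x\<close> enters and leaves the
   simplex.\<close>
 define P where "P = slab b \<xi> (1/2)"
 define en where "en x = x - bc b x *R \<xi>" for x
 define ex where "ex x = x + bc a x *R \<xi>" for x
 let ?h = "%x. f' x \<xi>"
 have h: "continuous_on UNIV ?h" using f' by (simp add: \<xi>_def)
 have contf: "continuous_on S f" for S by (rule has_derivative_continuous_on[OF has_derivative_at_withinI[OF f]])
 have P: "compact P" unfolding P_def using b gb by (intro compact_slab) auto
 have memP: "x : P \<longleftrightarrow> bc b x : {0..1} & en x : fac b" for x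
 by (simp add: P_def slab_def gb en_def)
 have bc_line: "bc c (x + r *R \<xi>) = bc c x + r * (g c \<bullet> \<xi>)" if "c : C" for c x r
 using that by (simp add: bary_add)
 have bc_le1: "bc c x <= 1" if "x : T" "c : C" for c x
 using member_le_sum[of c C "%c. bc c x"] that finite_C bary_sum[of x] by (simp add: mem_T)
 have en_bc: "bc c (en x) = bc c x - bc b x * (g c \<bullet> \<xi>)" if "c : C" for c x
 using bc_line[OF that, of x "- bc b x"] by (simp add: en_def)
 have inT: "x + r *R \<xi> : T \<longleftrightarrow> - bc b x <= r & r <= bc a x" if "x : P" for x r
 proof -
 have enT: "ALL c:C. 0 <= bc c (en x)" using that mem_fac[OF b] memP mem_T by blast
 have "bc c (x + r *R \<xi>) >= 0" if "c : C" "c ~= a" "c ~= b" for c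
 using bspec[OF enT that(1)] that by (simp add: bc_line en_bc gc)
 moreover have "bc a (x + r *R \<xi>) = bc a x - r" "bc b (x + r *R \<xi>) = bc b x + r"
 using a b by (simp_all add: bc_line ga gb)
 ultimately show ?thesis unfolding mem_T using a b
 by (metis add.commute diff_ge_0_iff_ge neg_le_iff_le minus_le_iff add_uminus_conv_diff diff_minus_eq_add)
 qed
 have M: "\<bar>r\<bar> <= 1" if x: "x : P" "x + r *R \<xi> : T" for x r
 proof -
 have "bc b (x + r *R \<xi>) = bc b x + r" using b by (simp add: bc_line gb)
 moreover have "0 <= bc b (x + r *R \<xi>)" "bc b (x + r *R \<xi>) <= 1"
 using x b mem_T bc_le1 by blast+
 moreover have "0 <= bc b x" "bc b x <= 1" using x memP by auto
 ultimately show ?thesis by linarith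
 qed
 have one: "EX c. {r. x - r *R \<xi> : P} = {c..c+1}" if x: "x : T" for x
 proof -
 have xc: "ALL c:C. 0 <= bc c x" using x mem_T by blast
 have en: "en (x - r *R \<xi>) = en x" for r
 proof -
 have "bc b (x - r *R \<xi>) = bc b x - r" using bc_line[OF b, of x "-r"] gb by simp
 then show ?thesis unfolding en_def by (simp only:) (simp add: algebra_simps)
 qed
 have "en x : fac b"
 proof -
 have "bc c (en x) >= 0" if c: "c : C" for c
 using en_bc[OF c, of x] xc a b c ga gb gc[of c] by (cases "c = a"; cases "c = b") auto
 moreover have "bc b (en x) = 0" using en_bc[OF b, of x] gb by simp
 ultimately show ?thesis unfolding mem_fac[OF b] mem_T by blast
 qed
 moreover have "bc b (x - r *R \<xi>) = bc b x - r" for r using bc_line[OF b, of x "-r"] by (simp add: gb)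
 ultimately have "{r. x - r *R \<xi> : P} = {bc b x - 1..bc b x - 1 + 1}" by (auto simp: memP en)
 then show ?thesis by blast
 qed
 have inner: "(\<integral>r. indicat_real {(x, r). x : P & x + r *R \<xi> : T} (x, r) * ?h (x + r *R \<xi>) \<partial>lborel)
 = indicat_real P x *R (f (ex x) - f (en x))" for x
 proof (cases "x : P")
 case True
 then have "bc a (en x) >= 0" using mem_fac[OF b] memP mem_T a by blast
 then have le: "- bc b x <= bc a x" using en_bc[OF a, of x] ga by simp
 let ?I = "{- bc b x..bc a x}"
 have "indicat_real {(x, r). x : P & x + r *R \<xi> : T} (x, r) = indicat_real ?I r" for r
 using inT[OF True, of r] True by (auto simp: indicator_def)
 then have "(\<integral>r. indicat_real {(x, r). x : P & x + r *R \<xi> : T} (x, r) * ?h (x + r *R \<xi>) \<partial>lborel)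
 = (\<integral>r. indicat_real ?I r *R ?h (x + r *R \<xi>) \<partial>lborel)" by simp
 also have "\<dots> = integral ?I (%r. ?h (x + r *R \<xi>))"
 by (rule lborel_integral_compact) (auto intro!: continuous_on_compose2[OF h] continuous_intros)
 also have "((%r. ?h (x + r *R \<xi>)) has_integral (f (x + bc a x *R \<xi>) - f (x + (- bc b x) *R \<xi>))) ?I"
 proof (rule fundamental_theorem_of_calculus[OF le])
 fix r
 have "((%r. x + r *R \<xi>) has_derivative (%t. t *R \<xi>)) (at r within ?I)"
 by (auto intro!: derivative_eq_intros)
 from has_derivative_compose[OF this f]
 have "((%r. f (x + r *R \<xi>)) has_derivative (%t. f' (x + r *R \<xi>) (t *R \<xi>))) (at r within ?I)" .
 moreover have "f' y (t *R \<xi>) = t *R f' y \<xi>" for y t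
 using linear_scale[OF has_derivative_linear[OF f]] .
 ultimately show "((%r. f (x + r *R \<xi>)) has_vector_derivative ?h (x + r *R \<xi>)) (at r within ?I)"
 by (simp add: has_vector_derivative_def)
 qed
 then have "integral ?I (%r. ?h (x + r *R \<xi>)) = f (ex x) - f (en x)"
 by (simp add: integral_unique ex_def en_def)
 finally show ?thesis using True by simp
 qed simp
 have cex: "continuous_on S (%x. f (ex x))" and cen: "continuous_on S (%x. f (en x))" for S
 unfolding ex_def en_def using a b
 by (auto intro!: continuous_on_compose2[OF contf[of UNIV]] continuous_intros continuous_bc)
 have "integral T ?h = (\<integral>x. indicat_real P x *R (f (ex x) - f (en x)) \<partial>lborel)"
 using line_fubini[OF compact_T P h M one] unfolding inner by simp
 also have "\<dots> = integral P (%x. f (ex x) - f (en x))"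
 by (intro lborel_integral_compact P continuous_on_diff cex cen)
 also have "\<dots> = integral P (%x. f (ex x)) - integral P (%x. f (en x))"
 by (intro integral_diff integrable_compact P cex cen)
 also have "integral P (%x. f (en x)) = \<bar>nu b \<bullet> \<xi>\<bar> * FI (fac b) f"
 using integral_slab[OF b _ contf, of \<xi> "1/2"] by (simp add: P_def en_def gb)
 also have "integral P (%x. f (ex x)) = \<bar>nu a \<bullet> \<xi>\<bar> * FI (fac a) f"
 proof -
 \<comment> \<open>The exit values are so far integrated over the prism of the entry facet. This
   shear along \<open>\<xi>\<close> turns it into the prism of the exit facet: it keeps the exit
   point and has determinant one, since \<open>g a\<close> and \<open>g b\<close> have opposite
   products with \<open>\<xi>\<close>.\<close>
 define Sh where "Sh x = x + ((g a + g b) \<bullet> (x - a)) *R \<xi> + \<xi>" for x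
 have Sh: "Sh x = x + (bc a x + bc b x) *R \<xi>" for x
 proof -
 have "(g a + g b) \<bullet> (x - a) = bc a x + bc b x - 1"
 using bary_affine[OF a, of x a] bary_affine[OF b, of x a] bary_vertex[OF a a] bary_vertex[OF b a] ab
 by (simp add: inner_add_left)
 then show ?thesis unfolding Sh_def by (simp only:) (simp add: algebra_simps)
 qed
 have bcSh: "bc a (Sh x) = - bc b x" "bc b (Sh x) = bc a x + 2 * bc b x" for x
 unfolding Sh using bc_line[OF a] bc_line[OF b] ga gb by simp_all
 have exSh: "ex (Sh x) = ex x" for x unfolding ex_def bcSh by (simp add: Sh algebra_simps)
 have im: "Sh ` P = slab a \<xi> (1/2)"
 proof (intro set_eqI iffI)
 fix x assume "x : Sh ` P"
 then obtain y where y: "x = Sh y" "y : P" by auto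
 have "ex y : fac a"
 proof -
 have "ex y : T" "- bc b y <= bc a y"
 proof -
 have "bc a (en y) >= 0" using y mem_fac[OF b] memP mem_T a by blast
 then show "- bc b y <= bc a y" using en_bc[OF a, of y] ga by simp
 then show "ex y : T" unfolding ex_def using inT[OF y(2)] by simp
 qed
 moreover have "bc a (ex y) = 0" unfolding ex_def using bc_line[OF a] ga by simp
 ultimately show ?thesis unfolding mem_fac[OF a] by simp
 qed
 then show "x : slab a \<xi> (1/2)" using y memP[of y] exSh[of y]
 by (simp add: slab_def ga bcSh) (simp add: ex_def bcSh)
 next
 fix x assume x: "x : slab a \<xi> (1/2)"
 define y where "y = x - (bc a x + bc b x) *R \<xi>"
 have bcy: "bc a y = 2 * bc a x + bc b x" "bc b y = - bc a x"
 proof -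
 have y: "y = x + (- (bc a x + bc b x)) *R \<xi>" by (simp add: y_def algebra_simps)
 show "bc a y = 2 * bc a x + bc b x" "bc b y = - bc a x"
 unfolding y bc_line[OF a] bc_line[OF b] ga gb by simp_all
 qed
 have xa: "ex x : fac a" "- bc a x : {0..1}" using x by (auto simp: slab_def ga ex_def)
 have "Sh y = x" unfolding Sh bcy by (simp add: y_def algebra_simps)
 moreover have "y : P" unfolding memP
 proof
 show "bc b y : {0..1}" using xa by (simp add: bcy)
 have eny: "en y = ex x + (- (bc a x + bc b x)) *R \<xi>"
 unfolding en_def bcy by (simp add: y_def ex_def algebra_simps)
 have exc: "ALL c:C. 0 <= bc c (ex x)" using xa mem_fac[OF a] mem_T by blast
 have bcex: "bc b (ex x) = bc b x + bc a x" "bc a (ex x) = 0"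
 unfolding ex_def using bc_line[OF a] bc_line[OF b] ga gb by simp_all
 have "bc b (en y) = 0" unfolding eny using bc_line[OF b] gb bcex by simp
 moreover have "bc c (en y) >= 0" if c: "c : C" for c
 using bc_line[OF c, of "ex x" "- (bc a x + bc b x)"] bcex bspec[OF exc c] bspec[OF exc b] ga gb gc[OF c]
 unfolding eny by (cases "c = a"; cases "c = b") auto
 ultimately show "en y : fac b" unfolding mem_fac[OF b] mem_T by blast
 qed
 ultimately show "x : Sh ` P" by blast
 qed
 have "integral (Sh ` P) (%x. f (ex x)) = \<bar>1 + (g a + g b) \<bullet> \<xi>\<bar> * integral P (%x. f (ex (Sh x)))"
 by (rule integral_image_rank_one[OF P cex Sh_def]) (simp add: inner_add_left ga gb)
 then have "integral P (%x. f (ex x)) = integral (slab a \<xi> (1/2)) (%x. f (ex x))"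
 unfolding im exSh by (simp add: inner_add_left ga gb)
 then show ?thesis using integral_slab[OF a _ contf, of \<xi> "1/2"] by (simp add: ex_def ga)
 qed
 finally have "integral T ?h = \<bar>nu a \<bullet> \<xi>\<bar> * FI (fac a) f - \<bar>nu b \<bullet> \<xi>\<bar> * FI (fac b) f" .
 moreover have "\<bar>nu a \<bullet> \<xi>\<bar> = nu a \<bullet> \<xi>" "\<bar>nu b \<bullet> \<xi>\<bar> = - (nu b \<bullet> \<xi>)"
 by (simp_all add: nu_def ga gb)
 ultimately show ?thesis by (simp add: \<xi>_def)
qed

text \<open>Both sides are linear in \<open>\<eta>\<close>, and by \<open>g_reconstruct\<close>
  every direction is a combination of the edges at a fixed vertex.\<close>

lemma divergence_direction:
 assumes f: "!!x. (f has_derivative f' x) (at x)" and f': "!!\<eta>. continuous_on UNIV (%x. f' x \<eta>)"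
 shows "integral T (%x. f' x \<eta>) = (SUM c:C. (nu c \<bullet> \<eta>) * FI (fac c) f)"
proof -
 obtain a where a: "a : C" using C_nonempty by blast
 have lin: "linear (f' x)" for x using has_derivative_linear[OF f] .
 have edge: "integral T (%x. f' x (b - a)) = (SUM c:C. (nu c \<bullet> (b - a)) * FI (fac c) f)"
 if b: "b : C" for b
 proof (cases "b = a")
 case True
 then show ?thesis by (simp add: linear_0[OF lin])
 next
 case False
 have "nu c \<bullet> (b - a) = 0" if "c : C - {a} - {b}" for c
 using that a b g_vertex[of c b a] by (simp add: nu_def)
 then have "(SUM c:C - {a} - {b}. (nu c \<bullet> (b - a)) * FI (fac c) f) = 0"
 by (intro sum.neutral) simp
 moreover have "b : C - {a}" using b False by simp
 ultimately have "(SUM c:C. (nu c \<bullet> (b - a)) * FI (fac c) f) =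
 (nu a \<bullet> (b - a)) * FI (fac a) f + (nu b \<bullet> (b - a)) * FI (fac b) f"
 using sum.remove[OF finite_C a, of "%c. (nu c \<bullet> (b - a)) * FI (fac c) f"]
 sum.remove[of "C - {a}" b "%c. (nu c \<bullet> (b - a)) * FI (fac c) f"] finite_C by simp
 then show ?thesis using divergence_edge[OF a b _ f f'] False by simp
 qed
 have \<eta>: "\<eta> = (SUM b:C. (g b \<bullet> \<eta>) *R (b - a))" using g_reconstruct[of \<eta> a] by simp
 have "f' x \<eta> = (SUM b:C. (g b \<bullet> \<eta>) * f' x (b - a))" for x
 by (subst \<eta>) (simp add: linear_sum[OF lin] linear_scale[OF lin])
 then have "integral T (%x. f' x \<eta>) = (SUM b:C. (g b \<bullet> \<eta>) * integral T (%x. f' x (b - a)))"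
 using finite_C f' by (simp, subst integral_sum)
 (auto intro!: integrable_compact compact_T continuous_intros continuous_on_subset[OF f'])
 also have "\<dots> = (SUM c:C. (SUM b:C. (g b \<bullet> \<eta>) * (nu c \<bullet> (b - a))) * FI (fac c) f)"
 by (simp add: edge sum_distrib_left sum_distrib_right mult.assoc, subst sum.swap) simp
 also have "\<dots> = (SUM c:C. (nu c \<bullet> \<eta>) * FI (fac c) f)"
 proof (intro sum.cong refl arg_cong2[where f="(*)"])
 fix c
 have "nu c \<bullet> \<eta> = nu c \<bullet> (SUM b:C. (g b \<bullet> \<eta>) *R (b - a))" using \<eta> by simp
 then show "(SUM b:C. (g b \<bullet> \<eta>) * (nu c \<bullet> (b - a))) = nu c \<bullet> \<eta>" by (simp add: inner_sum_right)
 qed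
 finally show ?thesis .
qed

end

context full_simplex begin

lemma compact_slab_nu: "a : C ==> compact (slab a (nu a) 0)"
 using g_nonzero by (intro compact_slab) (simp_all add: g_dot_nu)

lemma pr_in_fac: "a : C ==> x : slab a (nu a) 0 ==> pr a x : fac a"
 by (simp add: slab_def g_dot_nu pr_def)

lemma facet_integrable:
 assumes "a : C" "continuous_on UNIV f"
 shows "(%x. f (pr a x) :: real) integrable_on slab a (nu a) 0"
 by (intro integrable_compact compact_slab_nu assms(1)
 continuous_on_compose2[OF assms(2) continuous_pr[OF assms(1)]]) simp

lemma FI_add:
 assumes "a : C" "continuous_on UNIV f" "continuous_on UNIV k"
 shows "FI (fac a) (%x. f x + k x) = FI (fac a) f + FI (fac a) k"
 unfolding FI_slab[OF assms(1)] using assms by (intro integral_add facet_integrable)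

lemma FI_sum:
 assumes "a : C" "!!i. i : I ==> continuous_on UNIV (f i)" "finite I"
 shows "FI (fac a) (%x. SUM i:I. f i x) = (SUM i:I. FI (fac a) (f i))"
 unfolding FI_slab[OF assms(1)] using assms by (intro integral_sum facet_integrable)

lemma FI_cmult:
 assumes "a : C"
 shows "FI (fac a) (%x. c * f x) = c * FI (fac a) f"
 unfolding FI_slab[OF assms] by (rule integral_mult_right)

lemma FI_cong:
 assumes "a : C" "!!x. x : fac a ==> f x = k x"
 shows "FI (fac a) f = FI (fac a) k"
 unfolding FI_slab[OF assms(1)]
 using assms by (intro integral_cong) (simp del: mem_fac add: pr_in_fac)

lemma FI_mono:
 assumes "a : C" "continuous_on UNIV f" "continuous_on UNIV k" "!!x. x : fac a ==> f x <= k x"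
 shows "FI (fac a) f <= FI (fac a) k"
 unfolding FI_slab[OF assms(1)]
 using assms by (intro integral_le facet_integrable) (auto simp: pr_in_fac)

lemma FI_zero: "a : C ==> FI (fac a) (%_. 0) = 0"
 by (simp add: FI_slab)

lemma FI_nonneg:
 assumes "a : C" "continuous_on UNIV f" "!!x. x : fac a ==> 0 <= f x"
 shows "0 <= FI (fac a) f"
 using FI_mono[OF assms(1) _ assms(2), of "%_. 0"] assms by (simp add: FI_zero)

text \<open>The prism of height one in the definition is out of scale with the element; a height
  \<open>s\<close> comparable to the mesh size permits comparison with balls.\<close>

lemma FI_scale:
 assumes a: "a : C" and f: "continuous_on UNIV f" and s: "s > 0"
 shows "s * FI (fac a) f = integral (slab a (s *R nu a) 0) (%x. f (pr a x))"
proof -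
 have "g a \<bullet> (s *R nu a) ~= 0" using s g_nonzero[OF a] by (simp add: g_dot_nu[OF a])
 from integral_slab[OF a this f, of 0]
 have "integral (slab a (s *R nu a) 0) (%x. f (x - (bc a x / (g a \<bullet> s *R nu a)) *R s *R nu a))
 = \<bar>nu a \<bullet> s *R nu a\<bar> * FI (fac a) f" .
 moreover have "x - (bc a x / (g a \<bullet> s *R nu a)) *R s *R nu a = pr a x" for x
 using s by (simp add: g_dot_nu[OF a] pr_def)
 moreover have "\<bar>nu a \<bullet> s *R nu a\<bar> = s" using s norm_nu[OF a] by (simp add: dot_square_norm)
 ultimately show ?thesis by (simp only:)
qed

lemma mem_slab_scaled:
 assumes a: "a : C" and s: "s > 0"
 shows "x : slab a (s *R nu a) 0 \<longleftrightarrow> pr a x : fac a & \<bar>bc a x\<bar> <= s * norm (g a) / 2"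
proof -
 have 1: "x - (bc a x / (g a \<bullet> s *R nu a)) *R s *R nu a = pr a x"
 using s by (simp add: g_dot_nu[OF a] pr_def)
 have g: "g a \<bullet> s *R nu a = - (s * norm (g a))" by (simp add: g_dot_nu[OF a])
 have p: "s * norm (g a) > 0" using s g_nonzero[OF a] by simp
 have "bc a x / (g a \<bullet> s *R nu a) : {0 - 1/2..0 + 1/2} \<longleftrightarrow> - (1/2) <= - (bc a x / (s * norm (g a))) & - (bc a x / (s * norm (g a))) <= 1/2"
 unfolding g divide_minus_right by simp
 also have "\<dots> \<longleftrightarrow> \<bar>bc a x\<bar> <= s * norm (g a) / 2"
 using p by (auto simp: field_simps abs_le_iff)
 finally show ?thesis unfolding slab_def mem_Collect_eq 1 by blast
qed

definition cen :: "real^'n::_ => real^'n::_" where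
 "cen a = (SUM b:C - {a}. b) /\<^sub>R CARD('n)"

lemma bc_cen: assumes a: "a : C" and b: "b : C" shows "bc b (cen a) = (if b = a then 0 else 1 / CARD('n))"
proof (rule bary_unique)
 have "card (C - {a}) = CARD('n)" using card_C a finite_C by simp
 then show "(SUM b:C. if b = a then 0 else 1 / real CARD('n)) = 1"
 using sum.remove[OF finite_C a, of "%b. if b = a then 0 else 1 / real CARD('n)"] by simp
 have "(SUM b:C. (if b = a then 0 else 1 / real CARD('n)) *R b) = (SUM b:C - {a}. (1 / real CARD('n)) *R b)"
 using sum.remove[OF finite_C a, of "%b. (if b = a then 0 else 1 / real CARD('n)) *R b"] by simp
 then show "(SUM b:C. (if b = a then 0 else 1 / real CARD('n)) *R b) = cen a"
 by (simp add: cen_def scaleR_sum_right divide_inverse)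
qed (use b in simp)

lemma cen_in_fac: "a : C ==> cen a : fac a"
 unfolding mem_fac mem_T by (simp add: bc_cen)

lemma polys_bc: "a : C ==> bc a : polys 1 UNIV"
proof -
 assume a: "a : C"
 have "(%x. bc a 0 + g a \<bullet> x) : polys 1 UNIV"
 by (intro polys_add polys_const polys_linear sU UNIV_I) (simp add: linear_iff inner_add_right)
 moreover have "bc a = (%x. bc a 0 + g a \<bullet> x)"
 proof
 fix x show "bc a x = bc a 0 + g a \<bullet> x" using bary_affine[OF a, of x 0] by simp
 qed
 ultimately show ?thesis by (simp only:)
qed

lemma polys_pr: "a : C ==> pr a : polys 1 UNIV"
proof -
 assume a: "a : C"
 have "(%x. bc a x *R nu a) : polys (1 + 0) UNIV"
 by (intro polys_mult polys_bc polys_const sU UNIV_I a)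
 then have "(%x. inverse (norm (g a)) *R (bc a x *R nu a)) : polys 1 UNIV"
 by (intro polys_scaleR sU) simp
 then show ?thesis unfolding pr_def[abs_def] using polys_add[OF sU polys_id]
 by (simp add: divide_inverse mult.commute)
qed

end

section \<open>Shape-regular simplices\<close>

lemma measure_cball_scaled:
 "r >= 0 ==> measure lebesgue (cball (z :: real^'n) r) = r ^ CARD('n) * unit_ball_vol CARD('n)"
 using content_cball[of r z] by simp

text \<open>Here \<open>h\<close> is the global mesh size, which bounds the diameter of the element
  from above, while the inscribed ball bounds it from below. The centre \<open>z\<close> is the
  point at which \<open>\<gamma>\<close> will be frozen.\<close>

locale shaped_simplex = full_simplex C for C :: "(real^'n::{finite,wellorder}) set" +
 fixes z :: "real^'n::_" and h \<rho> :: real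
 assumes h: "h > 0" and rho: "\<rho> > 0" and ball: "cball z (\<rho> * h) \<subseteq> T" and diam: "diameter T <= h"
begin

lemma dist_T: "x : T ==> y : T ==> dist x y <= h"
 using diameter_bounded_bound[OF compact_imp_bounded[OF compact_T]] diam by fastforce

lemma z_in_T: "z : T"
 using ball h rho by (auto simp: subset_eq)

lemma T_subset: "y : T ==> T \<subseteq> cball y h"
 using dist_T by auto

text \<open>The point of the inscribed ball closest to the facet opposite to \<open>a\<close> still
  has a nonnegative coordinate of \<open>a\<close>.\<close>

lemma bary_ball: assumes a: "a : C" shows "\<rho> * h * norm (g a) <= bc a z"
proof -
 have "z - (\<rho> * h / norm (g a)) *R g a : cball z (\<rho> * h)" using g_nonzero[OF a] h rho by (simp add: dist_norm)
 then have "z - (\<rho> * h / norm (g a)) *R g a : T" using ball by blast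
 then have "0 <= bc a (z - (\<rho> * h / norm (g a)) *R g a)" using a mem_T by blast
 also have "bc a (z - (\<rho> * h / norm (g a)) *R g a) = bc a z - \<rho> * h * norm (g a)"
 using bary_add[OF a, of z "- ((\<rho> * h / norm (g a)) *R g a)"] g_nonzero[OF a]
 by (simp add: dot_square_norm power2_eq_square)
 finally show ?thesis by simp
qed

lemma bary_le_1: assumes "a : C" "x : T" shows "bc a x <= 1"
 using member_le_sum[of a C "%c. bc c x"] assms finite_C bary_sum[of x] by (simp add: mem_T)

lemma norm_g_le: assumes a: "a : C" shows "norm (g a) <= 1 / (\<rho> * h)"
 using bary_ball[OF a] bary_le_1[OF a z_in_T] h rho by (simp add: field_simps)

lemma norm_g_ge: assumes a: "a : C" shows "1 / h <= norm (g a)"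
proof -
 have "card (C - {a}) = CARD('n)" using card_C a finite_C by simp
 then have "C - {a} ~= {}" by (metis card.empty zero_less_card_finite less_irrefl)
 then obtain b where b: "b : C" "b ~= a" by blast
 have "1 = g a \<bullet> (a - b)" using g_vertex[OF a a b(1)] b by simp
 also have "\<dots> <= norm (g a) * norm (a - b)" by (rule norm_cauchy_schwarz)
 also have "\<dots> <= norm (g a) * h"
 using dist_T[of a b] a b(1) by (intro mult_left_mono) (auto simp: dist_norm hull_inc)
 finally show ?thesis using h by (simp add: field_simps)
qed

text \<open>On the ball of half the radius all products of barycentric coordinates are bounded below
  by a power of \<open>\<rho> / 2\<close>; this is why integrals over
  \<open>cball z (\<rho> * h / 2)\<close> serve as the local reference norm.\<close>

lemma bary_half_ball: assumes a: "a : C" and x: "x : cball z (\<rho> * h / 2)" shows "\<rho> / 2 <= bc a x"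
proof -
 have "bc a x = bc a z + g a \<bullet> (x - z)" by (rule bary_affine[OF a])
 moreover have "\<bar>g a \<bullet> (x - z)\<bar> <= norm (g a) * norm (x - z)" by (rule Cauchy_Schwarz_ineq2)
 moreover have "norm (g a) * norm (x - z) <= norm (g a) * (\<rho> * h / 2)"
 using x by (intro mult_left_mono) (auto simp: dist_norm norm_minus_commute)
 ultimately have "bc a x >= norm (g a) * (\<rho> * h / 2)" using bary_ball[OF a] by (simp add: algebra_simps)
 moreover have "norm (g a) * (\<rho> * h / 2) >= (1 / h) * (\<rho> * h / 2)"
 using norm_g_ge[OF a] h rho by (intro mult_right_mono) auto
 ultimately show ?thesis using h by simp
qed

lemma half_ball_subset: "cball z (\<rho> * h / 2) \<subseteq> T"
proof -
 have "cball z (\<rho> * h / 2) \<subseteq> cball z (\<rho> * h)" using h rho by (intro subset_cball) simp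
 then show ?thesis using ball by blast
qed

lemma integral_T_ge_ball:
 fixes f :: "real^'n::_ => real"
 assumes "continuous_on UNIV f" "!!x. x : T ==> 0 <= f x"
 shows "integral (cball z (\<rho> * h / 2)) f <= integral T f"
 using assms half_ball_subset
 by (intro integral_subset_le integrable_compact compact_T compact_cball continuous_on_subset[OF assms(1)]) auto

lemma measure_T_le: "measure lebesgue T <= unit_ball_vol CARD('n) * h ^ CARD('n)"
proof -
 have "measure lebesgue T <= measure lebesgue (cball z h)" using T_subset[OF z_in_T]
 by (intro measure_mono_fmeasurable) (auto simp: lmeasurable_compact compact_T fmeasurableD)
 then show ?thesis using measure_cball_scaled[of h z] h by (simp add: mult.commute)
qed

lemma integral_T_le:
 fixes f :: "real^'n::_ => real"
 assumes "continuous_on UNIV f" "!!x. x : T ==> f x <= c" "0 <= c"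
 shows "integral T f <= c * unit_ball_vol CARD('n) * h ^ CARD('n)"
proof -
 have "integral T f <= c * measure lebesgue T"
 by (intro integral_le_const_compact compact_T continuous_on_subset[OF assms(1)] assms(2)) auto
 also have "\<dots> <= c * (unit_ball_vol CARD('n) * h ^ CARD('n))" by (intro mult_left_mono measure_T_le assms(3))
 finally show ?thesis by (simp add: mult.assoc)
qed

text \<open>After multiplication by \<open>h\<close> the facet integral is one over a prism of
  height \<open>h\<close>, which stays within distance \<open>2 * h\<close> of
  \<open>z\<close>.\<close>

lemma FI_upper:
 assumes a: "a : C" and f: "continuous_on UNIV f" and A: "!!x. x : fac a ==> f x <= A" "0 <= A"
 shows "h * FI (fac a) f <= A * unit_ball_vol CARD('n) * (2 * h) ^ CARD('n)"
proof -
 let ?S = "slab a (h *R nu a) 0"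
 have "g a \<bullet> h *R nu a ~= 0" using h g_nonzero[OF a] by (simp add: g_dot_nu[OF a])
 then have cS: "compact ?S" by (rule compact_slab[OF a])
 have sub: "?S \<subseteq> cball z (2 * h)"
 proof
 fix x assume "x : ?S"
 then have x: "pr a x : T" "\<bar>bc a x\<bar> <= h * norm (g a) / 2"
 using mem_slab_scaled[OF a h] mem_fac[OF a] by auto
 have "\<bar>bc a x\<bar> / norm (g a) <= h / 2" using x(2) g_nonzero[OF a] by (simp add: field_simps)
 then have "dist (pr a x) x <= h / 2" using norm_nu[OF a] by (simp add: pr_def dist_norm)
 moreover have "dist z (pr a x) <= h" using dist_T[OF z_in_T x(1)] .
 ultimately show "x : cball z (2 * h)" using dist_triangle[of z x "pr a x"] h by simp
 qed
 have "h * FI (fac a) f = integral ?S (%x. f (pr a x))" by (rule FI_scale[OF a f h])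
 also have "\<dots> <= A * measure lebesgue ?S"
 using mem_slab_scaled[OF a h] A(1)
 by (intro integral_le_const_compact cS continuous_on_compose2[OF f continuous_pr[OF a]]) auto
 also have "\<dots> <= A * measure lebesgue (cball z (2 * h))"
 using sub A(2) cS by (intro mult_left_mono measure_mono_fmeasurable) (auto simp: lmeasurable_compact fmeasurableD)
 finally show ?thesis using measure_cball_scaled[of "2 * h" z] h by (simp add: mult_ac)
qed

text \<open>With \<open>n\<close> the dimension, the nonzero barycentric coordinates at the centroid
  of the facet are \<open>1 / n\<close>, and gradients are at most \<open>1 / (\<rho> * h)\<close>.
  So the ball of radius \<open>r\<close> around the centroid projects into the facet and lies in the
  prism of height \<open>2 * r\<close>.\<close>

lemma FI_lower:
 assumes a: "a : C" and f: "continuous_on UNIV f" "!!x. 0 <= f x"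
 defines "r \<equiv> \<rho> * h / CARD('n)"
 shows "integral (cball (cen a) r) (%x. f (pr a x)) <= 2 * r * FI (fac a) f"
proof -
 have r: "r > 0" using h rho by (simp add: r_def)
 then have r2: "2 * r > 0" by simp
 let ?S = "slab a ((2 * r) *R nu a) 0"
 have "g a \<bullet> (2 * r) *R nu a ~= 0" using r g_nonzero[OF a] by (simp add: g_dot_nu[OF a])
 then have cS: "compact ?S" by (rule compact_slab[OF a])
 have sub: "cball (cen a) r \<subseteq> ?S"
 proof
 fix x assume x: "x : cball (cen a) r"
 have n1: "norm (x - cen a) <= r" using x by (simp add: dist_norm norm_minus_commute)
 have bca: "bc a x = g a \<bullet> (x - cen a)" using bary_affine[OF a, of x "cen a"] bc_cen[OF a a] by simp
 have ineq: "\<bar>g c \<bullet> (x - cen a)\<bar> <= norm (g c) * r" for c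
 using Cauchy_Schwarz_ineq2[of "g c" "x - cen a"] mult_left_mono[OF n1, of "norm (g c)"] by simp
 have e1: "pr a x - cen a = (x - cen a) - ((x - cen a) \<bullet> nu a) *R nu a"
 proof -
 have "bc a x / norm (g a) = - ((x - cen a) \<bullet> nu a)"
 unfolding bca by (simp add: nu_def inner_commute divide_inverse mult.commute)
 then show ?thesis by (simp add: pr_def)
 qed
 have e2: "norm ((x - cen a) - ((x - cen a) \<bullet> nu a) *R nu a) <= norm (x - cen a)"
 proof -
 have "(norm ((x - cen a) - ((x - cen a) \<bullet> nu a) *R nu a))^2 = (norm (x - cen a))^2 - ((x - cen a) \<bullet> nu a)^2"
 using norm_nu[OF a] unfolding power2_norm_eq_inner norm_eq_1
 by (simp add: inner_diff_left inner_diff_right inner_commute power2_eq_square)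
 then have "(norm ((x - cen a) - ((x - cen a) \<bullet> nu a) *R nu a))^2 <= (norm (x - cen a))^2" by simp
 then show ?thesis by (rule power2_le_imp_le) simp
 qed
 have n2: "norm (pr a x - cen a) <= r" unfolding e1 using e2 n1 by (rule order_trans)
 have "0 <= bc c (pr a x)" if c: "c : C" for c
 proof (cases "c = a")
 case False
 have "\<bar>g c \<bullet> (pr a x - cen a)\<bar> <= norm (g c) * r"
 using Cauchy_Schwarz_ineq2[of "g c" "pr a x - cen a"] mult_left_mono[OF n2, of "norm (g c)"] by simp
 also have "\<dots> <= (1 / (\<rho> * h)) * r" using norm_g_le[OF c] r by (intro mult_right_mono) auto
 also have "\<dots> = 1 / CARD('n)" using h rho by (simp add: r_def)
 finally show ?thesis using bary_affine[OF c, of "pr a x" "cen a"] bc_cen[OF a c] False by simp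
 qed (simp add: bc_pr a)
 then have "pr a x : fac a" unfolding mem_fac[OF a] mem_T using bc_pr[OF a] by simp
 moreover have "\<bar>bc a x\<bar> <= 2 * r * norm (g a) / 2" unfolding bca using ineq[of a] by (simp add: mult.commute)
 ultimately show "x : ?S" using mem_slab_scaled[OF a r2] by simp
 qed
 have c: "continuous_on S (%x. f (pr a x))" for S
 by (rule continuous_on_compose2[OF f(1) continuous_pr[OF a]]) simp
 have "integral (cball (cen a) r) (%x. f (pr a x)) <= integral ?S (%x. f (pr a x))"
 using f(2) by (intro integral_subset_le sub integrable_compact cS compact_cball c) auto
 also have "\<dots> = 2 * r * FI (fac a) f" by (rule FI_scale[OF a f(1) r2, symmetric])
 finally show ?thesis .
qed

end

section \<open>Partial derivatives and integration by parts\<close>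

abbreviation pd :: "'n::finite => (real^'n => 'v::real_normed_vector) => real^'n => 'v" where
 "pd j f x \<equiv> frechet_derivative f (at x) (axis j 1)"

lemma pd_eqI: "(f has_derivative f') (at x) ==> pd j f x = f' (axis j 1)"
 using frechet_derivative_at by metis

lemma pd_linear:
 fixes f :: "real^'n => 'v::euclidean_space" and L :: "'v => 'w::real_normed_vector"
 assumes "linear L" "f differentiable (at x)"
 shows "pd j (%x. L (f x)) x = L (pd j f x)"
proof -
 have "(f has_derivative frechet_derivative f (at x)) (at x)" using assms(2) frechet_derivative_works by blast
 moreover have "bounded_linear L" using assms(1) by (simp add: linear_conv_bounded_linear)
 ultimately have "((%x. L (f x)) has_derivative (%\<xi>. L (frechet_derivative f (at x) \<xi>))) (at x)"
 by (rule bounded_linear.has_derivative[rotated])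
 then show ?thesis by (rule pd_eqI)
qed

lemma pd_scaleR:
 assumes "a differentiable (at x)" "f differentiable (at x)"
 shows "pd j (%x. a x *R f x) x = a x *R pd j f x + pd j a x *R f x"
proof -
 have "(f has_derivative frechet_derivative f (at x)) (at x)" "(a has_derivative frechet_derivative a (at x)) (at x)"
 using assms frechet_derivative_works by blast+
 from has_derivative_scaleR[OF this(2,1)] show ?thesis by (rule pd_eqI)
qed

lemma pd_mult:
 fixes a f :: "real^'n => real"
 assumes "a differentiable (at x)" "f differentiable (at x)"
 shows "pd j (%x. a x * f x) x = a x * pd j f x + pd j a x * f x"
 using pd_scaleR[OF assms] by simp

lemma pd_add:
 assumes "f differentiable (at x)" "g differentiable (at x)"
 shows "pd j (%x. f x + g x) x = pd j f x + pd j g x"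
proof -
 have "(f has_derivative frechet_derivative f (at x)) (at x)" "(g has_derivative frechet_derivative g (at x)) (at x)"
 using assms frechet_derivative_works by blast+
 from has_derivative_add[OF this] show ?thesis by (rule pd_eqI)
qed

lemma pd_diff:
 assumes "f differentiable (at x)" "g differentiable (at x)"
 shows "pd j (%x. f x - g x) x = pd j f x - pd j g x"
proof -
 have "(f has_derivative frechet_derivative f (at x)) (at x)" "(g has_derivative frechet_derivative g (at x)) (at x)"
 using assms frechet_derivative_works by blast+
 from has_derivative_diff[OF this] show ?thesis by (rule pd_eqI)
qed

lemma pd_const: "pd j (%_. c) x = 0"
 by (rule pd_eqI[OF has_derivative_const])

lemma pd_coord: "pd j (%x. x $ i) x = (if i = j then 1 else 0)"
 by (subst pd_eqI[OF bounded_linear_imp_has_derivative[OF bounded_linear_vec_nth]]) (simp add: axis_def)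

lemma linear_vec_nth: "linear (%x :: ('v::real_vector)^'n. x $ i)"
 by (simp add: linear_iff)

lemma polys_pd:
 fixes p :: "real^'n => 'v::real_normed_vector"
 assumes "subspace V" "p : polys k V"
 shows "(%x. pd j p x) : polys (k - 1) V"
 by (rule polys_derivative[OF assms(2,1)])

lemma polys_diffable:
 fixes p :: "real^'n => 'v::real_normed_vector"
 shows "p : polys k V ==> p differentiable (at x)"
 by (rule polys_differentiable[OF polys_UNIV sU])

lemma polys_nth:
 fixes p :: "real^'n => ('v::real_normed_vector)^'m"
 shows "p : polys k UNIV ==> (%x. p x $ i) : polys k UNIV"
 by (erule polys_lin_image[OF linear_vec_nth]) simp

lemma polys_vec:
 fixes p :: "real^'n => 'm::finite => 'v::real_normed_vector"
 assumes "!!i. (%x. p x i) : polys k UNIV"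
 shows "(%x. \<chi> i. p x i) : polys k UNIV"
proof -
 have "(%x. axis i (p x i) :: 'v^'m) : polys k UNIV" for i
 by (rule polys_lin_image[OF _ assms]) (auto simp: linear_iff axis_def vec_eq_iff)
 then have "(%x. SUM i:UNIV. axis i (p x i) :: 'v^'m) : polys k UNIV" by (intro polys_sum sU)
 moreover have "(SUM i:UNIV. axis i (p x i) :: 'v^'m) = (\<chi> i. p x i)" for x
 by (simp add: vec_eq_iff axis_def if_distrib cong: if_cong)
 ultimately show ?thesis by simp
qed

lemma pd_nth:
 fixes p :: "real^'n => ('v::euclidean_space)^'m"
 assumes "p differentiable (at x)"
 shows "pd j (%x. p x $ i) x = pd j p x $ i"
 by (rule pd_linear[OF linear_vec_nth assms])

lemma jacobian_nth: "jacobian v (at x) $ i $ j = pd j v x $ i"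
 by (simp add: jacobian_def matrix_def)

lemma div_vec_pd: "div_vec v x = (SUM j:UNIV. pd j v x $ j)"
 by (simp add: div_vec_def trace_def jacobian_nth)

lemma div_mat_pd:
 fixes \<tau> :: "real^'n => real^'n^'n"
 assumes "\<tau> differentiable (at x)"
 shows "div_mat \<tau> x $ i = (SUM j:UNIV. pd j \<tau> x $ i $ j)"
 by (simp add: div_mat_def div_vec_pd pd_nth[OF assms])

lemma inner_mat: "(A :: real^'n^'m) \<bullet> B = (SUM i:UNIV. SUM j:UNIV. A$i$j * B$i$j)"
 by (simp add: inner_vec_def)

lemma polys_jacobian:
 fixes v :: "real^'n => real^'n"
 assumes "v : polys k UNIV"
 shows "(%x. jacobian v (at x)) : polys (k - 1) UNIV"
proof -
 have "(%x. \<chi> i. \<chi> j. pd j v x $ i) : polys (k - 1) UNIV"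
 by (intro polys_vec polys_nth polys_pd sU assms)
 moreover have "jacobian v (at x) = (\<chi> i. \<chi> j. pd j v x $ i)" for x by (simp add: vec_eq_iff jacobian_nth)
 ultimately show ?thesis by simp
qed

lemma polys_div_vec:
 fixes v :: "real^'n => real^'n"
 assumes "v : polys k UNIV"
 shows "(%x. div_vec v x) : polys (k - 1) UNIV"
 unfolding div_vec_pd by (intro polys_sum polys_nth polys_pd sU assms)

lemma polys_div_mat:
 fixes \<tau> :: "real^'n => real^'n^'n"
 assumes "\<tau> : polys k UNIV"
 shows "(%x. div_mat \<tau> x) : polys (k - 1) UNIV"
proof -
 have "(%x. \<chi> i. div_vec (%y. \<tau> y $ i) x) : polys (k - 1) UNIV"
 by (intro polys_vec polys_div_vec polys_nth assms)
 then show ?thesis by (simp add: div_mat_def)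
qed

text \<open>On the homogeneous part of degree \<open>k\<close> the combination is zero by Euler's
  identity, so only lower-order terms survive. The second conjunct covers \<open>k = 0\<close>,
  where the truncated \<open>k - 1\<close> no longer records the drop in degree.\<close>

lemma polys_euler:
 fixes q :: "real^'n => real"
 assumes "q : polys k UNIV"
 shows "(%x. real k * q x - (SUM j:UNIV. x$j * pd j q x)) : polys (k - 1) UNIV &
 (k = 0 --> (ALL x. (SUM j:UNIV. x$j * pd j q x) = 0))"
 using sU assms
proof (induction rule: polys_induct)
 case (const k v)
 then show ?case by (auto simp: pd_const intro!: polys_const[OF sU])
next
 case (coord k f i)
 have df: "f differentiable (at x)" for x using coord(1) by (rule polys_diffable)
 have dc: "(%x :: real^'n. x $ i) differentiable (at x)" for x
 by (intro bounded_linear_imp_differentiable bounded_linear_vec_nth)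
 have "pd j (%x. x$i *R f x) x = x$i * pd j f x + (if i = j then f x else 0)" for j x
 using pd_scaleR[OF dc df] by (simp add: pd_coord)
 then have e: "(SUM j:UNIV. x$j * pd j (%x. x$i *R f x) x) = x$i * (SUM j:UNIV. x$j * pd j f x) + x$i * f x" for x
 by (simp add: algebra_simps sum.distrib sum_distrib_left if_distrib[of "%c. _ * c"] cong: if_cong)
 have "(%x. x$i *R (real k * f x - (SUM j:UNIV. x$j * pd j f x))) : polys k UNIV"
 proof (cases k)
 case 0
 then have "(%x. x$i *R (real k * f x - (SUM j:UNIV. x$j * pd j f x))) = (%_. 0)"
 using coord(2) by simp
 then show ?thesis using polys_zero[OF sU] by (simp only:)
 next
 case (Suc m)
 have "(%x. real k * f x - (SUM j:UNIV. x$j * pd j f x)) : polys (k - 1) UNIV" using coord(2) by blast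
 from polys_coord_mult[OF sU this, of i] show ?thesis using Suc by (simp only: diff_Suc_1)
 qed
 moreover have "real (Suc k) * (x$i *R f x) - (SUM j:UNIV. x$j * pd j (%x. x$i *R f x) x)
 = x$i *R (real k * f x - (SUM j:UNIV. x$j * pd j f x))" for x
 unfolding e by (simp add: algebra_simps)
 ultimately show ?case by simp
next
 case (add k f g)
 have d: "f differentiable (at x)" "g differentiable (at x)" for x
 using add(1,2) by (auto intro: polys_diffable)
 have e: "(SUM j:UNIV. x$j * pd j (%x. f x + g x) x) = (SUM j:UNIV. x$j * pd j f x) + (SUM j:UNIV. x$j * pd j g x)" for x
 unfolding pd_add[OF d] by (simp add: algebra_simps sum.distrib)
 have "(%x. (real k * f x - (SUM j:UNIV. x$j * pd j f x)) + (real k * g x - (SUM j:UNIV. x$j * pd j g x))) : polys (k - 1) UNIV"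
 using add(3,4) by (intro polys_add sU) auto
 moreover have "(%x. real k * (f x + g x) - (SUM j:UNIV. x$j * pd j (%x. f x + g x) x))
 = (%x. (real k * f x - (SUM j:UNIV. x$j * pd j f x)) + (real k * g x - (SUM j:UNIV. x$j * pd j g x)))"
 unfolding e by (simp add: algebra_simps fun_eq_iff)
 ultimately have "(%x. real k * (f x + g x) - (SUM j:UNIV. x$j * pd j (%x. f x + g x) x)) : polys (k - 1) UNIV"
 by (simp only:)
 moreover have "k = 0 --> (ALL x. (SUM j:UNIV. x$j * pd j (%x. f x + g x) x) = 0)"
 using add(3,4) unfolding e by simp
 ultimately show ?case by blast
qed

text \<open>The top-degree part \<open>q x\<close> of a Raviart-Thomas function is a multiple of its divergence, by
  Euler's identity for homogeneous polynomials.\<close>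

lemma raviart_thomas_split:
 fixes v :: "real^'n => real^'n"
 assumes v: "v : raviart_thomas k" and k: "k >= 1"
 shows "v : polys (Suc k) UNIV" "(%x. div_vec v x) : polys k UNIV"
 "(%x. v x - (div_vec v x / (CARD('n) + k)) *R (x - z)) : polys k UNIV"
proof -
 obtain p q where pq: "v = (%x. p x + q x *R x)" "p : polys k UNIV" "q : polys k UNIV"
 using v unfolding raviart_thomas_def by blast
 have qx: "(%x. q x *R x) : polys (Suc k) UNIV"
 using polys_mult[OF sU pq(3) polys_id] by simp
 then show vp: "v : polys (Suc k) UNIV" unfolding pq(1)
 by (intro polys_add sU polys_mono[OF sU pq(2)]) auto
 then show dv: "(%x. div_vec v x) : polys k UNIV" using polys_div_vec[OF vp] by simp
 have d: "p differentiable (at x)" "q differentiable (at x)" "(%x. q x *R x) differentiable (at x)" for x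
 using pq(2,3) qx by (auto intro: polys_diffable)
 have pdid: "pd j (%x :: real^'n. x) x = axis j 1" for j x by (rule pd_eqI[OF has_derivative_ident])
 have div: "div_vec v x = div_vec p x + CARD('n) * q x + (SUM j:UNIV. x$j * pd j q x)" for x
 proof -
 have "pd j v x $ j = pd j p x $ j + q x + x$j * pd j q x" for j
 unfolding pq(1) pd_add[OF d(1,3)] pd_scaleR[OF d(2) differentiable_ident] pdid
 by (simp add: axis_def mult.commute)
 then show ?thesis by (simp add: div_vec_pd sum.distrib)
 qed
 \<comment> \<open>The formula for \<open>div_vec v\<close> gives
   \<open>?N * q - div_vec v = ?r - div_vec p\<close>, a polynomial of degree \<open>k - 1\<close>;
   multiplied by \<open>x\<close> it has degree \<open>k\<close> again.\<close>
 let ?r = "%x. real k * q x - (SUM j:UNIV. x$j * pd j q x)"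
 let ?N = "real (CARD('n) + k)"
 have N: "?N > 0" using k by simp
 have r: "?r : polys (k - 1) UNIV" using polys_euler[OF pq(3)] by simp
 have k1: "k - 1 + 1 = k" using k by simp
 have "(%x. p x + (1 / ?N) *R (?r x *R x - div_vec p x *R x + div_vec v x *R z)) : polys k UNIV"
 using polys_mult[OF sU r polys_id] polys_mult[OF sU polys_div_vec[OF pq(2)] polys_id]
 polys_mult[OF sU dv polys_const[OF sU UNIV_I, of z 0]] unfolding k1 add_0_right
 by (intro polys_add polys_scaleR polys_diff sU pq(2))
 moreover have "v x - (div_vec v x / ?N) *R (x - z) =
 p x + (1 / ?N) *R (?r x *R x - div_vec p x *R x + div_vec v x *R z)" for x
 proof -
 have "?N *R q x *R x - div_vec v x *R x = ?r x *R x - div_vec p x *R x"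
 unfolding div by (simp add: algebra_simps)
 then have "(1 / ?N) *R (?r x *R x - div_vec p x *R x) = q x *R x - (div_vec v x / ?N) *R x"
 using N by (metis (no_types, lifting) divide_inverse_commute inverse_eq_divide less_irrefl mult.commute nonzero_eq_divide_eq scaleR_one scaleR_right_diff_distrib scaleR_scaleR mult.left_neutral)
 then show ?thesis unfolding pq(1) by (simp add: algebra_simps)
 qed
 ultimately show "(%x. v x - (div_vec v x / (CARD('n) + k)) *R (x - z)) : polys k UNIV" by simp
qed

context full_simplex begin

lemma divergence_polys:
 fixes p :: "real^'n::_ => real"
 assumes p: "p : polys k UNIV"
 shows "integral T (%x. pd j p x) = (SUM c:C. (nu c $ j) * FI (fac c) p)"
proof -
 have "integral T (%x. pd j p x) = (SUM c:C. (nu c \<bullet> axis j 1) * FI (fac c) p)"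
 proof (rule divergence_direction[of p "%x. frechet_derivative p (at x)" "axis j 1"])
 show "(p has_derivative frechet_derivative p (at x)) (at x)" for x
 using polys_diffable[OF p] frechet_derivative_works by blast
 show "continuous_on UNIV (%x. frechet_derivative p (at x) \<eta>)" for \<eta>
 by (rule polys_cont[OF polys_derivative[OF p sU]])
 qed
 then show ?thesis by (simp add: inner_axis)
qed

lemma integration_by_parts:
 fixes \<tau> :: "real^'n::_ => real^'n::_^'n::_" and v :: "real^'n::_ => real^'n::_"
 assumes \<tau>: "\<tau> : polys m UNIV" and v: "v : polys l UNIV"
 shows "integral T (%x. div_mat \<tau> x \<bullet> v x) =
 (SUM c:C. FI (fac c) (%x. (\<tau> x *v nu c) \<bullet> v x)) - integral T (%x. \<tau> x \<bullet> jacobian v (at x))"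
proof -
 define p where "p i j x = \<tau> x $ i $ j * v x $ i" for i j x
 have p: "p i j : polys (m + l) UNIV" for i j
 unfolding p_def[abs_def] using polys_mult[OF sU polys_nth[OF polys_nth[OF \<tau>]] polys_nth[OF v]] by simp
 have d: "\<tau> differentiable (at x)" "v differentiable (at x)" "(%x. \<tau> x $ i) differentiable (at x)"
 "(%x. \<tau> x $ i $ j) differentiable (at x)" "(%x. v x $ i) differentiable (at x)" for x i j
 by (rule polys_diffable[OF \<tau>] polys_diffable[OF v] polys_diffable[OF polys_nth[OF \<tau>]]
 polys_diffable[OF polys_nth[OF polys_nth[OF \<tau>]]] polys_diffable[OF polys_nth[OF v]])+
 have pdp: "pd j (p i j) x = \<tau> x $ i $ j * pd j v x $ i + pd j \<tau> x $ i $ j * v x $ i" for i j x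
 unfolding p_def[abs_def] pd_mult[OF d(4,5)] pd_nth[OF d(2)] pd_nth[OF d(3)] pd_nth[OF d(1)] ..
 have c0: "continuous_on S (%x. pd j (p i j) x)" for S i j
 by (rule polys_cont[OF polys_pd[OF sU p]])
 have c1: "continuous_on S (%x. div_mat \<tau> x \<bullet> v x)" "continuous_on S (%x. \<tau> x \<bullet> jacobian v (at x))" for S
 by (intro continuous_intros polys_cont[OF polys_div_mat[OF \<tau>]] polys_cont[OF v]
 polys_cont[OF \<tau>] polys_cont[OF polys_jacobian[OF v]])+
 have "integral T (%x. SUM i:UNIV. SUM j:UNIV. pd j (p i j) x)
 = (SUM i:UNIV. SUM j:UNIV. SUM c:C. (nu c $ j) * FI (fac c) (p i j))"
 by (simp add: integral_sum integrable_compact compact_T c0 integrable_sum divergence_polys[OF p])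
 also have "\<dots> = (SUM c:C. SUM i:UNIV. SUM j:UNIV. (nu c $ j) * FI (fac c) (p i j))"
 by (simp add: sum.swap[of _ C])
 also have "\<dots> = (SUM c:C. FI (fac c) (%x. (\<tau> x *v nu c) \<bullet> v x))"
 proof (rule sum.cong[OF refl])
 fix c assume c: "c : C"
 have cp: "continuous_on UNIV (%x. (nu c $ j) * p i j x)" for i j
 by (intro continuous_intros polys_cont[OF p])
 have "(SUM i:UNIV. SUM j:UNIV. (nu c $ j) * FI (fac c) (p i j))
 = FI (fac c) (%x. SUM i:UNIV. SUM j:UNIV. (nu c $ j) * p i j x)"
 using cp by (simp add: FI_sum[OF c] FI_cmult[OF c] continuous_on_sum)
 also have "(%x. SUM i:UNIV. SUM j:UNIV. (nu c $ j) * p i j x) = (%x. (\<tau> x *v nu c) \<bullet> v x)"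
 by (simp add: p_def matrix_vector_mult_def inner_vec_def sum_distrib_right sum_distrib_left mult_ac fun_eq_iff)
 finally show "(SUM i:UNIV. SUM j:UNIV. (nu c $ j) * FI (fac c) (p i j)) =
 FI (fac c) (%x. (\<tau> x *v nu c) \<bullet> v x)" .
 qed
 also have "(%x. SUM i:UNIV. SUM j:UNIV. pd j (p i j) x) = (%x. div_mat \<tau> x \<bullet> v x + \<tau> x \<bullet> jacobian v (at x))"
 by (simp add: pdp sum.distrib inner_mat jacobian_nth inner_vec_def[of "div_mat _ _"] div_mat_pd[OF d(1)] sum_distrib_right add.commute fun_eq_iff)
 finally show ?thesis
 by (simp add: integral_add integrable_compact compact_T c1)
qed

lemma sum_facets: "(SUM F:{F. F facet_of T}. \<Phi> F) = (SUM c:C. \<Phi> (fac c))"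
proof -
 have "inj_on (%a. fac a) C" using fac_inj by (rule inj_onI)
 then show ?thesis unfolding facets_T by (simp add: sum.reindex)
qed

text \<open>In the integration by parts the normal-normal part of the boundary term cancels against
  the one subtracted in \<open>b2\<close>. The trace that remains is tangential, so it sees only the
  tangential part of \<open>v\<close>.\<close>

lemma b2_element:
 fixes \<tau> \<eta> :: "real^'n::_ => real^'n::_^'n::_" and v :: "real^'n::_ => real^'n::_"
 assumes \<tau>: "\<tau> : polys m UNIV" and v: "v : polys l UNIV" and \<eta>: "\<eta> : polys l' UNIV"
 shows "integral T (%x. div_mat \<tau> x \<bullet> v x) + integral T (%x. \<tau> x \<bullet> \<eta> x)
 - (SUM F:{F. F facet_of T}. FI F
 (%x. nn_trace (outer_normal T F) (\<tau> x) * (v x \<bullet> outer_normal T F)))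
 = (SUM c:C. FI (fac c) (%x. nt_trace (nu c) (\<tau> x) \<bullet> v x))
 - integral T (%x. \<tau> x \<bullet> (jacobian v (at x) - \<eta> x))"
proof -
 have c1: "continuous_on S (%x. \<tau> x \<bullet> \<eta> x)" "continuous_on S (%x. \<tau> x \<bullet> jacobian v (at x))"
 "continuous_on S (%x. (\<tau> x *v n) \<bullet> v x)" "continuous_on S (%x. nn_trace n (\<tau> x) * (v x \<bullet> n))"
 "continuous_on S (%x. nt_trace n (\<tau> x) \<bullet> v x)" for S n
 proof -
 have "(%x. \<tau> x *v n) : polys m UNIV" by (rule polys_lin_image[OF _ \<tau>])
 (simp_all add: linear_iff matrix_vector_mult_add_rdistrib scaleR_matrix_vector_assoc)
 then have cn: "continuous_on S (%x. \<tau> x *v n)" by (rule polys_cont)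
 show "continuous_on S (%x. \<tau> x \<bullet> \<eta> x)" "continuous_on S (%x. \<tau> x \<bullet> jacobian v (at x))"
 "continuous_on S (%x. (\<tau> x *v n) \<bullet> v x)" "continuous_on S (%x. nn_trace n (\<tau> x) * (v x \<bullet> n))"
 "continuous_on S (%x. nt_trace n (\<tau> x) \<bullet> v x)"
 unfolding nn_trace_def nt_trace_def
 by (intro continuous_intros polys_cont[OF v] polys_cont[OF \<eta>] cn
 polys_cont[OF \<tau>] polys_cont[OF polys_jacobian[OF v]])+
 qed
 have f: "FI (fac c) (%x. (\<tau> x *v nu c) \<bullet> v x) =
 FI (fac c) (%x. nn_trace (nu c) (\<tau> x) * (v x \<bullet> nu c)) +
 FI (fac c) (%x. nt_trace (nu c) (\<tau> x) \<bullet> v x)" if c: "c : C" for c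
 proof -
 have "(%x. (\<tau> x *v nu c) \<bullet> v x) = (%x. nn_trace (nu c) (\<tau> x) * (v x \<bullet> nu c) + nt_trace (nu c) (\<tau> x) \<bullet> v x)"
 by (simp add: nt_trace_def inner_diff_left inner_commute[of "nu c"] fun_eq_iff)
 then show ?thesis using FI_add[OF c c1(4,5)] by simp
 qed
 have "(SUM F:{F. F facet_of T}. FI F (%x. nn_trace (outer_normal T F) (\<tau> x) * (v x \<bullet> outer_normal T F)))
 = (SUM c:C. FI (fac c) (%x. nn_trace (nu c) (\<tau> x) * (v x \<bullet> nu c)))"
 unfolding sum_facets by (rule sum.cong[OF refl]) (simp only: outer_normal_fac)
 moreover have "(SUM c:C. FI (fac c) (%x. (\<tau> x *v nu c) \<bullet> v x)) =
 (SUM c:C. FI (fac c) (%x. nn_trace (nu c) (\<tau> x) * (v x \<bullet> nu c))) +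
 (SUM c:C. FI (fac c) (%x. nt_trace (nu c) (\<tau> x) \<bullet> v x))"
 using f by (simp add: sum.distrib)
 moreover have "integral T (%x. \<tau> x \<bullet> (jacobian v (at x) - \<eta> x)) =
 integral T (%x. \<tau> x \<bullet> jacobian v (at x)) - integral T (%x. \<tau> x \<bullet> \<eta> x)"
 unfolding inner_diff_right by (intro integral_diff integrable_compact compact_T c1)
 ultimately show ?thesis using integration_by_parts[OF \<tau> v] by simp
qed

end

section \<open>Meshes\<close>

lemma full_simplex_subset_independent: "full_simplex C ==> \<not> affine_dependent (C - {a})"
 using affine_independent_subset[of C "C - {a}"] full_simplex.indep by blast

context full_simplex begin

lemma open_positive: "open {x. ALL c:D. 0 < bc c x}" if "D \<subseteq> C" for D
proof -
 have "{x. ALL c:D. 0 < bc c x} = (\<Inter>c\<in>D. {x. 0 < bc c x})" by auto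
 moreover have "open (\<Inter>c\<in>D. {x. 0 < bc c x})"
 proof (intro open_INT ballI)
 show "finite D" using that finite_C finite_subset by blast
 show "open {x. 0 < bc c x}" if "c : D" for c
 using continuous_bc[of c UNIV] that \<open>D \<subseteq> C\<close> by (intro open_Collect_less continuous_intros) auto
 qed
 ultimately show ?thesis by simp
qed

lemma interior_T: "(!!c. c : C ==> 0 < bc c x) ==> x : interior T"
proof (rule interiorI[OF open_positive[OF order_refl]])
 show "{x. ALL c:C. 0 < bc c x} \<subseteq> T" unfolding mem_T[of "_", abs_def] by (auto simp: mem_T less_imp_le)
qed simp

lemma aff_dim_T: "aff_dim T = int CARD('n)"
 using indep affine_independent_iff_card[of C] card_C by (simp add: aff_dim_convex_hull)

text \<open>A barycentric coordinate of one simplex is affine, hence determined by its values at the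
  vertices of the other.\<close>

lemma bc_combination: "a : C ==> full_simplex C' ==> b : C' ==>
 bary (convex hull C') b x = (SUM c:C. bc c x * bary (convex hull C') b c)"
proof -
 assume C': "full_simplex C'" "b : C'" and a: "a : C"
 interpret S': full_simplex C' by (rule C')
 have "x - a = (SUM c:C. bc c x *R (c - a))"
 using bary_sum[of x] bary_point[of x] by (simp add: scaleR_right_diff_distrib sum_subtractf scaleR_sum_left[symmetric])
 then have "S'.g b \<bullet> (x - a) = (SUM c:C. bc c x * (S'.g b \<bullet> (c - a)))" by (simp add: inner_sum_right)
 also have "\<dots> = (SUM c:C. bc c x * (S'.bc b c - S'.bc b a))"
 proof -
 have "S'.g b \<bullet> (c - a) = S'.bc b c - S'.bc b a" for c using S'.bary_affine[OF C'(2), of c a] by linarith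
 then show ?thesis by (simp only:)
 qed
 also have "\<dots> = (SUM c:C. bc c x * S'.bc b c) - S'.bc b a"
 using bary_sum[of x] by (simp add: right_diff_distrib sum_subtractf sum_distrib_right[symmetric])
 finally show ?thesis using S'.bary_affine[OF C'(2), of x a] by linarith
qed

end

text \<open>Both coordinates vanish on the common hyperplane, so one is a multiple \<open>s\<close>
  of the other, and \<open>s\<close> is negative because the simplices lie on opposite sides of
  it.\<close>

lemma shared_facet:
 fixes C C' :: "(real^'n::{finite,wellorder}) set"
 assumes S: "full_simplex C" "full_simplex C'" and ne: "convex hull C ~= convex hull C'"
 and face: "convex hull C \<inter> convex hull C' face_of convex hull C" "convex hull C \<inter> convex hull C' face_of convex hull C'"
 and a: "a : C" and a': "a' : C'" and F: "convex hull (C - {a}) = convex hull (C' - {a'})"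
 shows "C - {a} = C' - {a'}" "full_simplex.nu C' a' = - full_simplex.nu C a"
 "\<exists>s>0. ALL x. bary (convex hull C') a' x = - s * bary (convex hull C) a x"
proof -
 interpret S: full_simplex C by (rule S)
 interpret S': full_simplex C' by (rule S)
 have ext: "D - {d} = {x. x extreme_point_of convex hull (D - {d})}"
 if "full_simplex D" for D :: "(real^'n::_) set" and d
 using extreme_point_of_convex_hull_affine_independent[OF full_simplex_subset_independent[OF that]] by auto
 show CC: "C - {a} = C' - {a'}" by (subst ext[OF S(1)], subst ext[OF S(2)]) (simp only: F)
 define s where "s = S'.bc a' a"
 have bcs: "S'.bc a' x = s * S.bc a x" for x
 proof -
 have "S'.bc a' b = 0" if "b : C - {a}" for b
 proof -
 have "b : C'" "b ~= a'" using that CC by auto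
 then show ?thesis using S'.bary_vertex[OF a'] by simp
 qed
 then have "(SUM b:C - {a}. S.bc b x * S'.bc a' b) = 0" by (intro sum.neutral) simp
 then show ?thesis using S.bc_combination[OF a S(2) a', of x] sum.remove[OF S.finite_C a, of "%b. S.bc b x * S'.bc a' b"]
 by (simp add: s_def)
 qed
 have gs: "S'.g a' = s *R S.g a"
 proof -
 have "S'.g a' \<bullet> \<xi> = (s *R S.g a) \<bullet> \<xi>" for \<xi>
 unfolding S'.inner_g[OF a'] inner_scaleR_left S.inner_g[OF a] bcs by (simp add: algebra_simps)
 then show ?thesis using vector_eq_rdot[of "S'.g a'" "s *R S.g a"] by blast
 qed
 have s0: "s ~= 0" using S'.g_nonzero[OF a'] gs by auto
 \<comment> \<open>If both lay on the same side, a point slightly off the centroid of the facet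
   would be interior to both. Then the intersection, a face that meets the relative interior, would
   be all of each simplex. The step \<open>t\<close> is so small that the coordinates
   \<open>1 / n\<close> at the centroid of the facet change by at most half of their value.\<close>
 have "\<not> s > 0"
 proof
 assume s: "s > 0"
 define n where "n = real CARD('n)"
 have n: "n >= 1" unfolding n_def by (simp add: Suc_leI)
 define K where "K = (SUM b:C'. \<bar>S'.g b \<bullet> (a - S.cen a)\<bar>) + 1"
 have K: "K >= 1" unfolding K_def by (simp add: sum_nonneg)
 define t where "t = 1 / (2 * n * K)"
 have nK: "n * K >= 1" using mult_mono[of 1 n 1 K] n K by simp
 have t: "t > 0" "t < 1" unfolding t_def using nK by (auto simp: mult.assoc)
 define y where "y = S.cen a + t *R (a - S.cen a)"
 have cen: "S'.cen a' = S.cen a" by (simp add: S.cen_def S'.cen_def CC)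
 have y1: "0 < S.bc b y" if b: "b : C" for b
 proof -
 have "S.bc b y = S.bc b (S.cen a) + t * (S.bc b a - S.bc b (S.cen a))"
 unfolding y_def S.bary_add[OF b] by (simp add: S.bary_affine[OF b, of a "S.cen a"])
 moreover have "S.bc b y = (1 - t) * (1 / real CARD('n))" if "b ~= a"
 using calculation that S.bc_cen[OF a b] S.bary_vertex[OF b a] by (simp add: algebra_simps diff_divide_distrib)
 ultimately show ?thesis using t S.bc_cen[OF a b] S.bary_vertex[OF b a]
 by (cases "b = a") (auto simp: divide_strict_right_mono)
 qed
 have y2: "0 < S'.bc b y" if b: "b : C'" for b
 proof (cases "b = a'")
 case True
 then show ?thesis using bcs s y1[OF a] by simp
 next
 case False
 have "\<bar>S'.g b \<bullet> (a - S.cen a)\<bar> <= (SUM b:C'. \<bar>S'.g b \<bullet> (a - S.cen a)\<bar>)"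
 using b S'.finite_C by (intro member_le_sum) auto
 then have "\<bar>S'.g b \<bullet> (a - S.cen a)\<bar> <= K" by (simp add: K_def)
 then have "t * \<bar>S'.g b \<bullet> (a - S.cen a)\<bar> <= t * K" using t by (intro mult_left_mono) auto
 also have "t * K = 1 / (2 * n)" using K n by (simp add: t_def)
 finally have "\<bar>t * (S'.g b \<bullet> (a - S.cen a))\<bar> <= 1 / (2 * n)" using t by (simp add: abs_mult)
 moreover have "S'.bc b y = 1 / n + t * (S'.g b \<bullet> (a - S.cen a))"
 unfolding y_def S'.bary_add[OF b] using S'.bc_cen[OF a' b] False by (simp add: cen n_def)
 moreover have "1 / (2 * n) < 1 / n" using n by (simp add: field_simps)
 ultimately show ?thesis by linarith
 qed
 have "y : interior (convex hull C)" "y : interior (convex hull C')"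
 using S.interior_T[OF y1] S'.interior_T[OF y2] by auto
 then have r: "y : rel_interior (convex hull C)" "y : rel_interior (convex hull C')" "y : convex hull C \<inter> convex hull C'"
 using interior_subset_rel_interior interior_subset by blast+
 have "convex hull C \<subseteq> convex hull C \<inter> convex hull C'"
 using r by (intro subset_of_face_of[OF face(1) order_refl]) blast
 moreover have "convex hull C' \<subseteq> convex hull C \<inter> convex hull C'"
 using r by (intro subset_of_face_of[OF face(2) order_refl]) blast
 ultimately show False using ne by blast
 qed
 then have sn: "s < 0" using s0 by simp
 show "S'.nu a' = - S.nu a"
 unfolding S.nu_def S'.nu_def gs norm_scaleR using sn by simp
 show "\<exists>s>0. ALL x. S'.bc a' x = - s * S.bc a x"
 using bcs sn by (intro exI[of _ "- s"]) simp
qed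

text \<open>A Lipschitz domain lies on one side of its boundary: just below the graph of
  \<open>\<phi>\<close> there is an open set outside the domain, so no boundary point is interior to
  the closure. This is what rules out slits.\<close>

lemma interior_closure_lipschitz:
 fixes \<Omega> :: "(real^'n) set"
 assumes \<Omega>: "bounded_lipschitz_domain \<Omega>"
 shows "interior (closure \<Omega>) = \<Omega>"
proof
 have op\<Omega>: "open \<Omega>" using \<Omega> by (simp add: bounded_lipschitz_domain_def)
 have chart: "ALL p:frontier \<Omega>. EX e r L \<phi>. norm e = 1 & 0 < r & L-lipschitz_on {y. y \<bullet> e = 0} \<phi> &
 (ALL x:ball p r. x : \<Omega> \<longleftrightarrow> \<phi> (x - (x \<bullet> e) *R e) < x \<bullet> e)"
 using \<Omega> unfolding bounded_lipschitz_domain_def by (elim conjE)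
 show "\<Omega> \<subseteq> interior (closure \<Omega>)"
 by (rule interior_maximal[OF closure_subset op\<Omega>])
 show "interior (closure \<Omega>) \<subseteq> \<Omega>"
 proof (rule ccontr)
 assume "\<not> interior (closure \<Omega>) \<subseteq> \<Omega>"
 then obtain p where p: "p : interior (closure \<Omega>)" "p \<notin> \<Omega>" by blast
 then have "p : frontier \<Omega>" using op\<Omega> interior_subset[of "closure \<Omega>"]
 by (auto simp: frontier_def interior_open)
 from bspec[OF chart this] obtain e r L \<phi> where e: "norm e = 1" "0 < r" "L-lipschitz_on {y. y \<bullet> e = 0} \<phi>"
 "ALL x:ball p r. x : \<Omega> \<longleftrightarrow> \<phi> (x - (x \<bullet> e) *R e) < x \<bullet> e"
 by (elim exE conjE)
 have ee: "e \<bullet> e = 1" using e(1) by (simp add: norm_eq_1)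
 obtain r' where r': "r' > 0" "ball p r' \<subseteq> closure \<Omega>"
 using p(1) by (auto simp: mem_interior)
 define t where "t = min r r' / 2"
 have t: "t > 0" "t < r" "t < r'" using e(2) r'(1) by (auto simp: t_def)
 define q where "q = p - t *R e"
 have dq: "dist p q = t" using t e(1) by (simp add: q_def dist_norm)
 have "\<phi> (p - (p \<bullet> e) *R e) >= p \<bullet> e" using bspec[OF e(4), of p] e(2) p(2) by simp
 moreover have "q - (q \<bullet> e) *R e = p - (p \<bullet> e) *R e" by (simp add: q_def inner_diff_left ee algebra_simps)
 moreover have "q \<bullet> e = p \<bullet> e - t" by (simp add: q_def inner_diff_left ee)
 ultimately have less: "q \<bullet> e < \<phi> (q - (q \<bullet> e) *R e)" using t by simp
 let ?D = "%x. \<phi> (x - (x \<bullet> e) *R e) - x \<bullet> e"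
 have "continuous_on UNIV ?D"
 by (intro continuous_intros continuous_on_compose2[OF lipschitz_on_continuous_on[OF e(3)]])
 (auto simp: inner_diff_left ee)
 then have op: "open {x. 0 < ?D x}" using open_Collect_less[OF continuous_on_const] by blast
 define U where "U = {x. 0 < ?D x} \<inter> ball p r"
 have "open U" "q : U" unfolding U_def using op less dq t by auto
 moreover have "q : closure \<Omega>" using r'(2) dq t by auto
 ultimately have "U \<inter> \<Omega> ~= {}" using open_Int_closure_eq_empty[of U \<Omega>] by blast
 then obtain x where x: "x : U" "x : \<Omega>" by blast
 then show False using bspec[OF e(4), of x] by (simp add: U_def)
 qed
qed

locale mesh =
 fixes \<Omega> :: "(real^'n::{finite,wellorder}) set" and \<T> :: "(real^'n::_) set set" and \<rho> :: real
 assumes dom: "bounded_lipschitz_domain \<Omega>" and mesh: "simplicial_mesh \<Omega> \<T>"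
 and qu: "quasi_uniform \<rho> \<T>" and rho: "\<rho> > 0"
begin

abbreviation "h \<equiv> mesh_size \<T>"

definition ctr :: "(real^'n::_) set => real^'n::_" where "ctr T = (SOME z. cball z (\<rho> * h) \<subseteq> T)"

lemma finite_mesh: "finite \<T>"
 using mesh by (simp add: simplicial_mesh_def triangulation_def)

lemma face_mesh:
 assumes "T : \<T>" "T' : \<T>"
 shows "T \<inter> T' face_of T" "T \<inter> T' face_of T'"
proof -
 have *: "S \<inter> S' face_of S" if "S : \<T>" "S' : \<T>" for S S'
 using that mesh by (simp add: simplicial_mesh_def triangulation_def)
 show "T \<inter> T' face_of T" using *[OF assms] .
 show "T \<inter> T' face_of T'" using *[OF assms(2,1)] by (simp only: Int_commute)
qed

lemma Union_mesh: "\<Union>\<T> = closure \<Omega>"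
 using mesh by (simp add: simplicial_mesh_def)

lemma assumes "T : \<T>" shows full: "full_simplex (vertices T)" and hull: "convex hull (vertices T) = T"
proof -
 have "int CARD('n) simplex T" using assms mesh by (simp add: simplicial_mesh_def)
 then obtain C where C: "\<not> affine_dependent C" "int (card C) = int CARD('n) + 1" "T = convex hull C"
 unfolding simplex_def by blast
 interpret S: full_simplex C using C(1,2) by unfold_locales linarith+
 have "vertices T = C" using S.vertices_T C(3) by simp
 then show "full_simplex (vertices T)" "convex hull (vertices T) = T"
 using C(3) S.full_simplex_axioms by simp_all
qed

lemma diam_le: "T : \<T> ==> diameter T <= h"
 unfolding mesh_size_def using finite_mesh by simp

lemma mesh_nonempty: "\<T> ~= {}"
proof
 assume "\<T> = {}"
 then have "closure \<Omega> = {}" using Union_mesh by simp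
 then show False using dom by (simp add: bounded_lipschitz_domain_def)
qed

lemma h_pos: "h > 0"
proof -
 obtain T where T: "T : \<T>" using mesh_nonempty by blast
 interpret S: full_simplex "vertices T" by (rule full[OF T])
 obtain a where a: "a : vertices T" using S.C_nonempty by blast
 have "card (vertices T - {a}) = CARD('n)" using S.card_C a S.finite_C by simp
 then have "vertices T - {a} ~= {}" by (metis card.empty zero_less_card_finite less_irrefl)
 then obtain b where b: "b : vertices T" "b ~= a" by blast
 have "a : T" "b : T" using a b(1) hull_inc[of _ "vertices T" convex] hull[OF T] by auto
 then have "dist a b <= diameter T"
 using diameter_bounded_bound[OF compact_imp_bounded[OF S.compact_T], of a b] hull[OF T] by simp
 then show ?thesis using diam_le[OF T] b(2) by (metis dual_order.strict_trans1 order.trans zero_less_dist_iff)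
qed

lemma shaped: assumes T: "T : \<T>" shows "shaped_simplex (vertices T) (ctr T) h \<rho>"
proof -
 interpret S: full_simplex "vertices T" by (rule full[OF T])
 have "EX z. cball z (\<rho> * h) \<subseteq> T" using qu T by (simp add: quasi_uniform_def)
 then have "cball (ctr T) (\<rho> * h) \<subseteq> T" unfolding ctr_def by (rule someI_ex)
 then show ?thesis using h_pos rho diam_le[OF T] hull[OF T] by unfold_locales auto
qed

lemma facet_cases:
 assumes "T : \<T>"
 shows "F facet_of T \<longleftrightarrow> (EX a:vertices T. F = convex hull (vertices T - {a}))"
 using full_simplex.facet_iff[OF full[OF assms], of F] hull[OF assms] by simp

lemma shared:
 assumes T: "T : \<T>" "T' : \<T>" "T ~= T'" and a: "a : vertices T" "a' : vertices T'"
 and F: "convex hull (vertices T - {a}) = convex hull (vertices T' - {a'})"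
 shows "vertices T - {a} = vertices T' - {a'}"
 "full_simplex.nu (vertices T') a' = - full_simplex.nu (vertices T) a"
 "\<exists>s>0. ALL x. bary T' a' x = - s * bary T a x"
 using shared_facet[OF full[OF T(1)] full[OF T(2)] _ _ _ a F] face_mesh[OF T(1,2)] T(3)
 unfolding hull[OF T(1)] hull[OF T(2)] by blast+

lemma outer_normal_shared:
 assumes T: "T : \<T>" "T' : \<T>" "T ~= T'" and F: "F facet_of T" "F facet_of T'"
 shows "outer_normal T' F = - outer_normal T F"
proof -
 obtain a a' where a: "a : vertices T" "a' : vertices T'" "F = convex hull (vertices T - {a})" "F = convex hull (vertices T' - {a'})"
 using F facet_cases T by metis
 show ?thesis
 using shared(2)[OF T a(1,2)] a full_simplex.outer_normal_fac[OF full[OF T(1)] a(1)]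
 full_simplex.outer_normal_fac[OF full[OF T(2)] a(2)] unfolding hull[OF T(1)] hull[OF T(2)] by simp
qed

lemma norm_outer_normal:
 assumes T: "T : \<T>" and F: "F facet_of T" shows "norm (outer_normal T F) = 1"
proof -
 obtain a where a: "a : vertices T" "F = convex hull (vertices T - {a})" using F facet_cases T by blast
 show ?thesis
 using a full_simplex.outer_normal_fac[OF full[OF T] a(1)] full_simplex.norm_nu[OF full[OF T] a(1)]
 unfolding hull[OF T] by simp
qed

definition adj :: "(real^'n::_) set => (real^'n::_) set set" where "adj F = {T\<in>\<T>. F facet_of T}"

lemma finite_adj: "finite (adj F)"
 using finite_mesh by (simp add: adj_def)

text \<open>Any two elements at a facet have opposite outer normals there, which is impossible for
  three of them.\<close>

lemma adj_cases:
 assumes "F : mesh_facets \<T>"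
 obtains T where "adj F = {T}" | T T' where "adj F = {T, T'}" "T ~= T'"
proof -
 obtain T where T: "T : adj F" using assms by (auto simp: mesh_facets_def adj_def)
 show thesis
 proof (cases "adj F = {T}")
 case False
 then obtain T' where T': "T' : adj F" "T' ~= T" using T by blast
 have "T'' : {T, T'}" if T'': "T'' : adj F" for T''
 proof (rule ccontr)
 assume ne: "T'' \<notin> {T, T'}"
 have 1: "outer_normal T' F = - outer_normal T F" "outer_normal T'' F = - outer_normal T F"
 "outer_normal T'' F = - outer_normal T' F"
 using outer_normal_shared[of T T' F] outer_normal_shared[of T T'' F] outer_normal_shared[of T' T'' F] T T' T'' ne
 by (auto simp: adj_def)
 have "- outer_normal T F = outer_normal T F" using 1(3) unfolding 1(1,2) by (simp only: minus_minus)
 then have "outer_normal T F + outer_normal T F = outer_normal T F + - outer_normal T F" by (simp only:)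
 then have "2 *R outer_normal T F = 0" by (simp add: scaleR_2)
 then have "outer_normal T F = 0" by simp
 then show False using norm_outer_normal[of T F] T by (simp add: adj_def)
 qed
 then have "adj F = {T, T'}" using T T' by blast
 then show thesis using that(2) T'(2) by metis
 qed (rule that(1))
qed

text \<open>Suppose a relative interior point of the facet lies in the open domain. Leaving the
  element through it, one stays in the domain, hence in the union of the other elements, and one of
  these, being closed, contains the point too. Its intersection with \<open>T\<close> is a face of
  \<open>T\<close> that contains the facet, so it is the facet, and \<open>F\<close> has a second
  neighbour.\<close>

lemma boundary_facet:
 assumes F: "adj F = {T}"
 shows "F \<subseteq> frontier \<Omega>"
proof -
 have T: "T : \<T>" "F facet_of T" using F by (auto simp: adj_def)
 obtain a where a: "a : vertices T" "F = convex hull (vertices T - {a})" using facet_cases T by blast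
 interpret S: full_simplex "vertices T" by (rule full[OF T(1)])
 note hullT = hull[OF T(1)]
 have rel: "y : frontier \<Omega>" if y: "y : F" "!!b. b : vertices T - {a} ==> 0 < S.bc b y" for y
 proof (rule ccontr)
 assume nf: "y \<notin> frontier \<Omega>"
 have "y : closure \<Omega>" using y(1) facet_of_imp_subset[OF T(2)] T(1) Union_mesh by blast
 then have y\<Omega>: "y : \<Omega>" using nf dom unfolding frontier_def bounded_lipschitz_domain_def by (simp add: interior_open)
 \<comment> \<open>Points approaching \<open>y\<close> from outside \<open>T\<close>. There are
   finitely many elements, so one of them contains infinitely many of these points.\<close>
 define ys where "ys i = y + (1 / real (Suc i)) *R S.nu a" for i
 have lim: "ys \<longlonglongrightarrow> y + 0 *R S.nu a" unfolding ys_def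
 by (intro tendsto_intros LIMSEQ_Suc[OF lim_1_over_n])
 have ev: "eventually (%i. ys i : \<Omega>) sequentially"
 using lim y\<Omega> dom topological_tendstoD[of ys y sequentially \<Omega>] unfolding bounded_lipschitz_domain_def by simp
 have notT: "ys i \<notin> T" for i
 proof -
 have "S.bc a (ys i) < 0" using y(1) a S.g_nonzero[OF a(1)] S.mem_fac[OF a(1)]
 by (simp add: ys_def S.bary_add S.g_dot_nu)
 then show ?thesis using S.mem_T[of "ys i"] a(1) unfolding hullT by force
 qed
 obtain N where N: "!!i. i >= N ==> ys i : \<Omega>" using ev unfolding eventually_sequentially by blast
 have "ALL i. EX T'. T' : \<T> - {T} & ys (i + N) : T'"
 proof
 fix i
 have "ys (i + N) : \<Union>\<T>" using N[of "i + N"] closure_subset[of \<Omega>] Union_mesh by auto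
 then show "EX T'. T' : \<T> - {T} & ys (i + N) : T'" using notT by blast
 qed
 then obtain f where f: "!!i. f i : \<T> - {T}" "!!i. ys (i + N) : f i" by metis
 have "finite (range f)" using f(1) finite_mesh by (meson finite_Diff finite_subset image_subsetI)
 then obtain T' where T': "infinite (f -` {T'})" "T' : range f"
 using pigeonhole_infinite[of UNIV f] by (auto simp: vimage_def)
 have T'm: "T' : \<T>" "T' ~= T" using T'(2) f(1) by auto
 interpret S': full_simplex "vertices T'" by (rule full[OF T'm(1)])
 have "closed T'" using S'.compact_T hull[OF T'm(1)] compact_imp_closed by simp
 have yT': "y : T'"
 proof -
 obtain sq :: "nat => nat" where sq: "strict_mono sq" "!!i. sq i : f -` {T'}"
 using infinite_enumerate[OF T'(1)] by blast
 have i: "ys (sq i + N) : T'" for i using sq(2)[of i] f(2)[of "sq i"] by simp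
 have "(%i. ys (sq i + N)) \<longlonglongrightarrow> y"
 using LIMSEQ_subseq_LIMSEQ[OF LIMSEQ_ignore_initial_segment[OF lim, of N] sq(1)] by (simp add: o_def)
 then show ?thesis using closed_sequentially[OF \<open>closed T'\<close> i] by simp
 qed
 have FT: "F \<subseteq> T \<inter> T'"
 proof (rule subset_of_face_of[OF face_mesh(1)[OF T(1) T'm(1)] facet_of_imp_subset[OF T(2)]])
 have "y : rel_interior F"
 proof -
 have ri: "rel_interior F = {y. EX u. (ALL x:vertices T - {a}. 0 < u x) & sum u (vertices T - {a}) = 1 & (SUM x:vertices T - {a}. u x *R x) = y}"
 unfolding a(2) by (rule rel_interior_convex_hull_explicit[OF full_simplex_subset_independent[OF full[OF T(1)]]])
 have "S.bc a y = 0" using y(1) a S.mem_fac by blast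
 then have s1: "sum (%b. S.bc b y) (vertices T - {a}) = 1" "(SUM x:vertices T - {a}. S.bc x y *R x) = y"
 using S.bary_sum[of y] S.bary_point[of y] sum.remove[OF S.finite_C a(1), of "%b. S.bc b y"]
 sum.remove[OF S.finite_C a(1), of "%b. S.bc b y *R b"] by simp_all
 show ?thesis unfolding ri
 by (rule CollectI, rule exI[of _ "%b. S.bc b y"], intro conjI ballI s1 y(2))
 qed
 moreover have "y : T \<inter> T'" using y(1) yT' facet_of_imp_subset[OF T(2)] by blast
 ultimately show "T \<inter> T' \<inter> rel_interior F ~= {}" by blast
 qed
 have "T \<inter> T' ~= T"
 proof
 assume e: "T \<inter> T' = T"
 then have fT: "T face_of T'" using face_mesh(2)[OF T(1) T'm(1)] by simp
 obtain w where "w : interior T"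
 proof -
 define w where "w = (1 / real (Suc CARD('n))) *R (SUM b:vertices T. b)"
 have "S.bc b w = 1 / real (Suc CARD('n))" if "b : vertices T" for b
 proof (rule S.bary_unique[OF _ _ that])
 show "(SUM b:vertices T. 1 / real (Suc CARD('n))) = 1" by (simp add: S.card_C)
 qed (simp add: w_def scaleR_sum_right)
 then have "w : interior T" using S.interior_T[of w] unfolding hullT by simp
 then show thesis using that by blast
 qed
 then have "w : interior T'" "w : T" using e interior_mono[of T T'] interior_subset by blast+
 then have "T \<inter> rel_interior T' ~= {}" using interior_subset_rel_interior by blast
 then have "T' \<subseteq> T" using subset_of_face_of[OF fT order_refl] by blast
 then show False using e T'm by blast
 qed
 have "T \<inter> T' = F"
 proof -
 obtain c where c: "c \<subseteq> vertices T" "T \<inter> T' = convex hull c"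
 using face_mesh(1)[OF T(1) T'm(1)] face_of_convex_hull_affine_independent[OF S.indep] unfolding hullT by auto
 have "vertices T - {a} \<subseteq> c"
 proof
 fix b assume b: "b : vertices T - {a}"
 then have "b : convex hull c" using FT a(2) c(2) hull_inc[OF b, of convex] by blast
 moreover have "b extreme_point_of T" using b S.vertices_T hullT by (simp add: vertices_def)
 moreover have "convex hull c \<subseteq> T" using c(2) by blast
 ultimately have "b extreme_point_of (convex hull c)" by (auto simp: extreme_point_of_def subset_iff)
 then show "b : c" by (rule extreme_point_of_convex_hull)
 qed
 moreover have "c ~= vertices T" using \<open>T \<inter> T' ~= T\<close> c(2) hullT by auto
 ultimately have "c = vertices T - {a}" using c(1) by blast
 then show ?thesis using c(2) a(2) by simp
 qed
 then have "F face_of T'" using face_mesh(2)[OF T(1) T'm(1)] by simp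
 moreover have "F ~= {}" using y(1) by blast
 moreover have "aff_dim F = aff_dim T' - 1"
 proof -
 have "aff_dim F = aff_dim T - 1" using T(2) by (simp add: facet_of_def)
 moreover have "aff_dim T = aff_dim T'"
 using S.aff_dim_T S'.aff_dim_T unfolding hullT hull[OF T'm(1)] by simp
 ultimately show ?thesis by simp
 qed
 ultimately have "F facet_of T'" by (simp add: facet_of_def)
 then have "T' : adj F" using T'm by (simp add: adj_def)
 then show False using F T'm by blast
 qed
 show ?thesis
 proof
 fix x assume x: "x : F"
 \<comment> \<open>Shrinking towards the centroid leads into the relative interior of the facet; the
   frontier is closed, so the limit stays in it.\<close>
 define xs where "xs i = S.cen a + (1 - 1 / real (Suc i)) *R (x - S.cen a)" for i
 have xs: "xs i : frontier \<Omega>" for i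
 proof -
 let ?t = "1 - 1 / real (Suc i)"
 have t: "0 <= ?t" "?t < 1" by auto
 have bc: "S.bc b (xs i) = (1 - ?t) * S.bc b (S.cen a) + ?t * S.bc b x" if "b : vertices T" for b
 proof -
 have gx: "S.g b \<bullet> (x - S.cen a) = S.bc b x - S.bc b (S.cen a)"
 using S.bary_affine[OF that, of x "S.cen a"] by linarith
 have "S.bc b (S.cen a + t *R (x - S.cen a)) = (1 - t) * S.bc b (S.cen a) + t * S.bc b x" for t
 unfolding S.bary_add[OF that] inner_scaleR_right gx by (simp add: algebra_simps)
 then show ?thesis unfolding xs_def .
 qed
 have xT: "ALL b:vertices T. 0 <= S.bc b x" "S.bc a x = 0"
 using x a S.mem_fac[OF a(1), of x] S.mem_T[of x] by auto
 have pos: "0 < S.bc b (xs i)" if "b : vertices T - {a}" for b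
 proof -
 have "0 < (1 - ?t) * S.bc b (S.cen a)" using that t S.bc_cen[OF a(1), of b] by simp
 moreover have "0 <= ?t * S.bc b x" using that t xT by (intro mult_nonneg_nonneg) auto
 ultimately show ?thesis using bc[of b] that by simp
 qed
 have "S.bc a (xs i) = 0" using bc[OF a(1)] xT(2) S.bc_cen[OF a(1) a(1)] by simp
 moreover have "0 <= S.bc b (xs i)" if "b : vertices T" for b
 using pos[of b] calculation that by (cases "b = a") auto
 ultimately have "xs i : F" unfolding a(2) S.mem_fac[OF a(1)] S.mem_T by blast
 then show ?thesis using rel pos by blast
 qed
 have "xs \<longlonglongrightarrow> S.cen a + (1 - 0) *R (x - S.cen a)" unfolding xs_def
 by (intro tendsto_intros LIMSEQ_Suc[OF lim_1_over_n])
 then have "xs \<longlonglongrightarrow> x" by simp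
 from closed_sequentially[OF frontier_closed xs this] show "x : frontier \<Omega>" .
 qed
qed

end

section \<open>Smooth cutoff functions\<close>

definition flat_exp :: "real poly => real => real" where
 "flat_exp p x = (if x > 0 then poly p (1 / x) * exp (- (1 / x)) else 0)"

lemma flat_exp_tendsto_0: "(flat_exp p \<longlongrightarrow> 0) (at 0)"
proof -
 have "((%u. \<Sum>i\<le>degree p. coeff p i * (u ^ i / exp u)) \<longlongrightarrow> (\<Sum>i\<le>degree p. coeff p i * 0)) at_top"
 by (intro tendsto_sum tendsto_mult tendsto_const tendsto_power_div_exp_0)
 then have "((%u. poly p u * exp (- u)) \<longlongrightarrow> 0) (at_top :: real filter)"
 by (simp add: poly_altdef sum_distrib_right exp_minus divide_inverse mult.assoc)
 then have "((%x. poly p (inverse x) * exp (- inverse x)) \<longlongrightarrow> 0) (at_right (0::real))"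
 by (rule filterlim_compose[OF _ filterlim_inverse_at_top_right])
 moreover have "eventually (%x. poly p (inverse x) * exp (- inverse x) = flat_exp p x) (at_right (0::real))"
 unfolding flat_exp_def eventually_at_right_field by (intro exI[of _ 1]) (auto simp: inverse_eq_divide)
 ultimately have 1: "(flat_exp p \<longlongrightarrow> 0) (at_right 0)" by (rule Lim_transform_eventually)
 have "eventually (%x. 0 = flat_exp p x) (at_left (0::real))"
 unfolding flat_exp_def eventually_at_left_field by (intro exI[of _ "-1"]) auto
 then have 2: "(flat_exp p \<longlongrightarrow> 0) (at_left 0)" by (rule Lim_transform_eventually[OF tendsto_const])
 show ?thesis using 1 2 by (rule filterlim_split_at_real[rotated])
qed

text \<open>The functions \<open>p (1/x) * exp (- 1/x)\<close>, extended by zero, are closed under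
  differentiation: the chain rule replaces \<open>p\<close> by \<open>X^2 * (p - p')\<close>. This
  is the reason for carrying a polynomial along, although only \<open>p = 1\<close> serves as a
  cutoff.\<close>

lemma flat_exp_has_derivative:
 "(flat_exp p has_real_derivative flat_exp ([:0, 0, 1:] * (p - pderiv p)) x) (at x)"
proof -
 consider "x > 0" | "x < 0" | "x = 0" by linarith
 then show ?thesis
 proof cases
 case 1
 have "((%x. poly p (1 / x) * exp (- (1 / x))) has_real_derivative
 flat_exp ([:0, 0, 1:] * (p - pderiv p)) x) (at x)"
 using 1 unfolding flat_exp_def
 by (auto intro!: derivative_eq_intros DERIV_chain2[OF poly_DERIV] simp: power2_eq_square field_simps)
 then show ?thesis
 by (rule has_field_derivative_transform_within_open[of _ _ _ "{0<..}"]) (use 1 in \<open>auto simp: flat_exp_def\<close>)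
 next
 case 2
 have "((%_. 0) has_real_derivative flat_exp ([:0, 0, 1:] * (p - pderiv p)) x) (at x)"
 using 2 by (simp add: flat_exp_def)
 then show ?thesis
 by (rule has_field_derivative_transform_within_open[of _ _ _ "{..<0}"]) (use 2 in \<open>auto simp: flat_exp_def\<close>)
 next
 case 3
 \<comment> \<open>The difference quotient at 0 is itself of this form, with \<open>X * p\<close> in
   place of \<open>p\<close>, so its limit is known.\<close>
 have e: "(%y. (flat_exp p y - flat_exp p 0) / (y - 0)) = flat_exp ([:0, 1:] * p)"
 by (simp add: flat_exp_def fun_eq_iff)
 have "((%y. (flat_exp p y - flat_exp p 0) / (y - 0)) \<longlongrightarrow> 0) (at 0)"
 unfolding e by (rule flat_exp_tendsto_0)
 then show ?thesis unfolding has_field_derivative_iff 3 by (simp add: flat_exp_def)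
 qed
qed

lemma cont_diff_continuous: "cont_diff m f ==> continuous_on UNIV f"
proof (cases m)
 case (Suc l)
 then show "cont_diff m f ==> continuous_on UNIV f"
 by (auto intro!: continuous_at_imp_continuous_on differentiable_imp_continuous_within)
qed simp

lemma cont_diff_Suc: "cont_diff (Suc m) f ==> cont_diff m f"
proof (induction m arbitrary: f)
 case 0
 then show ?case using cont_diff_continuous[of "Suc 0" f] by simp
next
 case (Suc m)
 then show ?case by simp
qed

lemma cont_diff_add: "cont_diff m f ==> cont_diff m g ==> cont_diff m (%x. f x + g x)"
proof (induction m arbitrary: f g)
 case (Suc m)
 then have d: "f differentiable (at x)" "g differentiable (at x)" for x by auto
 have "cont_diff m (%x. pd j f x + pd j g x)" for j using Suc by auto
 then show ?case using d by (simp add: pd_add[OF d])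
qed (auto intro: continuous_intros)

lemma cont_diff_mult: "cont_diff m f ==> cont_diff m g ==> cont_diff m (%x. f x * g x)"
proof (induction m arbitrary: f g)
 case (Suc m)
 have d: "f differentiable (at x)" "g differentiable (at x)" for x using Suc.prems by auto
 have "cont_diff m f" "cont_diff m g" using Suc.prems cont_diff_Suc by blast+
 then have "cont_diff m (%x. f x * pd j g x + pd j f x * g x)" for j
 using Suc.IH Suc.prems by (intro cont_diff_add) auto
 then show ?case using d by (simp add: pd_mult[OF d])
qed (auto intro: continuous_intros)

lemma cont_diff_polys: "p : polys k UNIV ==> cont_diff m p"
proof (induction m arbitrary: p k)
 case 0
 then show ?case using polys_cont by auto
next
 case (Suc m)
 have "cont_diff m (%x. pd j p x)" for j by (rule Suc.IH[OF polys_pd[OF sU Suc.prems]])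
 then show ?case using polys_diffable[OF Suc.prems] by simp
qed

lemma cont_diff_flat_exp: "s : polys k UNIV ==> cont_diff m (%x. flat_exp p (s x))"
proof (induction m arbitrary: p)
 case 0
 have "continuous_on UNIV (flat_exp p)"
 by (intro continuous_at_imp_continuous_on ballI DERIV_isCont[OF flat_exp_has_derivative])
 then show ?case using continuous_on_compose2[OF _ polys_cont[OF 0, of UNIV]] by auto
next
 case (Suc m)
 let ?q = "[:0, 0, 1:] * (p - pderiv p)"
 have der: "((%x. flat_exp p (s x)) has_derivative (%\<xi>. flat_exp ?q (s x) * frechet_derivative s (at x) \<xi>)) (at x)" for x
 proof -
 have "(s has_derivative frechet_derivative s (at x)) (at x)"
 using polys_diffable[OF Suc.prems] frechet_derivative_works by blast
 moreover have "(flat_exp p has_derivative (%t. flat_exp ?q (s x) * t)) (at (s x))"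
 using flat_exp_has_derivative unfolding has_field_derivative_def .
 ultimately show ?thesis by (rule has_derivative_compose)
 qed
 have "cont_diff m (%x. flat_exp ?q (s x) * pd j s x)" for j
 by (rule cont_diff_mult[OF Suc.IH[OF Suc.prems] cont_diff_polys[OF polys_pd[OF sU Suc.prems]]])
 then show ?case using der by (auto simp: pd_eqI[OF der] differentiable_def)
qed

lemma flat_exp_1_bounds: "0 <= flat_exp 1 x" "flat_exp 1 x <= 1" "x > 0 ==> flat_exp 1 x > 0" "x <= 0 ==> flat_exp 1 x = 0"
 by (auto simp: flat_exp_def)

lemma grad_inner: "u \<bullet> grad f x = (SUM j:UNIV. u $ j * pd j f x)"
 by (simp add: grad_def inner_vec_def)

context full_simplex begin

lemma divergence_C1:
 assumes f: "cont_diff (Suc 0) f"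
 shows "integral T (%x. pd j f x) = (SUM c:C. (nu c $ j) * FI (fac c) f)"
proof -
 have d: "f differentiable (at x)" for x using f by simp
 have "integral T (%x. pd j f x) = (SUM c:C. (nu c \<bullet> axis j 1) * FI (fac c) f)"
 proof (rule divergence_direction[of f "%x. frechet_derivative f (at x)" "axis j 1"])
 show "(f has_derivative frechet_derivative f (at x)) (at x)" for x
 using d frechet_derivative_works by blast
 show "continuous_on UNIV (%x. frechet_derivative f (at x) \<eta>)" for \<eta>
 proof -
 have "frechet_derivative f (at x) \<eta> = (SUM i:UNIV. \<eta>$i * pd i f x)" for x
 proof -
 have lin: "linear (frechet_derivative f (at x))" using d by (rule linear_frechet_derivative)
 have "\<eta> = (SUM i:UNIV. \<eta>$i *R axis i 1)"
 using basis_expansion[of \<eta>] by (simp add: scalar_mult_eq_scaleR)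
 then have "frechet_derivative f (at x) \<eta> = frechet_derivative f (at x) (SUM i:UNIV. \<eta>$i *R axis i 1)"
 by (rule arg_cong)
 then show ?thesis by (simp add: linear_sum[OF lin] linear_scale[OF lin])
 qed
 moreover have "continuous_on UNIV (%x. SUM i:UNIV. \<eta>$i * pd i f x)"
 using f by (intro continuous_intros) simp
 ultimately show ?thesis by simp
 qed
 qed
 then show ?thesis by (simp add: inner_axis)
qed

lemma divergence_cutoff:
 fixes v :: "real^'n::_ => real^'n::_"
 assumes v: "v : polys k UNIV" and \<phi>: "!!m. cont_diff m \<phi>"
 shows "integral T (%x. v x \<bullet> grad \<phi> x) =
 (SUM c:C. FI (fac c) (%x. \<phi> x * (v x \<bullet> nu c))) - integral T (%x. \<phi> x * div_vec v x)"
proof -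
 define p where "p j x = v x $ j * \<phi> x" for j x
 have vj: "(%x. v x $ j) : polys k UNIV" for j by (rule polys_nth[OF v])
 have p: "cont_diff m (p j)" for m j
 unfolding p_def[abs_def] by (rule cont_diff_mult[OF cont_diff_polys[OF vj] \<phi>])
 have d: "(%x. v x $ j) differentiable (at x)" "\<phi> differentiable (at x)" "v differentiable (at x)" for x j
 using polys_diffable[OF vj] \<phi>[of 1] polys_diffable[OF v] by auto
 have pdp: "pd j (p j) x = v x $ j * pd j \<phi> x + pd j v x $ j * \<phi> x" for j x
 unfolding p_def[abs_def] pd_mult[OF d(1,2)] pd_nth[OF d(3)] ..
 have cp: "continuous_on S (%x. pd j (p j) x)" for S j
 using p[of "Suc 0" j] by (auto intro: continuous_on_subset)
 have cphi: "continuous_on S \<phi>" for S using cont_diff_continuous[OF \<phi>] by (rule continuous_on_subset) simp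
 have cg: "continuous_on S (%x. v x \<bullet> grad \<phi> x)" for S
 unfolding grad_inner using \<phi>[of "Suc 0"]
 by (intro continuous_intros polys_cont[OF vj]) (auto intro: continuous_on_subset)
 have cd: "continuous_on S (%x. \<phi> x * div_vec v x)" for S
 by (intro continuous_intros cphi polys_cont[OF polys_div_vec[OF v]])
 have cpn: "continuous_on UNIV (%x. nu c $ j * p j x)" for c j
 unfolding p_def by (intro continuous_intros polys_cont[OF vj] cphi)
 have "integral T (%x. SUM j:UNIV. pd j (p j) x) = (SUM j:UNIV. SUM c:C. (nu c $ j) * FI (fac c) (p j))"
 by (simp add: integral_sum integrable_compact compact_T cp divergence_C1[OF p])
 also have "\<dots> = (SUM c:C. SUM j:UNIV. (nu c $ j) * FI (fac c) (p j))" by (rule sum.swap)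
 also have "\<dots> = (SUM c:C. FI (fac c) (%x. \<phi> x * (v x \<bullet> nu c)))"
 proof (rule sum.cong[OF refl])
 fix c assume c: "c : C"
 have "(SUM j:UNIV. (nu c $ j) * FI (fac c) (p j)) = FI (fac c) (%x. SUM j:UNIV. nu c $ j * p j x)"
 using cpn by (simp add: FI_sum[OF c] FI_cmult[OF c])
 also have "(%x. SUM j:UNIV. nu c $ j * p j x) = (%x. \<phi> x * (v x \<bullet> nu c))"
 by (simp add: p_def inner_vec_def sum_distrib_left mult_ac fun_eq_iff)
 finally show "(SUM j:UNIV. (nu c $ j) * FI (fac c) (p j)) = FI (fac c) (%x. \<phi> x * (v x \<bullet> nu c))" .
 qed
 also have "(%x. SUM j:UNIV. pd j (p j) x) = (%x. v x \<bullet> grad \<phi> x + \<phi> x * div_vec v x)"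
 by (simp add: pdp sum.distrib grad_inner div_vec_pd sum_distrib_left mult_ac fun_eq_iff)
 finally show ?thesis
 by (simp add: integral_add integrable_compact compact_T cg cd)
qed

lemma facet_interior_dense:
 assumes a: "a : C" and x: "x : fac a" and U: "open U" "x : U"
 shows "EX y:U. y : fac a & (ALL b:C - {a}. 0 < bc b y)"
proof -
 define xs where "xs i = cen a + (1 - 1 / real (Suc i)) *R (x - cen a)" for i
 have "xs \<longlonglongrightarrow> cen a + (1 - 0) *R (x - cen a)" unfolding xs_def
 by (intro tendsto_intros LIMSEQ_Suc[OF lim_1_over_n])
 then have "eventually (%i. xs i : U) sequentially" using topological_tendstoD[of xs x sequentially U] U by simp
 then obtain i where i: "xs i : U" by (auto simp: eventually_sequentially)
 let ?t = "1 - 1 / real (Suc i)"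
 have t: "0 <= ?t" "?t < 1" by auto
 have bc: "bc b (xs i) = (1 - ?t) * bc b (cen a) + ?t * bc b x" if "b : C" for b
 proof -
 have gx: "g b \<bullet> (x - cen a) = bc b x - bc b (cen a)" using bary_affine[OF that, of x "cen a"] by linarith
 have "bc b (cen a + t *R (x - cen a)) = (1 - t) * bc b (cen a) + t * bc b x" for t
 unfolding bary_add[OF that] inner_scaleR_right gx by (simp add: algebra_simps)
 then show ?thesis unfolding xs_def .
 qed
 have xT: "ALL b:C. 0 <= bc b x" "bc a x = 0" using x mem_fac[OF a, of x] mem_T[of x] by auto
 have pos: "0 < bc b (xs i)" if "b : C - {a}" for b
 proof -
 have "0 < (1 - ?t) * bc b (cen a)" using that t bc_cen[OF a, of b] by simp
 moreover have "0 <= ?t * bc b x" using that t xT by (intro mult_nonneg_nonneg) auto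
 ultimately show ?thesis using bc[of b] that by simp
 qed
 have "bc a (xs i) = 0" using bc[OF a] xT(2) bc_cen[OF a a] by simp
 moreover have "0 <= bc b (xs i)" if "b : C" for b
 using pos[of b] calculation that by (cases "b = a") auto
 ultimately have "xs i : fac a" unfolding mem_fac[OF a] mem_T by blast
 then show ?thesis using i pos by blast
qed

text \<open>Positivity at one relative interior point persists on a ball inside the prism, where the
  extended integrand exceeds \<open>f y / 2\<close>.\<close>

lemma facet_integral_pos:
 assumes a: "a : C" and f: "continuous_on UNIV f" "!!x. x : fac a ==> 0 <= f x"
 and y: "y : fac a" "ALL b:C - {a}. 0 < bc b y" "0 < f y"
 shows "0 < FI (fac a) f"
proof -
 have cf: "continuous_on S (%x. f (pr a x))" for S
 by (rule continuous_on_compose2[OF f(1) continuous_pr[OF a]]) simp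
 have bcy: "bc a y = 0" using y(1) mem_fac[OF a] by blast
 have pry: "pr a y = y" using bcy by (rule pr_fixed)
 define W where "W = pr a -` {x. ALL b:C - {a}. 0 < bc b x} \<inter> {x. \<bar>bc a x\<bar> < norm (g a) / 2} \<inter> {x. f y / 2 < f (pr a x)}"
 have "open W" unfolding W_def
 proof (intro open_Int)
 show "open (pr a -` {x. ALL b:C - {a}. 0 < bc b x})"
 by (rule open_vimage[OF open_positive continuous_pr[OF a]]) auto
 show "open {x. \<bar>bc a x\<bar> < norm (g a) / 2}"
 by (intro open_Collect_less continuous_intros continuous_bc a)
 show "open {x. f y / 2 < f (pr a x)}" by (rule open_Collect_less[OF continuous_on_const cf])
 qed
 moreover have "y : W" using y g_nonzero[OF a] by (simp add: W_def pry bcy)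
 ultimately obtain r where r: "r > 0" "cball y r \<subseteq> W" unfolding open_contains_cball by blast
 have sub: "W \<subseteq> slab a (nu a) 0"
 proof
 fix x assume x: "x : W"
 have "0 <= bc b (pr a x)" if "b : C" for b
 using x bc_pr[OF a, of x] that by (cases "b = a") (auto simp: W_def less_imp_le)
 then have "pr a x : fac a" unfolding mem_fac[OF a] mem_T using bc_pr[OF a, of x] by blast
 then show "x : slab a (nu a) 0" using mem_slab_scaled[OF a zero_less_one, of x] x by (simp add: W_def)
 qed
 have "0 < f y / 2 * measure lebesgue (cball y r)" using y(3) r(1) by (simp add: content_cball_pos)
 also have "\<dots> <= integral (cball y r) (%x. f (pr a x))"
 using r(2) by (intro integral_ge_const_compact compact_cball cf) (auto simp: W_def)
 also have "\<dots> <= integral (slab a (nu a) 0) (%x. f (pr a x))"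
 using r(2) sub f(2) pr_in_fac[OF a]
 by (intro integral_subset_le integrable_compact compact_slab_nu[OF a] compact_cball cf) auto
 finally show ?thesis by (simp add: FI_slab[OF a])
qed

end

lemma l2_fun_absolutely_integrable:
 fixes \<Omega> :: "(real^'n) set" and f :: "real^'n => real"
 assumes f: "l2_fun \<Omega> f" and \<Omega>: "bounded \<Omega>" "open \<Omega>"
 shows "f absolutely_integrable_on \<Omega>"
proof -
 have lm: "\<Omega> : lmeasurable" using \<Omega> by (rule lmeasurable_open)
 have one: "integrable (lebesgue_on \<Omega>) (%_. 1 :: real)"
 using lm by (subst integrable_restrict_space) (auto simp: lmeasurable_iff_integrable fmeasurableD)
 have "integrable (lebesgue_on \<Omega>) (%x. 1 + (norm (f x))^2)"
 using f one by (intro Bochner_Integration.integrable_add) (auto simp: l2_fun_def)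
 then have "integrable (lebesgue_on \<Omega>) f"
 proof (rule Bochner_Integration.integrable_bound)
 show "f : borel_measurable (lebesgue_on \<Omega>)" using f by (simp add: l2_fun_def)
 have le: "\<bar>t\<bar> <= 1 + t^2" for t :: real
 proof -
 have "2 * \<bar>t\<bar> <= 1 + t^2" using zero_le_power2[of "\<bar>t\<bar> - 1"] by (simp add: power2_diff)
 then show ?thesis by linarith
 qed
 have "norm (f x) <= norm (1 + (norm (f x))^2)" for x
 unfolding real_norm_def power2_abs using le[of "f x"] by linarith
 then show "AE x in lebesgue_on \<Omega>. norm (f x) <= norm (1 + (norm (f x))^2)" by (intro AE_I2)
 qed
 then show ?thesis unfolding set_integrable_def
 using lm by (subst (asm) integrable_restrict_space) (auto simp: fmeasurableD)
qed

text \<open>Dominated convergence with \<open>\<bar>w x\<bar>\<close>. The cutoff functions tend to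
  zero only off the hyperplane of a facet, hence the exceptional set \<open>N\<close>.\<close>

lemma integral_vanishing_sequence:
 fixes w :: "real^'n => real" and \<phi> :: "nat => real^'n => real"
 assumes S: "S : sets lebesgue" and w: "w absolutely_integrable_on S"
 and c: "!!m. continuous_on UNIV (\<phi> m)" and b: "!!m x. \<bar>\<phi> m x\<bar> <= 1"
 and N: "negligible N" and lim: "!!x. x \<notin> N ==> (%m. \<phi> m x) \<longlonglongrightarrow> 0"
 shows "(%m. integral S (%x. \<phi> m x * w x)) \<longlonglongrightarrow> 0"
proof -
 define \<psi> where "\<psi> m x = (if x : N then 0 else \<phi> m x * w x)" for m x
 have int: "(%x. \<phi> m x * w x) absolutely_integrable_on S" for m
 proof (rule absolutely_integrable_bounded_measurable_product[OF bilinear_times _ S _ w])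
 show "\<phi> m : borel_measurable (lebesgue_on S)"
 using continuous_on_subset[OF c subset_UNIV] S by (rule continuous_imp_measurable_on_sets_lebesgue)
 show "bounded (\<phi> m ` S)" using b by (intro boundedI[of _ 1]) auto
 qed
 have e: "integral S (\<psi> m) = integral S (%x. \<phi> m x * w x)" for m
 by (rule integral_spike[OF N]) (simp add: \<psi>_def)
 have "(%m. integral S (\<psi> m)) \<longlonglongrightarrow> integral S (%_. 0)"
 proof (rule dominated_convergence(2)[of _ _ "%x. \<bar>w x\<bar>"])
 show "\<psi> m integrable_on S" for m
 by (rule integrable_spike[OF set_lebesgue_integral_eq_integral(1)[OF int[of m]] N]) (simp add: \<psi>_def)
 show "(%x. \<bar>w x\<bar>) integrable_on S" using w by (simp add: absolutely_integrable_on_def)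
 show "norm (\<psi> m x) <= \<bar>w x\<bar>" for m x
 using mult_right_mono[OF b[of m x], of "\<bar>w x\<bar>"] by (simp add: \<psi>_def abs_mult)
 show "(%m. \<psi> m x) \<longlonglongrightarrow> 0" for x
 using tendsto_mult[OF lim[of x] tendsto_const[of "w x"]] by (cases "x : N") (simp_all add: \<psi>_def)
 qed
 then show ?thesis unfolding e by simp
qed

section \<open>From weak divergences to matching normal components\<close>

context mesh begin

lemma interiors_disjoint:
 assumes T: "T : \<T>" "T' : \<T>" "T ~= T'"
 shows "interior T \<inter> interior T' = {}"
proof (rule ccontr)
 assume "interior T \<inter> interior T' ~= {}"
 then obtain x where "x : interior T" "x : interior T'" by blast
 then have x: "x : rel_interior T" "x : rel_interior T'" "x : T \<inter> T'"
 using interior_subset_rel_interior interior_subset by blast+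
 have "T \<subseteq> T \<inter> T'" using x by (intro subset_of_face_of[OF face_mesh(1)[OF T(1,2)] order_refl]) blast
 moreover have "T' \<subseteq> T \<inter> T'" using x by (intro subset_of_face_of[OF face_mesh(2)[OF T(1,2)] order_refl]) blast
 ultimately show False using T(3) by blast
qed

lemma glue_interior:
 assumes "T : \<T>" "x : interior T"
 shows "glue \<T> u x = u T x"
proof -
 have "indicat_real (interior T') x *R u T' x = (if T' = T then u T x else 0)" if "T' : \<T>" for T'
 using interiors_disjoint[OF assms(1) that] assms(2) by (auto simp: indicator_def)
 then show ?thesis unfolding glue_def using finite_mesh assms(1) by simp
qed

lemma V_h_polys: "v : V_h k \<Omega> \<T> ==> T : \<T> ==> v T : raviart_thomas k"
 by (simp add: V_h_def broken_space_def)

text \<open>Test functions concentrated near the facet (\<open>\<delta> \<rightarrow> 0\<close>): the volume terms vanish in the limit, and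
  the facet term does not change.\<close>

lemma normal_continuity:
 assumes k: "k >= 1" and v: "v : V_h k \<Omega> \<T>" and T: "T : \<T>" "T' : \<T>" "T ~= T'"
 and F: "F facet_of T" "F facet_of T'" and x: "x : F"
 shows "(v T x - v T' x) \<bullet> outer_normal T F = 0"
proof (rule ccontr)
 assume ne: "(v T x - v T' x) \<bullet> outer_normal T F ~= 0"
 obtain a where a: "a : vertices T" "F = convex hull (vertices T - {a})" using F(1) facet_cases[OF T(1)] by blast
 obtain a' where a': "a' : vertices T'" "F = convex hull (vertices T' - {a'})" using F(2) facet_cases[OF T(2)] by blast
 interpret S: full_simplex "vertices T" by (rule full[OF T(1)])
 interpret S': full_simplex "vertices T'" by (rule full[OF T(2)])
 note hl = hull[OF T(1)] hull[OF T(2)]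
 define n where "n = S.nu a"
 have on: "outer_normal T F = n" using S.outer_normal_fac[OF a(1)] unfolding hl a(2) n_def .
 have FF: "convex hull (vertices T - {a}) = convex hull (vertices T' - {a'})" using a(2) a'(2) by simp
 have vert: "vertices T - {a} = vertices T' - {a'}" by (rule shared(1)[OF T a(1) a'(1) FF])
 have n': "S'.nu a' = - n" unfolding n_def by (rule shared(2)[OF T a(1) a'(1) FF])
 obtain s where s: "s > 0" "!!x. S'.bc a' x = - s * S.bc a x"
 using shared(3)[OF T a(1) a'(1) FF] unfolding hl by blast
 have p: "v T : polys (Suc k) UNIV" "v T' : polys (Suc k) UNIV"
 using raviart_thomas_split(1)[OF V_h_polys[OF v] k] T by blast+
 define j where "j x = (v T x - v T' x) \<bullet> n" for x
 have cj: "continuous_on S j" for S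
 unfolding j_def by (intro continuous_intros polys_cont[OF p(1)] polys_cont[OF p(2)])
 have op: "open {x. j x ~= 0}" by (intro open_Collect_neq cj continuous_on_const)
 have jx: "x : {x. j x ~= 0}" using ne by (simp add: j_def on)
 have xf: "x : S.fac a" using x a(2) by simp
 \<comment> \<open>The jump is continuous, so the point of contradiction may be moved into the
   relative interior of the facet, away from all other facets.\<close>
 obtain y where y: "j y ~= 0" "y : F" "ALL b:vertices T - {a}. 0 < S.bc b y"
 using S.facet_interior_dense[OF a(1) xf op jx] a(2) by auto
 define \<sigma> where "\<sigma> = sgn (j y)"
 have \<sigma>: "\<sigma> * j y > 0" using y(1) by (simp add: \<sigma>_def sgn_if)
 have bcay: "S.bc a y = 0" using y(2) S.mem_fac[OF a(1)] unfolding a(2) by blast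
 have bc': "0 < S'.bc b y" if b: "b : vertices T' - {a'}" for b
 proof -
 have bT: "b : vertices T" "b ~= a" "b : vertices T'" using b vert by auto
 have z: "S.bc c y * S'.bc b c = 0" if "c : vertices T - {b}" for c
 proof (cases "c = a")
 case False
 then have "c : vertices T'" "c ~= b" using that vert by auto
 then show ?thesis using S'.bary_vertex[OF bT(3)] by simp
 qed (simp add: bcay)
 have "S'.bc b y = (SUM c:vertices T. S.bc c y * S'.bc b c)"
 by (rule S.bc_combination[OF a(1) full[OF T(2)] bT(3)])
 also have "\<dots> = S.bc b y * S'.bc b b + (SUM c:vertices T - {b}. S.bc c y * S'.bc b c)"
 by (rule sum.remove[OF S.finite_C bT(1)])
 also have "(SUM c:vertices T - {b}. S.bc c y * S'.bc b c) = 0" using z by (rule sum.neutral[OF ballI])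
 also have "S.bc b y * S'.bc b b + 0 = S.bc b y" using S'.bary_vertex[OF bT(3) bT(3)] by simp
 finally show ?thesis using y(3) bT by simp
 qed
 \<comment> \<open>In \<open>U\<close> no facet of the two elements but \<open>F\<close> is met and
   the jump keeps its sign; the sign of \<open>S.bc a\<close> decides in which of the two elements a
   point lies.\<close>
 define U where "U = {x. ALL b:vertices T - {a}. 0 < S.bc b x} \<inter> {x. ALL b:vertices T' - {a'}. 0 < S'.bc b x} \<inter> {x. 0 < \<sigma> * j x}"
 have "open U" unfolding U_def
 by (intro open_Int S.open_positive S'.open_positive open_Collect_less continuous_intros cj) auto
 moreover have "y : U" using y(3) bc' \<sigma> by (simp add: U_def)
 ultimately obtain \<epsilon> where \<epsilon>: "\<epsilon> > 0" "ball y \<epsilon> \<subseteq> U" unfolding open_contains_ball by blast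
 have intT: "x : interior T" if "x : U" "S.bc a x > 0" for x
 proof -
 have "0 < S.bc b x" if "b : vertices T" for b using that \<open>x : U\<close> \<open>S.bc a x > 0\<close> by (cases "b = a") (auto simp: U_def)
 then show ?thesis using S.interior_T[of x] unfolding hl by blast
 qed
 have intT': "x : interior T'" if "x : U" "S.bc a x < 0" for x
 proof -
 have "0 < S'.bc a' x" unfolding s(2) using that(2) s(1) by (simp add: mult_less_0_iff)
 then have "0 < S'.bc b x" if "b : vertices T'" for b using that \<open>x : U\<close> by (cases "b = a'") (auto simp: U_def)
 then show ?thesis using S'.interior_T[of x] unfolding hl by blast
 qed
 have UT: "x : T" if "x : U" "S.bc a x >= 0" for x
 proof -
 have "0 <= S.bc b x" if "b : vertices T" for b using that \<open>x : U\<close> \<open>S.bc a x >= 0\<close> by (cases "b = a") (auto simp: U_def less_imp_le)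
 then show ?thesis using S.mem_T[of x] unfolding hl by blast
 qed
 have UT': "x : T'" if "x : U" "S.bc a x <= 0" for x
 proof -
 have "0 <= S'.bc a' x" unfolding s(2) using that(2) s(1) by (simp add: mult_nonneg_nonpos)
 then have "0 <= S'.bc b x" if "b : vertices T'" for b using that \<open>x : U\<close> by (cases "b = a'") (auto simp: U_def less_imp_le)
 then show ?thesis using S'.mem_T[of x] unfolding hl by blast
 qed
 define K where "K = cball y (\<epsilon> / 2)"
 have KU: "K \<subseteq> U" using \<epsilon> by (auto simp: K_def)
 have "ball y \<epsilon> \<subseteq> \<Union>\<T>"
 proof
 fix x assume "x : ball y \<epsilon>"
 then have "x : U" using \<epsilon> by blast
 then show "x : \<Union>\<T>" using UT[of x] UT'[of x] T by (cases "S.bc a x >= 0") auto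
 qed
 then have "ball y \<epsilon> \<subseteq> interior (closure \<Omega>)" unfolding Union_mesh by (intro interior_maximal) auto
 then have "ball y \<epsilon> \<subseteq> \<Omega>" using interior_closure_lipschitz[OF dom] by simp
 then have K\<Omega>: "K \<subseteq> \<Omega>" using \<epsilon>(1) by (auto simp: K_def)
 have cK: "compact K" by (simp add: K_def)
 \<comment> \<open>A bump supported in \<open>K\<close> times a bump in the normal direction that
   vanishes at distance \<open>1 / (m + 1)\<close> from the hyperplane of \<open>F\<close>. On that
   hyperplane the second factor is constant, so the facet term is the same for every
   \<open>m\<close>.\<close>
 define \<phi> where "\<phi> m x = flat_exp 1 (\<epsilon>^2 / 4 - (x - y) \<bullet> (x - y)) * flat_exp 1 (1 - (real (Suc m))^2 * (n \<bullet> (x - y))^2)" for m x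
 have smooth: "cont_diff l (\<phi> m)" for l m
 proof -
 have q1: "(%x. x - y) : polys 1 UNIV" by (intro polys_diff polys_id polys_const sU UNIV_I)
 have q2: "(%x. n \<bullet> (x - y)) : polys 1 UNIV"
 by (rule polys_lin_image[OF _ q1]) (auto simp: linear_iff inner_add_right)
 have "(%x. \<epsilon>^2 / 4 - (x - y) \<bullet> (x - y)) : polys (1 + 1) UNIV"
 by (intro polys_diff polys_const polys_inner sU UNIV_I q1)
 moreover have "(%x. 1 - (real (Suc m))^2 * (n \<bullet> (x - y))^2) : polys (1 + 1) UNIV"
 using polys_diff[OF sU polys_const[OF sU UNIV_I] polys_scaleR[OF sU polys_mult[OF sU q2 q2]], of 1 "(real (Suc m))^2"]
 by (simp add: power2_eq_square)
 ultimately show ?thesis unfolding \<phi>_def[abs_def] by (intro cont_diff_mult cont_diff_flat_exp)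
 qed
 have c\<phi>: "continuous_on S (\<phi> m)" for S m using cont_diff_continuous[OF smooth] by (rule continuous_on_subset) simp
 have \<phi>0: "\<phi> m x = 0" if "x \<notin> K" for m x
 proof -
 have "\<epsilon> / 2 < norm (x - y)" using that by (simp add: K_def dist_norm norm_minus_commute)
 then have "(\<epsilon> / 2)^2 <= (norm (x - y))^2" using \<epsilon>(1) by (intro power_mono) auto
 then have "\<epsilon>^2 / 4 - (x - y) \<bullet> (x - y) <= 0" by (simp add: power2_norm_eq_inner power_divide)
 then show ?thesis by (simp add: \<phi>_def flat_exp_1_bounds(4))
 qed
 have grad0: "grad (\<phi> m) x = 0" if "x \<notin> K" for m x
 proof -
 have z: "((%_. 0 :: real) has_derivative (%_. 0)) (at x)" by simp
 have oK: "open (- K)" using cK by (simp add: compact_imp_closed open_Compl)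
 have "(\<phi> m has_derivative (%_. 0)) (at x)"
 by (rule has_derivative_transform_within_open[OF z oK]) (use that \<phi>0 in auto)
 then have "frechet_derivative (\<phi> m) (at x) = (%_. 0)" by (rule frechet_derivative_at[symmetric])
 then show ?thesis by (simp add: grad_def vec_eq_iff)
 qed
 have test: "test_fun \<Omega> (\<phi> m)" for m
 unfolding test_fun_def using smooth cK K\<Omega> \<phi>0 by blast
 obtain w where w: "l2_fun \<Omega> w" "!!\<phi>. test_fun \<Omega> \<phi> ==>
 integral \<Omega> (%x. glue \<T> v x \<bullet> grad \<phi> x) = - integral \<Omega> (%x. w x * \<phi> x)"
 using v unfolding V_h_def H_div_def by blast
 have neg: "negligible {x. S.bc a x = 0}"
 proof -
 have "{x. S.bc a x = 0} = {x. S.g a \<bullet> x = - S.bc a 0}" using S.inner_g[OF a(1)] by auto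
 then show ?thesis using negligible_hyperplane[of "S.g a" "- S.bc a 0"] S.g_nonzero[OF a(1)] by simp
 qed
 have cgrad: "continuous_on D (%x. u x \<bullet> grad (\<phi> m) x)" if u: "u : polys (Suc k) UNIV" for D m and u :: "real^'n::_ => real^'n::_"
 unfolding grad_inner using smooth[of "Suc 0" m]
 by (intro continuous_intros polys_cont[OF polys_nth[OF u]]) (auto intro: continuous_on_subset)
 have vol: "integral \<Omega> (%x. glue \<T> v x \<bullet> grad (\<phi> m) x)
 = integral T (%x. v T x \<bullet> grad (\<phi> m) x) + integral T' (%x. v T' x \<bullet> grad (\<phi> m) x)" for m
 proof -
 let ?f = "%x. glue \<T> v x \<bullet> grad (\<phi> m) x"
 have "x : T \<union> T'" if "x : K" for x
 using subsetD[OF KU that] UT[of x] UT'[of x] by (cases "S.bc a x >= 0") auto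
 then have K12: "K = (K \<inter> T) \<union> (K \<inter> T')" by blast
 have c1: "compact (K \<inter> T)" and c2: "compact (K \<inter> T')"
 using cK S.compact_T S'.compact_T unfolding hl by (auto intro: compact_Int)
 have i1: "(?f has_integral integral (K \<inter> T) (%x. v T x \<bullet> grad (\<phi> m) x)) (K \<inter> T)"
 proof (rule has_integral_spike[OF neg])
 show "((%x. v T x \<bullet> grad (\<phi> m) x) has_integral integral (K \<inter> T) (%x. v T x \<bullet> grad (\<phi> m) x)) (K \<inter> T)"
 by (intro integrable_integral integrable_compact c1 cgrad p)
 fix x assume x: "x : K \<inter> T - {x. S.bc a x = 0}"
 then have gt: "S.bc a x > 0" using S.mem_T[of x] a(1) unfolding hl by force
 have "x : U" using x KU by blast
 then have "glue \<T> v x = v T x" by (rule glue_interior[OF T(1) intT[OF _ gt]])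
 then show "?f x = v T x \<bullet> grad (\<phi> m) x" by (simp only:)
 qed
 have i2: "(?f has_integral integral (K \<inter> T') (%x. v T' x \<bullet> grad (\<phi> m) x)) (K \<inter> T')"
 proof (rule has_integral_spike[OF neg])
 show "((%x. v T' x \<bullet> grad (\<phi> m) x) has_integral integral (K \<inter> T') (%x. v T' x \<bullet> grad (\<phi> m) x)) (K \<inter> T')"
 by (intro integrable_integral integrable_compact c2 cgrad p)
 fix x assume x: "x : K \<inter> T' - {x. S.bc a x = 0}"
 then have "0 <= S'.bc a' x" using S'.mem_T[of x] a'(1) unfolding hl by blast
 then have lt: "S.bc a x < 0" using x s by (simp add: zero_le_mult_iff mult_le_0_iff)
 have "x : U" using x KU by blast
 then have "glue \<T> v x = v T' x" by (rule glue_interior[OF T(2) intT'[OF _ lt]])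
 then show "?f x = v T' x \<bullet> grad (\<phi> m) x" by (simp only:)
 qed
 have "negligible ((K \<inter> T) \<inter> (K \<inter> T'))"
 proof (rule negligible_subset[OF neg], rule subsetI)
 fix x assume x: "x : (K \<inter> T) \<inter> (K \<inter> T')"
 then have "0 <= S.bc a x" "0 <= S'.bc a' x" using S.mem_T[of x] S'.mem_T[of x] a(1) a'(1) unfolding hl by blast+
 then show "x : {x. S.bc a x = 0}" using s by (simp add: zero_le_mult_iff mult_le_0_iff)
 qed
 from has_integral_Un[OF i1 i2 this] have "(?f has_integral integral (K \<inter> T) (%x. v T x \<bullet> grad (\<phi> m) x)
 + integral (K \<inter> T') (%x. v T' x \<bullet> grad (\<phi> m) x)) K" using K12 by simp
 then have s1: "integral K ?f = integral (K \<inter> T) (%x. v T x \<bullet> grad (\<phi> m) x)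
 + integral (K \<inter> T') (%x. v T' x \<bullet> grad (\<phi> m) x)" by (rule integral_unique)
 have restr: "integral D (%x. u x \<bullet> grad (\<phi> m) x) = integral (K \<inter> D) (%x. u x \<bullet> grad (\<phi> m) x)" for D and u :: "real^'n::_ => real^'n::_"
 proof -
 have "(%x. u x \<bullet> grad (\<phi> m) x) = (%x. if x : K then u x \<bullet> grad (\<phi> m) x else 0)"
 using grad0 by (auto simp: fun_eq_iff)
 then have "integral D (%x. u x \<bullet> grad (\<phi> m) x) = integral D (%x. if x : K then u x \<bullet> grad (\<phi> m) x else 0)"
 by (rule arg_cong)
 then show ?thesis by (simp only: integral_restrict_Int)
 qed
 have KO: "K \<inter> \<Omega> = K" using K\<Omega> by blast
 show ?thesis using s1 restr[of \<Omega> "glue \<T> v"] restr[of T "v T"] restr[of T' "v T'"] unfolding KO by linarith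
 qed
 have div: "integral D (%x. u x \<bullet> grad (\<phi> m) x) =
 FI F (%x. \<phi> m x * (u x \<bullet> full_simplex.nu (vertices D) d)) - integral D (%x. \<phi> m x * div_vec u x)"
 if D: "D : \<T>" "d : vertices D" "F = convex hull (vertices D - {d})" "u : polys (Suc k) UNIV"
 and U: "!!b x. b : vertices D - {d} ==> x : U ==> 0 < bary D b x" for D d u m
 proof -
 interpret D: full_simplex "vertices D" by (rule full[OF D(1)])
 have "FI (convex hull (vertices D - {c})) (%x. \<phi> m x * (u x \<bullet> D.nu c)) = 0" if c: "c : vertices D - {d}" for c
 proof -
 have cD: "c : vertices D" using c by simp
 have "\<phi> m x * (u x \<bullet> D.nu c) = 0" if "x : convex hull (vertices D - {c})" for x
 using that D.mem_fac[OF cD] U[OF c, of x] KU \<phi>0[of x m] unfolding hull[OF D(1)] by force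
 from D.FI_cong[OF cD this] show ?thesis by (simp add: D.FI_zero[OF cD])
 qed
 then have "(SUM c:vertices D. FI (convex hull (vertices D - {c})) (%x. \<phi> m x * (u x \<bullet> D.nu c)))
 = FI F (%x. \<phi> m x * (u x \<bullet> D.nu d))"
 using sum.remove[OF D.finite_C D(2), of "%c. FI (convex hull (vertices D - {c})) (%x. \<phi> m x * (u x \<bullet> D.nu c))"] D(3) by simp
 then show ?thesis using D.divergence_cutoff[OF D(4) smooth, of m] unfolding hull[OF D(1)] by simp
 qed
 have U1: "0 < bary T b x" if "b : vertices T - {a}" "x : U" for b x using that by (auto simp: U_def hl)
 have U2: "0 < bary T' b x" if "b : vertices T' - {a'}" "x : U" for b x using that by (auto simp: U_def hl)
 \<comment> \<open>\<open>L\<close> does not depend on \<open>m\<close>, whereas the volume terms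
   that add up to it tend to zero because \<open>\<phi> m\<close> does so off the
   hyperplane.\<close>
 define L where "L = FI F (%x. \<phi> 0 x * j x)"
 have key: "L = integral T (%x. \<phi> m x * div_vec (v T) x) + integral T' (%x. \<phi> m x * div_vec (v T') x)
 - integral \<Omega> (%x. \<phi> m x * w x)" for m
 proof -
 have "FI F (%x. \<phi> m x * (v T x \<bullet> n)) + FI F (%x. \<phi> m x * (v T' x \<bullet> (- n)))
 = FI F (%x. \<phi> m x * (v T x \<bullet> n) + \<phi> m x * (v T' x \<bullet> (- n)))"
 unfolding a(2) by (rule S.FI_add[OF a(1), symmetric])
 (intro continuous_intros c\<phi> polys_cont[OF p(1)] polys_cont[OF p(2)])+
 also have "\<dots> = L" unfolding L_def a(2)
 proof (rule S.FI_cong[OF a(1)])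
 fix x assume "x : convex hull (vertices T - {a})"
 then have "S.bc a x = 0" using S.mem_fac[OF a(1)] by blast
 then have "S.g a \<bullet> (x - y) = 0" using S.bary_affine[OF a(1), of x y] bcay by simp
 then have "n \<bullet> (x - y) = 0" by (simp add: n_def S.nu_def)
 then have "\<phi> m x = \<phi> 0 x" by (simp add: \<phi>_def)
 then show "\<phi> m x * (v T x \<bullet> n) + \<phi> m x * (v T' x \<bullet> (- n)) = \<phi> 0 x * j x"
 by (simp add: j_def inner_diff_left algebra_simps)
 qed
 finally show ?thesis
 using w(2)[OF test[of m]] vol[of m] div[OF T(1) a p(1) U1, of m] div[OF T(2) a' p(2) U2, of m]
 unfolding hl n' n_def[symmetric] by (simp add: mult.commute)
 qed
 have b\<phi>: "\<bar>\<phi> m x\<bar> <= 1" for m x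
 unfolding \<phi>_def abs_mult by (intro mult_le_one) (simp_all add: flat_exp_1_bounds abs_of_nonneg)
 have negP: "negligible {x. n \<bullet> (x - y) = 0}"
 proof -
 have "{x. n \<bullet> (x - y) = 0} = {x. n \<bullet> x = n \<bullet> y}" by (auto simp: inner_diff_right)
 moreover have "n ~= 0" using S.norm_nu[OF a(1)] by (auto simp: n_def)
 ultimately show ?thesis using negligible_hyperplane[of n "n \<bullet> y"] by simp
 qed
 have lim\<phi>: "(%m. \<phi> m x) \<longlonglongrightarrow> 0" if "x \<notin> {x. n \<bullet> (x - y) = 0}" for x
 proof -
 let ?t = "(n \<bullet> (x - y))^2"
 have t: "?t > 0" using that by simp
 obtain N :: nat where N: "1 / ?t < real N" using reals_Archimedean2 by blast
 have "\<phi> m x = 0" if "m >= N" for m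
 proof -
 have "1 <= real N * ?t" using N t by (simp add: field_simps)
 also have "\<dots> <= (real (Suc m))^2 * ?t"
 proof (rule mult_right_mono)
 have "real N <= real (Suc m)" using that by simp
 also have "\<dots> <= (real (Suc m))^2" by (simp add: power2_eq_square)
 finally show "real N <= (real (Suc m))^2" .
 qed (use t in simp)
 finally show ?thesis by (simp add: \<phi>_def flat_exp_1_bounds(4))
 qed
 then have "eventually (%m. \<phi> m x = 0) sequentially" by (auto simp: eventually_sequentially)
 then show ?thesis by (rule tendsto_eventually)
 qed
 have lim0: "(%m. integral S (%x. \<phi> m x * u x)) \<longlonglongrightarrow> 0" if "S : sets lebesgue" "u absolutely_integrable_on S" for S u
 by (rule integral_vanishing_sequence[OF that c\<phi> b\<phi> negP lim\<phi>])
 have bd: "bounded \<Omega>" "open \<Omega>" using dom by (simp_all add: bounded_lipschitz_domain_def)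
 have cT: "compact T" "compact T'" using S.compact_T S'.compact_T unfolding hl by auto
 have l1: "(%m. integral T (%x. \<phi> m x * div_vec (v T) x)) \<longlonglongrightarrow> 0"
 using cT(1) by (intro lim0 absolutely_integrable_continuous_compact polys_cont[OF polys_div_vec[OF p(1)]] fmeasurableD lmeasurable_compact)
 have l2: "(%m. integral T' (%x. \<phi> m x * div_vec (v T') x)) \<longlonglongrightarrow> 0"
 using cT(2) by (intro lim0 absolutely_integrable_continuous_compact polys_cont[OF polys_div_vec[OF p(2)]] fmeasurableD lmeasurable_compact)
 have l3: "(%m. integral \<Omega> (%x. \<phi> m x * w x)) \<longlonglongrightarrow> 0"
 by (rule lim0[OF fmeasurableD[OF lmeasurable_open[OF bd]] l2_fun_absolutely_integrable[OF w(1) bd]])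
 have "(%m. integral T (%x. \<phi> m x * div_vec (v T) x) + integral T' (%x. \<phi> m x * div_vec (v T') x)
 - integral \<Omega> (%x. \<phi> m x * w x)) \<longlonglongrightarrow> 0 + 0 - 0" by (intro tendsto_diff tendsto_add l1 l2 l3)
 then have "(%m :: nat. L) \<longlonglongrightarrow> 0" unfolding key[symmetric] by simp
 then have L0: "L = 0" by (simp add: LIMSEQ_const_iff)
 \<comment> \<open>Yet \<open>L\<close> times the sign of the jump at \<open>y\<close> is the
   integral of a nonnegative function that is positive at \<open>y\<close>.\<close>
 have "0 < FI F (%x. \<sigma> * (\<phi> 0 x * j x))" unfolding a(2)
 proof (rule S.facet_integral_pos[OF a(1)])
 show "continuous_on UNIV (%x. \<sigma> * (\<phi> 0 x * j x))" by (intro continuous_intros c\<phi> cj)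
 have nonneg: "0 <= \<phi> 0 x" for x by (simp add: \<phi>_def flat_exp_1_bounds(1))
 show "0 <= \<sigma> * (\<phi> 0 x * j x)" for x
 proof (cases "x : K")
 case True
 then have "0 < \<sigma> * j x" using KU by (auto simp: U_def)
 from mult_nonneg_nonneg[OF nonneg less_imp_le[OF this]] show ?thesis by (simp only: mult_ac)
 qed (simp add: \<phi>0)
 show "y : convex hull (vertices T - {a})" using y(2) a(2) by simp
 show "ALL b:vertices T - {a}. 0 < S.bc b y" by (rule y(3))
 have "\<phi> 0 y > 0" using \<epsilon>(1) by (simp add: \<phi>_def flat_exp_1_bounds(3))
 from mult_pos_pos[OF this \<sigma>] show "0 < \<sigma> * (\<phi> 0 y * j y)" by (simp only: mult_ac)
 qed
 also have "FI F (%x. \<sigma> * (\<phi> 0 x * j x)) = \<sigma> * L"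
 unfolding L_def a(2) by (rule S.FI_cmult[OF a(1)])
 finally show False using L0 by simp
qed

lemma finite_mesh_facets: "finite (mesh_facets \<T>)"
proof -
 have "mesh_facets \<T> = (\<Union>T\<in>\<T>. {F. F facet_of T})" by (auto simp: mesh_facets_def)
 moreover have "finite {F. F facet_of T}" if "T : \<T>" for T
 using full_simplex.facets_T[OF full[OF that]] full_simplex.finite_C[OF full[OF that]] unfolding hull[OF that] by simp
 ultimately show ?thesis using finite_mesh by simp
qed

lemma sum_facets_swap:
 "(SUM T:\<T>. SUM F:{F. F facet_of T}. \<Phi> T F) = (SUM F:mesh_facets \<T>. SUM T:adj F. \<Phi> T F)"
proof -
 have "{F. F facet_of T} = {F\<in>mesh_facets \<T>. F facet_of T}" if "T : \<T>" for T
 using that by (auto simp: mesh_facets_def)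
 then have "(SUM T:\<T>. SUM F:{F. F facet_of T}. \<Phi> T F) = (SUM T:\<T>. SUM F:{F\<in>mesh_facets \<T>. F facet_of T}. \<Phi> T F)"
 by simp
 also have "\<dots> = (SUM F:mesh_facets \<T>. SUM T:{T\<in>\<T>. F facet_of T}. \<Phi> T F)"
 by (rule sum.swap_restrict[OF finite_mesh finite_mesh_facets])
 finally show ?thesis by (simp add: adj_def)
qed

text \<open>Summed over the elements, the boundary fluxes cancel in pairs on interior facets by
  \<open>normal_continuity\<close> and vanish on the others by the boundary condition. This puts
  multiples of \<open>div v\<close> into \<open>Q_h\<close>, whose functions have mean zero.\<close>

lemma integral_div_zero:
 assumes k: "k >= 1" and v: "v : V_h k \<Omega> \<T>"
 shows "(SUM T:\<T>. integral T (%x. div_vec (v T) x)) = 0"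
proof -
 have p: "v T : polys (Suc k) UNIV" if "T : \<T>" for T
 using raviart_thomas_split(1)[OF V_h_polys[OF v that] k] .
 have el: "integral T (%x. div_vec (v T) x) = (SUM F:{F. F facet_of T}. FI F (%x. v T x \<bullet> outer_normal T F))"
 if T: "T : \<T>" for T
 proof -
 interpret S: full_simplex "vertices T" by (rule full[OF T])
 have pj: "(%x. v T x $ j) : polys (Suc k) UNIV" for j by (rule polys_nth[OF p[OF T]])
 have "div_vec (v T) x = (SUM j:UNIV. pd j (%x. v T x $ j) x)" for x
 by (simp add: div_vec_pd pd_nth[OF polys_diffable[OF p[OF T]]])
 moreover have "integral T (%x. SUM j:UNIV. pd j (%x. v T x $ j) x) =
 (SUM j:UNIV. SUM c:vertices T. S.nu c $ j * FI (convex hull (vertices T - {c})) (%x. v T x $ j))"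
 using S.divergence_polys[OF pj] S.compact_T unfolding hull[OF T]
 by (subst integral_sum) (auto intro!: integrable_compact polys_cont[OF polys_pd[OF sU pj]])
 ultimately have "integral T (%x. div_vec (v T) x) =
 (SUM c:vertices T. SUM j:UNIV. S.nu c $ j * FI (convex hull (vertices T - {c})) (%x. v T x $ j))"
 by (simp add: sum.swap[of _ "vertices T"])
 also have "\<dots> = (SUM c:vertices T. FI (convex hull (vertices T - {c})) (%x. v T x \<bullet> S.nu c))"
 proof (rule sum.cong[OF refl])
 fix c assume c: "c : vertices T"
 have "(SUM j:UNIV. S.nu c $ j * FI (convex hull (vertices T - {c})) (%x. v T x $ j))
 = FI (convex hull (vertices T - {c})) (%x. SUM j:UNIV. S.nu c $ j * (v T x $ j))"
 by (subst S.FI_sum[OF c]) (auto simp: S.FI_cmult[OF c] intro!: continuous_intros polys_cont[OF pj])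
 then show "(SUM j:UNIV. S.nu c $ j * FI (convex hull (vertices T - {c})) (%x. v T x $ j))
 = FI (convex hull (vertices T - {c})) (%x. v T x \<bullet> S.nu c)"
 by (simp add: inner_vec_def mult.commute)
 qed
 also have "\<dots> = (SUM F:{F. F facet_of T}. FI F (%x. v T x \<bullet> outer_normal T F))"
 using S.sum_facets[of "%F. FI F (%x. v T x \<bullet> outer_normal T F)"] S.outer_normal_fac
 unfolding hull[OF T] by simp
 finally show ?thesis .
 qed
 have "(SUM T:adj F. FI F (%x. v T x \<bullet> outer_normal T F)) = 0" if F: "F : mesh_facets \<T>" for F
 using F
 proof (cases rule: adj_cases)
 case (1 T)
 then have T: "T : \<T>" "F facet_of T" by (auto simp: adj_def)
 then obtain a where a: "a : vertices T" "F = convex hull (vertices T - {a})" using facet_cases by blast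
 have "v T x \<bullet> outer_normal T F = 0" if "x : F" for x
 using v T boundary_facet[OF 1] that unfolding V_h_def by blast
 then have "FI F (%x. v T x \<bullet> outer_normal T F) = FI F (%_. 0)"
 unfolding a(2) by (rule full_simplex.FI_cong[OF full[OF T(1)] a(1)])
 then show ?thesis using 1 full_simplex.FI_zero[OF full[OF T(1)] a(1)] unfolding a(2) by simp
 next
 case (2 T T')
 then have T: "T : \<T>" "F facet_of T" "T' : \<T>" "F facet_of T'" by (auto simp: adj_def)
 then obtain a where a: "a : vertices T" "F = convex hull (vertices T - {a})" using facet_cases by blast
 interpret S: full_simplex "vertices T" by (rule full[OF T(1)])
 let ?n = "outer_normal T F"
 have "FI F (%x. v T x \<bullet> ?n) + FI F (%x. v T' x \<bullet> - ?n) = FI F (%x. v T x \<bullet> ?n + v T' x \<bullet> - ?n)"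
 unfolding a(2) by (rule S.FI_add[OF a(1), symmetric])
 (intro continuous_intros polys_cont[OF p[OF T(1)]] polys_cont[OF p[OF T(3)]])+
 also have "\<dots> = FI F (%_. 0)"
 proof -
 have "v T x \<bullet> ?n + v T' x \<bullet> - ?n = 0" if "x : F" for x
 using normal_continuity[OF k v T(1,3) 2(2) T(2,4) that] by (simp add: inner_diff_left)
 then show ?thesis unfolding a(2) by (rule S.FI_cong[OF a(1)])
 qed
 also have "\<dots> = 0" unfolding a(2) by (rule S.FI_zero[OF a(1)])
 finally show ?thesis using 2 outer_normal_shared[OF T(1,3) 2(2) T(2,4)] by simp
 qed
 then show ?thesis using sum_facets_swap[of "%T F. FI F (%x. v T x \<bullet> outer_normal T F)"] el by simp
qed

end

section \<open>Local test functions\<close>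

lemma inner_mat_1: "(A :: real^'n^'n) \<bullet> mat 1 = trace A"
 by (simp add: inner_mat mat_def trace_def if_distrib cong: if_cong)

lemma trace_mat_1: "trace (mat 1 :: real^'n^'n) = CARD('n)"
 by (simp add: trace_def mat_def)

lemma linear_trace: "linear (trace :: real^'n^'n => real)"
 by (simp add: linear_iff trace_def sum.distrib sum_distrib_left)

lemma linear_dev: "linear (dev :: real^'n^'n => _)"
 by (simp add: linear_iff dev_def linear_add[OF linear_trace] linear_scale[OF linear_trace] add_divide_distrib algebra_simps)

lemma trace_dev: "trace (dev A :: real^'n^'n) = 0"
 by (simp add: dev_def linear_diff[OF linear_trace] linear_scale[OF linear_trace] trace_mat_1)

lemma dev_trace_free: "trace A = 0 ==> dev A = A"
 by (simp add: dev_def)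

lemma dev_inner: "trace B = 0 ==> dev A \<bullet> B = A \<bullet> (B :: real^'n^'n)"
 by (simp add: dev_def inner_diff_left inner_commute[of "mat 1"] inner_mat_1)

lemma inner_dev: "trace A = 0 ==> A \<bullet> dev B = A \<bullet> (B :: real^'n^'n)"
 by (metis dev_inner inner_commute)

lemma norm_dev_trace: "(norm (A :: real^'n^'n))^2 = (norm (dev A))^2 + (trace A)^2 / CARD('n)"
proof -
 have "dev A \<bullet> dev A = A \<bullet> dev A" by (rule dev_inner[OF trace_dev])
 also have "\<dots> = A \<bullet> A - (trace A)^2 / CARD('n)"
 by (simp add: dev_def inner_diff_right inner_mat_1 power2_eq_square)
 finally show ?thesis by (simp add: power2_norm_eq_inner)
qed

lemma norm_dev_le: "norm (dev A :: real^'n^'n) <= norm A"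
proof -
 have "(norm (dev A))^2 <= (norm A)^2" using norm_dev_trace[of A] by simp
 then show ?thesis by (rule power2_le_imp_le) simp
qed

lemma skew_iff: "(A :: real^'n^'n) : skew \<longleftrightarrow> (ALL i j. A$i$j + A$j$i = 0)"
proof -
 have "A : skew \<longleftrightarrow> (ALL i j. A$j$i = - (A$i$j))" by (simp add: skew_def vec_eq_iff transpose_def)
 also have "\<dots> \<longleftrightarrow> (ALL i j. A$i$j + A$j$i = 0)" by (simp only: eq_neg_iff_add_eq_0 add.commute)
 finally show ?thesis .
qed

lemma trace_skew: "A : skew ==> trace (A :: real^'n^'n) = 0"
proof -
 assume "A : skew"
 then have "A$i$i + A$i$i = 0" for i unfolding skew_iff by blast
 then have "A$i$i = 0" for i by simp
 then show ?thesis by (simp add: trace_def)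
qed

lemma subspace_skew: "subspace (skew :: (real^'n^'n) set)"
proof (rule subspaceI)
 show "(0 :: real^'n^'n) : skew" by (simp add: skew_iff)
 fix A B :: "real^'n^'n" and c :: real assume A: "A : skew"
 have "(c *R A)$i$j + (c *R A)$j$i = c * (A$i$j + A$j$i)" for i j by (simp add: distrib_left)
 then show "c *R A : skew" using A unfolding skew_iff by simp
 assume B: "B : skew"
 have "(A + B)$i$j + (A + B)$j$i = (A$i$j + A$j$i) + (B$i$j + B$j$i)" for i j by simp
 then show "A + B : skew" using A B unfolding skew_iff by simp
qed

lemma sym_skew_inner: "transpose A = A ==> B : skew ==> A \<bullet> (B :: real^'n^'n) = 0"
proof -
 assume A: "transpose A = A" and B: "B : skew"
 have "A \<bullet> B = transpose A \<bullet> transpose B" unfolding inner_mat transpose_def vec_lambda_beta by (rule sum.swap)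
 also have "\<dots> = - (A \<bullet> B)" using A B by (simp add: skew_def)
 finally show ?thesis by simp
qed

lemma trace_outer_prod: "trace (outer_prod a b) = a \<bullet> b"
 by (simp add: trace_def outer_prod_def inner_vec_def)

lemma outer_prod_mult: "outer_prod a b *v x = (b \<bullet> x) *R a"
 by (simp add: vec_eq_iff outer_prod_def matrix_vector_mult_def inner_vec_def sum_distrib_left mult_ac)

lemma inner_outer_prod: "M \<bullet> outer_prod a b = a \<bullet> (M *v b)"
 by (simp add: inner_mat outer_prod_def inner_vec_def matrix_vector_mult_def sum_distrib_left mult_ac)

lemma norm_outer_prod: "norm (outer_prod a b) = norm a * norm b"
proof -
 have "(norm (outer_prod a b))^2 = (norm a * norm b)^2"
 unfolding power2_norm_eq_inner inner_outer_prod outer_prod_mult power_mult_distrib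
 by (simp add: inner_commute)
 then show ?thesis by (simp add: power2_eq_iff_nonneg)
qed

lemma linear_mat_vec: "linear (%A :: real^'n^'m. A *v x)"
 by (simp add: linear_iff matrix_vector_mult_add_rdistrib scaleR_matrix_vector_assoc)

lemma lin_nt: "linear (nt_trace n)"
 by (simp add: linear_iff nt_trace_def nn_trace_def linear_add[OF linear_mat_vec] linear_scale[OF linear_mat_vec] inner_add_right algebra_simps)

lemma nt_trace_dev: "norm n = 1 ==> nt_trace n (dev A) = nt_trace n A"
proof -
 assume n: "norm n = 1"
 then have "n \<bullet> n = 1" by (simp add: dot_square_norm)
 then have "nt_trace n (mat 1) = 0" by (simp add: nt_trace_def nn_trace_def)
 then show ?thesis unfolding dev_def by (simp add: linear_diff[OF lin_nt] linear_scale[OF lin_nt])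
qed

lemma nt_trace_uminus: "nt_trace (- n) A = - nt_trace n A"
 by (simp add: nt_trace_def nn_trace_def linear_neg[OF matrix_vector_mul_linear])

lemma Young: "\<epsilon> > 0 ==> (a :: 'v::real_inner) \<bullet> b <= \<epsilon> / 2 * (norm a)^2 + 1 / (2 * \<epsilon>) * (norm b)^2"
proof -
 assume e: "\<epsilon> > 0"
 have "0 <= (norm (\<epsilon> *R a - b))^2" by simp
 also have "\<dots> = \<epsilon> * (\<epsilon> * (norm a)^2) - 2 * \<epsilon> * (a \<bullet> b) + (norm b)^2"
 unfolding power2_norm_eq_inner by (simp add: inner_diff_left inner_diff_right inner_commute)
 finally have "2 * \<epsilon> * (a \<bullet> b) <= \<epsilon> * (\<epsilon> * (norm a)^2) + (norm b)^2" by simp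
 then show ?thesis using e by (simp add: field_simps power2_eq_square)
qed

lemma norm_sum_sq_le:
 fixes f :: "'i => 'v::real_inner"
 assumes "finite I"
 shows "(norm (SUM i:I. f i))^2 <= card I * (SUM i:I. (norm (f i))^2)"
proof -
 have "(norm (SUM i:I. f i))^2 <= (SUM i:I. norm (f i))^2" by (intro power_mono norm_sum) simp
 also have "\<dots> <= (SUM i:I. (1::real)^2) * (SUM i:I. (norm (f i))^2)"
 using Cauchy_Schwarz_ineq_sum[of "%_. 1" "%i. norm (f i)" I] by simp
 finally show ?thesis by simp
qed

lemma norm_add_sq_le: "(norm ((a :: 'v::real_inner) + b))^2 <= 2 * (norm a)^2 + 2 * (norm b)^2"
proof -
 have "0 <= (norm (a - b))^2" by simp
 then show ?thesis unfolding power2_norm_eq_inner by (simp add: inner_diff_left inner_diff_right inner_add_left inner_add_right inner_commute)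
qed

text \<open>A correction proportional to the divergence that carries the excess degree of a
  Raviart-Thomas function, by \<open>raviart_thomas_split\<close>. Centring it at \<open>z\<close>
  makes it small, at most \<open>h\<close> times the divergence on the element.\<close>

definition ecor :: "nat => (real^'n => real^'n) => real^'n => real^'n => real^'n" where
 "ecor k v z x = (div_vec v x / (CARD('n) + k)) *R (x - z)"

definition pcor :: "nat => (real^'n => real^'n) => real^'n => real^'n => real^'n" where
 "pcor k v z x = v x - ecor k v z x"

lemma pcor_polys: "v : raviart_thomas k ==> k >= 1 ==> pcor k v z : polys k UNIV"
 using raviart_thomas_split(3)[of v k z] by (simp add: pcor_def[abs_def] ecor_def)

lemma ecor_polys: "v : raviart_thomas k ==> k >= 1 ==> ecor k v z : polys (Suc k) UNIV"
proof -
 assume v: "v : raviart_thomas k" "k >= 1"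
 have "(%x. v x - pcor k v z x) : polys (Suc k) UNIV"
 by (intro polys_diff sU raviart_thomas_split(1)[OF v] polys_mono[OF sU pcor_polys[OF v]]) simp
 then show ?thesis by (simp add: pcor_def)
qed

lemma norm_jacobian: "(norm (jacobian v (at x)))^2 = (SUM j:UNIV. (norm (pd j v x))^2)"
 unfolding power2_norm_eq_inner inner_mat jacobian_nth inner_vec_def inner_real_def by (rule sum.swap)

text \<open>This is \<open>polys_L2_lower\<close> with the half ball as reference; the factor
  \<open>2 / \<rho>\<close> enlarges its radius to \<open>h\<close>, so all points of the element
  are covered.\<close>

lemma L2_lower_shaped:
 assumes rho: "\<rho> > 0"
 shows "\<exists>c>0. ALL C z h p x. shaped_simplex C (z :: real^'n::{finite,wellorder}) h \<rho> --> p : polys K (UNIV :: 'v::euclidean_space set) --> x : cball z h -->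
 c * h ^ CARD('n) * (norm (p x))^2 <= integral (cball z (\<rho> * h / 2)) (%x. (norm (p x))^2)"
proof -
 define R where "R = max 1 (2 / \<rho>)"
 have R: "R >= 1" by (simp add: R_def)
 obtain c where c: "c > 0 & (ALL p z r x. p : polys K (UNIV :: 'v set) --> r > 0 --> x : cball z (R * r) -->
 c * r ^ CARD('n) * (norm (p (x :: real^'n::_)))^2 <= integral (cball z r) (%x. (norm (p x))^2))"
 using polys_L2_lower[OF R] by blast
 have "c * (\<rho> / 2) ^ CARD('n) * h ^ CARD('n) * (norm (p x))^2 <= integral (cball z (\<rho> * h / 2)) (%x. (norm (p x))^2)"
 if S: "shaped_simplex C z h \<rho>" and p: "p : polys K (UNIV :: 'v set)" and x: "x : cball z h"
 for C and z x :: "real^'n::_" and h p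
 proof -
 have h: "h > 0" using S by (simp add: shaped_simplex_def shaped_simplex_axioms_def)
 have "1 * h <= (R * (\<rho> / 2)) * h"
 proof (rule mult_right_mono)
 have "(2 / \<rho>) * (\<rho> / 2) <= R * (\<rho> / 2)" using rho by (intro mult_right_mono) (auto simp: R_def)
 then show "1 <= R * (\<rho> / 2)" using rho by simp
 qed (use h in simp)
 then have "x : cball z (R * (\<rho> * h / 2))" using x by (simp add: mult.assoc)
 then have "c * (\<rho> * h / 2) ^ CARD('n) * (norm (p x))^2 <= integral (cball z (\<rho> * h / 2)) (%x. (norm (p x))^2)"
 using c p h rho by simp
 then show ?thesis by (simp add: power_mult_distrib power_divide mult_ac)
 qed
 moreover have "c * (\<rho> / 2) ^ CARD('n) > 0" using c rho by simp
 ultimately show ?thesis by blast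
qed

text \<open>The correction is at most \<open>h\<close> times the sup of \<open>div v\<close>, and
  the inverse estimate removes the factor \<open>h\<close> from its gradient. On a facet,
  \<open>inverse h\<close> times \<open>h^2\<close> leaves the one factor \<open>h\<close> that
  turns a facet integral into a volume.\<close>

lemma ecor_bounds:
 assumes rho: "\<rho> > 0" and k: "k >= 1"
 shows "\<exists>K>0. ALL C z h v. shaped_simplex C (z :: real^'n::{finite,wellorder}) h \<rho> --> v : raviart_thomas k -->
 integral (convex hull C) (%x. (norm (jacobian (ecor k v z) (at x)))^2) <= K * integral (convex hull C) (%x. (div_vec v x)^2) &
 (ALL a:C. inverse h * FI (convex hull (C - {a})) (%x. (norm (ecor k v z x))^2) <= K * integral (convex hull C) (%x. (div_vec v x)^2))"
proof -
 let ?V = "unit_ball_vol CARD('n)"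
 have V: "?V > 0" by simp
 obtain c where c: "c > 0 & (ALL C z h p x. shaped_simplex C (z :: real^'n::_) h \<rho> --> p : polys k (UNIV :: real set) --> x : cball z h -->
 c * h ^ CARD('n) * (norm (p x))^2 <= integral (cball z (\<rho> * h / 2)) (%x. (norm (p x))^2))"
 using L2_lower_shaped[OF rho, where K=k and 'n='n and 'v=real] by blast
 obtain C2 where "C2 >= 1 & (ALL p z r A x \<xi>. p : polys (Suc k) (UNIV :: (real^'n::_) set) --> r > 0 -->
 (ALL x:cball (z :: real^'n::_) r. norm (p x) <= A) --> x : cball z r -->
 norm (frechet_derivative p (at x) \<xi>) <= C2 * A * norm \<xi> / r)"
 using polys_inverse_estimate[of "Suc k", where 'v="real^'n::_" and 'n='n] ..
 then have C2: "C2 >= 1" "!!p z r A x \<xi>. p : polys (Suc k) (UNIV :: (real^'n::_) set) ==> r > 0 ==>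
 (ALL x:cball (z :: real^'n::_) r. norm (p x) <= A) ==> x : cball z r ==>
 norm (frechet_derivative p (at x) \<xi>) <= C2 * A * norm \<xi> / r" by blast+
 define K where "K = real CARD('n) * C2^2 * ?V / c + ?V * 2 ^ CARD('n) / c"
 have K: "K > 0" unfolding K_def using c V C2(1) by (intro add_nonneg_pos divide_nonneg_pos divide_pos_pos mult_nonneg_nonneg mult_pos_pos) auto
 have "integral (convex hull C) (%x. (norm (jacobian (ecor k v z) (at x)))^2) <= K * integral (convex hull C) (%x. (div_vec v x)^2) &
 (ALL a:C. inverse h * FI (convex hull (C - {a})) (%x. (norm (ecor k v z x))^2) <= K * integral (convex hull C) (%x. (div_vec v x)^2))"
 if S: "shaped_simplex C z h \<rho>" and v: "v : raviart_thomas k" for C and z :: "real^'n::_" and h v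
 proof -
 interpret shaped_simplex C z h \<rho> by (rule S)
 define D where "D = integral T (%x. (div_vec v x)^2)"
 have pdiv: "(%x. div_vec v x) : polys k UNIV" by (rule raviart_thomas_split(2)[OF v k])
 have pe: "ecor k v z : polys (Suc k) UNIV" by (rule ecor_polys[OF v k])
 have D0: "0 <= D" unfolding D_def by (intro integral_nonneg integrable_compact compact_T continuous_intros polys_cont[OF pdiv]) simp
 \<comment> \<open>The sup bound on \<open>div_vec v\<close> implied by its integral; the power of
   \<open>h\<close> cancels when the bound is integrated over the element.\<close>
 define A where "A = sqrt (D / (c * h ^ CARD('n)))"
 have A2: "A^2 = D / (c * h ^ CARD('n))" using D0 c h by (simp add: A_def)
 have A2': "A^2 * (h ^ CARD('n)) = D / c" unfolding A2 using h c by simp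
 have A0: "A >= 0" using D0 c h by (simp add: A_def)
 have dle: "\<bar>div_vec v x\<bar> <= A" if x: "x : cball z h" for x
 proof -
 have "c * h ^ CARD('n) * (norm (div_vec v x))^2 <= integral (cball z (\<rho> * h / 2)) (%x. (norm (div_vec v x))^2)"
 using c S pdiv x by blast
 also have "\<dots> <= D" unfolding D_def
 using integral_T_ge_ball[of "%x. (div_vec v x)^2"] polys_cont[OF pdiv] by (simp add: continuous_on_power)
 finally have "(div_vec v x)^2 <= A^2" unfolding A2 using c h by (simp add: field_simps)
 then show ?thesis using A0 by (simp add: abs_le_square_iff[symmetric])
 qed
 have ele: "ALL x:cball z h. norm (ecor k v z x) <= A * h"
 proof
 fix x assume x: "x : cball z h"
 have "norm (ecor k v z x) = (\<bar>div_vec v x\<bar> / (CARD('n) + k)) * norm (x - z)" by (simp add: ecor_def)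
 also have "\<dots> <= A * h"
 proof (rule mult_mono)
 have "\<bar>div_vec v x\<bar> / (CARD('n) + k) <= \<bar>div_vec v x\<bar> / 1" using k by (intro divide_left_mono) auto
 then show "\<bar>div_vec v x\<bar> / (CARD('n) + k) <= A" using dle[OF x] by simp
 qed (use x A0 in \<open>auto simp: dist_norm norm_minus_commute\<close>)
 finally show "norm (ecor k v z x) <= A * h" .
 qed
 have jle: "(norm (jacobian (ecor k v z) (at x)))^2 <= real CARD('n) * (C2 * A)^2" if x: "x : T" for x
 proof -
 have "x : cball z h" using T_subset[OF z_in_T] x by blast
 then have "norm (pd j (ecor k v z) x) <= C2 * (A * h) * norm (axis j (1::real) :: real^'n::_) / h" for j
 by (rule C2(2)[OF pe h ele])
 then have "(norm (pd j (ecor k v z) x))^2 <= (C2 * A)^2" for j using h by (intro power_mono) auto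
 then show ?thesis unfolding norm_jacobian using sum_bounded_above[of UNIV "%j. (norm (pd j (ecor k v z) x))^2"] by simp
 qed
 have "integral T (%x. (norm (jacobian (ecor k v z) (at x)))^2) <= real CARD('n) * (C2 * A)^2 * ?V * h ^ CARD('n)"
 using jle by (intro integral_T_le continuous_intros polys_cont[OF polys_jacobian[OF pe]]) auto
 also have "\<dots> = real CARD('n) * C2^2 * ?V * (A^2 * h ^ CARD('n))" by (simp add: power_mult_distrib)
 also have "\<dots> = (real CARD('n) * C2^2 * ?V / c) * D" unfolding A2' by simp
 also have "\<dots> <= K * D" using D0 c V by (intro mult_right_mono) (auto simp: K_def)
 finally have 1: "integral T (%x. (norm (jacobian (ecor k v z) (at x)))^2) <= K * D" .
 have 2: "inverse h * FI (fac a) (%x. (norm (ecor k v z x))^2) <= K * D" if a: "a : C" for a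
 proof -
 have "h * FI (fac a) (%x. (norm (ecor k v z x))^2) <= (A * h)^2 * ?V * (2 * h) ^ CARD('n)"
 proof (rule FI_upper[OF a])
 fix x assume "x : fac a"
 then have "x : cball z h" using T_subset[OF z_in_T] mem_fac[OF a] by blast
 then show "(norm (ecor k v z x))^2 <= (A * h)^2" using ele by (intro power_mono) auto
 qed (auto intro!: continuous_intros polys_cont[OF pe])
 then have "FI (fac a) (%x. (norm (ecor k v z x))^2) <= ((A * h)^2 * ?V * (2 * h) ^ CARD('n)) / h"
 using h by (simp add: pos_le_divide_eq mult.commute)
 then have "inverse h * FI (fac a) (%x. (norm (ecor k v z x))^2) <= inverse h * (((A * h)^2 * ?V * (2 * h) ^ CARD('n)) / h)"
 using h by (intro mult_left_mono) auto
 also have "\<dots> = ?V * 2 ^ CARD('n) * (A^2 * h ^ CARD('n))" using h by (simp add: power_mult_distrib power2_eq_square field_simps)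
 also have "\<dots> = (?V * 2 ^ CARD('n) / c) * D" unfolding A2' by simp
 also have "\<dots> <= K * D" using D0 c V C2(1) by (intro mult_right_mono) (auto simp: K_def)
 finally show ?thesis .
 qed
 show ?thesis using 1 2 unfolding D_def by blast
 qed
 then show ?thesis using K by blast
qed

context full_simplex begin

text \<open>Rank-one matrices indexed by ordered pairs of vertices, with \<open>E a a\<close> zero.
  The product of \<open>M\<close> with \<open>E b a\<close> is the change of \<open>M\<close> along
  an edge, measured by a gradient; together these products determine \<open>M\<close>
  (\<open>norm_le_E\<close>).\<close>

definition E :: "real^'n::_ => real^'n::_ => real^'n::_^'n::_" where
 "E b a = outer_prod (g b) (b - a)"

text \<open>\<open>nt_trace\<close> of \<open>dev (E b a)\<close> vanishes on all facets but the one opposite to \<open>a\<close>, so weighted with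
  the barycentric coordinate of \<open>a\<close> it is a bubble.\<close>

lemma nt_trace_E:
 assumes "a : C" "b : C" "c : C" "a ~= c"
 shows "nt_trace (nu c) (dev (E b a)) = 0"
proof -
 have nn: "nu c \<bullet> nu c = 1" using norm_nu[OF assms(3)] by (simp add: norm_eq_1)
 have "E b a *v nu c = (((b - a) \<bullet> nu c) *R g b)" by (simp add: E_def outer_prod_mult)
 also have "\<dots> = (if b = c then - (((b - a) \<bullet> nu c) * norm (g c)) else 0) *R nu c"
 proof (cases "b = c")
 case True
 have gc: "g c = (- norm (g c)) *R nu c" using g_nu[of c] by simp
 have "((b - a) \<bullet> nu c) *R g c = ((b - a) \<bullet> nu c) *R ((- norm (g c)) *R nu c)" by (rule arg_cong[OF gc])
 then show ?thesis using True by (simp only: scaleR_scaleR refl if_True mult_minus_right)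
 next
 case False
 then have "(b - a) \<bullet> nu c = 0" using g_vertex[of c b a] assms by (simp add: nu_def inner_commute)
 then show ?thesis using False by simp
 qed
 finally have "EX t. E b a *v nu c = t *R nu c" by blast
 then obtain t where "E b a *v nu c = t *R nu c" by blast
 then have "nt_trace (nu c) (E b a) = 0" by (simp add: nt_trace_def nn_trace_def nn)
 then show ?thesis using nt_trace_dev[OF norm_nu[OF assms(3)]] by simp
qed

text \<open>The coefficients are chosen so that, for trace-free \<open>M\<close>, the product with
  \<open>- M\<close> is the sum of the squares of \<open>M x \<bullet> E b a\<close> weighted by
  \<open>bc a\<close>. The minus sign matches the one of the volume term of
  \<open>b2\<close>.\<close>

definition tau1 :: "(real^'n::_ => real^'n::_^'n::_) => real^'n::_ => real^'n::_^'n::_" where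
 "tau1 M x = - (SUM a:C. SUM b:C. (bc a x * (M x \<bullet> E b a)) *R dev (E b a))"

lemma tau1_polys: "M : polys k UNIV ==> tau1 M : polys (Suc k) UNIV"
proof -
 assume M: "M : polys k UNIV"
 have "(%x. (bc a x * (M x \<bullet> E b a)) *R dev (E b a)) : polys (Suc k) UNIV" if "a : C" for a b
 proof -
 have "(%x. bc a x *R (M x \<bullet> E b a)) : polys (1 + k) UNIV"
 by (intro polys_mult polys_bc that polys_component[OF M] sU)
 from polys_mult[OF sU this polys_const[OF sU UNIV_I, of "dev (E b a)" 0]]
 show ?thesis by simp
 qed
 then show ?thesis unfolding tau1_def[abs_def] by (intro polys_uminus polys_sum sU)
qed

lemma tau1_trace: "trace (tau1 M x) = 0"
 by (simp add: tau1_def linear_neg[OF linear_trace] linear_sum[OF linear_trace] linear_scale[OF linear_trace] trace_dev)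

text \<open>In the terms with \<open>a\<close> different from \<open>c\<close> the matrix has no
  tangential trace; in those with \<open>a = c\<close> the weight vanishes on the facet.\<close>

lemma tau1_nt: assumes c: "c : C" and x: "x : fac c" shows "nt_trace (nu c) (tau1 M x) = 0"
proof -
 have "(bc a x * (M x \<bullet> E b a)) *R nt_trace (nu c) (dev (E b a)) = 0" if "a : C" "b : C" for a b
 using that nt_trace_E[OF that c] mem_fac[OF c, of x] x by (cases "a = c") auto
 then have "(SUM a:C. SUM b:C. (bc a x * (M x \<bullet> E b a)) *R nt_trace (nu c) (dev (E b a))) = 0"
 by (intro sum.neutral ballI)
 then show ?thesis
 by (simp only: tau1_def linear_neg[OF lin_nt] linear_sum[OF lin_nt] linear_scale[OF lin_nt] neg_equal_0_iff_equal)
qed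

text \<open>For tangential \<open>t\<close>, a constant trace-free matrix whose
  \<open>nt_trace\<close> is \<open>t\<close> on the facet opposite to \<open>a\<close> and zero on
  the others. The factor \<open>norm (g a)\<close> is the reciprocal of the height
  \<open>(b - a) \<bullet> nu a\<close>, which is the same for all vertices \<open>b\<close> of that
  facet.\<close>

definition tau3 :: "real^'n::_ => real^'n::_ => real^'n::_^'n::_" where
 "tau3 a t = norm (g a) *R dev (SUM b:C. (t \<bullet> (b - a)) *R E b a)"

lemma tau3_sum: "tau3 a t = norm (g a) *R (SUM b:C. (t \<bullet> (b - a)) *R dev (E b a))"
 by (simp add: tau3_def linear_sum[OF linear_dev] linear_scale[OF linear_dev])

lemma linear_tau3: "linear (tau3 a)"
 by (simp add: linear_iff tau3_sum inner_add_left scaleR_add_left sum.distrib scaleR_add_right scaleR_sum_right mult_ac)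

lemma tau3_trace: "trace (tau3 a t) = 0"
 by (simp add: tau3_def linear_scale[OF linear_trace] trace_dev)

lemma tau3_nt_other: "a : C ==> c : C ==> a ~= c ==> nt_trace (nu c) (tau3 a t) = 0"
 by (simp add: tau3_sum linear_sum[OF lin_nt] linear_scale[OF lin_nt] nt_trace_E)

lemma tau3_nt: assumes a: "a : C" and t: "t \<bullet> nu a = 0" shows "nt_trace (nu a) (tau3 a t) = t"
proof -
 have nn: "nu a \<bullet> nu a = 1" using norm_nu[OF a] by (simp add: norm_eq_1)
 have ng: "norm (g a) ~= 0" using g_nonzero[OF a] by simp
 have "(t \<bullet> (b - a)) *R ((b - a) \<bullet> nu a) *R g b = (1 / norm (g a)) *R ((b - a) \<bullet> t) *R g b" if b: "b : C" for b
 proof (cases "b = a")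
 case False
 then have "(b - a) \<bullet> nu a = 1 / norm (g a)" using g_vertex[OF a b a] by (simp add: nu_def inner_commute divide_inverse)
 then show ?thesis by (simp add: inner_commute)
 qed simp
 then have "(SUM b:C. (t \<bullet> (b - a)) *R ((b - a) \<bullet> nu a) *R g b) = (SUM b:C. (1 / norm (g a)) *R ((b - a) \<bullet> t) *R g b)"
 by (rule sum.cong[OF refl])
 also have "\<dots> = (1 / norm (g a)) *R t" unfolding scaleR_sum_right[symmetric] g_reconstruct_dual ..
 finally have e: "(SUM b:C. (t \<bullet> (b - a)) *R E b a) *v nu a = (1 / norm (g a)) *R t"
 by (simp add: linear_sum[OF linear_mat_vec] linear_scale[OF linear_mat_vec] E_def outer_prod_mult)
 have "nt_trace (nu a) (tau3 a t) = norm (g a) *R nt_trace (nu a) (SUM b:C. (t \<bullet> (b - a)) *R E b a)"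
 unfolding tau3_def linear_scale[OF lin_nt] nt_trace_dev[OF norm_nu[OF a]] ..
 also have "\<dots> = t" unfolding nt_trace_def nn_trace_def e using ng t by (simp add: inner_commute)
 finally show ?thesis .
qed

end

context shaped_simplex begin

lemma z_dist: "b : C ==> norm (b - z) <= h"
 using dist_T[OF _ z_in_T, of b] by (simp add: dist_norm hull_inc)

lemma norm_E: assumes "a : C" "b : C" shows "norm (E b a) <= 1 / \<rho>"
proof -
 have "norm (b - a) <= h" using dist_T[of b a] assms by (simp add: dist_norm hull_inc)
 then have "norm (E b a) <= (1 / (\<rho> * h)) * h"
 unfolding E_def norm_outer_prod using norm_g_le[OF assms(2)] rho h by (intro mult_mono) auto
 then show ?thesis using h by simp
qed

text \<open>By \<open>g_reconstruct_dual\<close>, the transpose of \<open>M\<close> applied to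
  \<open>g b\<close> is recovered from the products with the edges at \<open>b\<close>; a second use
  expresses the unit vectors through the \<open>g b\<close>, and thereby the rows of
  \<open>M\<close>.\<close>

lemma norm_le_E:
 fixes M :: "real^'n::_^'n::_"
 shows "(norm M)^2 <= (CARD('n) * (real (Suc CARD('n)))^2 / \<rho>^2) * (SUM a:C. SUM b:C. (M \<bullet> E b a)^2)"
proof -
 define f where "f u = transpose M *v u" for u
 have lf: "linear f" unfolding f_def[abs_def] by (rule matrix_vector_mul_linear)
 have fi: "f u \<bullet> w = u \<bullet> (M *v w)" for u w
 unfolding f_def transpose_matrix_vector by (rule dot_lmul_matrix)
 define S where "S = (SUM a:C. SUM b:C. \<bar>M \<bullet> E b a\<bar>)"
 have fg: "norm (f (g b)) <= (1 / (\<rho> * h)) * (SUM a:C. \<bar>M \<bullet> E b a\<bar>)" if "b : C" for b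
 proof -
 have "(a - b) \<bullet> f (g b) = - (M \<bullet> E b a)" for a
 proof -
 have "(a - b) \<bullet> f (g b) = g b \<bullet> (M *v (a - b))" using fi[of "g b" "a - b"] by (simp add: inner_commute)
 also have "\<dots> = - (g b \<bullet> (M *v (b - a)))" by (simp add: linear_diff[OF matrix_vector_mul_linear] inner_diff_right)
 finally show ?thesis by (simp add: E_def inner_outer_prod)
 qed
 then have "f (g b) = (SUM a:C. (- (M \<bullet> E b a)) *R g a)" using g_reconstruct_dual[of b "f (g b)"] by simp
 then have "norm (f (g b)) <= (SUM a:C. \<bar>M \<bullet> E b a\<bar> * norm (g a))"
 using norm_sum[of "%a. (- (M \<bullet> E b a)) *R g a" C] by simp
 also have "\<dots> <= (SUM a:C. \<bar>M \<bullet> E b a\<bar> * (1 / (\<rho> * h)))" using norm_g_le by (intro sum_mono mult_left_mono) auto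
 finally show ?thesis by (simp add: sum_distrib_left sum_distrib_right[symmetric] mult.commute)
 qed
 have row: "norm (M $ i) <= S / \<rho>" for i
 proof -
 have "M $ i = f (axis i 1)"
 by (simp add: f_def vec_eq_iff matrix_vector_mult_def transpose_def axis_def if_distrib cong: if_cong)
 also have "\<dots> = f (SUM b:C. ((b - z) \<bullet> axis i 1) *R g b)" by (simp only: g_reconstruct_dual)
 also have "\<dots> = (SUM b:C. ((b - z) \<bullet> axis i 1) *R f (g b))" by (simp add: linear_sum[OF lf] linear_scale[OF lf])
 also have "norm \<dots> <= (SUM b:C. norm (((b - z) \<bullet> axis i 1) *R f (g b)))" by (rule norm_sum)
 also have "\<dots> <= (SUM b:C. h * ((1 / (\<rho> * h)) * (SUM a:C. \<bar>M \<bullet> E b a\<bar>)))"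
 proof (rule sum_mono)
 fix b assume b: "b : C"
 have "\<bar>(b - z) \<bullet> axis i 1\<bar> <= norm (b - z) * norm (axis i (1::real) :: real^'n::_)" by (rule Cauchy_Schwarz_ineq2)
 then have "\<bar>(b - z) \<bullet> axis i 1\<bar> <= h" using z_dist[OF b] by simp
 then show "norm (((b - z) \<bullet> axis i 1) *R f (g b)) <= h * ((1 / (\<rho> * h)) * (SUM a:C. \<bar>M \<bullet> E b a\<bar>))"
 unfolding norm_scaleR using fg[OF b] h by (intro mult_mono) auto
 qed
 also have "\<dots> = (SUM b:C. (1 / \<rho>) * (SUM a:C. \<bar>M \<bullet> E b a\<bar>))" using h by simp
 also have "\<dots> = (1 / \<rho>) * (SUM b:C. SUM a:C. \<bar>M \<bullet> E b a\<bar>)" by (rule sum_distrib_left[symmetric])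
 also have "(SUM b:C. SUM a:C. \<bar>M \<bullet> E b a\<bar>) = S" unfolding S_def by (rule sum.swap)
 also have "(1 / \<rho>) * S = S / \<rho>" by simp
 finally show ?thesis .
 qed
 have "(norm M)^2 = (SUM i:UNIV. (norm (M $ i))^2)" unfolding power2_norm_eq_inner by (simp add: inner_vec_def[of M])
 also have "\<dots> <= (SUM i:(UNIV :: 'n set). (S / \<rho>)^2)" using row by (intro sum_mono power_mono) auto
 also have "\<dots> = CARD('n) / \<rho>^2 * S^2" by (simp add: power_divide)
 also have "\<dots> <= CARD('n) / \<rho>^2 * ((real (Suc CARD('n)))^2 * (SUM a:C. SUM b:C. (M \<bullet> E b a)^2))"
 proof (rule mult_left_mono)
 have sc: "S = (SUM p:C \<times> C. \<bar>M \<bullet> E (snd p) (fst p)\<bar>)" unfolding S_def by (simp add: sum.cartesian_product case_prod_beta)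
 have ns: "(norm (SUM p:C \<times> C. \<bar>M \<bullet> E (snd p) (fst p)\<bar>))^2 <= card (C \<times> C) * (SUM p:C \<times> C. (norm \<bar>M \<bullet> E (snd p) (fst p)\<bar>)^2)"
 using finite_C by (intro norm_sum_sq_le) simp
 have cc: "real (card (C \<times> C)) = (real (Suc CARD('n)))^2"
 unfolding card_cartesian_product card_C power2_eq_square by (rule of_nat_mult)
 show "S^2 <= (real (Suc CARD('n)))^2 * (SUM a:C. SUM b:C. (M \<bullet> E b a)^2)"
 using ns unfolding cc sc by (simp add: sum.cartesian_product case_prod_beta del: of_nat_Suc)
 qed simp
 finally show ?thesis by (simp add: mult_ac)
qed

lemma norm_tau1_le:
 assumes x: "x : T" shows "norm (tau1 M x) <= (real (Suc CARD('n)))^2 / \<rho>^2 * norm (M x)"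
proof -
 have "norm (tau1 M x) <= (SUM a:C. SUM b:C. norm ((bc a x * (M x \<bullet> E b a)) *R dev (E b a)))"
 unfolding tau1_def norm_minus_cancel by (intro order_trans[OF norm_sum] sum_mono norm_sum)
 also have "\<dots> <= (SUM a:C. SUM b:C. norm (M x) / \<rho>^2)"
 proof (intro sum_mono)
 fix a b assume ab: "a : C" "b : C"
 have "\<bar>bc a x\<bar> <= 1" using bary_le_1[OF ab(1) x] x ab(1) mem_T by simp
 moreover have "\<bar>M x \<bullet> E b a\<bar> <= norm (M x) * (1 / \<rho>)"
 by (rule order_trans[OF Cauchy_Schwarz_ineq2 mult_left_mono[OF norm_E[OF ab]]]) simp
 ultimately have p1: "\<bar>bc a x\<bar> * \<bar>M x \<bullet> E b a\<bar> <= 1 * (norm (M x) * (1 / \<rho>))" using rho by (intro mult_mono) auto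
 have p2: "norm (dev (E b a)) <= 1 / \<rho>" using norm_dev_le norm_E[OF ab] by (rule order_trans)
 have "(\<bar>bc a x\<bar> * \<bar>M x \<bullet> E b a\<bar>) * norm (dev (E b a)) <= (1 * (norm (M x) * (1 / \<rho>))) * (1 / \<rho>)"
 by (rule mult_mono[OF p1 p2]) (use rho in simp_all)
 moreover have "(1 * (norm (M x) * (1 / \<rho>))) * (1 / \<rho>) = norm (M x) / \<rho>^2" by (simp add: power2_eq_square)
 ultimately show "norm ((bc a x * (M x \<bullet> E b a)) *R dev (E b a)) <= norm (M x) / \<rho>^2"
 by (simp only: norm_scaleR abs_mult)
 qed
 also have "\<dots> = (real (Suc CARD('n)))^2 / \<rho>^2 * norm (M x)" by (simp add: card_C power2_eq_square)
 finally show ?thesis .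
qed

lemma norm_tau3_le:
 assumes a: "a : C" shows "norm (tau3 a t) <= real (Suc CARD('n)) / \<rho>^2 * norm t"
proof -
 have "norm (SUM b:C. (t \<bullet> (b - a)) *R E b a) <= (SUM b:C. norm ((t \<bullet> (b - a)) *R E b a))" by (rule norm_sum)
 also have "\<dots> <= (SUM b:C. norm t * h * (1 / \<rho>))"
 proof (rule sum_mono)
 fix b assume b: "b : C"
 have "norm (b - a) <= h" using dist_T[of b a] a b by (simp add: dist_norm hull_inc)
 then have "\<bar>t \<bullet> (b - a)\<bar> <= norm t * h" using order_trans[OF Cauchy_Schwarz_ineq2 mult_left_mono] by (metis norm_ge_zero)
 then show "norm ((t \<bullet> (b - a)) *R E b a) <= norm t * h * (1 / \<rho>)"
 unfolding norm_scaleR using norm_E[OF a b] h rho by (intro mult_mono) auto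
 qed
 also have "\<dots> = real (Suc CARD('n)) * (norm t * h * (1 / \<rho>))" by (simp add: card_C)
 finally have "norm (dev (SUM b:C. (t \<bullet> (b - a)) *R E b a)) <= real (Suc CARD('n)) * (norm t * h * (1 / \<rho>))"
 by (rule order_trans[OF norm_dev_le])
 then have "norm (tau3 a t) <= (1 / (\<rho> * h)) * (real (Suc CARD('n)) * (norm t * h * (1 / \<rho>)))"
 unfolding tau3_def norm_scaleR abs_norm_cancel using norm_g_le[OF a] rho h by (intro mult_mono) auto
 then show ?thesis using h by (simp add: power2_eq_square mult_ac)
qed

text \<open>Completing the square: \<open>m * (m + r)\<close> is at least
  \<open>m^2 / 2 - r^2 / 2\<close>. Here \<open>r\<close> comes from the perturbation
  \<open>R\<close>, in whose term the weight \<open>bc a\<close> is estimated by one.\<close>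

lemma tau1_pointwise:
 assumes x: "x : T" and M: "trace (M x) = 0" and R: "trace R = 0"
 shows "(1/2) * (SUM a:C. SUM b:C. bc a x * (M x \<bullet> E b a)^2) - ((real (Suc CARD('n)))^2 / (2 * \<rho>^2)) * (norm R)^2
 <= - (tau1 M x \<bullet> (M x + R))"
proof -
 have "(1/2) * (bc a x * (M x \<bullet> E b a)^2) - 1 / (2 * \<rho>^2) * (norm R)^2
 <= (bc a x * (M x \<bullet> E b a)) * (dev (E b a) \<bullet> (M x + R))" if ab: "a : C" "b : C" for a b
 proof -
 let ?m = "M x \<bullet> E b a" and ?r = "E b a \<bullet> R" and ?l = "bc a x"
 have l: "0 <= ?l" "?l <= 1" using bary_le_1[OF ab(1) x] x ab(1) mem_T by auto
 have tr: "trace (M x + R) = 0" using M R by (simp add: linear_add[OF linear_trace])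
 have "dev (E b a) \<bullet> (M x + R) = ?m + ?r" unfolding dev_inner[OF tr] by (simp add: inner_add_right inner_commute[of "M x"])
 moreover have "?l * (?m^2 / 2 - ?r^2 / 2) <= ?l * (?m * (?m + ?r))"
 proof (rule mult_left_mono[OF _ l(1)])
 have "0 <= (?m + ?r)^2" by simp
 then show "?m^2 / 2 - ?r^2 / 2 <= ?m * (?m + ?r)" by (simp add: power2_sum power2_eq_square algebra_simps)
 qed
 moreover have "?l * (?r^2 / 2) <= 1 / (2 * \<rho>^2) * (norm R)^2"
 proof -
 have "\<bar>?r\<bar> <= (1 / \<rho>) * norm R"
 by (rule order_trans[OF Cauchy_Schwarz_ineq2 mult_right_mono[OF norm_E[OF ab]]]) simp
 then have "?r^2 <= ((1 / \<rho>) * norm R)^2" by (rule power2_le_iff_abs_le[THEN iffD2, rotated]) (use rho in simp)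
 moreover have "?l * (?r^2 / 2) <= 1 * (?r^2 / 2)" using l by (intro mult_right_mono) auto
 ultimately show ?thesis by (simp add: power_mult_distrib power_divide)
 qed
 ultimately show ?thesis by (simp add: algebra_simps)
 qed
 then have "(SUM a:C. SUM b:C. (1/2) * (bc a x * (M x \<bullet> E b a)^2) - 1 / (2 * \<rho>^2) * (norm R)^2)
 <= (SUM a:C. SUM b:C. (bc a x * (M x \<bullet> E b a)) * (dev (E b a) \<bullet> (M x + R)))"
 by (intro sum_mono)
 also have "\<dots> = - (tau1 M x \<bullet> (M x + R))" by (simp add: tau1_def inner_sum_left)
 finally show ?thesis by (simp add: sum_subtractf sum_distrib_left card_C power2_eq_square mult_ac)
qed

end

lemma L2_ball_dominates:
 assumes rho: "\<rho> > 0"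
 shows "\<exists>K>0. ALL C z h p. shaped_simplex C (z :: real^'n::{finite,wellorder}) h \<rho> --> p : polys k (UNIV :: 'v::euclidean_space set) -->
 integral (convex hull C) (%x. (norm (p x))^2) <= K * integral (cball z (\<rho> * h / 2)) (%x. (norm (p x))^2)"
proof -
 let ?V = "unit_ball_vol CARD('n)"
 obtain c where c: "c > 0 & (ALL C z h p x. shaped_simplex C (z :: real^'n::_) h \<rho> --> p : polys k (UNIV :: 'v set) --> x : cball z h -->
 c * h ^ CARD('n) * (norm (p x))^2 <= integral (cball z (\<rho> * h / 2)) (%x. (norm (p x))^2))"
 using L2_lower_shaped[OF rho, where K=k and 'n='n and 'v='v] by blast
 have "integral (convex hull C) (%x. (norm (p x))^2) <= (?V / c) * integral (cball z (\<rho> * h / 2)) (%x. (norm (p x))^2)"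
 if S: "shaped_simplex C z h \<rho>" and p: "p : polys k (UNIV :: 'v set)" for C and z :: "real^'n::_" and h p
 proof -
 interpret shaped_simplex C z h \<rho> by (rule S)
 let ?I = "integral (cball z (\<rho> * h / 2)) (%x. (norm (p x))^2)"
 have cp: "continuous_on D (%x. (norm (p x))^2)" for D by (intro continuous_intros polys_cont[OF p])
 have I0: "0 <= ?I" by (intro integral_nonneg integrable_compact compact_cball cp) simp
 have "integral T (%x. (norm (p x))^2) <= (?I / (c * h ^ CARD('n))) * ?V * h ^ CARD('n)"
 proof (rule integral_T_le[OF cp])
 fix x assume "x : T"
 then have "x : cball z h" using T_subset[OF z_in_T] by blast
 then have "c * h ^ CARD('n) * (norm (p x))^2 <= ?I" using c S p by blast
 then show "(norm (p x))^2 <= ?I / (c * h ^ CARD('n))" using c h by (simp add: field_simps)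
 qed (use I0 c h in simp)
 then show ?thesis using h by (simp add: mult.commute)
 qed
 moreover have "?V / c > 0" using c by simp
 ultimately show ?thesis by blast
qed

lemma tau1_test:
 assumes rho: "\<rho> > 0"
 shows "\<exists>c>0. \<exists>K>0. ALL C z h M R. shaped_simplex C (z :: real^'n::{finite,wellorder}) h \<rho> --> M : polys k UNIV -->
 (ALL x. trace (M x) = 0) --> continuous_on UNIV R --> (ALL x. trace (R x) = 0) -->
 c * integral (convex hull C) (%x. (norm (M x))^2) - K * integral (convex hull C) (%x. (norm (R x))^2)
 <= - integral (convex hull C) (%x. full_simplex.tau1 C M x \<bullet> (M x + R x)) &
 integral (convex hull C) (%x. (norm (full_simplex.tau1 C M x))^2) <= K * integral (convex hull C) (%x. (norm (M x))^2)"
proof -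
 obtain K0 where K0: "K0 > 0 & (ALL C z h p. shaped_simplex C (z :: real^'n::_) h \<rho> --> p : polys k (UNIV :: (real^'n::_^'n::_) set) -->
 integral (convex hull C) (%x. (norm (p x))^2) <= K0 * integral (cball z (\<rho> * h / 2)) (%x. (norm (p x))^2))"
 using L2_ball_dominates[OF rho, where k=k and 'n='n and 'v="real^'n::_^'n::_"] by blast
 let ?N = "(real (Suc CARD('n)))^2"
 define Q where "Q = CARD('n) * ?N / \<rho>^2"
 have Q: "Q > 0" using rho by (simp add: Q_def)
 \<comment> \<open>Passing to the half ball costs \<open>K0\<close>, going from the matrix to its
   products with \<open>E\<close> costs \<open>Q\<close>, inserting the weights costs
   \<open>2 / \<rho>\<close>, and \<open>tau1_pointwise\<close> leaves half of the weighted
   sum.\<close>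
 define c where "c = (\<rho> / 4) / (Q * K0)"
 have c: "c > 0" using rho Q K0 by (simp add: c_def)
 define K where "K = ?N / (2 * \<rho>^2) + (?N / \<rho>^2)^2"
 have K: "K > 0" using rho by (simp add: K_def add_pos_pos)
 have "c * integral (convex hull C) (%x. (norm (M x))^2) - K * integral (convex hull C) (%x. (norm (R x))^2)
 <= - integral (convex hull C) (%x. full_simplex.tau1 C M x \<bullet> (M x + R x)) &
 integral (convex hull C) (%x. (norm (full_simplex.tau1 C M x))^2) <= K * integral (convex hull C) (%x. (norm (M x))^2)"
 if S: "shaped_simplex C z h \<rho>" and M: "M : polys k UNIV" "ALL x. trace (M x) = 0"
 and R: "continuous_on UNIV R" "ALL x. trace (R x) = 0" for C and z :: "real^'n::_" and h M and R :: "real^'n::_ => real^'n::_^'n::_"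
 proof -
 interpret shaped_simplex C z h \<rho> by (rule S)
 have cM: "continuous_on D M" for D by (rule polys_cont[OF M(1)])
 have cR: "continuous_on D R" for D by (rule continuous_on_subset[OF R(1)]) simp
 have ct: "continuous_on D (tau1 M)" for D by (rule polys_cont[OF tau1_polys[OF M(1)]])
 let ?q = "%x. SUM a:C. SUM b:C. bc a x * (M x \<bullet> E b a)^2"
 have cq: "continuous_on D ?q" for D by (intro continuous_intros cM continuous_bc)
 have cq': "continuous_on D (%x. c' * ?q x)" for D c' by (rule continuous_on_mult_left[OF cq])
 have cM2: "continuous_on D (%x. (norm (M x))^2)" and cR2: "continuous_on D (%x. c' * (norm (R x))^2)" for D c'
 by (intro continuous_intros cM cR)+
 have IM0: "0 <= integral T (%x. (norm (M x))^2)" and IR0: "0 <= integral T (%x. (norm (R x))^2)"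
 by (intro integral_nonneg integrable_compact compact_T continuous_intros cM cR; simp)+
 have "integral T (%x. (norm (M x))^2) <= K0 * integral (cball z (\<rho> * h / 2)) (%x. (norm (M x))^2)"
 using K0 S M(1) by blast
 also have "\<dots> <= K0 * ((Q * (2 / \<rho>)) * integral T ?q)"
 proof (rule mult_left_mono)
 have "integral (cball z (\<rho> * h / 2)) (%x. (norm (M x))^2) <= integral (cball z (\<rho> * h / 2)) (%x. (Q * (2 / \<rho>)) * ?q x)"
 proof (intro integral_le integrable_compact compact_cball cM2 cq')
 fix x assume x: "x : cball z (\<rho> * h / 2)"
 have "(SUM a:C. SUM b:C. (M x \<bullet> E b a)^2) <= (SUM a:C. SUM b:C. (2 / \<rho>) * (bc a x * (M x \<bullet> E b a)^2))"
 proof (intro sum_mono)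
 fix a b assume "a : C" "b : C"
 have "1 <= (2 / \<rho>) * bc a x" using bary_half_ball[OF \<open>a : C\<close> x] rho by (simp add: field_simps)
 from mult_right_mono[OF this, of "(M x \<bullet> E b a)^2"]
 show "(M x \<bullet> E b a)^2 <= (2 / \<rho>) * (bc a x * (M x \<bullet> E b a)^2)" by (simp add: mult.assoc)
 qed
 also have "\<dots> = (2 / \<rho>) * ?q x" by (simp add: sum_distrib_left)
 finally have "Q * (SUM a:C. SUM b:C. (M x \<bullet> E b a)^2) <= Q * ((2 / \<rho>) * ?q x)" using Q by (intro mult_left_mono) auto
 then show "(norm (M x))^2 <= (Q * (2 / \<rho>)) * ?q x" using norm_le_E[of "M x"] unfolding Q_def by (simp add: mult.assoc)
 qed
 also have "\<dots> = (Q * (2 / \<rho>)) * integral (cball z (\<rho> * h / 2)) ?q" by (rule integral_mult_right)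
 also have "\<dots> <= (Q * (2 / \<rho>)) * integral T ?q"
 using Q rho by (intro mult_left_mono integral_T_ge_ball cq) (auto intro!: sum_nonneg mult_nonneg_nonneg simp: mem_T)
 finally show "integral (cball z (\<rho> * h / 2)) (%x. (norm (M x))^2) <= (Q * (2 / \<rho>)) * integral T ?q" .
 qed (use K0 in simp)
 finally have "c * integral T (%x. (norm (M x))^2) <= c * (K0 * ((Q * (2 / \<rho>)) * integral T ?q))"
 using c by (intro mult_left_mono) auto
 also have "\<dots> = (1/2) * integral T ?q" unfolding c_def using K0 Q rho by (simp add: field_simps)
 finally have 1: "c * integral T (%x. (norm (M x))^2) <= (1/2) * integral T ?q" .
 have "integral T (%x. (1/2) * ?q x - (?N / (2 * \<rho>^2)) * (norm (R x))^2) <= integral T (%x. - (tau1 M x \<bullet> (M x + R x)))"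
 using M(2) R(2)
 by (intro integral_le integrable_compact compact_T continuous_on_diff cq' cR2 continuous_on_minus
 continuous_on_inner continuous_on_add cR cM ct tau1_pointwise) auto
 moreover have "integral T (%x. (1/2) * ?q x - (?N / (2 * \<rho>^2)) * (norm (R x))^2)
 = (1/2) * integral T ?q - (?N / (2 * \<rho>^2)) * integral T (%x. (norm (R x))^2)"
 by (simp only: integral_diff[OF integrable_compact[OF compact_T cq'] integrable_compact[OF compact_T cR2]] integral_mult_right)
 moreover have "(?N / (2 * \<rho>^2)) * integral T (%x. (norm (R x))^2) <= K * integral T (%x. (norm (R x))^2)"
 using IR0 by (intro mult_right_mono) (simp_all add: K_def)
 ultimately have A: "c * integral T (%x. (norm (M x))^2) - K * integral T (%x. (norm (R x))^2) <= - integral T (%x. tau1 M x \<bullet> (M x + R x))"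
 using 1 by (simp add: integral_neg)
 have "integral T (%x. (norm (tau1 M x))^2) <= integral T (%x. (?N / \<rho>^2)^2 * (norm (M x))^2)"
 proof (intro integral_le integrable_compact compact_T continuous_intros cM ct)
 fix x assume "x : T"
 from power_mono[OF norm_tau1_le[OF this, of M] norm_ge_zero, of 2]
 show "(norm (tau1 M x))^2 <= (?N / \<rho>^2)^2 * (norm (M x))^2" by (simp only: power_mult_distrib)
 qed
 also have "\<dots> = (?N / \<rho>^2)^2 * integral T (%x. (norm (M x))^2)" by (rule integral_mult_right)
 also have "\<dots> <= K * integral T (%x. (norm (M x))^2)" using IM0 by (intro mult_right_mono) (simp_all add: K_def)
 finally show ?thesis using A by blast
 qed
 then show ?thesis using c K by blast
qed

text \<open>The extension \<open>q (pr a x)\<close>, constant in the normal direction, is again a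
  polynomial. Near the centroid of the facet its norm is bounded by the facet integral
  (\<open>FI_lower\<close>), and this controls a polynomial on the whole element.\<close>

lemma facet_extension:
 assumes rho: "\<rho> > 0"
 shows "\<exists>K>0. ALL C z h q. ALL a:C. shaped_simplex C (z :: real^'n::{finite,wellorder}) h \<rho> --> q : polys k (UNIV :: 'v::euclidean_space set) -->
 integral (convex hull C) (%x. (norm (q (full_simplex.pr C a x)))^2) <= K * h * FI (convex hull (C - {a})) (%x. (norm (q x))^2)"
proof -
 let ?V = "unit_ball_vol CARD('n)" and ?n = "real CARD('n)"
 define R where "R = max 1 (?n / \<rho>)"
 have R: "R >= 1" by (simp add: R_def)
 obtain c where c: "c > 0 & (ALL p z r x. p : polys k (UNIV :: 'v set) --> r > 0 --> x : cball z (R * r) -->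
 c * r ^ CARD('n) * (norm (p (x :: real^'n::_)))^2 <= integral (cball z r) (%x. (norm (p x))^2))"
 using polys_L2_lower[OF R, where 'n='n and 'v='v] by blast
 define K where "K = ?V * (?n / \<rho>) ^ CARD('n) * (2 * \<rho> / ?n) / c"
 have K: "K > 0" using c rho by (simp add: K_def)
 have "integral (convex hull C) (%x. (norm (q (full_simplex.pr C a x)))^2) <= K * h * FI (convex hull (C - {a})) (%x. (norm (q x))^2)"
 if a: "a : C" and S: "shaped_simplex C z h \<rho>" and q: "q : polys k (UNIV :: 'v set)" for C and z :: "real^'n::_" and h q a
 proof -
 interpret shaped_simplex C z h \<rho> by (rule S)
 define r where "r = \<rho> * h / CARD('n)"
 have r: "r > 0" using h rho by (simp add: r_def)
 define J where "J = FI (fac a) (%x. (norm (q x))^2)"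
 have cq: "continuous_on D (%x. (norm (q x))^2)" for D by (intro continuous_intros polys_cont[OF q])
 have J0: "0 <= J" unfolding J_def by (rule FI_nonneg[OF a cq]) simp
 have qp: "(%x. q (pr a x)) : polys k UNIV" by (rule polys_affine_compose[OF sU q polys_pr[OF a]])
 have cqp: "continuous_on D (%x. (norm (q (pr a x)))^2)" for D by (intro continuous_intros polys_cont[OF qp])
 have "integral (cball (cen a) r) (%x. (norm (q (pr a x)))^2) <= 2 * r * J"
 using FI_lower[OF a cq] by (simp add: r_def J_def)
 moreover have "c * r ^ CARD('n) * (norm (q (pr a x)))^2 <= integral (cball (cen a) r) (%x. (norm (q (pr a x)))^2)" if x: "x : T" for x
 proof -
 have "(?n / \<rho>) * r <= R * r" using r by (intro mult_right_mono) (simp_all add: R_def)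
 then have "h <= R * r" using rho by (simp add: r_def)
 moreover have "x : cball (cen a) h" using T_subset[of "cen a"] cen_in_fac[OF a] mem_fac[OF a] x by blast
 ultimately have "x : cball (cen a) (R * r)" by simp
 then show ?thesis using c qp r by blast
 qed
 ultimately have sup: "(norm (q (pr a x)))^2 <= 2 * r * J / (c * r ^ CARD('n))" if "x : T" for x
 using that c r by (simp add: pos_le_divide_eq mult.commute) (meson order_trans)
 have "integral T (%x. (norm (q (pr a x)))^2) <= (2 * r * J / (c * r ^ CARD('n))) * ?V * h ^ CARD('n)"
 using sup J0 r c by (intro integral_T_le cqp) auto
 also have "\<dots> = K * h * J" unfolding K_def r_def using h rho c by (simp add: field_simps power_mult_distrib power_divide)
 finally show ?thesis unfolding J_def .
 qed
 then show ?thesis using K by blast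
qed

section \<open>Symmetry of second derivatives and orthogonal projection\<close>

lemma pd_commute:
 fixes p :: "real^'n => real"
 assumes "p : polys k UNIV"
 shows "pd i (%x. pd j p x) x = pd j (%x. pd i p x) x"
proof -
 have "ALL x. pd i (%x. pd j p x) x = pd j (%x. pd i p x) x"
 using sU assms
 proof (induction rule: polys_induct)
 case (const k v)
 then show ?case by (simp add: pd_const)
 next
 case (coord k f l)
 have df: "f differentiable (at x)" "(%x. pd j f x) differentiable (at x)" "(%x :: real^'n. x $ l) differentiable (at x)" for x j
 using polys_diffable[OF coord(1)] polys_diffable[OF polys_pd[OF sU coord(1)]] polys_diffable[OF polys_coord] by auto
 have d1: "pd j (%x. x$l *R f x) x = x$l *R pd j f x + (if l = j then 1 else 0) *R f x" for j x
 unfolding pd_scaleR[OF df(3,1)] pd_coord ..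
 have d2: "pd i (%x. x$l *R pd j f x + (if l = j then 1 else 0) *R f x) x =
 x$l *R pd i (%x. pd j f x) x + (if l = i then 1 else 0) *R pd j f x + (if l = j then 1 else 0) *R pd i f x" for i j x
 proof -
 have a: "(%x. x$l *R pd j f x) differentiable (at x)" by (intro differentiable_scaleR df)
 have b: "(%x. (if l = j then 1 else 0 :: real) *R f x) differentiable (at x)" by (intro differentiable_scaleR df differentiable_const)
 show ?thesis unfolding pd_add[OF a b] pd_scaleR[OF df(3,2)] pd_scaleR[OF differentiable_const df(1)] pd_coord pd_const by simp
 qed
 show ?case unfolding d1 d2 using coord(2) by auto
 next
 case (add k f g)
 have d: "f differentiable (at x)" "g differentiable (at x)" "(%x. pd j f x) differentiable (at x)" "(%x. pd j g x) differentiable (at x)" for x j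
 using polys_diffable[OF add(1)] polys_diffable[OF add(2)] polys_diffable[OF polys_pd[OF sU add(1)]]
 polys_diffable[OF polys_pd[OF sU add(2)]] by auto
 show ?case unfolding pd_add[OF d(1,2)] pd_add[OF d(3,4)] using add(3,4) by simp
 qed
 then show ?thesis by blast
qed

text \<open>Orthogonalising both \<open>f\<close> and \<open>g0\<close> against \<open>G\<close>
  gives \<open>p\<close> and \<open>u\<close>, and a multiple of \<open>u\<close> corrects
  \<open>p\<close>. The form \<open>I\<close> is merely positive semidefinite, so
  \<open>I u u\<close> may vanish for nonzero \<open>u\<close>.\<close>

lemma Gram_Schmidt:
 fixes I :: "('a => 'v::real_vector) => ('a => 'v) => real"
 assumes G: "finite G" "G \<subseteq> \<V>" and f: "f : \<V>"
 and add: "!!f g. f : \<V> ==> g : \<V> ==> (%x. f x + g x) : \<V>" and scale: "!!f c. f : \<V> ==> (%x. c *R f x) : \<V>"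
 and Iadd: "!!f g h. f : \<V> ==> g : \<V> ==> h : \<V> ==> I (%x. f x + g x) h = I f h + I g h"
 and Iscale: "!!f g c. f : \<V> ==> g : \<V> ==> I (%x. c *R f x) g = c * I f g"
 and Isym: "!!f g. I f g = I g f" and Ipos: "!!f. f : \<V> ==> I f f >= 0"
 shows "EX c. (%x. f x - (SUM g:G. c g *R g x)) : \<V> & (ALL g:G. I (%x. f x - (SUM g:G. c g *R g x)) g = 0)"
 using G f
proof (induction G arbitrary: f rule: finite_induct)
 case empty
 then show ?case by simp
next
 case (insert g0 G)
 obtain c where c: "(%x. f x - (SUM g:G. c g *R g x)) : \<V>" "ALL g:G. I (%x. f x - (SUM g:G. c g *R g x)) g = 0"
 using insert.IH[of f] insert.prems by blast
 obtain d where d: "(%x. g0 x - (SUM g:G. d g *R g x)) : \<V>" "ALL g:G. I (%x. g0 x - (SUM g:G. d g *R g x)) g = 0"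
 using insert.IH[of g0] insert.prems by blast
 define p where "p x = f x - (SUM g:G. c g *R g x)" for x
 define u where "u x = g0 x - (SUM g:G. d g *R g x)" for x
 have pV: "p : \<V>" and uV: "u : \<V>" using c(1) d(1) by (simp_all add: p_def[abs_def] u_def[abs_def])
 have pG: "I p g = 0" and uG: "I u g = 0" if "g : G" for g
 using c(2) d(2) that by (simp_all add: p_def[abs_def] u_def[abs_def])
 define t where "t = I p u / I u u"
 have tu: "I p u = t * I u u"
 \<comment> \<open>Here \<open>t\<close> is 0 by the convention for division. If
   \<open>I p u\<close> were nonzero, the square of \<open>p + s *R u\<close> would be affine in
   \<open>s\<close> and negative somewhere; the chosen \<open>s\<close> gives the value -1.\<close>
 proof (cases "I u u = 0")
 case True
 have "I p u = 0"
 proof (rule ccontr)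
 assume ne: "I p u ~= 0"
 define s where "s = - (I p p + 1) / (2 * I p u)"
 have V: "(%x. s *R u x) : \<V>" "(%x. p x + s *R u x) : \<V>" using add[OF pV scale[OF uV]] scale[OF uV] by auto
 have "0 <= I (%x. p x + s *R u x) (%x. p x + s *R u x)" by (rule Ipos[OF V(2)])
 also have "\<dots> = I p (%x. p x + s *R u x) + s * I u (%x. p x + s *R u x)"
 unfolding Iadd[OF pV V(1) V(2)] Iscale[OF uV V(2)] ..
 also have "\<dots> = (I p p + s * I u p) + s * (I p u + s * I u u)"
 unfolding Isym[of p "%x. p x + s *R u x"] Isym[of u "%x. p x + s *R u x"] Iadd[OF pV V(1) pV] Iadd[OF pV V(1) uV]
 Iscale[OF uV pV] Iscale[OF uV uV] ..
 also have "\<dots> = I p p + 2 * s * I p u" using True Isym[of u p] by simp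
 also have "\<dots> = -1"
 proof -
 have "s * I p u = - (I p p + 1) / 2" using ne by (simp add: s_def)
 then show ?thesis by simp
 qed
 finally show False by simp
 qed
 then show ?thesis using True by simp
 qed (simp add: t_def)
 define c' where "c' g = (if g = g0 then t else c g - t * d g)" for g
 have e: "(%x. f x - (SUM g:insert g0 G. c' g *R g x)) = (%x. p x + (- t) *R u x)"
 proof
 fix x
 have "(SUM g:G. c' g *R g x) = (SUM g:G. c g *R g x - t *R (d g *R g x))"
 using insert.hyps by (intro sum.cong refl) (auto simp: c'_def algebra_simps)
 then have "(SUM g:G. c' g *R g x) = (SUM g:G. c g *R g x) - t *R (SUM g:G. d g *R g x)"
 by (simp add: sum_subtractf scaleR_sum_right)
 then show "f x - (SUM g:insert g0 G. c' g *R g x) = p x + (- t) *R u x"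
 using insert.hyps by (simp add: c'_def p_def u_def algebra_simps)
 qed
 have sV: "(%x. (- t) *R u x) : \<V>" by (rule scale[OF uV])
 have qV: "(%x. p x + (- t) *R u x) : \<V>" by (rule add[OF pV sV])
 have qI: "I (%x. p x + (- t) *R u x) w = I p w - t * I u w" if "w : \<V>" for w
 unfolding Iadd[OF pV sV that] Iscale[OF uV that] by simp
 have qG: "I (%x. p x + (- t) *R u x) g = 0" if "g : G" for g
 using qI[of g] pG[OF that] uG[OF that] that insert.prems by auto
 have sumG: "finite A ==> A \<subseteq> G ==> w : \<V> ==> (%x. w x + (SUM g:A. d g *R g x)) : \<V> &
 I (%x. w x + (SUM g:A. d g *R g x)) (%x. p x + (- t) *R u x) = I w (%x. p x + (- t) *R u x)" for A w
 proof (induction A rule: finite_induct)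
 case empty
 then show ?case by simp
 next
 case (insert a A)
 have aG: "a : G" and aV: "a : \<V>" using insert.prems \<open>insert g0 G \<subseteq> \<V>\<close> by auto
 let ?w = "%x. w x + (SUM g:A. d g *R g x)"
 have IH: "?w : \<V>" "I ?w (%x. p x + (- t) *R u x) = I w (%x. p x + (- t) *R u x)" using insert by auto
 have e: "(%x. w x + (SUM g:insert a A. d g *R g x)) = (%x. ?w x + d a *R a x)"
 using insert.hyps by (simp add: algebra_simps)
 have "I (%x. ?w x + d a *R a x) (%x. p x + (- t) *R u x) = I w (%x. p x + (- t) *R u x)"
 unfolding Iadd[OF IH(1) scale[OF aV] qV] Iscale[OF aV qV] IH(2) using Isym[of a "%x. p x + (- t) *R u x"] qG[OF aG] by simp
 then show ?case unfolding e using add[OF IH(1) scale[OF aV]] by blast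
 qed
 have "I (%x. p x + (- t) *R u x) g0 = I g0 (%x. p x + (- t) *R u x)" by (rule Isym)
 also have "\<dots> = I (%x. u x + (SUM g:G. d g *R g x)) (%x. p x + (- t) *R u x)"
 by (simp add: u_def)
 also have "I (%x. u x + (SUM g:G. d g *R g x)) (%x. p x + (- t) *R u x) = I u (%x. p x + (- t) *R u x)"
 using sumG[OF insert.hyps(1) order_refl uV] by blast
 also have "\<dots> = I p u - t * I u u" by (rule trans[OF Isym qI[OF uV]])
 also have "\<dots> = 0" using tu by simp
 finally have "I (%x. p x + (- t) *R u x) g0 = 0" .
 then show ?case using qG qV by (intro exI[of _ c'], unfold e) blast
qed

text \<open>Monomials times a finite basis of \<open>V\<close> span the space of lower degree, so
  orthogonality to these finitely many functions suffices.\<close>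

lemma polys_L2_projection:
 fixes f :: "real^'n => 'v::euclidean_space"
 assumes T: "compact T" and V: "subspace V" and f: "f : polys k V" and l: "l <= k"
 obtains r where "r : polys l V" "!!s. s : polys l V ==> integral T (%x. (f x - r x) \<bullet> s x) = 0"
proof -
 obtain B where B: "finite B" "span B = V" "B \<subseteq> V"
 using basis_subspace_exists[OF V] by (metis span_subspace)
 define m where "m \<alpha> b x = (PROD i:UNIV. (x$i) ^ \<alpha> i) *R b" for \<alpha> :: "'n => nat" and b :: 'v and x :: "real^'n"
 define G where "G = (%(\<alpha>, b). m \<alpha> b) ` ({\<alpha>. sum \<alpha> UNIV <= l} \<times> B)"
 have finG: "finite G" unfolding G_def using finite_multi_indices B(1) by blast
 have mG: "m \<alpha> b : polys l V" if "sum \<alpha> UNIV <= l" "b : V" for \<alpha> b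
 unfolding m_def[abs_def] using that by (intro polys_monomial V)
 have GV: "G \<subseteq> polys l V" using mG B(3) by (auto simp: G_def)
 have int: "(%x. p x \<bullet> q x) integrable_on T" if "p : polys k V" "q : polys k V" for p q
 by (intro integrable_compact T continuous_intros polys_cont[OF that(1)] polys_cont[OF that(2)])
 obtain c where c: "(%x. f x - (SUM g:G. c g *R g x)) : polys k V" "ALL g:G. integral T (%x. (f x - (SUM g:G. c g *R g x)) \<bullet> g x) = 0"
 proof -
 have "EX c. (%x. f x - (SUM g:G. c g *R g x)) : polys k V & (ALL g:G. integral T (%x. (f x - (SUM g:G. c g *R g x)) \<bullet> g x) = 0)"
 proof (rule Gram_Schmidt[where I = "%p q. integral T (%x. p x \<bullet> q x)"])
 show "G \<subseteq> polys k V" using GV polys_mono[OF V _ l] by blast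
 show "integral T (%x. (p x + q x) \<bullet> w x) = integral T (%x. p x \<bullet> w x) + integral T (%x. q x \<bullet> w x)"
 if "p : polys k V" "q : polys k V" "w : polys k V" for p q w
 unfolding inner_add_left by (intro integral_add int that)
 show "integral T (%x. p x \<bullet> p x) >= 0" if "p : polys k V" for p by (intro integral_nonneg int that) simp
 qed (auto intro: finG f polys_add[OF V] polys_scaleR[OF V] simp: inner_commute)
 then show thesis using that by blast
 qed
 define r where "r x = (SUM g:G. c g *R g x)" for x
 have r: "r : polys l V" unfolding r_def[abs_def] using GV by (intro polys_sum polys_scaleR V) blast
 have fr: "(%x. f x - r x) : polys k V" using c(1) by (simp add: r_def)
 have "integral T (%x. (f x - r x) \<bullet> s x) = 0" if s: "s : polys l V" for s
 proof -
 obtain d where d: "range d \<subseteq> V" and sd: "s = (%x. SUM \<alpha>:{\<alpha>. sum \<alpha> UNIV <= l}. m \<alpha> (d \<alpha>) x)"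
 using s unfolding polys_def m_def by blast
 have zero: "integral T (%x. (f x - r x) \<bullet> m \<alpha> b x) = 0" if \<alpha>: "sum \<alpha> UNIV <= l" and b: "b : V" for \<alpha> b
 proof -
 obtain w where w: "b = (SUM a:B. w a *R a)" using b B(2) span_finite[OF B(1)] by auto
 have "m \<alpha> b x = (SUM a:B. w a *R m \<alpha> a x)" for x by (simp add: m_def w scaleR_sum_right mult.commute)
 then have "integral T (%x. (f x - r x) \<bullet> m \<alpha> b x) = integral T (%x. SUM a:B. w a * ((f x - r x) \<bullet> m \<alpha> a x))"
 by (simp add: inner_sum_right)
 also have "\<dots> = (SUM a:B. integral T (%x. w a * ((f x - r x) \<bullet> m \<alpha> a x)))"
 proof (rule integral_sum[OF B(1)])
 fix a assume a: "a : B"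
 show "(%x. w a * ((f x - r x) \<bullet> m \<alpha> a x)) integrable_on T"
 using int[OF fr polys_mono[OF V mG[OF \<alpha>] l]] a B(3) by (intro integrable_on_mult_right) blast
 qed
 also have "\<dots> = 0"
 proof (intro sum.neutral ballI)
 fix a assume "a : B"
 then have "m \<alpha> a : G" unfolding G_def using \<alpha> by force
 then have "integral T (%x. (f x - r x) \<bullet> m \<alpha> a x) = 0" using c(2) by (simp add: r_def)
 then show "integral T (%x. w a * ((f x - r x) \<bullet> m \<alpha> a x)) = 0" by simp
 qed
 finally show ?thesis .
 qed
 have dV: "d \<alpha> : V" for \<alpha> using d by blast
 have "integral T (%x. (f x - r x) \<bullet> s x) = (SUM \<alpha>:{\<alpha>. sum \<alpha> UNIV <= l}. integral T (%x. (f x - r x) \<bullet> m \<alpha> (d \<alpha>) x))"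
 unfolding sd inner_sum_right
 proof (rule integral_sum[OF finite_multi_indices])
 fix \<alpha> :: "'n => nat" assume "\<alpha> : {\<alpha>. sum \<alpha> UNIV <= l}"
 then show "(%x. (f x - r x) \<bullet> m \<alpha> (d \<alpha>) x) integrable_on T" using int[OF fr polys_mono[OF V mG l]] dV by blast
 qed
 also have "\<dots> = 0" using zero dV by (intro sum.neutral) blast
 finally show ?thesis .
 qed
 with r that show thesis by blast
qed

text \<open>What the dimension-specific bubbles must deliver. \<open>W\<close> is a curl bubble made
  from \<open>\<gamma> - \<gamma> z\<close>: its deviator splits into a part \<open>\<sigma>\<close>
  of degree \<open>k\<close>, admissible in \<open>Sigma_h\<close>, and a part
  \<open>\<delta>\<close> from the local bubble space. The lower bound is uniform in
  \<open>v\<close> because the curl of a field with zero tangential trace is orthogonal to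
  gradients, so that only \<open>\<gamma>\<close> is seen.\<close>

definition bubble_property ::
 "nat => ((real^'n::{finite,wellorder}) set => (real^'n::_ => real^'n::_^'n::_) set) => real => bool" where
 "bubble_property k D \<rho> \<longleftrightarrow> (\<exists>c>0. \<exists>K>0. ALL C z h \<gamma>. shaped_simplex C z h \<rho> --> \<gamma> : polys k skew -->
 (EX W \<sigma> \<delta>. W : polys (Suc k) UNIV & (ALL x. dev (W x) = \<sigma> x + \<delta> x) & \<sigma> : polys k UNIV & (ALL x. trace (\<sigma> x) = 0) &
 (ALL a:C. ALL x:convex hull (C - {a}). nt_trace (full_simplex.nu C a) (\<sigma> x) = 0) & \<delta> : D (convex hull C) &
 (ALL a:C. ALL x:convex hull (C - {a}). nt_trace (full_simplex.nu C a) (dev (W x)) = 0) &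
 integral (convex hull C) (%x. (norm (W x))^2) <= K * integral (convex hull C) (%x. (norm (\<gamma> x - \<gamma> z))^2) &
 (ALL v:polys (Suc k) UNIV. c * h^2 * integral (cball z (\<rho> * h / 2)) (%x. SUM j:UNIV. (norm (pd j \<gamma> x))^2)
 <= - integral (convex hull C) (%x. W x \<bullet> (jacobian v (at x) - \<gamma> x)))))"

text \<open>A Poincare inequality by the mean value theorem. The partial derivatives are collected
  into one vector-valued polynomial so that the sup bound applies to them jointly.\<close>

lemma oscillation_le_gradient:
 assumes rho: "\<rho> > 0"
 shows "\<exists>K>0. ALL C z h p. shaped_simplex C (z :: real^'n::{finite,wellorder}) h \<rho> --> p : polys k (UNIV :: 'v::euclidean_space set) -->
 integral (convex hull C) (%x. (norm (p x - p z))^2) <= K * h^2 * integral (cball z (\<rho> * h / 2)) (%x. SUM j:UNIV. (norm (pd j p x))^2)"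
proof -
 let ?V = "unit_ball_vol CARD('n)"
 obtain c where c: "c > 0 & (ALL C z h p x. shaped_simplex C (z :: real^'n::_) h \<rho> --> p : polys (k - 1) (UNIV :: ('v^'n::_) set) --> x : cball z h -->
 c * h ^ CARD('n) * (norm (p x))^2 <= integral (cball z (\<rho> * h / 2)) (%x. (norm (p x))^2))"
 using L2_lower_shaped[OF rho, where K="k - 1" and 'n='n and 'v="'v^'n::_"] by blast
 define K where "K = (real CARD('n))^2 * ?V / c"
 have K: "K > 0" using c by (simp add: K_def)
 have "integral (convex hull C) (%x. (norm (p x - p z))^2) <= K * h^2 * integral (cball z (\<rho> * h / 2)) (%x. SUM j:UNIV. (norm (pd j p x))^2)"
 if S: "shaped_simplex C z h \<rho>" and p: "p : polys k (UNIV :: 'v set)" for C and z :: "real^'n::_" and h p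
 proof -
 interpret shaped_simplex C z h \<rho> by (rule S)
 define q where "q x = (\<chi> j. pd j p x)" for x
 have q: "q : polys (k - 1) UNIV" unfolding q_def[abs_def] by (intro polys_vec polys_pd sU p)
 have nq: "(norm (q x))^2 = (SUM j:UNIV. (norm (pd j p x))^2)" for x
 unfolding power2_norm_eq_inner by (simp add: inner_vec_def q_def)
 define I where "I = integral (cball z (\<rho> * h / 2)) (%x. (norm (q x))^2)"
 have I0: "0 <= I" unfolding I_def by (intro integral_nonneg integrable_compact compact_cball continuous_intros polys_cont[OF q]) simp
 define A where "A = sqrt (I / (c * h ^ CARD('n)))"
 have A0: "A >= 0" using I0 c h by (simp add: A_def)
 have A2: "A^2 = I / (c * h ^ CARD('n))" using I0 c h by (simp add: A_def)
 have qA: "norm (q x) <= A" if "x : cball z h" for x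
 proof -
 have "c * h ^ CARD('n) * (norm (q x))^2 <= I" unfolding I_def using c S q that by blast
 then have "(norm (q x))^2 <= A^2" unfolding A2 using c h by (simp add: field_simps)
 then show ?thesis using A0 by (rule power2_le_imp_le)
 qed
 have der: "norm (frechet_derivative p (at x) \<xi>) <= (CARD('n) * A) * norm \<xi>" if "x : cball z h" for x \<xi>
 proof -
 have lin: "linear (frechet_derivative p (at x))" using polys_diffable[OF p] by (rule linear_frechet_derivative)
 have "\<xi> = (SUM i:UNIV. \<xi>$i *R axis i 1)" using basis_expansion[of \<xi>] by (simp add: scalar_mult_eq_scaleR)
 then have "frechet_derivative p (at x) \<xi> = frechet_derivative p (at x) (SUM i:UNIV. \<xi>$i *R axis i 1)" by (rule arg_cong)
 also have "\<dots> = (SUM i:UNIV. \<xi>$i *R pd i p x)" by (simp add: linear_sum[OF lin] linear_scale[OF lin])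
 also have "norm \<dots> <= (SUM i:(UNIV :: 'n set). norm \<xi> * A)"
 proof (rule order_trans[OF norm_sum sum_mono])
 fix i
 have "norm (pd i p x) <= A" using qA[OF that] Finite_Cartesian_Product.norm_nth_le[of "q x" i] by (simp add: q_def)
 then show "norm (\<xi>$i *R pd i p x) <= norm \<xi> * A"
 unfolding norm_scaleR using component_le_norm_cart[of \<xi> i] by (intro mult_mono) auto
 qed
 finally show ?thesis by (simp add: mult_ac)
 qed
 have osc: "(norm (p x - p z))^2 <= ((CARD('n) * A) * h)^2" if x: "x : T" for x
 proof (rule power_mono)
 have xz: "x : cball z h" using T_subset[OF z_in_T] x by blast
 have "norm (p x - p z) <= (CARD('n) * A) * norm (x - z)"
 proof (rule differentiable_bound[OF convex_cball[of z h]])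
 fix w assume w: "w : cball z h"
 show "(p has_derivative frechet_derivative p (at w)) (at w within cball z h)"
 using polys_diffable[OF p] frechet_derivative_works by (blast intro: has_derivative_at_withinI)
 show "onorm (frechet_derivative p (at w)) <= CARD('n) * A" using der[OF w] by (intro onorm_le)
 qed (use xz h in auto)
 also have "\<dots> <= (CARD('n) * A) * h" using xz A0 by (intro mult_left_mono) (auto simp: dist_norm norm_minus_commute)
 finally show "norm (p x - p z) <= (CARD('n) * A) * h" .
 qed simp
 have "integral T (%x. (norm (p x - p z))^2) <= ((CARD('n) * A) * h)^2 * ?V * h ^ CARD('n)"
 using osc by (intro integral_T_le continuous_intros polys_cont[OF p]) auto
 also have "\<dots> = (real CARD('n))^2 * ?V / c * h^2 * I" using h c unfolding power_mult_distrib A2 by (simp add: field_simps)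
 finally have "integral T (%x. (norm (p x - p z))^2) <= (real CARD('n))^2 * ?V / c * h^2 * I" .
 then show ?thesis unfolding I_def nq K_def by simp
 qed
 then show ?thesis using K by blast
qed

section \<open>Curl bubbles: what both dimensions share\<close>

lemma polys_value:
 assumes V: "subspace V" and p: "p : polys k V" shows "p x : V"
proof -
 obtain c where c: "range c \<subseteq> V" "p = (%x. SUM \<alpha>:{\<alpha>. sum \<alpha> UNIV <= k}. (PROD i:UNIV. (x$i) ^ \<alpha> i) *R c \<alpha>)"
 using p unfolding polys_def by blast
 then show ?thesis unfolding c(2) by (intro subspace_sum subspace_scale V) auto
qed

lemma norm_mat_le:
 fixes M :: "real^'n^'m" and B :: real
 assumes "!!i j. \<bar>M$i$j\<bar> <= B"
 shows "norm M <= CARD('m) * (CARD('n) * B)"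
proof -
 have "norm (M$i) <= CARD('n) * B" for i
 using order_trans[OF norm_le_l1_cart sum_bounded_above[of UNIV "%j. \<bar>M$i$j\<bar>" B]] assms by simp
 then have "(SUM i:UNIV. norm (M$i)) <= CARD('m) * (CARD('n) * B)"
 using sum_bounded_above[of UNIV "%i. norm (M$i)" "CARD('n) * B"] by simp
 moreover have "norm M <= (SUM i:UNIV. norm (M$i))"
 unfolding norm_vec_def by (intro L2_set_le_sum) simp
 ultimately show ?thesis by (rule order_trans[rotated])
qed

lemma norm_mult_vec_le: "norm ((A :: real^'n^'m) *v x) <= norm A * norm x"
proof -
 have e: "(A *v x) $ i = A$i \<bullet> x" for i by (simp add: matrix_vector_mult_def inner_vec_def)
 have "norm (A *v x) = L2_set (%i. \<bar>A$i \<bullet> x\<bar>) UNIV" by (simp add: norm_vec_def e)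
 also have "\<dots> <= L2_set (%i. norm (A$i) * norm x) UNIV" by (intro L2_set_mono Cauchy_Schwarz_ineq2) simp
 also have "\<dots> = norm A * norm x" by (simp add: norm_vec_def L2_set_left_distrib)
 finally show ?thesis .
qed

context full_simplex
begin

lemma pd_bc: "a : C ==> pd j (bc a) x = g a $ j"
 using arg_cong[OF grad_bary[of a x], of "%v. v $ j"] by (simp add: grad_def)

lemma pd_bc_zero:
 assumes a: "a : C" and x: "bc a x = 0" and p: "p : polys k UNIV"
 shows "pd j (%x. bc a x *R p x) x = g a $ j *R p x"
 using pd_scaleR[OF polys_diffable[OF polys_bc[OF a]] polys_diffable[OF p], where j=j and x=x] x pd_bc[OF a, where j=j and x=x] by simp

lemma polys_prod_bc:
 assumes "A \<subseteq> C" shows "(%x. PROD a:A. bc a x) : polys (card A) UNIV"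
proof -
 have "finite A" using assms finite_C by (rule finite_subset)
 then show ?thesis using assms
 proof (induction A rule: finite_induct)
 case empty
 show ?case by (simp add: polys_const sU)
 next
 case (insert a A)
 then have a: "a : C" and A: "(%x. PROD a:A. bc a x) : polys (card A) UNIV" by auto
 show ?case using polys_mult[OF sU polys_bc[OF a] A] insert.hyps by simp
 qed
qed

lemma integral_div_vec_zero:
 fixes w :: "real^'n::_ => real^'n::_"
 assumes w: "w : polys m UNIV" and z: "!!c x. c : C ==> x : fac c ==> nu c \<bullet> w x = 0"
 shows "integral T (%x. SUM j:UNIV. pd j w x $ j) = 0"
proof -
 have pw: "(%x. w x $ j) : polys m UNIV" for j by (rule polys_nth[OF w])
 have e: "pd j w x $ j = pd j (%x. w x $ j) x" for j x by (rule pd_nth[OF polys_diffable[OF w], symmetric])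
 have "integral T (%x. SUM j:UNIV. pd j w x $ j) = (SUM j:UNIV. integral T (%x. pd j (%x. w x $ j) x))"
 unfolding e by (intro integral_sum integrable_compact compact_T polys_cont[OF polys_pd[OF sU pw]]) simp
 also have "\<dots> = (SUM j:UNIV. SUM c:C. (nu c $ j) * FI (fac c) (%x. w x $ j))"
 by (simp only: divergence_polys[OF pw])
 also have "\<dots> = (SUM c:C. SUM j:UNIV. (nu c $ j) * FI (fac c) (%x. w x $ j))" by (rule sum.swap)
 also have "\<dots> = (SUM c:C. 0)"
 proof (rule sum.cong[OF refl])
 fix c assume c: "c : C"
 have "(SUM j:UNIV. (nu c $ j) * FI (fac c) (%x. w x $ j)) = FI (fac c) (%x. SUM j:UNIV. (nu c $ j) * (w x $ j))"
 unfolding FI_cmult[OF c, symmetric]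
 by (rule FI_sum[OF c, symmetric]) (auto intro: continuous_on_mult_left polys_cont[OF pw])
 also have "\<dots> = FI (fac c) (%_. 0)"
 using z[OF c] by (intro FI_cong[OF c]) (simp add: inner_vec_def)
 also have "\<dots> = 0" by (rule FI_zero[OF c])
 finally show "(SUM j:UNIV. (nu c $ j) * FI (fac c) (%x. w x $ j)) = 0" .
 qed
 finally show ?thesis by simp
qed

end

context shaped_simplex
begin

lemma abs_bc_le: assumes a: "a : C" and x: "x : cball z h" shows "\<bar>bc a x\<bar> <= 1 + 1 / \<rho>"
proof -
 have "bc a x = bc a z + g a \<bullet> (x - z)" by (rule bary_affine[OF a])
 moreover have "\<bar>g a \<bullet> (x - z)\<bar> <= norm (g a) * norm (x - z)" by (rule Cauchy_Schwarz_ineq2)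
 moreover have "norm (g a) * norm (x - z) <= 1 / (\<rho> * h) * h"
 using x norm_g_le[OF a] h rho by (intro mult_mono) (auto simp: dist_norm norm_minus_commute)
 moreover have "1 / (\<rho> * h) * h = 1 / \<rho>" using h by simp
 moreover have "0 <= bc a z" "bc a z <= 1" using z_in_T bary_le_1[OF a z_in_T] a by (simp_all add: mem_T)
 ultimately show ?thesis by linarith
qed

lemma prod_bc_le:
 assumes A: "A \<subseteq> C" and x: "x : cball z h" shows "\<bar>PROD a:A. bc a x\<bar> <= (1 + 1 / \<rho>) ^ card A"
proof -
 have "(PROD a:A. \<bar>bc a x\<bar>) <= (PROD a:A. 1 + 1 / \<rho>)"
 by (intro prod_mono conjI abs_ge_zero abs_bc_le[OF _ x] subsetD[OF A])
 then show ?thesis by (simp only: abs_prod prod_constant)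
qed

lemma prod_bc_ge:
 assumes A: "A \<subseteq> C" and x: "x : cball z (\<rho> * h / 2)" shows "(\<rho> / 2) ^ card A <= (PROD a:A. bc a x)"
proof -
 have "(PROD a:A. \<rho> / 2) <= (PROD a:A. bc a x)"
 by (intro prod_mono conjI bary_half_ball[OF _ x] subsetD[OF A]) (use rho in simp_all)
 then show ?thesis by (simp only: prod_constant)
qed

lemma prod_bc_nonneg: "A \<subseteq> C ==> x : T ==> 0 <= (PROD a:A. bc a x)"
 by (intro prod_nonneg) (auto simp: mem_T)

end

text \<open>\<open>Wop T r\<close> stands for the outer curl of the inner curl of \<open>r\<close>
  times the bubble, and \<open>m\<close> for the power of \<open>1 / h\<close> it carries: one for
  each of the two derivatives, and in three dimensions two more from the gradients inside the matrix
  bubble.\<close>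

lemma bubble_propertyI:
 fixes Wop :: "(real^'n::{finite,wellorder}) set => (real^'n::_ => real^'n::_^'n::_) => real^'n::_ => real^'n::_^'n::_"
 assumes rho: "\<rho> > 0" and k: "k >= 1"
 and add: "!!C r s. full_simplex C ==> r : polys k skew ==> s : polys k skew ==>
 Wop (convex hull C) (%x. r x + s x) = (%x. Wop (convex hull C) r x + Wop (convex hull C) s x)"
 and scale: "!!C r t. full_simplex C ==> r : polys k skew ==>
 Wop (convex hull C) (%x. t *R r x) = (%x. t *R Wop (convex hull C) r x)"
 and deg: "!!C r j. full_simplex C ==> r : polys j skew ==> Wop (convex hull C) r : polys (Suc j) UNIV"
 and facet: "!!C r c x. full_simplex C ==> r : polys k skew ==> c : C ==> x : convex hull (C - {c}) ==>
 Wop (convex hull C) r x *v full_simplex.nu C c = 0"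
 and bound: "\<exists>K>0. ALL C z h r A. shaped_simplex C z h \<rho> --> r : polys k skew --> (ALL x:cball z h. norm (r x) <= A) -->
 (ALL x:cball z h. norm (Wop (convex hull C) r x) <= K * A / h ^ m)"
 and lower: "\<exists>c>0. ALL C z h r v. shaped_simplex C z h \<rho> --> r : polys k skew --> v : polys (Suc k) UNIV -->
 c * h^2 * integral (cball z (\<rho> * h / 2)) (%x. SUM j:UNIV. (norm (pd j r x))^2)
 <= h ^ m * (- integral (convex hull C) (%x. Wop (convex hull C) r x \<bullet> (jacobian v (at x) - r x)))"
 shows "bubble_property k (%T. {%x. dev (Wop T r x) |r. r : skew_polys_perp k T}) \<rho>"
proof -
 obtain Kb where Kb: "Kb > 0" "!!C z h r A x. shaped_simplex C z h \<rho> ==> r : polys k skew ==> (ALL x:cball z h. norm (r x) <= A) ==>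
 x : cball z h ==> norm (Wop (convex hull C) r x) <= Kb * A / h ^ m"
 using bound by blast
 obtain c1 where c1: "c1 > 0" "!!C z h r v. shaped_simplex C z h \<rho> ==> r : polys k skew ==> v : polys (Suc k) UNIV ==>
 c1 * h^2 * integral (cball z (\<rho> * h / 2)) (%x. SUM j:UNIV. (norm (pd j r x))^2)
 <= h ^ m * (- integral (convex hull C) (%x. Wop (convex hull C) r x \<bullet> (jacobian v (at x) - r x)))"
 using lower by blast
 obtain c where c: "c > 0 & (ALL C z h p x. shaped_simplex C (z :: real^'n::_) h \<rho> --> p : polys k (UNIV :: (real^'n::_^'n::_) set) --> x : cball z h -->
 c * h ^ CARD('n) * (norm (p x))^2 <= integral (cball z (\<rho> * h / 2)) (%x. (norm (p x))^2))"
 using L2_lower_shaped[OF rho, where K="k" and 'n='n and 'v="real^'n::_^'n::_"] by blast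
 let ?V = "unit_ball_vol CARD('n)"
 define K where "K = Kb^2 * ?V / c"
 have K: "K > 0" using c Kb by (simp add: K_def)
 have "EX W \<sigma> \<delta>. W : polys (Suc k) UNIV & (ALL x. dev (W x) = \<sigma> x + \<delta> x) & \<sigma> : polys k UNIV & (ALL x. trace (\<sigma> x) = 0) &
 (ALL a:C. ALL x:convex hull (C - {a}). nt_trace (full_simplex.nu C a) (\<sigma> x) = 0) &
 \<delta> : {%x. dev (Wop (convex hull C) r x) |r. r : skew_polys_perp k (convex hull C)} &
 (ALL a:C. ALL x:convex hull (C - {a}). nt_trace (full_simplex.nu C a) (dev (W x)) = 0) &
 integral (convex hull C) (%x. (norm (W x))^2) <= K * integral (convex hull C) (%x. (norm (\<gamma> x - \<gamma> z))^2) &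
 (ALL v:polys (Suc k) UNIV. c1 * h^2 * integral (cball z (\<rho> * h / 2)) (%x. SUM j:UNIV. (norm (pd j \<gamma> x))^2)
 <= - integral (convex hull C) (%x. W x \<bullet> (jacobian v (at x) - \<gamma> x)))"
 if S: "shaped_simplex C z h \<rho>" and \<gamma>: "\<gamma> : polys k skew" for C and z :: "real^'n::_" and h \<gamma>
 proof -
 interpret shaped_simplex C z h \<rho> by (rule S)
 have fs: "full_simplex C" by unfold_locales
 define \<beta> where "\<beta> x = \<gamma> x - \<gamma> z" for x
 have \<gamma>z: "\<gamma> z : skew" by (rule polys_value[OF subspace_skew \<gamma>])
 have \<beta>: "\<beta> : polys k skew" unfolding \<beta>_def[abs_def] by (intro polys_diff polys_const subspace_skew \<gamma> \<gamma>z)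
 have \<beta>U: "\<beta> : polys k UNIV" using \<beta> by (rule polys_UNIV)
 \<comment> \<open>Only the component orthogonal to degree \<open>k - 1\<close> may enter the bubble
   space. The remaining component \<open>r0\<close> has lower degree and yields a field of degree
   \<open>k\<close>, which belongs to the \<open>Sigma_h\<close> part.\<close>
 obtain r0 where r0: "r0 : polys (k - 1) skew" "!!s. s : polys (k - 1) skew ==> integral T (%x. (\<beta> x - r0 x) \<bullet> s x) = 0"
 using polys_L2_projection[OF compact_T subspace_skew \<beta>, of "k - 1"] by auto
 have r0k: "r0 : polys k skew" using r0(1) by (rule polys_mono[OF subspace_skew]) simp
 define ra where "ra x = h ^ m *R r0 x" for x
 define rb where "rb x = h ^ m *R (\<beta> x - r0 x)" for x
 have ra1: "ra : polys (k - 1) skew" unfolding ra_def[abs_def] by (intro polys_scaleR subspace_skew r0)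
 have ra: "ra : polys k skew" unfolding ra_def[abs_def] by (intro polys_scaleR subspace_skew r0k)
 have rb: "rb : polys k skew" unfolding rb_def[abs_def] by (intro polys_scaleR polys_diff subspace_skew r0k \<beta>)
 have rbp: "rb : skew_polys_perp k T" unfolding skew_polys_perp_def using rb r0(2) by (simp add: rb_def)
 \<comment> \<open>The factor \<open>h ^ m\<close> makes \<open>W\<close> comparable in size to
   \<open>\<beta>\<close>, whatever the element size.\<close>
 define W where "W x = h ^ m *R Wop T \<beta> x" for x
 have W_split: "W x = Wop T ra x + Wop T rb x" for x
 proof -
 have "(%x. ra x + rb x) = (%x. h ^ m *R \<beta> x)" by (simp add: ra_def rb_def fun_eq_iff algebra_simps)
 then show ?thesis using fun_cong[OF add[OF fs ra rb], of x] fun_cong[OF scale[OF fs \<beta>, of "h ^ m"], of x] by (simp add: W_def)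
 qed
 have nt0: "nt_trace n A = 0" if "A *v n = 0" for n and A :: "real^'n::_^'n::_" using that by (simp add: nt_trace_def nn_trace_def)
 have Wk: "W : polys (Suc k) UNIV" unfolding W_def[abs_def] by (intro polys_scaleR sU deg fs \<beta>)
 have ntW: "nt_trace (nu a) (dev (W x)) = 0" if "a : C" "x : fac a" for a x
 unfolding nt_trace_dev[OF norm_nu[OF that(1)]] W_def linear_scale[OF lin_nt] using nt0[OF facet[OF fs \<beta> that]] by simp
 have nts: "nt_trace (nu a) (dev (Wop T ra x)) = 0" if "a : C" "x : fac a" for a x
 unfolding nt_trace_dev[OF norm_nu[OF that(1)]] using nt0[OF facet[OF fs ra that]] by simp
 have sk: "(%x. dev (Wop T ra x)) : polys k UNIV"
 using polys_lin_image[OF linear_dev deg[OF fs ra1]] k by simp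
 have dW: "dev (W x) = dev (Wop T ra x) + dev (Wop T rb x)" for x unfolding W_split by (rule linear_add[OF linear_dev])
 have up: "integral T (%x. (norm (W x))^2) <= K * integral T (%x. (norm (\<beta> x))^2)"
 proof -
 define I where "I = integral T (%x. (norm (\<beta> x))^2)"
 have cb: "continuous_on A (%x. (norm (\<beta> x))^2)" for A by (intro continuous_intros polys_cont[OF \<beta>])
 have I0: "0 <= I" unfolding I_def by (intro integral_nonneg integrable_compact compact_T cb) simp
 have hI: "integral (cball z (\<rho> * h / 2)) (%x. (norm (\<beta> x))^2) <= I" unfolding I_def by (intro integral_T_ge_ball cb) simp
 define A where "A = sqrt (I / (c * h ^ CARD('n)))"
 have A0: "A >= 0" using I0 c h by (simp add: A_def)
 have A2: "A^2 = I / (c * h ^ CARD('n))" using I0 c h by (simp add: A_def)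
 have bA: "ALL x:cball z h. norm (\<beta> x) <= A"
 proof
 fix x assume "x : cball z h"
 then have "c * h ^ CARD('n) * (norm (\<beta> x))^2 <= I" using c S \<beta>U hI order_trans by blast
 then have "(norm (\<beta> x))^2 <= A^2" unfolding A2 using c h by (simp add: field_simps)
 then show "norm (\<beta> x) <= A" using A0 by (rule power2_le_imp_le)
 qed
 have Wb: "(norm (W x))^2 <= (Kb * A)^2" if x: "x : T" for x
 proof (rule power_mono)
 have "x : cball z h" using T_subset[OF z_in_T] x by blast
 then have "norm (Wop T \<beta> x) <= Kb * A / h ^ m" by (rule Kb(2)[OF S \<beta> bA])
 then show "norm (W x) <= Kb * A" using h by (simp add: W_def field_simps)
 qed simp
 have "integral T (%x. (norm (W x))^2) <= (Kb * A)^2 * ?V * h ^ CARD('n)"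
 using Wb by (intro integral_T_le continuous_intros polys_cont[OF Wk]) auto
 also have "\<dots> = K * I" unfolding power_mult_distrib A2 K_def using h c by (simp add: field_simps)
 finally show ?thesis unfolding I_def .
 qed
 have low: "c1 * h^2 * integral (cball z (\<rho> * h / 2)) (%x. SUM j:UNIV. (norm (pd j \<gamma> x))^2)
 <= - integral T (%x. W x \<bullet> (jacobian v (at x) - \<gamma> x))" if v: "v : polys (Suc k) UNIV" for v
 proof -
 \<comment> \<open>The constant \<open>\<gamma> z\<close> is the gradient of a linear field and can
   be absorbed in \<open>v\<close>; this trades \<open>\<gamma>\<close> for
   \<open>\<beta>\<close>.\<close>
 define v' where "v' x = v x - \<gamma> z *v x" for x
 have lin: "(%x. \<gamma> z *v x) : polys (Suc k) UNIV"
 by (rule polys_mono[OF sU polys_linear[OF matrix_vector_mul_linear]]) simp_all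
 have v': "v' : polys (Suc k) UNIV" unfolding v'_def[abs_def] by (intro polys_diff sU v lin)
 have pdl: "pd j (%x. \<gamma> z *v x) x = \<gamma> z *v axis j 1" for j x
 by (rule pd_eqI[OF linear_imp_has_derivative[OF matrix_vector_mul_linear]])
 have "jacobian v' (at x) $ i $ j = (jacobian v (at x) - \<gamma> z) $ i $ j" for x i j
 unfolding jacobian_nth v'_def[abs_def] pd_diff[OF polys_diffable[OF v] polys_diffable[OF lin]] pdl
 by (simp add: jacobian_nth matrix_vector_mult_def axis_def if_distrib cong: if_cong)
 then have j: "jacobian v' (at x) = jacobian v (at x) - \<gamma> z" for x by (simp add: vec_eq_iff)
 have pb: "pd j \<beta> x = pd j \<gamma> x" for j x
 unfolding \<beta>_def[abs_def] pd_diff[OF polys_diffable[OF \<gamma>] differentiable_const] pd_const by simp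
 have e: "h ^ m * (- integral T (%x. Wop T \<beta> x \<bullet> (jacobian v' (at x) - \<beta> x))) = - integral T (%x. W x \<bullet> (jacobian v (at x) - \<gamma> x))"
 unfolding W_def inner_scaleR_left integral_mult_right j \<beta>_def by (simp add: algebra_simps)
 show ?thesis using c1(2)[OF S \<beta> v'] unfolding e pb .
 qed
 have rbD: "(%x. dev (Wop T rb x)) : {%x. dev (Wop T r x) |r. r : skew_polys_perp k T}" using rbp by blast
 show ?thesis
 by (rule exI[of _ W], rule exI[of _ "%x. dev (Wop T ra x)"], rule exI[of _ "%x. dev (Wop T rb x)"],
 intro conjI Wk sk rbD allI dW trace_dev ballI ntW nts low up[unfolded \<beta>_def])
 qed
 then show ?thesis unfolding bubble_property_def using c1(1) K by blast
qed

lemma pd_inner: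
 fixes f g :: "real^'n => 'v::euclidean_space"
 assumes "f differentiable (at x)" "g differentiable (at x)"
 shows "pd j (%x. f x \<bullet> g x) x = f x \<bullet> pd j g x + pd j f x \<bullet> g x"
proof -
 have "(f has_derivative frechet_derivative f (at x)) (at x)" "(g has_derivative frechet_derivative g (at x)) (at x)"
 using assms frechet_derivative_works by blast+
 from has_derivative_inner[OF this] show ?thesis by (rule pd_eqI)
qed

lemma linear_column: "linear (column j :: real^'n^'m => _)"
 by (simp add: linear_iff column_def vec_eq_iff)

lemma column_nth: "column j A $ i = A $ i $ j"
 by (simp add: column_def)

lemma pd_column: "p : polys k V ==> pd j (%x. column i (p x :: real^'n^'m)) x = column i (pd j p x)"
 by (rule pd_linear[OF linear_column polys_diffable])

lemma pd_zero: "p : polys 0 V ==> subspace V ==> pd j (p :: real^'n => 'v::euclidean_space) x = 0"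
 by (simp add: polys_derivative_0)

text \<open>Row by row, a gradient is curl-free; this is what removes \<open>v\<close> from the
  lower bounds for the bubbles.\<close>

lemma pd_jacobian_commute:
 fixes v :: "real^'n => real^'n"
 assumes v: "v : polys k UNIV"
 shows "pd a (%x. jacobian v (at x)) x $ i $ b = pd b (%x. jacobian v (at x)) x $ i $ a"
proof -
 have j: "(%x. jacobian v (at x)) differentiable (at x)" for x by (rule polys_diffable[OF polys_jacobian[OF v]])
 have j': "(%x. jacobian v (at x) $ i) differentiable (at x)" for x by (rule polys_diffable[OF polys_nth[OF polys_jacobian[OF v]]])
 have e: "pd a (%x. jacobian v (at x)) x $ i $ b = pd a (%x. pd b (%x. v x $ i) x) x" for a b
 unfolding pd_nth[OF j, symmetric] pd_nth[OF j', symmetric] jacobian_nth pd_nth[OF polys_diffable[OF v]] ..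
 show ?thesis unfolding e by (rule pd_commute[OF polys_nth[OF v]])
qed

section \<open>Curl bubbles in two dimensions\<close>

lemma curl2_mat_nth:
 assumes "r differentiable (at x)"
 shows "curl2_mat r x $ i = pd 1 r x $ i $ 2 - pd 2 r x $ i $ 1"
 by (simp add: curl2_mat_def curl2_def Let_def jacobian_nth pd_nth[OF assms])

lemma rot2_nth: "rot2 \<phi> x $ i $ 1 = pd 2 \<phi> x $ i" "rot2 \<phi> x $ i $ 2 = - pd 1 \<phi> x $ i"
 by (simp_all add: rot2_def Let_def jacobian_nth)

lemma polys_curl2_mat:
 assumes "r : polys k V" shows "curl2_mat r : polys (k - 1) UNIV"
proof -
 have r: "r : polys k UNIV" using assms by (rule polys_UNIV)
 have "curl2_mat r = (%x. \<chi> i. pd 1 r x $ i $ 2 - pd 2 r x $ i $ 1)"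
 by (simp add: fun_eq_iff vec_eq_iff curl2_mat_nth[OF polys_diffable[OF r]])
 also have "\<dots> : polys (k - 1) UNIV"
 by (intro polys_vec polys_diff sU polys_nth polys_pd r)
 finally show ?thesis .
qed

lemma polys_rot2:
 assumes "\<phi> : polys k UNIV" shows "rot2 \<phi> : polys (k - 1) UNIV"
proof -
 have "rot2 \<phi> = (%x. \<chi> i j. if j = 1 then pd 2 \<phi> x $ i else - pd 1 \<phi> x $ i)"
 by (simp add: fun_eq_iff vec_eq_iff forall_2 rot2_nth)
 also have "\<dots> : polys (k - 1) UNIV"
 proof (intro polys_vec)
 fix i j :: 2
 show "(%x. if j = 1 then pd 2 \<phi> x $ i else - pd 1 \<phi> x $ i) : polys (k - 1) UNIV"
 using polys_nth[OF polys_pd[OF sU assms], of 2 i] polys_uminus[OF sU polys_nth[OF polys_pd[OF sU assms], of 1 i]]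
 by (cases "j = 1") (simp_all only: if_True if_False simp_thms)
 qed
 finally show ?thesis .
qed

definition W2 :: "(real^2) set => (real^2 => real^2^2) => real^2 => real^2^2" where
 "W2 T r = rot2 (%y. bubble2 T y *R curl2_mat r y)"

lemma
 assumes fs: "full_simplex (C :: (real^2) set)"
 shows bubble2_eq: "bubble2 (convex hull C) = (%x. PROD a:C. bary (convex hull C) a x)"
 and polys_bubble2: "bubble2 (convex hull C) : polys 3 UNIV"
proof -
 interpret full_simplex C by (rule fs)
 show e: "bubble2 T = (%x. PROD a:C. bc a x)" by (simp add: bubble2_def fun_eq_iff vertices_T)
 show "bubble2 T : polys 3 UNIV" unfolding e using polys_prod_bc[OF order_refl] card_C by simp
qed

lemma polys_W2_aux:
 assumes fs: "full_simplex (C :: (real^2) set)" and r: "r : polys k V"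
 shows "(%y. bubble2 (convex hull C) y *R curl2_mat r y) : polys (3 + (k - 1)) UNIV"
 by (rule polys_mult[OF sU polys_bubble2[OF fs] polys_curl2_mat[OF r]])

lemma W2_add:
 assumes fs: "full_simplex (C :: (real^2) set)" and r: "r : polys k V" and s: "s : polys k V"
 shows "W2 (convex hull C) (%x. r x + s x) = (%x. W2 (convex hull C) r x + W2 (convex hull C) s x)"
proof -
 have d: "r differentiable (at x)" "s differentiable (at x)" for x using polys_diffable[OF r] polys_diffable[OF s] by auto
 have c: "curl2_mat (%x. r x + s x) x = curl2_mat r x + curl2_mat s x" for x
 by (simp add: vec_eq_iff curl2_mat_nth d differentiable_add pd_add[OF d])
 let ?b = "bubble2 (convex hull C)"
 have pa: "pd j (%y. ?b y *R curl2_mat r y + ?b y *R curl2_mat s y) x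
 = pd j (%y. ?b y *R curl2_mat r y) x + pd j (%y. ?b y *R curl2_mat s y) x" for j x
 by (rule pd_add[OF polys_diffable[OF polys_W2_aux[OF fs r]] polys_diffable[OF polys_W2_aux[OF fs s]]])
 show ?thesis unfolding W2_def c scaleR_add_right
 by (simp add: fun_eq_iff vec_eq_iff forall_2 rot2_nth pa)
qed

lemma W2_scale:
 assumes fs: "full_simplex (C :: (real^2) set)" and r: "r : polys k V"
 shows "W2 (convex hull C) (%x. t *R r x) = (%x. t *R W2 (convex hull C) r x)"
proof -
 have ls: "linear (%x :: 'v::real_vector. t *R x)" by (simp add: linear_iff scaleR_add_right)
 have d: "r differentiable (at x)" for x by (rule polys_diffable[OF r])
 have d': "(%x. t *R r x) differentiable (at x)" for x by (intro differentiable_scaleR d differentiable_const)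
 have ps: "pd j (%x. t *R r x) x = t *R pd j r x" for j x by (rule pd_linear[OF ls d])
 have c: "curl2_mat (%x. t *R r x) x = t *R curl2_mat r x" for x
 by (simp add: vec_eq_iff curl2_mat_nth[OF d] curl2_mat_nth[OF d'] ps right_diff_distrib)
 let ?b = "bubble2 (convex hull C)"
 have pa: "pd j (%y. t *R (?b y *R curl2_mat r y)) x = t *R pd j (%y. ?b y *R curl2_mat r y) x" for j x
 by (rule pd_linear[OF ls polys_diffable[OF polys_W2_aux[OF fs r]]])
 have e: "?b y *R (t *R curl2_mat r y) = t *R (?b y *R curl2_mat r y)" for y by simp
 show ?thesis unfolding W2_def c e
 by (simp only: fun_eq_iff vec_eq_iff forall_2 rot2_nth pa) (simp add: rot2_nth)
qed

lemma W2_deg: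
 assumes fs: "full_simplex (C :: (real^2) set)" and r: "r : polys k skew"
 shows "W2 (convex hull C) r : polys (Suc k) UNIV"
\<comment> \<open>Because of truncated subtraction, the degree count \<open>3 + (k - 1) - 1\<close>
  equals \<open>Suc k\<close> for positive \<open>k\<close> only; for \<open>k = 0\<close> the curl
  of a constant is zero.\<close>
proof (cases "k = 0")
 case True
 have "curl2_mat r x = 0" for x
 using r True by (simp add: vec_eq_iff curl2_mat_nth[OF polys_diffable[OF r]] pd_zero[OF _ subspace_skew])
 then have "curl2_mat r = (%_. 0)" by (rule ext)
 then have "W2 (convex hull C) r x = 0" for x
 unfolding vec_eq_iff forall_2 W2_def rot2_nth by (simp add: pd_const)
 then have "W2 (convex hull C) r = (%_. 0)" by (rule ext)
 then show ?thesis by (simp add: polys_zero sU)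
next
 case False
 then have "3 + (k - 1) - 1 = Suc k" by simp
 then show ?thesis using polys_rot2[OF polys_W2_aux[OF fs r]] by (simp add: W2_def)
qed

text \<open>On the facet the bubble vanishes and only the derivative of its factor
  \<open>bc c\<close> survives, so the gradient has direction \<open>g c\<close>; the rotation by a
  right angle makes it tangential.\<close>

lemma W2_facet:
 assumes fs: "full_simplex (C :: (real^2) set)" and r: "r : polys k skew" and c: "c : C" and x: "x : convex hull (C - {c})"
 shows "W2 (convex hull C) r x *v full_simplex.nu C c = 0"
proof -
 interpret full_simplex C by (rule fs)
 define \<psi> where "\<psi> y = (PROD b:C - {c}. bc b y) *R curl2_mat r y" for y
 have \<psi>: "\<psi> : polys (card (C - {c}) + (k - 1)) UNIV" unfolding \<psi>_def[abs_def]
 by (intro polys_mult sU polys_prod_bc polys_curl2_mat[OF r]) auto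
 have e: "(%y. bubble2 T y *R curl2_mat r y) = (%y. bc c y *R \<psi> y)"
 by (simp add: fun_eq_iff bubble2_eq[OF fs] \<psi>_def prod.remove[OF finite_C c])
 have x0: "bc c x = 0" using x mem_fac[OF c] by blast
 have p: "pd j (%y. bubble2 T y *R curl2_mat r y) x = g c $ j *R \<psi> x" for j
 unfolding e by (rule pd_bc_zero[OF c x0 \<psi>])
 have gj: "g c $ j = - (norm (g c) * nu c $ j)" for j using arg_cong[OF g_nu[of c], of "%v. v $ j"] by simp
 show ?thesis
 by (simp add: vec_eq_iff matrix_vector_mult_def sum_2 W2_def rot2_nth p gj)
qed

lemma W2_bound:
 assumes rho: "\<rho> > 0"
 shows "\<exists>K>0. ALL C z h r A. shaped_simplex C z h \<rho> --> r : polys k skew --> (ALL x:cball z h. norm (r x) <= A) -->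
 (ALL x:cball z h. norm (W2 (convex hull C) r x) <= K * A / h ^ 2)"
proof -
 obtain C1 where C1: "C1 >= 1 & (ALL p z r A x \<xi>. p : polys k (UNIV :: (real^2^2) set) --> r > 0 -->
 (ALL x:cball (z :: real^2) r. norm (p x) <= A) --> x : cball z r --> norm (frechet_derivative p (at x) \<xi>) <= C1 * A * norm \<xi> / r)"
 using polys_inverse_estimate by blast
 obtain C2 where C2: "C2 >= 1 & (ALL p z r A x \<xi>. p : polys (3 + (k - 1)) (UNIV :: (real^2) set) --> r > 0 -->
 (ALL x:cball (z :: real^2) r. norm (p x) <= A) --> x : cball z r --> norm (frechet_derivative p (at x) \<xi>) <= C2 * A * norm \<xi> / r)"
 using polys_inverse_estimate by blast
 define P where "P = (1 + 1 / \<rho>) ^ 3"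
 have P: "P > 0" using rho by (simp add: P_def add_pos_pos)
 \<comment> \<open>A factor 4 for the norm of the inner curl, which has two components of two
   derivatives each, and a factor 4 for the four entries of the result; \<open>P\<close> bounds the
   product of the three coordinates.\<close>
 define K where "K = 16 * C1 * C2 * P"
 have K: "K > 0" using P C1 C2 by (simp add: K_def)
 have "norm (W2 (convex hull C) r x) <= K * A / h ^ 2"
 if S: "shaped_simplex C z h \<rho>" and r: "r : polys k skew" and A: "ALL x:cball z h. norm (r x) <= A" and x: "x : cball z h" for C z h r A x
 proof -
 interpret shaped_simplex C z h \<rho> by (rule S)
 have fs: "full_simplex C" by unfold_locales
 have rU: "r : polys k UNIV" using r by (rule polys_UNIV)
 let ?\<phi> = "%y. bubble2 T y *R curl2_mat r y"
 have pr: "norm (pd j r y) <= C1 * A / h" if "y : cball z h" for j y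
 proof -
 have "norm (frechet_derivative r (at y) (axis j 1)) <= C1 * A * norm (axis j (1::real)) / h" using C1 rU h A that by blast
 then show ?thesis by simp
 qed
 have \<phi>: "ALL y:cball z h. norm (?\<phi> y) <= P * (4 * (C1 * A / h))"
 proof
 fix y assume y: "y : cball z h"
 have en: "\<bar>pd j r y $ i $ l\<bar> <= C1 * A / h" for i j l
 using pr[OF y, of j] component_le_norm_cart[of "pd j r y $ i" l] Finite_Cartesian_Product.norm_nth_le[of "pd j r y" i] by linarith
 have "\<bar>curl2_mat r y $ i\<bar> <= 2 * (C1 * A / h)" for i
 unfolding curl2_mat_nth[OF polys_diffable[OF r]] using en[of 1 i 2] en[of 2 i 1] by linarith
 then have "norm (curl2_mat r y) <= 4 * (C1 * A / h)"
 using norm_le_l1_cart[of "curl2_mat r y"] by (smt (verit) sum_2)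
 moreover have "\<bar>bubble2 T y\<bar> <= P" unfolding bubble2_eq[OF fs] P_def using prod_bc_le[OF order_refl y] card_C by simp
 ultimately show "norm (?\<phi> y) <= P * (4 * (C1 * A / h))" unfolding norm_scaleR using P by (intro mult_mono) auto
 qed
 have pp: "norm (pd j ?\<phi> x) <= C2 * (P * (4 * (C1 * A / h))) / h" for j
 proof -
 have "norm (frechet_derivative ?\<phi> (at x) (axis j 1)) <= C2 * (P * (4 * (C1 * A / h))) * norm (axis j (1::real)) / h"
 using C2 polys_W2_aux[OF fs r] h \<phi> x by blast
 then show ?thesis by simp
 qed
 have "\<bar>W2 T r x $ i $ j\<bar> <= C2 * (P * (4 * (C1 * A / h))) / h" for i j
 proof -
 have "\<bar>pd l ?\<phi> x $ i\<bar> <= C2 * (P * (4 * (C1 * A / h))) / h" for l using pp[of l] component_le_norm_cart[of "pd l ?\<phi> x" i] by linarith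
 then have "ALL j. \<bar>W2 T r x $ i $ j\<bar> <= C2 * (P * (4 * (C1 * A / h))) / h" unfolding forall_2 W2_def rot2_nth by simp
 then show ?thesis by blast
 qed
 then have "norm (W2 T r x) <= CARD(2) * (CARD(2) * (C2 * (P * (4 * (C1 * A / h))) / h))"
 using norm_mat_le[of "W2 T r x" "C2 * (P * (4 * (C1 * A / h))) / h"] by blast
 also have "\<dots> = K * A / h ^ 2" using h by (simp add: K_def field_simps power2_eq_square)
 finally show ?thesis .
 qed
 then show ?thesis using K by blast
qed

text \<open>A skew 2 by 2 field has a single free entry. Its two partial derivatives are the
  components of the curl, and the full gradient contains each of them twice up to sign.\<close>

lemma curl2_skew:
 assumes r: "r : polys k skew"
 shows "(norm (curl2_mat r x))^2 = (1/2) * (SUM j:UNIV. (norm (pd j r x))^2)"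
proof -
 have "pd j r x : skew" for j by (rule polys_value[OF subspace_skew polys_pd[OF subspace_skew r]])
 then have s: "pd j r x $ a $ b + pd j r x $ b $ a = 0" for j a b unfolding skew_iff by blast
 have d: "pd j r x $ 1 $ 1 = 0" "pd j r x $ 2 $ 2 = 0" "pd j r x $ 2 $ 1 = - pd j r x $ 1 $ 2" for j
 using s[of j 1 1] s[of j 2 2] s[of j 1 2] by simp_all
 show ?thesis
 unfolding power2_norm_eq_inner inner_mat inner_vec_def sum_2 curl2_mat_nth[OF polys_diffable[OF r]] by (simp add: d)
qed

text \<open>Integration by parts moves the outer curl onto \<open>jacobian v - r\<close>. Gradients
  have zero curl, so what remains is the integral of \<open>bubble2\<close> times the square of the
  curl of \<open>r\<close>.\<close>

lemma W2_lower:
 assumes rho: "\<rho> > 0"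
 shows "\<exists>c>0. ALL C z h r v. shaped_simplex C z h \<rho> --> r : polys k skew --> v : polys (Suc k) UNIV -->
 c * h^2 * integral (cball z (\<rho> * h / 2)) (%x. SUM j:UNIV. (norm (pd j r x))^2)
 <= h ^ 2 * (- integral (convex hull C) (%x. W2 (convex hull C) r x \<bullet> (jacobian v (at x) - r x)))"
proof -
 define c where "c = (1/2) * (\<rho> / 2) ^ 3"
 have c: "c > 0" using rho by (simp add: c_def)
 have "c * h^2 * integral (cball z (\<rho> * h / 2)) (%x. SUM j:UNIV. (norm (pd j r x))^2)
 <= h ^ 2 * (- integral (convex hull C) (%x. W2 (convex hull C) r x \<bullet> (jacobian v (at x) - r x)))"
 if S: "shaped_simplex C z h \<rho>" and r: "r : polys k skew" and v: "v : polys (Suc k) UNIV" for C z h r v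
 proof -
 interpret shaped_simplex C z h \<rho> by (rule S)
 have fs: "full_simplex C" by unfold_locales
 define \<phi> where "\<phi> y = bubble2 T y *R curl2_mat r y" for y
 have \<phi>: "\<phi> : polys (3 + (k - 1)) UNIV" unfolding \<phi>_def[abs_def] by (rule polys_W2_aux[OF fs r])
 define s where "s x = jacobian v (at x) - r x" for x
 have rU: "r : polys k UNIV" using r by (rule polys_UNIV)
 have jv: "(%x. jacobian v (at x)) : polys k UNIV" using polys_jacobian[OF v] by simp
 have s: "s : polys k UNIV" unfolding s_def[abs_def] by (intro polys_diff sU jv rU)
 have sc: "(%x. column j (s x)) : polys k UNIV" for j by (rule polys_lin_image[OF linear_column s]) simp
 have cr: "curl2_mat r : polys (k - 1) UNIV" by (rule polys_curl2_mat[OF r])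
 \<comment> \<open>The flux of the integration by parts: its divergence is
   \<open>W2 T r \<bullet> s + \<phi> \<bullet> curl2_mat r\<close>, and it vanishes on the boundary
   together with the bubble.\<close>
 define w where "w x = (\<chi> j. if j = (1::2) then - (\<phi> x \<bullet> column 2 (s x)) else \<phi> x \<bullet> column 1 (s x))" for x
 have pw0: "(%x. \<phi> x \<bullet> column j (s x)) : polys (3 + (k - 1) + k) UNIV" for j by (rule polys_inner[OF \<phi> sc])
 have w: "w : polys (3 + (k - 1) + k) UNIV" unfolding w_def[abs_def]
 proof (rule polys_vec)
 fix j :: 2
 show "(%x. if j = 1 then - (\<phi> x \<bullet> column 2 (s x)) else \<phi> x \<bullet> column 1 (s x)) : polys (3 + (k - 1) + k) UNIV"
 using pw0[of 1] polys_uminus[OF sU pw0[of 2]] by (cases "j = 1") (simp_all only: if_True if_False simp_thms)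
 qed
 have div: "(SUM j:UNIV. pd j w x $ j) = W2 T r x \<bullet> s x + \<phi> x \<bullet> curl2_mat r x" for x
 proof -
 have wn: "pd j w x $ j = pd j (%x. w x $ j) x" for j by (rule pd_nth[OF polys_diffable[OF w], symmetric])
 have w1: "pd 1 (%x. w x $ 1) x = - (\<phi> x \<bullet> column 2 (pd 1 s x) + pd 1 \<phi> x \<bullet> column 2 (s x))"
 using pd_linear[OF linear_uminus polys_diffable[OF pw0[of 2]], where j=1 and x=x] pd_inner[OF polys_diffable[OF \<phi>] polys_diffable[OF sc[of 2]], where j=1 and x=x]
 by (simp add: w_def pd_column[OF s])
 have w2: "pd 2 (%x. w x $ 2) x = \<phi> x \<bullet> column 1 (pd 2 s x) + pd 2 \<phi> x \<bullet> column 1 (s x)"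
 using pd_inner[OF polys_diffable[OF \<phi>] polys_diffable[OF sc[of 1]], where j=2 and x=x]
 by (simp add: w_def pd_column[OF s])
 have ps: "pd j s x = pd j (%x. jacobian v (at x)) x - pd j r x" for j
 unfolding s_def[abs_def] by (rule pd_diff[OF polys_diffable[OF jv] polys_diffable[OF r]])
 have cs: "column 1 (pd 2 s x) - column 2 (pd 1 s x) = curl2_mat r x"
 unfolding vec_eq_iff vector_minus_component column_nth ps curl2_mat_nth[OF polys_diffable[OF r]]
 using pd_jacobian_commute[OF v] by simp
 have W: "W2 T r x \<bullet> s x = pd 2 \<phi> x \<bullet> column 1 (s x) - pd 1 \<phi> x \<bullet> column 2 (s x)"
 unfolding inner_mat sum_2 W2_def rot2_nth \<phi>_def[abs_def, symmetric] inner_vec_def column_nth by (simp add: algebra_simps)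
 show ?thesis unfolding sum_2 wn w1 w2 W cs[symmetric] inner_diff_right by simp
 qed
 have w0: "nu c \<bullet> w x = 0" if c: "c : C" and x: "x : fac c" for c x
 proof -
 have "bc c x = 0" using x mem_fac[OF c] by blast
 then have "bubble2 T x = 0" unfolding bubble2_eq[OF fs] using c finite_C by (intro prod_zero) auto
 then have "w x = 0" by (simp add: w_def \<phi>_def vec_eq_iff)
 then show ?thesis by simp
 qed
 have Wp: "W2 T r : polys (Suc k) UNIV" by (rule W2_deg[OF fs r])
 have i1: "(%x. W2 T r x \<bullet> s x) integrable_on T" and i2: "(%x. \<phi> x \<bullet> curl2_mat r x) integrable_on T"
 by (intro integrable_compact compact_T continuous_on_inner polys_cont[OF Wp] polys_cont[OF s]
 polys_cont[OF \<phi>] polys_cont[OF cr])+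
 have "0 = integral T (%x. SUM j:UNIV. pd j w x $ j)" using integral_div_vec_zero[OF w w0] by simp
 also have "\<dots> = integral T (%x. W2 T r x \<bullet> s x) + integral T (%x. \<phi> x \<bullet> curl2_mat r x)"
 unfolding div by (rule integral_add[OF i1 i2])
 finally have eq: "- integral T (%x. W2 T r x \<bullet> s x) = integral T (%x. \<phi> x \<bullet> curl2_mat r x)" by linarith
 have cpos: "continuous_on A (%x. \<phi> x \<bullet> curl2_mat r x)" for A
 by (intro continuous_on_inner polys_cont[OF \<phi>] polys_cont[OF cr])
 have cd: "continuous_on A (%x. SUM j:UNIV. (norm (pd j r x))^2)" for A
 by (intro continuous_intros polys_cont[OF polys_pd[OF subspace_skew r]])
 have ec: "\<phi> x \<bullet> curl2_mat r x = (PROD a:C. bc a x) * (norm (curl2_mat r x))^2" for x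
 by (simp add: \<phi>_def bubble2_eq[OF fs] power2_norm_eq_inner)
 have "c * integral (cball z (\<rho> * h / 2)) (%x. SUM j:UNIV. (norm (pd j r x))^2)
 = integral (cball z (\<rho> * h / 2)) (%x. c * (SUM j:UNIV. (norm (pd j r x))^2))" by (rule integral_mult_right[symmetric])
 also have "\<dots> <= integral (cball z (\<rho> * h / 2)) (%x. \<phi> x \<bullet> curl2_mat r x)"
 proof (intro integral_le integrable_compact compact_cball cpos continuous_on_mult_left cd)
 fix x assume x: "x : cball z (\<rho> * h / 2)"
 have "(\<rho> / 2) ^ 3 <= (PROD a:C. bc a x)" using prod_bc_ge[OF order_refl x] card_C by simp
 then have "(\<rho> / 2) ^ 3 * (norm (curl2_mat r x))^2 <= \<phi> x \<bullet> curl2_mat r x" unfolding ec by (rule mult_right_mono) simp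
 then show "c * (SUM j:UNIV. (norm (pd j r x))^2) <= \<phi> x \<bullet> curl2_mat r x" unfolding curl2_skew[OF r] c_def by simp
 qed
 also have "\<dots> <= integral T (%x. \<phi> x \<bullet> curl2_mat r x)"
 by (intro integral_T_ge_ball cpos) (simp add: ec prod_bc_nonneg)
 finally have "c * integral (cball z (\<rho> * h / 2)) (%x. SUM j:UNIV. (norm (pd j r x))^2) <= - integral T (%x. W2 T r x \<bullet> s x)"
 unfolding eq .
 from mult_left_mono[OF this, of "h^2"] show ?thesis unfolding s_def by (simp add: mult_ac)
 qed
 then show ?thesis using c by blast
qed

lemma bubble_property_2:
 assumes "\<rho> > 0" "k >= 1"
 shows "bubble_property k (%T. {%x. dev (rot2 (%y. bubble2 T y *R curl2_mat r y) x) |r. r : skew_polys_perp k T}) \<rho>"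
 using bubble_propertyI[where Wop=W2 and k=k and m=2, OF assms W2_add W2_scale W2_deg W2_facet W2_bound[OF assms(1)] W2_lower[OF assms(1)]]
 unfolding W2_def .

section \<open>Curl bubbles in three dimensions\<close>

lemma curl3_mat_nth:
 assumes "r differentiable (at x)"
 shows "curl3_mat r x $ i $ 1 = pd 2 r x $ i $ 3 - pd 3 r x $ i $ 2"
 "curl3_mat r x $ i $ 2 = pd 3 r x $ i $ 1 - pd 1 r x $ i $ 3"
 "curl3_mat r x $ i $ 3 = pd 1 r x $ i $ 2 - pd 2 r x $ i $ 1"
 by (simp_all add: curl3_mat_def curl3_def Let_def jacobian_nth pd_nth[OF assms])

lemma polys_curl3_mat:
 assumes "r : polys k V" shows "curl3_mat r : polys (k - 1) UNIV"
proof -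
 have r: "r : polys k UNIV" using assms by (rule polys_UNIV)
 have d: "r differentiable (at x)" for x by (rule polys_diffable[OF r])
 have e: "(%x. pd a r x $ i $ b - pd c r x $ i $ d) : polys (k - 1) UNIV" for a b c d i
 by (intro polys_diff sU polys_nth polys_pd r)
 have "ALL j. (%x. curl3_mat r x $ i $ j) : polys (k - 1) UNIV" for i
 unfolding forall_3 curl3_mat_nth[OF d] using e by blast
 then have "(%x. \<chi> i j. curl3_mat r x $ i $ j) : polys (k - 1) UNIV" by (intro polys_vec) blast
 moreover have "(%x. \<chi> i j. curl3_mat r x $ i $ j) = curl3_mat r" by (simp add: fun_eq_iff vec_eq_iff)
 ultimately show ?thesis by simp
qed

lemma curl3_mat_add:
 assumes "r : polys k V" "s : polys l V'"
 shows "curl3_mat (%x. r x + s x) x = curl3_mat r x + curl3_mat s x"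
proof -
 have d: "r differentiable (at x)" "s differentiable (at x)" using polys_diffable[OF assms(1)] polys_diffable[OF assms(2)] by auto
 show ?thesis unfolding vec_eq_iff forall_3 vector_add_component
 curl3_mat_nth[OF d(1)] curl3_mat_nth[OF d(2)] curl3_mat_nth[OF differentiable_add[OF d]] pd_add[OF d] by simp
qed

lemma curl3_mat_scale:
 assumes "r : polys k V"
 shows "curl3_mat (%x. t *R r x) x = t *R curl3_mat r x"
proof -
 have d: "r differentiable (at x)" by (rule polys_diffable[OF assms])
 have d': "(%x. t *R r x) differentiable (at x)" by (intro differentiable_scaleR d differentiable_const)
 have "linear (%x :: real^3^3. t *R x)" by (simp add: linear_iff scaleR_add_right)
 from pd_linear[OF this d] have ps: "pd j (%x. t *R r x) x = t *R pd j r x" for j .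
 show ?thesis unfolding vec_eq_iff forall_3 vector_scaleR_component
 curl3_mat_nth[OF d] curl3_mat_nth[OF d'] ps by (simp add: right_diff_distrib)
qed

lemma outer_prod_mult_left: "A ** outer_prod u v = outer_prod (A *v u) v"
 by (simp add: vec_eq_iff outer_prod_def matrix_matrix_mult_def matrix_vector_mult_def sum_distrib_left sum_distrib_right mult_ac)

lemma linear_outer_prod: "linear (%u :: real^'n. outer_prod u v)"
 by (simp add: linear_iff outer_prod_def vec_eq_iff distrib_right)

lemma linear_outer_prod_mat: "linear (%A :: real^'n^'n. outer_prod (A *v u) v)"
 by (simp add: linear_iff linear_add[OF linear_mat_vec] linear_scale[OF linear_mat_vec]
 linear_add[OF linear_outer_prod] linear_scale[OF linear_outer_prod])

lemma linear_mult_mat: "linear (%B :: real^'n^'n. A ** B)" "linear (%A :: real^'n^'n. A ** B)"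
 by (simp_all add: linear_iff matrix_matrix_mult_def vec_eq_iff sum.distrib sum_distrib_left distrib_left distrib_right mult_ac)

definition phi3 :: "(real^3) set => (real^3 => real^3^3) => real^3 => real^3^3" where
 "phi3 T r y = curl3_mat r y ** bubble3 T y"

definition W3 :: "(real^3) set => (real^3 => real^3^3) => real^3 => real^3^3" where
 "W3 T r = curl3_mat (phi3 T r)"

lemma phi3_eq:
 assumes fs: "full_simplex (C :: (real^3) set)"
 shows "phi3 (convex hull C) r y = (SUM a:C. (PROD b:C - {a}. bary (convex hull C) b y) *\<^sub>R
 outer_prod (curl3_mat r y *v full_simplex.g C a) (full_simplex.g C a))"
proof -
 interpret full_simplex C by (rule fs)
 have "bubble3 T y = (SUM a:C. (PROD b:C - {a}. bc b y) *R outer_prod (g a) (g a))"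
 unfolding bubble3_def vertices_T by (intro sum.cong refl) (simp add: grad_bary)
 then show ?thesis
 by (simp add: phi3_def linear_sum[OF linear_mult_mat(1)] linear_scale[OF linear_mult_mat(1)] outer_prod_mult_left)
qed

lemma polys_phi3:
 assumes fs: "full_simplex (C :: (real^3) set)" and r: "r : polys k V"
 shows "phi3 (convex hull C) r : polys (3 + (k - 1)) UNIV"
proof -
 interpret full_simplex C by (rule fs)
 have "(%y. (PROD b:C - {a}. bc b y) *R outer_prod (curl3_mat r y *v g a) (g a)) : polys (3 + (k - 1)) UNIV" if a: "a : C" for a
 proof (rule polys_mult[OF sU])
 have "card (C - {a}) = 3" using card_C a finite_C by simp
 then show "(%y. PROD b:C - {a}. bc b y) : polys 3 UNIV" using polys_prod_bc[of "C - {a}"] by auto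
 show "(%y. outer_prod (curl3_mat r y *v g a) (g a)) : polys (k - 1) UNIV"
 by (rule polys_lin_image[OF linear_outer_prod_mat polys_curl3_mat[OF r]]) simp
 qed
 then have "(%y. SUM a:C. (PROD b:C - {a}. bc b y) *R outer_prod (curl3_mat r y *v g a) (g a)) : polys (3 + (k - 1)) UNIV"
 by (intro polys_sum sU)
 then show ?thesis unfolding phi3_eq[OF fs, abs_def] .
qed

lemma W3_add:
 assumes fs: "full_simplex (C :: (real^3) set)" and r: "r : polys k V" and s: "s : polys k V"
 shows "W3 (convex hull C) (%x. r x + s x) = (%x. W3 (convex hull C) r x + W3 (convex hull C) s x)"
proof -
 have e: "phi3 (convex hull C) (%x. r x + s x) = (%x. phi3 (convex hull C) r x + phi3 (convex hull C) s x)"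
 by (simp add: fun_eq_iff phi3_def curl3_mat_add[OF r s] linear_add[OF linear_mult_mat(2)])
 show ?thesis unfolding W3_def e curl3_mat_add[OF polys_phi3[OF fs r] polys_phi3[OF fs s]] ..
qed

lemma W3_scale:
 assumes fs: "full_simplex (C :: (real^3) set)" and r: "r : polys k V"
 shows "W3 (convex hull C) (%x. t *R r x) = (%x. t *R W3 (convex hull C) r x)"
proof -
 have e: "phi3 (convex hull C) (%x. t *R r x) = (%x. t *R phi3 (convex hull C) r x)"
 by (simp add: fun_eq_iff phi3_def curl3_mat_scale[OF r] linear_scale[OF linear_mult_mat(2)])
 show ?thesis unfolding W3_def e curl3_mat_scale[OF polys_phi3[OF fs r]] ..
qed

lemma W3_deg:
 assumes fs: "full_simplex (C :: (real^3) set)" and r: "r : polys k skew"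
 shows "W3 (convex hull C) r : polys (Suc k) UNIV"
proof (cases "k = 0")
 case True
 have "curl3_mat r x = 0" for x
 unfolding vec_eq_iff forall_3 curl3_mat_nth[OF polys_diffable[OF r]] using r True by (simp add: pd_zero[OF _ subspace_skew])
 then have "phi3 (convex hull C) r = (%_. 0)" by (simp add: phi3_def fun_eq_iff linear_0[OF linear_mult_mat(2)])
 then have "W3 (convex hull C) r x = 0" for x
 unfolding vec_eq_iff forall_3 W3_def by (simp add: curl3_mat_nth pd_const)
 then have "W3 (convex hull C) r = (%_. 0)" by (rule ext)
 then show ?thesis by (simp add: polys_zero sU)
next
 case False
 then have "3 + (k - 1) - 1 = Suc k" by simp
 then show ?thesis using polys_curl3_mat[OF polys_phi3[OF fs r]] by (simp add: W3_def)
qed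

text \<open>In the matrix bubble every term except that of \<open>c\<close> contains the factor
  \<open>bc c\<close>, and the term of \<open>c\<close> has rows parallel to
  \<open>g c\<close>.\<close>

lemma phi3_split:
 assumes fs: "full_simplex (C :: (real^3) set)" and r: "r : polys k V" and c: "c : C"
 obtains \<Psi> \<xi> m m' where "\<Psi> : polys m UNIV" "\<xi> : polys m' UNIV"
 "!!y. phi3 (convex hull C) r y = bary (convex hull C) c y *R \<Psi> y + outer_prod (\<xi> y) (full_simplex.g C c)"
proof -
 interpret full_simplex C by (rule fs)
 define P where "P a y = outer_prod (curl3_mat r y *v g a) (g a)" for a y
 have P: "P a : polys (k - 1) UNIV" for a unfolding P_def[abs_def]
 by (rule polys_lin_image[OF linear_outer_prod_mat polys_curl3_mat[OF r]]) simp
 define \<Psi> where "\<Psi> y = (SUM a:C - {c}. (PROD b:C - {a} - {c}. bc b y) *R P a y)" for y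
 have \<Psi>: "\<Psi> : polys (4 + (k - 1)) UNIV" unfolding \<Psi>_def[abs_def]
 proof (intro polys_sum sU polys_mult P)
 fix a
 have "card (C - {a} - {c}) <= card C" by (intro card_mono finite_C) auto
 then show "(%y. PROD b:C - {a} - {c}. bc b y) : polys 4 UNIV"
 using polys_mono[OF sU polys_prod_bc[of "C - {a} - {c}"]] card_C by auto
 qed
 define \<xi> where "\<xi> y = (PROD b:C - {c}. bc b y) *R (curl3_mat r y *v g c)" for y
 have \<xi>: "\<xi> : polys (card (C - {c}) + (k - 1)) UNIV" unfolding \<xi>_def[abs_def]
 by (intro polys_mult sU polys_prod_bc polys_lin_image[OF linear_mat_vec polys_curl3_mat[OF r]]) auto
 have "phi3 T r y = bc c y *R \<Psi> y + outer_prod (\<xi> y) (g c)" for y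
 proof -
 have "(PROD b:C - {a}. bc b y) *R P a y = bc c y *R ((PROD b:C - {a} - {c}. bc b y) *R P a y)" if "a : C - {c}" for a
 proof -
 have "c : C - {a}" using c that by blast
 then show ?thesis using prod.remove[of "C - {a}" c "%b. bc b y"] finite_C by simp
 qed
 then have "(SUM a:C - {c}. (PROD b:C - {a}. bc b y) *R P a y) = bc c y *R \<Psi> y"
 unfolding \<Psi>_def scaleR_sum_right by (intro sum.cong refl)
 moreover have "(PROD b:C - {c}. bc b y) *R P c y = outer_prod (\<xi> y) (g c)"
 unfolding P_def \<xi>_def linear_scale[OF linear_outer_prod] ..
 ultimately show ?thesis unfolding phi3_eq[OF fs] P_def[symmetric] sum.remove[OF finite_C c] by simp
 qed
 with \<Psi> \<xi> that show thesis by blast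
qed

text \<open>With the splitting of \<open>phi3\<close>, each row of the curl on the facet is a sum of
  two cross products with \<open>g c\<close>, hence orthogonal to the normal: one comes from
  differentiating \<open>bc c\<close>, the other from rows that are multiples of the constant vector
  \<open>g c\<close>.\<close>

lemma W3_facet:
 assumes fs: "full_simplex (C :: (real^3) set)" and r: "r : polys k skew" and c: "c : C" and x: "x : convex hull (C - {c})"
 shows "W3 (convex hull C) r x *v full_simplex.nu C c = 0"
proof -
 interpret full_simplex C by (rule fs)
 obtain \<Psi> \<xi> m m' where \<Psi>: "\<Psi> : polys m UNIV" and \<xi>: "\<xi> : polys m' UNIV"
 and e: "!!y. phi3 T r y = bc c y *R \<Psi> y + outer_prod (\<xi> y) (g c)"
 by (rule phi3_split[OF fs r c], rule that; assumption)
 have x0: "bc c x = 0" using x mem_fac[OF c] by blast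
 have d: "(%y. bc c y *R \<Psi> y) differentiable (at x)" "(%y. outer_prod (\<xi> y) (g c)) differentiable (at x)"
 using polys_diffable[OF polys_mult[OF sU polys_bc[OF c] \<Psi>]]
 polys_diffable[OF polys_lin_image[OF linear_outer_prod \<xi>, where W=UNIV]] by auto
 have p: "pd j (phi3 T r) x = g c $ j *R \<Psi> x + outer_prod (pd j \<xi> x) (g c)" for j
 unfolding e[abs_def] pd_add[OF d] pd_bc_zero[OF c x0 \<Psi>] pd_linear[OF linear_outer_prod polys_diffable[OF \<xi>]] ..
 have gj: "g c $ j = - (norm (g c) * nu c $ j)" for j using arg_cong[OF g_nu[of c], of "%v. v $ j"] by simp
 show ?thesis
 unfolding vec_eq_iff matrix_vector_mult_def W3_def
 by (simp add: sum_3 curl3_mat_nth[OF polys_diffable[OF polys_phi3[OF fs r]]] p outer_prod_def gj algebra_simps)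
qed

lemma W3_bound:
 assumes rho: "\<rho> > 0"
 shows "\<exists>K>0. ALL C z h r A. shaped_simplex C z h \<rho> --> r : polys k skew --> (ALL x:cball z h. norm (r x) <= A) -->
 (ALL x:cball z h. norm (W3 (convex hull C) r x) <= K * A / h ^ 4)"
proof -
 obtain C1 where C1: "C1 >= 1 & (ALL p z r A x \<xi>. p : polys k (UNIV :: (real^3^3) set) --> r > 0 -->
 (ALL x:cball (z :: real^3) r. norm (p x) <= A) --> x : cball z r --> norm (frechet_derivative p (at x) \<xi>) <= C1 * A * norm \<xi> / r)"
 using polys_inverse_estimate by blast
 obtain C2 where C2: "C2 >= 1 & (ALL p z r A x \<xi>. p : polys (3 + (k - 1)) (UNIV :: (real^3^3) set) --> r > 0 -->
 (ALL x:cball (z :: real^3) r. norm (p x) <= A) --> x : cball z r --> norm (frechet_derivative p (at x) \<xi>) <= C2 * A * norm \<xi> / r)"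
 using polys_inverse_estimate by blast
 define P where "P = (1 + 1 / \<rho>) ^ 3"
 have P: "P > 0" using rho by (simp add: P_def add_pos_pos)
 \<comment> \<open>Each curl costs 18, for nine entries that are differences of two derivatives; the
   bubble is a sum over 4 vertices, and its two gradient factors give the \<open>\<rho>^2\<close>.
   So 1296 is \<open>18 * 4 * 18\<close>.\<close>
 define K where "K = 1296 * C1 * C2 * P / \<rho>^2"
 have K: "K > 0" using P C1 C2 rho by (simp add: K_def)
 have entry: "\<bar>curl3_mat r y $ i $ j\<bar> <= 2 * B" if "!!j. norm (pd j r y) <= B" "r differentiable (at y)" for r y i j B
 proof -
 have "\<bar>pd j r y $ i $ l\<bar> <= B" for i j l
 using that(1)[of j] component_le_norm_cart[of "pd j r y $ i" l] Finite_Cartesian_Product.norm_nth_le[of "pd j r y" i] by linarith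
 then have "\<bar>pd a r y $ i $ b - pd a' r y $ i $ b'\<bar> <= 2 * B" for a b a' b'
 by (smt (verit, ccfv_SIG))
 then have "ALL j. \<bar>curl3_mat r y $ i $ j\<bar> <= 2 * B" unfolding forall_3 curl3_mat_nth[OF that(2)] by blast
 then show ?thesis by blast
 qed
 have "norm (W3 (convex hull C) r x) <= K * A / h ^ 4"
 if S: "shaped_simplex C z h \<rho>" and r: "r : polys k skew" and A: "ALL x:cball z h. norm (r x) <= A" and x: "x : cball z h" for C z h r A x
 proof -
 interpret shaped_simplex C z h \<rho> by (rule S)
 have fs: "full_simplex C" by unfold_locales
 have rU: "r : polys k UNIV" using r by (rule polys_UNIV)
 define B where "B = C1 * A / h"
 have pr: "norm (pd j r y) <= B" if "y : cball z h" for j y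
 proof -
 have "norm (frechet_derivative r (at y) (axis j 1)) <= C1 * A * norm (axis j (1::real)) / h" using C1 rU h A that by blast
 then show ?thesis by (simp add: B_def)
 qed
 define D where "D = 4 * (P * (18 * B / (\<rho> * h)^2))"
 have \<phi>: "ALL y:cball z h. norm (phi3 T r y) <= D"
 proof
 fix y assume y: "y : cball z h"
 have B0: "0 <= B" using order_trans[OF norm_ge_zero pr[OF y, of 1]] .
 have c: "norm (curl3_mat r y) <= 18 * B"
 using norm_mat_le[of "curl3_mat r y" "2 * B"] entry[OF pr[OF y] polys_diffable[OF r]] by simp
 have "norm (phi3 T r y) <= (SUM a:C. norm ((PROD b:C - {a}. bc b y) *R outer_prod (curl3_mat r y *v g a) (g a)))"
 unfolding phi3_eq[OF fs] by (rule norm_sum)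
 also have "\<dots> <= (SUM a:C. P * (18 * B / (\<rho> * h)^2))"
 proof (rule sum_mono)
 fix a assume a: "a : C"
 have "card (C - {a}) = 3" using card_C a finite_C by simp
 then have p: "\<bar>PROD b:C - {a}. bc b y\<bar> <= P" unfolding P_def using prod_bc_le[OF Diff_subset y, of "{a}"] by simp
 have "norm (curl3_mat r y *v g a) * norm (g a) <= (norm (curl3_mat r y) * norm (g a)) * norm (g a)"
 by (intro mult_right_mono norm_mult_vec_le) simp
 also have "\<dots> <= (18 * B * (1 / (\<rho> * h))) * (1 / (\<rho> * h))"
 using c norm_g_le[OF a] B0 h rho by (intro mult_mono mult_nonneg_nonneg norm_ge_zero) simp_all
 also have "\<dots> = 18 * B / (\<rho> * h)^2" by (simp add: power2_eq_square)
 finally show "norm ((PROD b:C - {a}. bc b y) *R outer_prod (curl3_mat r y *v g a) (g a)) <= P * (18 * B / (\<rho> * h)^2)"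
 unfolding norm_scaleR norm_outer_prod using p P by (intro mult_mono) auto
 qed
 also have "\<dots> = D" using card_C by (simp add: D_def)
 finally show "norm (phi3 T r y) <= D" .
 qed
 have pp: "norm (pd j (phi3 T r) x) <= C2 * D / h" for j
 proof -
 have "norm (frechet_derivative (phi3 T r) (at x) (axis j 1)) <= C2 * D * norm (axis j (1::real)) / h"
 using C2 polys_phi3[OF fs r] h \<phi> x by blast
 then show ?thesis by simp
 qed
 have "norm (W3 T r x) <= CARD(3) * (CARD(3) * (2 * (C2 * D / h)))"
 unfolding W3_def using norm_mat_le[of "curl3_mat (phi3 T r) x" "2 * (C2 * D / h)"] entry[OF pp polys_diffable[OF polys_phi3[OF fs r]]] by blast
 also have "\<dots> = K * A / h ^ 4" using h rho by (simp add: K_def D_def B_def field_simps power2_eq_square power4_eq_xxxx)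
 finally show ?thesis .
 qed
 then show ?thesis using K by blast
qed

text \<open>The curl of a skew field determines all its first derivatives: six of the nine free ones
  occur alone in an entry, up to sign, the other three, \<open>b 2\<close>, \<open>a 3\<close> and
  \<open>c 1\<close>, only in pairwise combinations.\<close>

lemma curl3_skew:
 assumes r: "r : polys k skew"
 shows "(SUM j:UNIV. (norm (pd j r x))^2) <= 5 * (norm (curl3_mat r x))^2"
proof -
 have "pd j r x : skew" for j by (rule polys_value[OF subspace_skew polys_pd[OF subspace_skew r]])
 then have s: "pd j r x $ a $ b + pd j r x $ b $ a = 0" for j a b unfolding skew_iff by blast
 define a b c where "a j = pd j r x $ 1 $ 2" and "b j = pd j r x $ 1 $ 3" and "c j = pd j r x $ 2 $ 3" for j
 have d: "pd j r x $ 1 $ 1 = 0" "pd j r x $ 2 $ 2 = 0" "pd j r x $ 3 $ 3 = 0" "pd j r x $ 1 $ 2 = a j" "pd j r x $ 1 $ 3 = b j"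
 "pd j r x $ 2 $ 3 = c j" "pd j r x $ 2 $ 1 = - a j" "pd j r x $ 3 $ 1 = - b j" "pd j r x $ 3 $ 2 = - c j" for j
 using s[of j 1 1] s[of j 2 2] s[of j 3 3] s[of j 1 2] s[of j 1 3] s[of j 2 3] by (simp_all add: a_def b_def c_def)
 have L: "(SUM j:UNIV. (norm (pd j r x))^2) = 2 * ((a 1)^2 + (a 2)^2 + (a 3)^2 + (b 1)^2 + (b 2)^2 + (b 3)^2 + (c 1)^2 + (c 2)^2 + (c 3)^2)"
 unfolding power2_norm_eq_inner inner_mat sum_3 d by (simp add: power2_eq_square)
 have R: "(norm (curl3_mat r x))^2 = (b 2 - a 3)^2 + (b 1)^2 + (a 1)^2 + (c 2)^2 + (a 3 + c 1)^2 + (a 2)^2 + (c 3)^2 + (b 3)^2 + (b 2 - c 1)^2"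
 unfolding power2_norm_eq_inner inner_mat sum_3 curl3_mat_nth[OF polys_diffable[OF r]] d by (simp add: power2_eq_square algebra_simps)
 \<comment> \<open>The three pairwise combinations are linearly independent; with the constant 5 the
   difference is visibly a sum of squares.\<close>
 have "5 * ((b 2 - a 3)^2 + (a 3 + c 1)^2 + (b 2 - c 1)^2) - 2 * ((b 2)^2 + (a 3)^2 + (c 1)^2)
 = 3 * ((b 2)^2 + (a 3)^2 + (c 1)^2) + 5 * (b 2 - a 3 - c 1)^2"
 by (simp add: power2_eq_square algebra_simps)
 moreover have "0 <= 3 * ((b 2)^2 + (a 3)^2 + (c 1)^2) + 5 * (b 2 - a 3 - c 1)^2" by (intro add_nonneg_nonneg mult_nonneg_nonneg) auto
 moreover have "0 <= (a 1)^2" "0 <= (a 2)^2" "0 <= (b 1)^2" "0 <= (b 3)^2" "0 <= (c 2)^2" "0 <= (c 3)^2" by simp_all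
 ultimately show ?thesis unfolding L R distrib_left by linarith
qed

text \<open>A frame bound for the gradients. It makes the matrix bubble, a combination of the tensor
  squares of the \<open>g a\<close>, positive definite on the half ball with a lower bound of order
  \<open>1 / h^2\<close>.\<close>

lemma (in shaped_simplex) norm_mat_le_g:
 fixes A :: "real^'n::_^'n::_"
 shows "(norm A)^2 <= card C * h^2 * (SUM a:C. (norm (A *v g a))^2)"
proof -
 have row: "(norm (A$i))^2 <= card C * (SUM a:C. h^2 * ((A *v g a) $ i)^2)" for i
 proof -
 have "(norm (A$i))^2 = (norm (SUM a:C. (g a \<bullet> A$i) *R (a - z)))^2" by (simp only: g_reconstruct)
 also have "\<dots> <= card C * (SUM a:C. (norm ((g a \<bullet> A$i) *R (a - z)))^2)" by (rule norm_sum_sq_le[OF finite_C])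
 also have "\<dots> <= card C * (SUM a:C. h^2 * ((A *v g a) $ i)^2)"
 proof (intro mult_left_mono sum_mono)
 fix a assume a: "a : C"
 have e: "g a \<bullet> A$i = (A *v g a) $ i" by (simp add: matrix_vector_mult_def inner_vec_def mult.commute)
 have "(norm (a - z))^2 <= h^2" by (intro power_mono z_dist a) simp
 then have "((A *v g a) $ i)^2 * (norm (a - z))^2 <= ((A *v g a) $ i)^2 * h^2" by (intro mult_left_mono) simp_all
 then show "(norm ((g a \<bullet> A$i) *R (a - z)))^2 <= h^2 * ((A *v g a) $ i)^2"
 unfolding e norm_scaleR power_mult_distrib power2_abs by (simp only: mult.commute)
 qed simp
 finally show ?thesis .
 qed
 have "(norm A)^2 = (SUM i:UNIV. (norm (A$i))^2)" unfolding power2_norm_eq_inner by (rule inner_vec_def)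
 also have "\<dots> <= (SUM i:UNIV. card C * (SUM a:C. h^2 * ((A *v g a) $ i)^2))" by (rule sum_mono[OF row])
 also have "\<dots> = card C * (SUM i:UNIV. SUM a:C. h^2 * ((A *v g a) $ i)^2)" by (rule sum_distrib_left[symmetric])
 also have "(SUM i:UNIV. SUM a:C. h^2 * ((A *v g a) $ i)^2) = (SUM a:C. SUM i:UNIV. h^2 * ((A *v g a) $ i)^2)" by (rule sum.swap)
 also have "\<dots> = h^2 * (SUM a:C. (norm (A *v g a))^2)"
 unfolding power2_norm_eq_inner sum_distrib_left by (simp add: inner_vec_def sum_distrib_left power2_eq_square)
 finally show ?thesis by (simp add: mult_ac)
qed

lemma W3_lower:
 assumes rho: "\<rho> > 0"
 shows "\<exists>c>0. ALL C z h r v. shaped_simplex C z h \<rho> --> r : polys k skew --> v : polys (Suc k) UNIV -->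
 c * h^2 * integral (cball z (\<rho> * h / 2)) (%x. SUM j:UNIV. (norm (pd j r x))^2)
 <= h ^ 4 * (- integral (convex hull C) (%x. W3 (convex hull C) r x \<bullet> (jacobian v (at x) - r x)))"
proof -
 \<comment> \<open>The power of \<open>\<rho> / 2\<close> bounds the products of three coordinates
   from below; the 20 is 5 from \<open>curl3_skew\<close> times 4, the number of vertices, from
   \<open>norm_mat_le_g\<close>.\<close>
 define c where "c = (\<rho> / 2) ^ 3 / 20"
 have c: "c > 0" using rho by (simp add: c_def)
 have "c * h^2 * integral (cball z (\<rho> * h / 2)) (%x. SUM j:UNIV. (norm (pd j r x))^2)
 <= h ^ 4 * (- integral (convex hull C) (%x. W3 (convex hull C) r x \<bullet> (jacobian v (at x) - r x)))"
 if S: "shaped_simplex C z h \<rho>" and r: "r : polys k skew" and v: "v : polys (Suc k) UNIV" for C z h r v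
 proof -
 interpret shaped_simplex C z h \<rho> by (rule S)
 have fs: "full_simplex C" by unfold_locales
 define \<phi> where "\<phi> = phi3 T r"
 have \<phi>: "\<phi> : polys (3 + (k - 1)) UNIV" unfolding \<phi>_def by (rule polys_phi3[OF fs r])
 define s where "s x = jacobian v (at x) - r x" for x
 have rU: "r : polys k UNIV" using r by (rule polys_UNIV)
 have jv: "(%x. jacobian v (at x)) : polys k UNIV" using polys_jacobian[OF v] by simp
 have s: "s : polys k UNIV" unfolding s_def[abs_def] by (intro polys_diff sU jv rU)
 have sc: "(%x. column j (s x)) : polys k UNIV" for j by (rule polys_lin_image[OF linear_column s]) simp
 have pc: "(%x. column j (\<phi> x)) : polys (3 + (k - 1)) UNIV" for j by (rule polys_lin_image[OF linear_column \<phi>]) simp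
 have cr: "curl3_mat r : polys (k - 1) UNIV" by (rule polys_curl3_mat[OF r])
 define u where "u i j x = column i (\<phi> x) \<bullet> column j (s x)" for i j x
 have u: "u i j : polys (3 + (k - 1) + k) UNIV" for i j unfolding u_def[abs_def] by (rule polys_inner[OF pc sc])
 have pu: "pd l (u i j) x = column i (\<phi> x) \<bullet> column j (pd l s x) + column i (pd l \<phi> x) \<bullet> column j (s x)" for l i j x
 unfolding u_def[abs_def] pd_inner[OF polys_diffable[OF pc] polys_diffable[OF sc]] pd_column[OF s] pd_column[OF \<phi>] ..
 \<comment> \<open>The sum over the rows of the cross products of \<open>\<phi>\<close> and
   \<open>s\<close>. The curl of \<open>s\<close> is minus that of \<open>r\<close>, which fixes the
   sign in \<open>div\<close>; on a facet the rows of \<open>\<phi>\<close> are parallel to the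
   normal, so the flux is tangential.\<close>
 define w :: "real^3 => real^3" where "w x = vector [u 2 3 x - u 3 2 x, u 3 1 x - u 1 3 x, u 1 2 x - u 2 1 x]" for x
 have wn: "w x $ 1 = u 2 3 x - u 3 2 x" "w x $ 2 = u 3 1 x - u 1 3 x" "w x $ 3 = u 1 2 x - u 2 1 x" for x by (simp_all add: w_def)
 have w: "w : polys (3 + (k - 1) + k) UNIV"
 proof -
 have "ALL j. (%x. w x $ j) : polys (3 + (k - 1) + k) UNIV" unfolding forall_3 wn by (intro conjI polys_diff sU u)
 then have "(%x. \<chi> j. w x $ j) : polys (3 + (k - 1) + k) UNIV" by (intro polys_vec) blast
 then show ?thesis by simp
 qed
 have div: "(SUM j:UNIV. pd j w x $ j) = W3 T r x \<bullet> s x + \<phi> x \<bullet> curl3_mat r x" for x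
 proof -
 have pw: "pd j w x $ j = pd j (%x. w x $ j) x" for j by (rule pd_nth[OF polys_diffable[OF w], symmetric])
 have du: "pd l (%x. u i j x - u i' j' x) x = pd l (u i j) x - pd l (u i' j') x" for l i j i' j'
 by (rule pd_diff[OF polys_diffable[OF u] polys_diffable[OF u]])
 have ps: "pd j s x = pd j (%x. jacobian v (at x)) x - pd j r x" for j
 unfolding s_def[abs_def] by (rule pd_diff[OF polys_diffable[OF jv] polys_diffable[OF r]])
 have cs: "curl3_mat r x $ i $ 1 = pd 3 s x $ i $ 2 - pd 2 s x $ i $ 3"
 "curl3_mat r x $ i $ 2 = pd 1 s x $ i $ 3 - pd 3 s x $ i $ 1"
 "curl3_mat r x $ i $ 3 = pd 2 s x $ i $ 1 - pd 1 s x $ i $ 2" for i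
 unfolding ps curl3_mat_nth[OF polys_diffable[OF r]] vector_minus_component
 using pd_jacobian_commute[OF v, where a=3 and x=x and i=i and b=2] pd_jacobian_commute[OF v, where a=1 and x=x and i=i and b=3]
 pd_jacobian_commute[OF v, where a=2 and x=x and i=i and b=1] by linarith+
 show ?thesis unfolding sum_3 pw wn du pu inner_mat inner_vec_def column_nth W3_def \<phi>_def[symmetric] cs
 curl3_mat_nth[OF polys_diffable[OF \<phi>]] by (simp add: algebra_simps)
 qed
 have w0: "nu c \<bullet> w x = 0" if c: "c : C" and x: "x : fac c" for c x
 proof -
 have x0: "bc c x = 0" using x mem_fac[OF c] by blast
 obtain \<xi> where "\<phi> x = outer_prod (\<xi> x) (g c)"
 proof -
 obtain \<Psi> \<xi> m m' where "!!y. phi3 T r y = bc c y *R \<Psi> y + outer_prod (\<xi> y) (g c)"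
 by (rule phi3_split[OF fs r c], rule that; assumption)
 from this[of x] that[of \<xi>] show thesis by (simp add: \<phi>_def x0)
 qed
 then have "column i (\<phi> x) = (g c $ i) *R \<xi> x" for i by (simp add: column_def outer_prod_def vec_eq_iff)
 moreover have "g c $ j = - (norm (g c) * nu c $ j)" for j using arg_cong[OF g_nu[of c], of "%v. v $ j"] by simp
 ultimately have ue: "u i j x = - (norm (g c) * nu c $ i * (\<xi> x \<bullet> column j (s x)))" for i j by (simp add: u_def)
 have "nu c \<bullet> w x = nu c $ 1 * w x $ 1 + nu c $ 2 * w x $ 2 + nu c $ 3 * w x $ 3" by (simp add: inner_vec_def sum_3)
 then show ?thesis unfolding wn ue by (simp add: algebra_simps)
 qed
 have Wp: "W3 T r : polys (Suc k) UNIV" by (rule W3_deg[OF fs r])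
 have i1: "(%x. W3 T r x \<bullet> s x) integrable_on T" and i2: "(%x. \<phi> x \<bullet> curl3_mat r x) integrable_on T"
 by (intro integrable_compact compact_T continuous_on_inner polys_cont[OF Wp] polys_cont[OF s]
 polys_cont[OF \<phi>] polys_cont[OF cr])+
 have "0 = integral T (%x. SUM j:UNIV. pd j w x $ j)" using integral_div_vec_zero[OF w w0] by simp
 also have "\<dots> = integral T (%x. W3 T r x \<bullet> s x) + integral T (%x. \<phi> x \<bullet> curl3_mat r x)"
 unfolding div by (rule integral_add[OF i1 i2])
 finally have eq: "- integral T (%x. W3 T r x \<bullet> s x) = integral T (%x. \<phi> x \<bullet> curl3_mat r x)" by linarith
 have cpos: "continuous_on A (%x. \<phi> x \<bullet> curl3_mat r x)" for A
 by (intro continuous_on_inner polys_cont[OF \<phi>] polys_cont[OF cr])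
 have cd: "continuous_on A (%x. SUM j:UNIV. (norm (pd j r x))^2)" for A
 by (intro continuous_intros polys_cont[OF polys_pd[OF subspace_skew r]])
 have ec: "\<phi> x \<bullet> curl3_mat r x = (SUM a:C. (PROD b:C - {a}. bc b x) * (norm (curl3_mat r x *v g a))^2)" for x
 unfolding \<phi>_def phi3_eq[OF fs] inner_commute[of _ "curl3_mat r x"] inner_sum_right inner_scaleR_right inner_outer_prod power2_norm_eq_inner ..
 have "c / h^2 * integral (cball z (\<rho> * h / 2)) (%x. SUM j:UNIV. (norm (pd j r x))^2)
 = integral (cball z (\<rho> * h / 2)) (%x. c / h^2 * (SUM j:UNIV. (norm (pd j r x))^2))" by (rule integral_mult_right[symmetric])
 also have "\<dots> <= integral (cball z (\<rho> * h / 2)) (%x. \<phi> x \<bullet> curl3_mat r x)"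
 proof (intro integral_le integrable_compact compact_cball cpos continuous_on_mult_left cd)
 fix x assume x: "x : cball z (\<rho> * h / 2)"
 have "(SUM a:C. (\<rho> / 2) ^ 3 * (norm (curl3_mat r x *v g a))^2) <= \<phi> x \<bullet> curl3_mat r x" unfolding ec
 proof (rule sum_mono)
 fix a assume a: "a : C"
 have "card (C - {a}) = 3" using card_C a finite_C by simp
 then have "(\<rho> / 2) ^ 3 <= (PROD b:C - {a}. bc b x)" using prod_bc_ge[OF Diff_subset x, of "{a}"] by simp
 then show "(\<rho> / 2) ^ 3 * (norm (curl3_mat r x *v g a))^2 <= (PROD b:C - {a}. bc b x) * (norm (curl3_mat r x *v g a))^2"
 by (rule mult_right_mono) simp
 qed
 then have 1: "(\<rho> / 2) ^ 3 * (SUM a:C. (norm (curl3_mat r x *v g a))^2) <= \<phi> x \<bullet> curl3_mat r x" unfolding sum_distrib_left .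
 have "(norm (curl3_mat r x))^2 <= 4 * h^2 * (SUM a:C. (norm (curl3_mat r x *v g a))^2)"
 using norm_mat_le_g[of "curl3_mat r x"] card_C by simp
 then have "(SUM j:UNIV. (norm (pd j r x))^2) <= 20 * h^2 * (SUM a:C. (norm (curl3_mat r x *v g a))^2)"
 using curl3_skew[OF r, of x] by linarith
 then have "c / h^2 * (SUM j:UNIV. (norm (pd j r x))^2) <= c / h^2 * (20 * h^2 * (SUM a:C. (norm (curl3_mat r x *v g a))^2))"
 using c by (intro mult_left_mono) simp_all
 also have "\<dots> = (\<rho> / 2) ^ 3 * (SUM a:C. (norm (curl3_mat r x *v g a))^2)" using h by (simp add: c_def)
 finally show "c / h^2 * (SUM j:UNIV. (norm (pd j r x))^2) <= \<phi> x \<bullet> curl3_mat r x" using 1 by linarith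
 qed
 also have "\<dots> <= integral T (%x. \<phi> x \<bullet> curl3_mat r x)"
 unfolding ec by (rule integral_T_ge_ball[OF cpos[unfolded ec]]) (intro sum_nonneg mult_nonneg_nonneg prod_bc_nonneg Diff_subset zero_le_power2)
 finally have "c / h^2 * integral (cball z (\<rho> * h / 2)) (%x. SUM j:UNIV. (norm (pd j r x))^2) <= - integral T (%x. W3 T r x \<bullet> s x)"
 unfolding eq .
 from mult_left_mono[OF this, of "h ^ 4"]
 have "h ^ 4 * (c / h^2 * integral (cball z (\<rho> * h / 2)) (%x. SUM j:UNIV. (norm (pd j r x))^2)) <= h ^ 4 * (- integral T (%x. W3 T r x \<bullet> s x))"
 by simp
 moreover have "h ^ 4 * (c / h^2 * I) = c * h^2 * I" for I using h by (simp add: power2_eq_square power4_eq_xxxx)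
 ultimately show ?thesis unfolding s_def by simp
 qed
 then show ?thesis using c by blast
qed

lemma bubble_property_3:
 assumes "\<rho> > 0" "k >= 1"
 shows "bubble_property k (%T. {%x. dev (curl3_mat (%y. curl3_mat r y ** bubble3 T y) x) |r. r : skew_polys_perp k T}) \<rho>"
 using bubble_propertyI[where Wop=W3 and k=k and m=4, OF assms W3_add W3_scale W3_deg W3_facet W3_bound[OF assms(1)] W3_lower[OF assms(1)]]
 unfolding W3_def phi3_def[abs_def] .

section \<open>The inf-sup condition\<close>

definition divergence_sq :: "(real^'n::{finite,wellorder}) set => (real^'n::_ => real^'n::_) => real" where
 "divergence_sq T v = integral T (%x. (div_vec v x)^2)"

definition osc_sq :: "(real^'n::{finite,wellorder}) set => real^'n::_ => (real^'n::_ => real^'n::_^'n::_) => real" where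
 "osc_sq T z \<gamma> = integral T (%x. (norm (\<gamma> x - \<gamma> z))^2)"

definition dev_sq :: "nat => (real^'n::{finite,wellorder}) set => real^'n::_ => (real^'n::_ => real^'n::_) => (real^'n::_ => real^'n::_^'n::_) => real" where
 "dev_sq k T z v \<gamma> = integral T (%x. (norm (dev (jacobian (pcor k v z) (at x) - \<gamma> z)))^2)"

lemma trace_sq_le: "(trace (A :: real^'n^'n))^2 <= CARD('n) * (norm A)^2"
proof -
 have "(trace A)^2 / CARD('n) <= (norm A)^2" using norm_dev_trace[of A] by simp
 then show ?thesis by (simp add: field_simps)
qed

text \<open>The local result handed to the assembly. One test function with zero
  \<open>nt_trace\<close> controls deviator and oscillation up to the divergence; its size, the full
  gradient error and the facet values of \<open>ecor\<close> are bounded by these same three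
  quantities.\<close>

definition element_bounds where
 "element_bounds k D h c K C z v \<gamma> \<longleftrightarrow>
 (EX \<sigma> \<delta>. \<sigma> : polys k UNIV & (ALL x. trace (\<sigma> x) = 0) &
 (ALL a:C. ALL x:convex hull (C - {a}). nt_trace (full_simplex.nu C a) (\<sigma> x) = 0) & \<delta> : D (convex hull C) &
 (%x. \<sigma> x + \<delta> x) : polys (Suc k) UNIV &
 (ALL a:C. ALL x:convex hull (C - {a}). nt_trace (full_simplex.nu C a) (\<sigma> x + \<delta> x) = 0) &
 c * (dev_sq k (convex hull C) z v \<gamma> + osc_sq (convex hull C) z \<gamma>) - K * divergence_sq (convex hull C) v
 <= - integral (convex hull C) (%x. (\<sigma> x + \<delta> x) \<bullet> (jacobian v (at x) - \<gamma> x)) &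
 integral (convex hull C) (%x. (norm (\<sigma> x + \<delta> x))^2) <= K * (dev_sq k (convex hull C) z v \<gamma> + osc_sq (convex hull C) z \<gamma>)) &
 integral (convex hull C) (%x. (norm (jacobian v (at x) - \<gamma> x))^2)
 <= K * (dev_sq k (convex hull C) z v \<gamma> + osc_sq (convex hull C) z \<gamma> + divergence_sq (convex hull C) v) &
 (ALL a:C. inverse h * FI (convex hull (C - {a})) (%x. (norm (ecor k v z x))^2) <= K * divergence_sq (convex hull C) v)"

lemma element_test:
 assumes rho: "\<rho> > 0" and k: "k >= 1" and bp: "bubble_property k D \<rho>"
 shows "\<exists>c>0. \<exists>K>0. ALL C z h v \<gamma>. shaped_simplex C (z :: real^'n::{finite,wellorder}) h \<rho> --> v : raviart_thomas k --> \<gamma> : polys k skew -->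
 element_bounds k D h c K C z v \<gamma>"
proof -
 let ?n = "real CARD('n)"
 obtain c1 K1 where c1: "c1 > 0" and K1: "K1 > 0" and t1: "ALL C z h M R. shaped_simplex C (z :: real^'n::_) h \<rho> --> M : polys (k - 1) UNIV -->
 (ALL x. trace (M x) = 0) --> continuous_on UNIV R --> (ALL x. trace (R x) = 0) -->
 c1 * integral (convex hull C) (%x. (norm (M x))^2) - K1 * integral (convex hull C) (%x. (norm (R x))^2)
 <= - integral (convex hull C) (%x. full_simplex.tau1 C M x \<bullet> (M x + R x)) &
 integral (convex hull C) (%x. (norm (full_simplex.tau1 C M x))^2) <= K1 * integral (convex hull C) (%x. (norm (M x))^2)"
 using tau1_test[OF rho, where k="k - 1" and 'n='n] by (elim exE conjE) (rule that; assumption)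
 obtain c2 K2 where c2: "c2 > 0" and K2: "K2 > 0" and t2: "\<forall>C (z :: real^'n::_) h \<gamma>. shaped_simplex C z h \<rho> --> \<gamma> : polys k skew -->
 (EX W \<sigma> \<delta>. W : polys (Suc k) UNIV & (ALL x. dev (W x) = \<sigma> x + \<delta> x) & \<sigma> : polys k UNIV & (ALL x. trace (\<sigma> x) = 0) &
 (ALL a:C. ALL x:convex hull (C - {a}). nt_trace (full_simplex.nu C a) (\<sigma> x) = 0) & \<delta> : D (convex hull C) &
 (ALL a:C. ALL x:convex hull (C - {a}). nt_trace (full_simplex.nu C a) (dev (W x)) = 0) &
 integral (convex hull C) (%x. (norm (W x))^2) <= K2 * integral (convex hull C) (%x. (norm (\<gamma> x - \<gamma> z))^2) &
 (ALL v:polys (Suc k) UNIV. c2 * h^2 * integral (cball z (\<rho> * h / 2)) (%x. SUM j:UNIV. (norm (pd j \<gamma> x))^2)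
 <= - integral (convex hull C) (%x. W x \<bullet> (jacobian v (at x) - \<gamma> x))))"
 using bp unfolding bubble_property_def by (elim exE conjE) (rule that; assumption)
 obtain K3 where K3: "K3 > 0" and os: "ALL C z h p. shaped_simplex C (z :: real^'n::_) h \<rho> --> p : polys k (UNIV :: (real^'n::_^'n::_) set) -->
 integral (convex hull C) (%x. (norm (p x - p z))^2) <= K3 * h^2 * integral (cball z (\<rho> * h / 2)) (%x. SUM j:UNIV. (norm (pd j p x))^2)"
 using oscillation_le_gradient[OF rho, where k=k and 'n='n and 'v="real^'n::_^'n::_"] by (elim exE conjE) (rule that; assumption)
 obtain K4 where K4: "K4 > 0" and ec: "ALL C z h v. shaped_simplex C (z :: real^'n::_) h \<rho> --> v : raviart_thomas k -->
 integral (convex hull C) (%x. (norm (jacobian (ecor k v z) (at x)))^2) <= K4 * integral (convex hull C) (%x. (div_vec v x)^2) &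
 (ALL a:C. inverse h * FI (convex hull (C - {a})) (%x. (norm (ecor k v z x))^2) <= K4 * integral (convex hull C) (%x. (div_vec v x)^2))"
 using ecor_bounds[OF rho k, where 'n='n] by (elim exE conjE) (rule that; assumption)
 define c where "c = c2 / K3"
 have c: "c > 0" using c2 K3 by (simp add: c_def)
 define K5 where "K5 = 2 * K1 * (K4 + 1)"
 have K5: "K5 > 0" using K1 K4 by (simp add: K5_def)
 \<comment> \<open>Weight of \<open>tau1\<close> relative to the curl bubble. Its perturbation
   \<open>K5 * (d + \<eta>)\<close> then costs \<open>c / 4 * \<eta>\<close>, half of the
   \<open>c / 2 * \<eta>\<close> gained from the bubble.\<close>
 define L where "L = c / (4 * K5)"
 have L: "L > 0" using c K5 by (simp add: L_def)
 \<comment> \<open>Price of replacing \<open>W\<close> by its deviator: the two differ by a multiple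
   of the trace of \<open>W\<close>, which meets \<open>div v\<close>, the trace of
   \<open>jacobian v - \<gamma>\<close>. Young's inequality with weight \<open>c / K2\<close> keeps
   half of \<open>c * \<eta>\<close>.\<close>
 define Ey where "Ey = K2 / (2 * c)"
 have Ey: "Ey > 0" using K2 c by (simp add: Ey_def)
 define c' where "c' = min (c / 4) (L * c1)"
 have c': "c' > 0" using c L c1 by (simp add: c'_def)
 define K where "K = Ey + L * K5 + (2 * K2 + 2 * L^2 * K1) + (6 + 4 * K4) + K4"
 have Kp: "Ey + L * K5 <= K" "2 * K2 <= K" "2 * L^2 * K1 <= K" "6 + 4 * K4 <= K" "K4 <= K" "K > 0"
 using K1 K2 K4 K5 L Ey by (simp_all add: K_def add_nonneg_nonneg add_pos_pos)
 have main: "element_bounds k D h c' K C z v \<gamma>"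
 if S: "shaped_simplex C z h \<rho>" and v: "v : raviart_thomas k" and \<gamma>: "\<gamma> : polys k skew" for C and z :: "real^'n::_" and h v \<gamma>
 proof -
 interpret shaped_simplex C z h \<rho> by (rule S)
 define p where "p = pcor k v z"
 define e where "e = ecor k v z"
 have p: "p : polys k UNIV" and e: "e : polys (Suc k) UNIV" and vk: "v : polys (Suc k) UNIV"
 unfolding p_def e_def by (rule pcor_polys[OF v k], rule ecor_polys[OF v k], rule raviart_thomas_split(1)[OF v k])
 have pe: "v = (%x. p x + e x)" by (simp add: p_def e_def pcor_def fun_eq_iff)
 have \<gamma>U: "\<gamma> : polys k UNIV" using \<gamma> by (rule polys_UNIV)
 have \<gamma>s: "\<gamma> x : skew" for x by (rule polys_value[OF subspace_skew \<gamma>])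
 define Z where "Z x = jacobian v (at x) - \<gamma> x" for x
 define G where "G x = \<gamma> x - \<gamma> z" for x
 \<comment> \<open>The deviator of the gradient error is \<open>M + R\<close>. \<open>M\<close> has
   degree \<open>k - 1\<close>, so that \<open>tau1 M\<close> has degree \<open>k\<close>; this is
   the purpose of splitting \<open>v\<close> and freezing \<open>\<gamma>\<close>. \<open>R\<close>
   holds the divergence correction and the oscillation of \<open>\<gamma>\<close>, which are
   controlled otherwise.\<close>
 define M where "M x = dev (jacobian p (at x) - \<gamma> z)" for x
 define R where "R x = dev (jacobian e (at x)) - G x" for x
 have Gs: "G x : skew" for x unfolding G_def by (rule subspace_diff[OF subspace_skew \<gamma>s \<gamma>s])
 have Zk: "Z : polys k UNIV" unfolding Z_def[abs_def] using polys_jacobian[OF vk] by (intro polys_diff sU \<gamma>U) simp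
 have Gk: "G : polys k UNIV" unfolding G_def[abs_def] by (intro polys_diff polys_const sU \<gamma>U UNIV_I)
 have Mk: "M : polys (k - 1) UNIV" unfolding M_def[abs_def]
 by (intro polys_lin_image[OF linear_dev polys_diff[OF sU polys_jacobian[OF p] polys_const]] sU UNIV_I) simp
 have jek: "(%x. jacobian e (at x)) : polys k UNIV" using polys_jacobian[OF e] by simp
 have Rk: "R : polys k UNIV" unfolding R_def[abs_def]
 by (intro polys_diff sU Gk polys_lin_image[OF linear_dev jek]) simp
 have cZ: "continuous_on A Z" and cG: "continuous_on A G" and cM: "continuous_on A M" and cR: "continuous_on A R" for A
 by (rule polys_cont[OF Zk], rule polys_cont[OF Gk], rule polys_cont[OF Mk], rule polys_cont[OF Rk])
 have cje: "continuous_on A (%x. jacobian e (at x))" for A by (rule polys_cont[OF jek])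
 have cdv: "continuous_on A (%x. div_vec v x)" for A by (rule polys_cont[OF raviart_thomas_split(2)[OF v k]])
 note cc = cZ cG cM cR cje cdv
 have jac: "jacobian v (at x) = jacobian p (at x) + jacobian e (at x)" for x
 unfolding vec_eq_iff vector_add_component jacobian_nth pe pd_add[OF polys_diffable[OF p] polys_diffable[OF e]] by simp
 have dG: "dev (G x) = G x" for x by (rule dev_trace_free[OF trace_skew[OF Gs]])
 have dZ: "dev (Z x) = M x + R x" for x
 proof -
 have "Z x = (jacobian p (at x) - \<gamma> z) + (jacobian e (at x) - G x)" by (simp add: Z_def jac G_def)
 then show ?thesis by (simp only: M_def R_def linear_add[OF linear_dev] linear_diff[OF linear_dev] dG)
 qed
 have trZ: "trace (Z x) = div_vec v x" for x
 unfolding Z_def linear_diff[OF linear_trace] trace_skew[OF \<gamma>s] by (simp add: div_vec_def)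
 have trM: "ALL x. trace (M x) = 0" by (simp add: M_def trace_dev)
 have trR: "ALL x. trace (R x) = 0" by (simp add: R_def linear_diff[OF linear_trace] trace_dev trace_skew[OF Gs])
 define m where "m = integral T (%x. (norm (M x))^2)"
 define \<eta> where "\<eta> = integral T (%x. (norm (G x))^2)"
 define d where "d = integral T (%x. (div_vec v x)^2)"
 define r where "r = integral T (%x. (norm (R x))^2)"
 have int: "f integrable_on T" if "continuous_on T f" for f :: "real^'n::_ => real" by (rule integrable_compact[OF compact_T that])
 have m0: "0 <= m" and \<eta>0: "0 <= \<eta>" and d0: "0 <= d" unfolding m_def \<eta>_def d_def
 by (intro integral_nonneg int continuous_intros cc; simp)+
 have names: "dev_sq k T z v \<gamma> = m" "osc_sq T z \<gamma> = \<eta>" "divergence_sq T v = d"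
 by (simp_all add: dev_sq_def osc_sq_def divergence_sq_def m_def \<eta>_def d_def M_def G_def p_def)
 have ee: "integral T (%x. (norm (jacobian e (at x)))^2) <= K4 * d"
 and eF: "ALL a:C. inverse h * FI (fac a) (%x. (norm (e x))^2) <= K4 * d"
 using ec[rule_format, OF S v] unfolding e_def d_def by blast+
 have rle: "r <= 2 * (K4 + 1) * (d + \<eta>)"
 proof -
 have "r <= integral T (%x. 2 * (norm (jacobian e (at x)))^2 + 2 * (norm (G x))^2)" unfolding r_def
 proof (intro integral_le int continuous_intros cc)
 fix x
 have "(norm (R x))^2 <= 2 * (norm (dev (jacobian e (at x))))^2 + 2 * (norm (- G x))^2"
 unfolding R_def diff_conv_add_uminus by (rule norm_add_sq_le)
 moreover have "(norm (dev (jacobian e (at x))))^2 <= (norm (jacobian e (at x)))^2" by (intro power_mono norm_dev_le) simp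
 ultimately show "(norm (R x))^2 <= 2 * (norm (jacobian e (at x)))^2 + 2 * (norm (G x))^2" unfolding norm_minus_cancel by linarith
 qed
 also have "\<dots> = integral T (%x. 2 * (norm (jacobian e (at x)))^2) + integral T (%x. 2 * (norm (G x))^2)"
 by (intro integral_add int continuous_intros cc)
 also have "\<dots> <= 2 * (K4 * d) + 2 * \<eta>" unfolding integral_mult_right \<eta>_def using ee by simp
 also have "\<dots> <= 2 * (K4 + 1) * (d + \<eta>)" using K4 d0 \<eta>0 by (simp add: algebra_simps)
 finally show ?thesis .
 qed
 have \<eta>_eq: "integral T (%x. (norm (\<gamma> x - \<gamma> z))^2) = \<eta>" by (simp add: \<eta>_def G_def)
 obtain W \<sigma> \<delta> where W: "W : polys (Suc k) UNIV" and dW: "ALL x. dev (W x) = \<sigma> x + \<delta> x" and \<sigma>: "\<sigma> : polys k UNIV" "ALL x. trace (\<sigma> x) = 0"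
 "ALL a:C. ALL x:fac a. nt_trace (nu a) (\<sigma> x) = 0" and \<delta>: "\<delta> : D T"
 and ntW: "ALL a:C. ALL x:fac a. nt_trace (nu a) (dev (W x)) = 0"
 and nW: "integral T (%x. (norm (W x))^2) <= K2 * \<eta>"
 and bW: "ALL v:polys (Suc k) UNIV. c2 * h^2 * integral (cball z (\<rho> * h / 2)) (%x. SUM j:UNIV. (norm (pd j \<gamma> x))^2)
 <= - integral T (%x. W x \<bullet> (jacobian v (at x) - \<gamma> x))"
 using t2[rule_format, OF S \<gamma>, unfolded \<eta>_eq] by (elim exE conjE) (rule that; assumption)
 have cW: "continuous_on A W" for A by (rule polys_cont[OF W])
 have cdW: "continuous_on A (%x. dev (W x))" for A by (rule polys_cont[OF polys_lin_image[OF linear_dev W, where W=UNIV]]) simp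
 have b2: "c / 2 * \<eta> - Ey * d <= - integral T (%x. dev (W x) \<bullet> Z x)"
 proof -
 have "\<eta> <= K3 * (h^2 * integral (cball z (\<rho> * h / 2)) (%x. SUM j:UNIV. (norm (pd j \<gamma> x))^2))"
 using os[rule_format, OF S \<gamma>U] unfolding \<eta>_def G_def by (simp add: mult.assoc)
 then have "c * \<eta> <= c * (K3 * (h^2 * integral (cball z (\<rho> * h / 2)) (%x. SUM j:UNIV. (norm (pd j \<gamma> x))^2)))"
 using c by (intro mult_left_mono) simp_all
 also have "\<dots> = c2 * h^2 * integral (cball z (\<rho> * h / 2)) (%x. SUM j:UNIV. (norm (pd j \<gamma> x))^2)"
 using K3 by (simp add: c_def)
 also have "\<dots> <= - integral T (%x. W x \<bullet> Z x)" using bW vk unfolding Z_def by blast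
 finally have 1: "c * \<eta> <= - integral T (%x. W x \<bullet> Z x)" .
 have "integral T (%x. dev (W x) \<bullet> Z x) <= integral T (%x. W x \<bullet> Z x + (c / (2 * K2) * (norm (W x))^2 + Ey * (div_vec v x)^2))"
 proof (intro integral_le int continuous_on_add continuous_on_inner continuous_on_mult_left continuous_on_power continuous_on_norm cc cW cdW)
 fix x
 define t where "t = trace (W x) / ?n"
 have t: "t^2 <= (norm (W x))^2"
 proof -
 have "t^2 * ?n^2 <= ?n * (norm (W x))^2" using trace_sq_le[of "W x"] by (simp add: t_def power_divide)
 also have "\<dots> <= ?n^2 * (norm (W x))^2" by (intro mult_right_mono) (simp_all add: power2_eq_square)
 finally show ?thesis by simp
 qed
 have "dev (W x) \<bullet> Z x = W x \<bullet> Z x + t * (- div_vec v x)"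
 unfolding dev_def inner_diff_left inner_scaleR_left inner_commute[of "mat 1"] inner_mat_1 trZ t_def by simp
 moreover have "t * (- div_vec v x) <= c / (2 * K2) * (norm (W x))^2 + Ey * (div_vec v x)^2"
 proof -
 have y: "t * (- div_vec v x) <= (c / K2) / 2 * (norm t)^2 + 1 / (2 * (c / K2)) * (norm (- div_vec v x))^2"
 using Young[of "c / K2" t "- div_vec v x"] c K2 by simp
 have "(c / K2) / 2 * (norm t)^2 <= (c / K2) / 2 * (norm (W x))^2" using t c K2 by (intro mult_left_mono) simp_all
 moreover have "(c / K2) / 2 = c / (2 * K2)" by simp
 ultimately have l: "(c / K2) / 2 * (norm t)^2 <= c / (2 * K2) * (norm (W x))^2" by (simp only:)
 have r: "1 / (2 * (c / K2)) * (norm (- div_vec v x))^2 = Ey * (div_vec v x)^2" by (simp add: Ey_def)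
 show ?thesis by (rule order_trans[OF y add_mono[OF l eq_refl[OF r]]])
 qed
 ultimately show "dev (W x) \<bullet> Z x <= W x \<bullet> Z x + (c / (2 * K2) * (norm (W x))^2 + Ey * (div_vec v x)^2)" by (simp only: add_left_mono)
 qed
 also have "\<dots> = integral T (%x. W x \<bullet> Z x) + (integral T (%x. c / (2 * K2) * (norm (W x))^2) + integral T (%x. Ey * (div_vec v x)^2))"
 proof -
 have i: "(%x. W x \<bullet> Z x) integrable_on T" "(%x. c / (2 * K2) * (norm (W x))^2) integrable_on T" "(%x. Ey * (div_vec v x)^2) integrable_on T"
 by (intro int continuous_on_inner continuous_on_mult_left continuous_on_power continuous_on_norm cc cW)+
 show ?thesis unfolding integral_add[OF i(1) integrable_add[OF i(2,3)]] integral_add[OF i(2,3)] ..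
 qed
 also have "\<dots> <= integral T (%x. W x \<bullet> Z x) + (c / (2 * K2) * (K2 * \<eta>) + Ey * d)"
 unfolding integral_mult_right d_def using nW c K2 by (intro add_left_mono add_right_mono mult_left_mono) simp_all
 also have "c / (2 * K2) * (K2 * \<eta>) = c / 2 * \<eta>" using K2 by simp
 finally show ?thesis using 1 by (simp add: field_simps)
 qed
 define \<tau> where "\<tau> = tau1 M"
 have "Suc (k - 1) = k" using k by simp
 then have \<tau>k: "\<tau> : polys k UNIV" using tau1_polys[OF Mk] by (simp add: \<tau>_def)
 have c\<tau>: "continuous_on A \<tau>" for A by (rule polys_cont[OF \<tau>k])
 have \<tau>1: "c1 * m - K1 * r <= - integral T (%x. \<tau> x \<bullet> (M x + R x))" and n\<tau>: "integral T (%x. (norm (\<tau> x))^2) <= K1 * m"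
 using t1[rule_format, OF S Mk spec[OF trM] cR spec[OF trR]] unfolding m_def r_def \<tau>_def by blast+
 have tr\<tau>: "trace (\<tau> x) = 0" for x by (simp add: \<tau>_def tau1_trace)
 have \<tau>Z: "\<tau> x \<bullet> (M x + R x) = \<tau> x \<bullet> Z x" for x unfolding dZ[symmetric] by (rule inner_dev[OF tr\<tau>])
 have "K1 * r <= K1 * (2 * (K4 + 1) * (d + \<eta>))" by (rule mult_left_mono[OF rle]) (use K1 in simp)
 also have "\<dots> = K5 * (d + \<eta>)" by (simp add: K5_def)
 finally have "K1 * r <= K5 * (d + \<eta>)" .
 then have b1: "c1 * m - K5 * (d + \<eta>) <= - integral T (%x. \<tau> x \<bullet> Z x)"
 using \<tau>1 unfolding \<tau>Z by linarith
 define \<sigma>' where "\<sigma>' x = \<sigma> x + L *R \<tau> x" for x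
 have s': "\<sigma>' x + \<delta> x = dev (W x) + L *R \<tau> x" for x unfolding \<sigma>'_def dW[rule_format] by simp
 have lower: "c' * (m + \<eta>) - K * d <= - integral T (%x. (\<sigma>' x + \<delta> x) \<bullet> Z x)"
 proof -
 have i: "(%x. dev (W x) \<bullet> Z x) integrable_on T" "(%x. L * (\<tau> x \<bullet> Z x)) integrable_on T"
 by (intro int continuous_on_inner continuous_on_mult_left cc cdW c\<tau>)+
 have "integral T (%x. (\<sigma>' x + \<delta> x) \<bullet> Z x) = integral T (%x. dev (W x) \<bullet> Z x) + L * integral T (%x. \<tau> x \<bullet> Z x)"
 unfolding s' inner_add_left inner_scaleR_left integral_add[OF i] integral_mult_right ..
 moreover have "L * (c1 * m - K5 * (d + \<eta>)) <= L * (- integral T (%x. \<tau> x \<bullet> Z x))" using b1 L by (intro mult_left_mono) simp_all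
 moreover have "L * (c1 * m - K5 * (d + \<eta>)) = L * c1 * m - L * K5 * d - c / 4 * \<eta>" using K5 by (simp add: L_def field_simps)
 moreover have "c' * m <= L * c1 * m" "c' * \<eta> <= c / 4 * \<eta>" using m0 \<eta>0 by (intro mult_right_mono; simp add: c'_def)+
 moreover have "(Ey + L * K5) * d <= K * d" using Kp d0 by (intro mult_right_mono)
 moreover have "(Ey + L * K5) * d = Ey * d + L * K5 * d" by (rule distrib_right)
 moreover have "c / 2 * \<eta> = c / 4 * \<eta> + c / 4 * \<eta>" by simp
 moreover have "c' * (m + \<eta>) = c' * m + c' * \<eta>" by (rule distrib_left)
 ultimately show ?thesis using b2 by linarith
 qed
 have upper: "integral T (%x. (norm (\<sigma>' x + \<delta> x))^2) <= K * (m + \<eta>)"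
 proof -
 have "integral T (%x. (norm (\<sigma>' x + \<delta> x))^2) <= integral T (%x. 2 * (norm (W x))^2 + 2 * L^2 * (norm (\<tau> x))^2)"
 unfolding s'
 proof (intro integral_le int continuous_on_add continuous_on_mult_left continuous_on_power continuous_on_norm continuous_on_scaleR continuous_on_const cW cdW c\<tau>)
 fix x
 have "(norm (dev (W x) + L *R \<tau> x))^2 <= 2 * (norm (dev (W x)))^2 + 2 * (norm (L *R \<tau> x))^2" by (rule norm_add_sq_le)
 moreover have "(norm (dev (W x)))^2 <= (norm (W x))^2" by (intro power_mono norm_dev_le) simp
 moreover have "(norm (L *R \<tau> x))^2 = L^2 * (norm (\<tau> x))^2" by (simp add: power_mult_distrib)
 ultimately show "(norm (dev (W x) + L *R \<tau> x))^2 <= 2 * (norm (W x))^2 + 2 * L^2 * (norm (\<tau> x))^2" by linarith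
 qed
 also have "\<dots> = integral T (%x. 2 * (norm (W x))^2) + integral T (%x. 2 * L^2 * (norm (\<tau> x))^2)"
 by (intro integral_add int continuous_on_mult_left continuous_on_power continuous_on_norm cW c\<tau>)
 also have "\<dots> <= 2 * (K2 * \<eta>) + 2 * L^2 * (K1 * m)" unfolding integral_mult_right
 using nW n\<tau> by (intro add_mono mult_left_mono) simp_all
 also have "\<dots> = (2 * K2) * \<eta> + (2 * L^2 * K1) * m" by simp
 also have "\<dots> <= K * \<eta> + K * m" using Kp m0 \<eta>0 by (intro add_mono mult_right_mono)
 finally show ?thesis by (simp add: distrib_left)
 qed
 have normZ: "integral T (%x. (norm (Z x))^2) <= K * (m + \<eta> + d)"
 proof -
 have "integral T (%x. (norm (Z x))^2) <= integral T (%x. (2 * (norm (M x))^2 + 2 * (norm (R x))^2) + (div_vec v x)^2)"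
 proof (intro integral_le int continuous_on_add continuous_on_mult_left continuous_on_power continuous_on_norm cc)
 fix x
 have "(norm (Z x))^2 = (norm (M x + R x))^2 + (div_vec v x)^2 / ?n" unfolding norm_dev_trace[of "Z x"] dZ trZ ..
 moreover have "(norm (M x + R x))^2 <= 2 * (norm (M x))^2 + 2 * (norm (R x))^2" by (rule norm_add_sq_le)
 moreover have "(div_vec v x)^2 / ?n <= (div_vec v x)^2" by (simp add: divide_le_eq mult_le_cancel_left1)
 ultimately show "(norm (Z x))^2 <= (2 * (norm (M x))^2 + 2 * (norm (R x))^2) + (div_vec v x)^2" by linarith
 qed
 also have "\<dots> = (integral T (%x. 2 * (norm (M x))^2) + integral T (%x. 2 * (norm (R x))^2)) + integral T (%x. (div_vec v x)^2)"
 proof -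
 have i: "(%x. 2 * (norm (M x))^2) integrable_on T" "(%x. 2 * (norm (R x))^2) integrable_on T" "(%x. (div_vec v x)^2) integrable_on T"
 by (intro int continuous_on_mult_left continuous_on_power continuous_on_norm cc)+
 show ?thesis unfolding integral_add[OF integrable_add[OF i(1,2)] i(3)] integral_add[OF i(1,2)] ..
 qed
 also have "\<dots> = 2 * m + 2 * r + d" unfolding integral_mult_right m_def r_def d_def ..
 also have "\<dots> <= 2 * m + 2 * (2 * (K4 + 1) * (d + \<eta>)) + d" using rle by linarith
 also have "\<dots> <= (6 + 4 * K4) * (m + \<eta> + d)" using K4 m0 \<eta>0 d0 by (simp add: algebra_simps)
 also have "\<dots> <= K * (m + \<eta> + d)" using Kp m0 \<eta>0 d0 by (intro mult_right_mono) simp_all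
 finally show ?thesis .
 qed
 have sk: "\<sigma>' : polys k UNIV" unfolding \<sigma>'_def[abs_def] by (intro polys_add polys_scaleR sU \<sigma>(1) \<tau>k)
 have st: "trace (\<sigma>' x) = 0" for x unfolding \<sigma>'_def linear_add[OF linear_trace] linear_scale[OF linear_trace] using \<sigma>(2) tr\<tau> by simp
 have nt\<tau>: "nt_trace (nu a) (\<tau> x) = 0" if "a : C" "x : fac a" for a x unfolding \<tau>_def by (rule tau1_nt[OF that])
 have sn: "nt_trace (nu a) (\<sigma>' x) = 0" if "a : C" "x : fac a" for a x
 unfolding \<sigma>'_def linear_add[OF lin_nt] linear_scale[OF lin_nt] nt\<tau>[OF that] using \<sigma>(3) that by simp
 have ssn: "nt_trace (nu a) (\<sigma>' x + \<delta> x) = 0" if "a : C" "x : fac a" for a x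
 unfolding s' linear_add[OF lin_nt] linear_scale[OF lin_nt] nt\<tau>[OF that] using ntW that by simp
 have ssk: "(%x. \<sigma>' x + \<delta> x) : polys (Suc k) UNIV" unfolding s'
 by (intro polys_add polys_scaleR sU polys_lin_image[OF linear_dev W] polys_mono[OF sU \<tau>k]) simp_all
 have eF': "inverse h * FI (fac a) (%x. (norm (ecor k v z x))^2) <= K * d" if "a : C" for a
 using bspec[OF eF that] mult_right_mono[OF Kp(5) d0] unfolding e_def by linarith
 show ?thesis unfolding element_bounds_def names Z_def[symmetric]
 by (intro conjI exI[of _ \<sigma>'] exI[of _ \<delta>] sk allI st ballI sn \<delta> ssk ssn lower upper normZ eF')
 qed
 show ?thesis
 by (rule exI[of _ c'], rule conjI[OF c'], rule exI[of _ K], rule conjI[OF Kp(6)], intro allI impI, rule main; assumption)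
qed

section \<open>Tangential jumps and their lifting\<close>

lemma linear_tang: "linear (tang n)"
 by (simp add: linear_iff tang_def inner_add_left algebra_simps)

lemma tang_uminus: "tang (- n) w = tang n w"
 by (simp add: tang_def)

lemma tang_orth: "norm n = 1 ==> tang n w \<bullet> n = 0"
 by (simp add: tang_def inner_diff_left dot_square_norm)

lemma tang_inner: "norm n = 1 ==> tang n w \<bullet> w = (norm (tang n w))^2"
proof -
 assume n: "norm n = 1"
 have "tang n w \<bullet> w = tang n w \<bullet> (tang n w + (w \<bullet> n) *R n)" by (simp add: tang_def)
 then show ?thesis by (simp only: inner_add_right inner_scaleR_right tang_orth[OF n] power2_norm_eq_inner mult_zero_right add_0_right)
qed

lemma norm_tang_le: "norm n = 1 ==> (norm (tang n w))^2 <= (norm w)^2"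
proof -
 assume n: "norm n = 1"
 have "(norm (tang n w))^2 <= norm (tang n w) * norm w" unfolding tang_inner[OF n, symmetric] by (rule norm_cauchy_schwarz)
 then have "norm (tang n w) <= norm w" by (cases "tang n w = 0") (auto simp: power2_eq_square)
 then show ?thesis by (intro power_mono) auto
qed

text \<open>The integral of a nonintegrable function is 0 by convention, which is nonnegative
  too.\<close>

lemma integral_nonneg_all:
 fixes f :: "real^'n => real"
 assumes "!!x. 0 <= f x" shows "0 <= integral S f"
 using assms by (cases "f integrable_on S") (auto intro: integral_nonneg simp: not_integrable_integral)

lemma l2_norm_sq: "(l2_norm \<T> u)^2 = (SUM T:\<T>. integral T (%x. (norm (u T x))^2))"
proof -
 have "0 <= l2_inner \<T> u u" unfolding l2_inner_def by (intro sum_nonneg integral_nonneg_all) simp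
 then show ?thesis unfolding l2_norm_def power2_norm_eq_inner l2_inner_def by simp
qed

lemma l2_norm_nonneg: "0 <= l2_norm \<T> u"
 unfolding l2_norm_def l2_inner_def by (intro real_sqrt_ge_zero sum_nonneg integral_nonneg_all) simp

context mesh
begin

lemma facet_normal: "T : \<T> ==> a : vertices T ==> outer_normal T (convex hull (vertices T - {a})) = full_simplex.nu (vertices T) a"
proof -
 assume T: "T : \<T>" and a: "a : vertices T"
 show ?thesis using full_simplex.outer_normal_fac[OF full[OF T] a] unfolding hull[OF T] .
qed

lemma sum_facets_T: "T : \<T> ==> (SUM F:{F. F facet_of T}. \<Phi> F) = (SUM a:vertices T. \<Phi> (convex hull (vertices T - {a})))"
proof -
 assume T: "T : \<T>"
 show ?thesis using full_simplex.sum_facets[OF full[OF T], of \<Phi>] unfolding hull[OF T] .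
qed

lemma b2_sum:
 assumes \<tau>: "!!T. T : \<T> ==> \<tau> T : polys m UNIV" and v: "!!T. T : \<T> ==> v T : polys l UNIV" and \<eta>: "!!T. T : \<T> ==> \<eta> T : polys l' UNIV"
 shows "b2 \<T> \<tau> (v, \<eta>) = (SUM T:\<T>. (SUM F:{F. F facet_of T}. FI F (%x. nt_trace (outer_normal T F) (\<tau> T x) \<bullet> v T x))
 - integral T (%x. \<tau> T x \<bullet> (jacobian (v T) (at x) - \<eta> T x)))"
 unfolding b2_def prod.case
proof (rule sum.cong[OF refl])
 fix T assume T: "T : \<T>"
 have "(SUM F:{F. F facet_of T}. FI F (%x. nt_trace (outer_normal T F) (\<tau> T x) \<bullet> v T x))
 = (SUM c:vertices T. FI (convex hull (vertices T - {c})) (%x. nt_trace (full_simplex.nu (vertices T) c) (\<tau> T x) \<bullet> v T x))"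
 unfolding sum_facets_T[OF T] by (intro sum.cong refl) (simp only: facet_normal[OF T])
 then show "integral T (%x. div_mat (\<tau> T) x \<bullet> v T x) + integral T (%x. \<tau> T x \<bullet> \<eta> T x)
 - (SUM F:{F. F facet_of T}. FI F (%x. nn_trace (outer_normal T F) (\<tau> T x) * (v T x \<bullet> outer_normal T F)))
 = (SUM F:{F. F facet_of T}. FI F (%x. nt_trace (outer_normal T F) (\<tau> T x) \<bullet> v T x))
 - integral T (%x. \<tau> T x \<bullet> (jacobian (v T) (at x) - \<eta> T x))"
 using full_simplex.b2_element[OF full[OF T] \<tau>[OF T] v[OF T] \<eta>[OF T]] unfolding hull[OF T] by (simp only:)
qed

lemma adj_obtain:
 assumes "T : adj F" shows "adj F = {T} | (EX T'. T' ~= T & adj F = {T, T'})"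
proof -
 have "F : mesh_facets \<T>" using assms by (auto simp: adj_def mesh_facets_def)
 then show ?thesis by (rule adj_cases) (use assms in auto)
qed

text \<open>The tangential jump as seen from \<open>T\<close>, divided by \<open>h\<close>; on a
  boundary facet the inner sum is empty and the trace itself remains. Seen from the other side it
  changes sign, just as \<open>nt_trace\<close> does with the normal, so prescribing it as
  \<open>nt_trace\<close> on both sides satisfies the continuity condition of
  \<open>Sigma_h\<close>.\<close>

definition tjump :: "((real^'n::_) set => real^'n::_ => real^'n::_) => (real^'n::_) set => (real^'n::_) set => real^'n::_ => real^'n::_" where
 "tjump p F T x = inverse h *R tang (outer_normal T F) (p T x - (SUM T':adj F - {T}. p T' x))"

definition jump_sq :: "((real^'n::_) set => real^'n::_ => real^'n::_) => (real^'n::_) set => real" where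
 "jump_sq p F = FI F (%x. h * (norm (tjump p F (SOME T. T : adj F) x))^2)"

lemma tjump_flip:
 assumes "adj F = {T, T'}" "T' ~= T" shows "tjump p F T' x = - tjump p F T x"
proof -
 have T: "T : \<T>" "T' : \<T>" "F facet_of T" "F facet_of T'" using assms(1) by (auto simp: adj_def)
 have a: "adj F - {T} = {T'}" "adj F - {T'} = {T}" using assms by auto
 have n: "outer_normal T' F = - outer_normal T F" by (rule outer_normal_shared[OF T(1,2) assms(2)[symmetric] T(3,4)])
 have "tang (outer_normal T F) (p T' x - p T x) = - tang (outer_normal T F) (p T x - p T' x)"
 using linear_neg[OF linear_tang, of "outer_normal T F" "p T x - p T' x"] by simp
 then show ?thesis unfolding tjump_def a n tang_uminus by simp
qed

lemma norm_tjump: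
 assumes "T : adj F" "T' : adj F" shows "norm (tjump p F T x) = norm (tjump p F T' x)"
proof (cases "T = T'")
 case False
 then have "adj F = {T, T'}" using adj_obtain[OF assms(1)] assms(2) by auto
 then show ?thesis using tjump_flip[of F T T' p x] False by simp
qed simp

lemma tjump_some: "T : adj F ==> norm (tjump p F (SOME T. T : adj F) x) = norm (tjump p F T x)"
 using norm_tjump[of "SOME T. T : adj F" F T] someI[of "%T. T : adj F" T] by blast

lemma tjump_polys:
 assumes "!!T. T : \<T> ==> p T : polys k UNIV" "T : \<T>" shows "tjump p F T : polys k UNIV"
proof -
 have "(%x. p T x - (SUM T':adj F - {T}. p T' x)) : polys k UNIV"
 by (intro polys_diff polys_sum sU assms) (simp add: adj_def)
 then have "(%x. tang (outer_normal T F) (p T x - (SUM T':adj F - {T}. p T' x))) : polys k UNIV"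
 by (rule polys_lin_image[OF linear_tang]) simp
 then show ?thesis unfolding tjump_def[abs_def] by (rule polys_scaleR[OF sU])
qed

text \<open>Tested with \<open>p\<close>, the jump gives \<open>h\<close> times the square of
  \<open>tjump\<close>. Each of the at most two sides loses an eighth of this to the error
  \<open>e\<close> by Young's inequality, which leaves at least 3/4.\<close>

lemma facet_pointwise:
 assumes T: "T : adj F"
 shows "(SUM T':adj F. tjump p F T' x \<bullet> (p T' x + e T' x)) >= 3/4 * (h * (norm (tjump p F T x))^2) - (SUM T':adj F. 2 * inverse h * (norm (e T' x))^2)"
proof -
 have y: "- (u \<bullet> w) <= h / 8 * (norm u)^2 + 2 * inverse h * (norm w)^2" for u w :: "real^'n::_"
 using Young[of "h / 4" "- u" w] h_pos by (simp add: field_simps)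
 have n: "norm (outer_normal T F) = 1" using T norm_outer_normal by (auto simp: adj_def)
 define t where "t = tjump p F T x"
 have tt: "t \<bullet> (p T x - (SUM T':adj F - {T}. p T' x)) = h * (norm t)^2"
 using h_pos unfolding t_def tjump_def inner_scaleR_left tang_inner[OF n] by (simp add: power2_eq_square field_simps)
 have t0: "0 <= h * (norm t)^2" using h_pos by simp
 consider "adj F = {T}" | T' where "T' ~= T" "adj F = {T, T'}" using adj_obtain[OF T] by blast
 then show ?thesis
 proof cases
 case 1
 have "t \<bullet> p T x = h * (norm t)^2" using tt 1 by simp
 moreover have s1: "(SUM T':adj F. f T') = f T" for f :: "_ => real" unfolding 1 by simp
 ultimately show ?thesis unfolding s1 t_def[symmetric] inner_add_right using y[of t "e T x"] t0 by linarith
 next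
 case 2
 have a: "adj F - {T} = {T'}" using 2 by auto
 have s: "(SUM T':adj F. f T') = f T + f T'" for f :: "_ => real" unfolding 2 using 2(1) by simp
 have "t \<bullet> p T x - t \<bullet> p T' x = h * (norm t)^2" using tt unfolding a by (simp add: inner_diff_right)
 then show ?thesis using y[of t "e T x"] y[of "- t" "e T' x"] t0 unfolding s tjump_flip[OF 2(2,1)] t_def[symmetric]
 inner_add_right inner_minus_left norm_minus_cancel by linarith
 qed
qed

text \<open>The element picked in \<open>tang_jump\<close> may differ from \<open>T\<close>, but the
  norm of \<open>tjump\<close> does not depend on the side. The factor 4 is 2 for separating
  \<open>e\<close> and 2 for its two one-sided values.\<close>

lemma jump_pointwise:
 fixes v p e :: "(real^'n::_) set => real^'n::_ => real^'n::_"
 assumes T: "T : adj F" and v: "!!T. T : adj F ==> v T x = p T x + e T x"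
 shows "(norm (tang_jump \<T> F v x))^2 <= 2 * h^2 * (norm (tjump p F T x))^2 + 4 * (SUM T':adj F. (norm (e T' x))^2)"
proof -
 define T0 where "T0 = (SOME T. T : adj F)"
 have T0: "T0 : adj F" unfolding T0_def using T by (rule someI)
 have e0: "(SOME T. T : \<T> & F facet_of T) = T0" by (simp add: T0_def adj_def)
 have e1: "{T' : \<T>. F facet_of T' & T' ~= T0} = adj F - {T0}" by (auto simp: adj_def)
 define n where "n = outer_normal T0 F"
 have nn: "norm n = 1" unfolding n_def using T0 norm_outer_normal by (auto simp: adj_def)
 define E where "E = e T0 x - (SUM T':adj F - {T0}. e T' x)"
 have "tang_jump \<T> F v x = tang n (v T0 x) - (SUM T':adj F - {T0}. tang n (v T' x))"
 unfolding tang_jump_def Let_def e0 e1 n_def ..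
 also have "\<dots> = tang n (v T0 x - (SUM T':adj F - {T0}. v T' x))" by (simp add: linear_diff[OF linear_tang] linear_sum[OF linear_tang])
 also have "v T0 x - (SUM T':adj F - {T0}. v T' x) = (p T0 x - (SUM T':adj F - {T0}. p T' x)) + E"
 proof -
 have "(SUM T':adj F - {T0}. v T' x) = (SUM T':adj F - {T0}. p T' x + e T' x)" using v by (intro sum.cong) auto
 then show ?thesis using v[OF T0] by (simp add: E_def sum.distrib)
 qed
 also have "tang n ((p T0 x - (SUM T':adj F - {T0}. p T' x)) + E) = h *R tjump p F T0 x + tang n E"
 using h_pos by (simp add: linear_add[OF linear_tang] tjump_def n_def)
 finally have "(norm (tang_jump \<T> F v x))^2 <= 2 * (norm (h *R tjump p F T0 x))^2 + 2 * (norm (tang n E))^2"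
 using norm_add_sq_le[of "h *R tjump p F T0 x" "tang n E"] by (simp only:)
 moreover have "(norm (h *R tjump p F T0 x))^2 = h^2 * (norm (tjump p F T x))^2"
 using norm_tjump[OF T0 T, of p x] by (simp add: power_mult_distrib)
 moreover have "(norm (tang n E))^2 <= (norm E)^2" by (rule norm_tang_le[OF nn])
 moreover have "(norm E)^2 <= 2 * (SUM T':adj F. (norm (e T' x))^2)"
 proof -
 consider "adj F = {T0}" | T' where "T' ~= T0" "adj F = {T0, T'}" using adj_obtain[OF T0] by blast
 then show ?thesis
 proof cases
 case 1
 then show ?thesis by (simp add: E_def)
 next
 case 2
 have a: "adj F - {T0} = {T'}" using 2 by auto
 have s: "(SUM T':adj F. f T') = f T0 + f T'" for f :: "_ => real" unfolding 2 using 2(1) by simp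
 show ?thesis unfolding s E_def a using norm_add_sq_le[of "e T0 x" "- e T' x"] by simp
 qed
 qed
 ultimately show ?thesis by linarith
qed

text \<open>Each facet datum is extended into the element along the normal by \<open>pr\<close> and
  turned into a matrix by \<open>tau3\<close>, so that on every facet only its own contribution
  shows in \<open>nt_trace\<close>.\<close>

definition tau_jump :: "((real^'n::_) set => real^'n::_ => real^'n::_) => (real^'n::_) set => real^'n::_ => real^'n::_^'n::_" where
 "tau_jump p T x = (SUM a:vertices T. full_simplex.tau3 (vertices T) a (tjump p (convex hull (vertices T - {a})) T (full_simplex.pr (vertices T) a x)))"

lemma tau_jump_props:
 assumes p: "!!T. T : \<T> ==> p T : polys k UNIV" and T: "T : \<T>"
 shows "tau_jump p T : polys k UNIV" "trace (tau_jump p T x) = 0"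
 "F facet_of T ==> x : F ==> nt_trace (outer_normal T F) (tau_jump p T x) = tjump p F T x"
proof -
 interpret S: full_simplex "vertices T" by (rule full[OF T])
 show "tau_jump p T : polys k UNIV" unfolding tau_jump_def[abs_def]
 proof (intro polys_sum sU)
 fix a assume a: "a : vertices T"
 show "(%x. S.tau3 a (tjump p (S.fac a) T (S.pr a x))) : polys k UNIV"
 by (rule polys_lin_image[OF S.linear_tau3 polys_affine_compose[OF sU tjump_polys[OF p T] S.polys_pr[OF a]]]) simp_all
 qed
 show "trace (tau_jump p T x) = 0" by (simp add: tau_jump_def linear_sum[OF linear_trace] S.tau3_trace)
 assume F: "F facet_of T" and x: "x : F"
 obtain c where c: "c : vertices T" "F = S.fac c" using F facet_cases[OF T] by blast
 have n: "outer_normal T F = S.nu c" unfolding c(2) by (rule facet_normal[OF T c(1)])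
 have "S.bc c x = 0" using x S.mem_fac[OF c(1)] unfolding c(2) by blast
 then have pr: "S.pr c x = x" by (rule S.pr_fixed)
 have o: "tjump p F T x \<bullet> S.nu c = 0" unfolding tjump_def n using tang_orth[OF S.norm_nu[OF c(1)]] by simp
 have "nt_trace (S.nu c) (tau_jump p T x) = (SUM a:vertices T. if a = c then tjump p F T x else 0)"
 unfolding tau_jump_def linear_sum[OF lin_nt]
 proof (rule sum.cong[OF refl])
 fix a assume a: "a : vertices T"
 show "nt_trace (S.nu c) (S.tau3 a (tjump p (S.fac a) T (S.pr a x))) = (if a = c then tjump p F T x else 0)"
 proof (cases "a = c")
 case True
 have "nt_trace (S.nu c) (S.tau3 c (tjump p F T x)) = tjump p F T x" by (rule S.tau3_nt[OF c(1) o])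
 then show ?thesis using True pr c(2) by simp
 next
 case False
 then show ?thesis using S.tau3_nt_other[OF a c(1) False] by simp
 qed
 qed
 also have "\<dots> = tjump p F T x" using c(1) S.finite_C by simp
 finally show "nt_trace (outer_normal T F) (tau_jump p T x) = tjump p F T x" unfolding n .
qed

lemma sum_adj_le:
 fixes f :: "(real^'n::_) set => real"
 assumes "!!F. F : mesh_facets \<T> ==> 0 <= f F"
 shows "(SUM T:\<T>. SUM F:{F. F facet_of T}. f F) <= 2 * (SUM F:mesh_facets \<T>. f F)"
 unfolding sum_facets_swap sum_distrib_left
proof (rule sum_mono)
 fix F assume F: "F : mesh_facets \<T>"
 have "card (adj F) <= 2" by (rule adj_cases[OF F]) (auto simp: card_insert_if)
 then have "real (card (adj F)) * f F <= 2 * f F" using assms[OF F] by (intro mult_right_mono) simp_all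
 then show "(SUM T:adj F. f F) <= 2 * f F" by simp
qed

lemma jump_sq_nonneg: "0 <= jump_sq p F"
 unfolding jump_sq_def facet_integral_def using h_pos by (intro integral_nonneg_all) simp

text \<open>The pointwise estimates integrated over a facet, with \<open>pcor\<close> and
  \<open>ecor\<close> in mind for \<open>p\<close> and \<open>e\<close>. Only \<open>p\<close>
  enters the lifting, whose degree must not exceed \<open>k\<close>.\<close>

lemma facet_sums:
 fixes v p e :: "(real^'n::_) set => real^'n::_ => real^'n::_"
 assumes p: "!!T. T : \<T> ==> p T : polys k UNIV" and e: "!!T. T : \<T> ==> e T : polys l UNIV"
 and v: "!!T x. T : \<T> ==> v T x = p T x + e T x" and F: "F : mesh_facets \<T>"
 shows "3/4 * jump_sq p F - 2 * (SUM T:adj F. inverse h * FI F (%x. (norm (e T x))^2))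
 <= (SUM T:adj F. FI F (%x. tjump p F T x \<bullet> v T x))"
 and "inverse h * FI F (%x. (norm (tang_jump \<T> F v x))^2)
 <= 2 * jump_sq p F + 4 * (SUM T:adj F. inverse h * FI F (%x. (norm (e T x))^2))"
 and "T : adj F ==> jump_sq p F = h * FI F (%x. (norm (tjump p F T x))^2)"
proof -
 obtain T where T: "T : adj F" using F by (auto simp: adj_def mesh_facets_def)
 have TT: "T : \<T>" "F facet_of T" using T by (auto simp: adj_def)
 interpret S: full_simplex "vertices T" by (rule full[OF TT(1)])
 obtain a where a: "a : vertices T" "F = S.fac a" using TT(2) facet_cases[OF TT(1)] by blast
 have A: "T' : \<T>" if "T' : adj F" for T' using that by (simp add: adj_def)
 have ce: "continuous_on UNIV (e T')" and cp: "continuous_on UNIV (p T')" and ct: "continuous_on UNIV (tjump p F T')" if "T' : adj F" for T'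
 by (rule polys_cont[OF e[OF A[OF that]]], rule polys_cont[OF p[OF A[OF that]]], rule polys_cont[OF tjump_polys[OF p A[OF that]]])
 have cv: "continuous_on UNIV (v T')" if "T' : adj F" for T'
 using continuous_on_add[OF cp[OF that] ce[OF that]] v[OF A[OF that]] by (simp cong: continuous_on_cong)
 have js: "jump_sq p F = FI F (%x. h * (norm (tjump p F T x))^2)" if "T : adj F" for T
 unfolding jump_sq_def tjump_some[OF that] ..
 have fc: "FI F (%x. s * f x) = s * FI F f" for s f
 unfolding a(2) by (rule S.FI_cmult[OF a(1)])
 show j: "jump_sq p F = h * FI F (%x. (norm (tjump p F T x))^2)" if "T : adj F" for T
 unfolding js[OF that] fc ..
 have cn: "continuous_on UNIV (%x. (norm (f x))^2)" if "continuous_on UNIV f" for f :: "real^'n::_ => real^'n::_"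
 using that by (intro continuous_intros)
 define ee where "ee x = (SUM T:adj F. (norm (e T x))^2)" for x
 have cee: "continuous_on UNIV ee" unfolding ee_def[abs_def] by (intro continuous_on_sum cn ce)
 have Iee: "FI F ee = (SUM T:adj F. FI F (%x. (norm (e T x))^2))"
 unfolding ee_def[abs_def] a(2) by (rule S.FI_sum[OF a(1) _ finite_adj[of F, unfolded a(2)]]) (rule cn[OF ce], simp add: a(2))
 have f1: "3/4 * jump_sq p F = FI F (%x. 3/4 * (h * (norm (tjump p F T x))^2))"
 unfolding js[OF T] fc ..
 have f2: "2 * (SUM T:adj F. inverse h * FI F (%x. (norm (e T x))^2)) = FI F (%x. 2 * inverse h * ee x)"
 by (simp only: fc Iee sum_distrib_left mult.assoc)
 have f3: "FI F (%x. SUM T:adj F. tjump p F T x \<bullet> v T x) = (SUM T:adj F. FI F (%x. tjump p F T x \<bullet> v T x))"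
 unfolding a(2) by (rule S.FI_sum[OF a(1) _ finite_adj]) (rule continuous_on_inner[OF ct[unfolded a(2)] cv[unfolded a(2)]])
 have ch: "continuous_on UNIV (%x. 3/4 * (h * (norm (tjump p F T x))^2))" "continuous_on UNIV (%x. 2 * inverse h * ee x)"
 "continuous_on UNIV (%x. SUM T:adj F. tjump p F T x \<bullet> v T x)"
 by (intro continuous_on_mult_left cn ct T, intro continuous_on_mult_left cee, intro continuous_on_sum continuous_on_inner ct cv)
 have "FI F (%x. 3/4 * (h * (norm (tjump p F T x))^2))
 <= FI F (%x. (SUM T:adj F. tjump p F T x \<bullet> v T x) + 2 * inverse h * ee x)"
 unfolding a(2)
 proof (rule S.FI_mono[OF a(1) ch(1)[unfolded a(2)] continuous_on_add[OF ch(3)[unfolded a(2)] ch(2)]])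
 fix x
 have "(SUM T':adj F. tjump p F T' x \<bullet> (p T' x + e T' x)) = (SUM T':adj F. tjump p F T' x \<bullet> v T' x)"
 by (intro sum.cong refl) (simp add: v A)
 then show "3/4 * (h * (norm (tjump p (S.fac a) T x))^2) <= (SUM T:adj (S.fac a). tjump p (S.fac a) T x \<bullet> v T x) + 2 * inverse h * ee x"
 using facet_pointwise[OF T, of p x e] unfolding a(2)[symmetric] ee_def sum_distrib_left by linarith
 qed
 also have "\<dots> = FI F (%x. SUM T:adj F. tjump p F T x \<bullet> v T x) + FI F (%x. 2 * inverse h * ee x)"
 unfolding a(2) by (rule S.FI_add[OF a(1) ch(3)[unfolded a(2)] ch(2)])
 finally show "3/4 * jump_sq p F - 2 * (SUM T:adj F. inverse h * FI F (%x. (norm (e T x))^2))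
 <= (SUM T:adj F. FI F (%x. tjump p F T x \<bullet> v T x))"
 unfolding f1 f2 f3[symmetric] by linarith
 have ctj: "continuous_on UNIV (%x. (norm (tang_jump \<T> F v x))^2)"
 proof -
 have T0: "(SOME T. T : \<T> & F facet_of T) : adj F" using someI_ex[of "%T. T : \<T> & F facet_of T"] TT by (auto simp: adj_def)
 have ctv: "continuous_on UNIV (%x. tang n (v T' x))" if "T' : adj F" for n T'
 unfolding tang_def by (intro continuous_intros cv that)
 have "continuous_on UNIV (tang_jump \<T> F v)" unfolding tang_jump_def[abs_def] Let_def
 by (intro continuous_on_diff continuous_on_sum ctv T0) (auto simp: adj_def)
 then show ?thesis by (intro continuous_intros)
 qed
 have "FI F (%x. (norm (tang_jump \<T> F v x))^2) <= FI F (%x. 2 * h^2 * (norm (tjump p F T x))^2 + 4 * ee x)"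
 unfolding a(2)
 proof (rule S.FI_mono[OF a(1) ctj[unfolded a(2)] continuous_on_add[OF continuous_on_mult_left[OF cn[OF ct[OF T, unfolded a(2)]]] continuous_on_mult_left[OF cee]]])
 fix x
 show "(norm (tang_jump \<T> (S.fac a) v x))^2 <= 2 * h^2 * (norm (tjump p (S.fac a) T x))^2 + 4 * ee x"
 using jump_pointwise[OF T, of v x p e] v A unfolding a(2)[symmetric] ee_def by blast
 qed
 also have "\<dots> = 2 * h^2 * FI F (%x. (norm (tjump p F T x))^2) + 4 * FI F ee"
 unfolding a(2) S.FI_add[OF a(1) continuous_on_mult_left[OF cn[OF ct[OF T, unfolded a(2)]]] continuous_on_mult_left[OF cee]]
 S.FI_cmult[OF a(1)] ..
 finally have "inverse h * FI F (%x. (norm (tang_jump \<T> F v x))^2)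
 <= inverse h * (2 * h^2 * FI F (%x. (norm (tjump p F T x))^2) + 4 * FI F ee)"
 using h_pos by (intro mult_left_mono) simp_all
 also have "\<dots> = 2 * jump_sq p F + 4 * (inverse h * FI F ee)"
 unfolding j[OF T] using h_pos by (simp add: power2_eq_square field_simps)
 finally show "inverse h * FI F (%x. (norm (tang_jump \<T> F v x))^2)
 <= 2 * jump_sq p F + 4 * (SUM T:adj F. inverse h * FI F (%x. (norm (e T x))^2))"
 unfolding Iee sum_distrib_left[symmetric] .
qed

end

context mesh
begin

lemma tau_jump_norm:
 assumes K3: "!!C z h q a. shaped_simplex C (z :: real^'n::_) h \<rho> ==> a : C ==> q : polys k (UNIV :: (real^'n::_) set) ==>
 integral (convex hull C) (%x. (norm (q (full_simplex.pr C a x)))^2) <= K3 * h * FI (convex hull (C - {a})) (%x. (norm (q x))^2)"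
 and p: "!!T. T : \<T> ==> p T : polys k UNIV" and T: "T : \<T>"
 shows "integral T (%x. (norm (tau_jump p T x))^2)
 <= real (Suc CARD('n)) * (real (Suc CARD('n)) / \<rho>^2)^2 * K3 * (SUM F:{F. F facet_of T}. jump_sq p F)"
proof -
 interpret S: shaped_simplex "vertices T" "ctr T" h \<rho> by (rule shaped[OF T])
 let ?N = "real (Suc CARD('n))"
 let ?t = "%a x. tjump p (S.fac a) T (S.pr a x)"
 have ct: "continuous_on A (%x. ?t a x)" if "a : vertices T" for A a
 by (rule polys_cont[OF polys_affine_compose[OF sU tjump_polys[OF p T] S.polys_pr[OF that]]])
 have c0: "continuous_on A (tau_jump p T)" for A by (rule polys_cont[OF tau_jump_props(1)[OF p T]])
 have "integral T (%x. (norm (tau_jump p T x))^2) <= integral T (%x. SUM a:vertices T. ?N * (?N / \<rho>^2)^2 * (norm (?t a x))^2)"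
 proof (intro integral_le integrable_compact S.compact_T[unfolded hull[OF T]] continuous_on_sum continuous_on_mult_left continuous_on_power continuous_on_norm ct c0)
 fix x
 have "(norm (tau_jump p T x))^2 <= card (vertices T) * (SUM a:vertices T. (norm (S.tau3 a (?t a x)))^2)"
 unfolding tau_jump_def by (rule norm_sum_sq_le[OF S.finite_C])
 also have "\<dots> <= ?N * (SUM a:vertices T. (?N / \<rho>^2)^2 * (norm (?t a x))^2)"
 unfolding S.card_C
 proof (intro mult_left_mono sum_mono)
 fix a assume a: "a : vertices T"
 from power_mono[OF S.norm_tau3_le[OF a, of "?t a x"] norm_ge_zero, of 2]
 show "(norm (S.tau3 a (?t a x)))^2 <= (?N / \<rho>^2)^2 * (norm (?t a x))^2" by (simp only: power_mult_distrib)
 qed simp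
 also have "\<dots> = (SUM a:vertices T. ?N * (?N / \<rho>^2)^2 * (norm (?t a x))^2)" by (simp only: sum_distrib_left mult.assoc)
 finally show "(norm (tau_jump p T x))^2 <= (SUM a:vertices T. ?N * (?N / \<rho>^2)^2 * (norm (?t a x))^2)" .
 qed
 also have "\<dots> = (SUM a:vertices T. integral T (%x. ?N * (?N / \<rho>^2)^2 * (norm (?t a x))^2))"
 by (rule integral_sum[OF S.finite_C]) (intro integrable_compact S.compact_T[unfolded hull[OF T]] continuous_on_mult_left continuous_on_power continuous_on_norm ct)
 also have "\<dots> = (SUM a:vertices T. ?N * (?N / \<rho>^2)^2 * integral T (%x. (norm (?t a x))^2))" by (simp only: integral_mult_right)
 also have "\<dots> <= (SUM a:vertices T. ?N * (?N / \<rho>^2)^2 * (K3 * jump_sq p (S.fac a)))"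
 proof (intro sum_mono mult_left_mono)
 fix a assume a: "a : vertices T"
 have F: "S.fac a facet_of T" using facet_cases[OF T] a by blast
 then have m: "S.fac a : mesh_facets \<T>" "T : adj (S.fac a)" using T by (auto simp: mesh_facets_def adj_def)
 have js: "jump_sq p (S.fac a) = h * FI (S.fac a) (%x. (norm (tjump p (S.fac a) T x))^2)"
 by (rule facet_sums(3)[OF p p _ m(1) m(2), where v="%T x. p T x + p T x"]) auto
 show "integral T (%x. (norm (?t a x))^2) <= K3 * jump_sq p (S.fac a)"
 using K3[OF shaped[OF T] a tjump_polys[OF p T]] unfolding hull[OF T] js by (simp only: mult.assoc)
 qed (use rho in simp)
 finally show ?thesis unfolding sum_facets_T[OF T] sum_distrib_left[symmetric] by (simp only: mult.assoc)
qed

end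

text \<open>\<open>X\<close> will be the sum of the squared divergence, oscillation, deviator and
  jumps. Squared norms bounded by \<open>X\<close> and a form bounded below by \<open>X\<close> are
  what a quotient needs; the last conjunct lets the same \<open>\<tau>\<close> serve for
  divergence-free \<open>v\<close>.\<close>

definition test_pair where
 "test_pair k D c K \<Omega> \<T> v \<gamma> \<longleftrightarrow>
 (EX X \<tau> q. 0 <= X & \<tau> : broken_sum (Sigma_h k \<T>) (broken_space \<T> D) & q : Q_h k \<T> & (ALL T:\<T>. \<tau> T : polys (Suc k) UNIV) &
 (norm_U \<T> (v, \<gamma>))^2 <= K * X & (l2_norm \<T> \<tau>)^2 <= K * X & (l2_norm \<T> q)^2 <= K * X &
 c * X <= b1 \<T> v q + b2 \<T> \<tau> (v, \<gamma>) & (v : V0_h k \<Omega> \<T> --> b1 \<T> v q = 0))"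

lemma inf_sup_pair:
 assumes rho: "\<rho> > 0" and k: "k >= 1" and bp: "bubble_property k D \<rho>"
 shows "\<exists>c>0. \<exists>K>0. ALL \<Omega> \<T> v \<gamma>. mesh \<Omega> (\<T> :: (real^'n::{finite,wellorder}) set set) \<rho> --> v : V_h k \<Omega> \<T> --> \<gamma> : W_h k \<T> -->
 test_pair k D c K \<Omega> \<T> v \<gamma>"
proof -
 let ?N = "real (Suc CARD('n))"
 obtain c K where c: "c > 0" and K: "K > 0" and el: "ALL C z h v \<gamma>. shaped_simplex C (z :: real^'n::_) h \<rho> --> v : raviart_thomas k --> \<gamma> : polys k skew -->
 element_bounds k D h c K C z v \<gamma>"
 using element_test[OF rho k bp] by (elim exE conjE) (rule that; assumption)
 obtain K3 where K3: "K3 > 0" and fe: "ALL C z h q. ALL a:C. shaped_simplex C (z :: real^'n::_) h \<rho> --> q : polys k (UNIV :: (real^'n::_) set) -->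
 integral (convex hull C) (%x. (norm (q (full_simplex.pr C a x)))^2) <= K3 * h * FI (convex hull (C - {a})) (%x. (norm (q x))^2)"
 using facet_extension[OF rho, where k=k and 'n='n and 'v="real^'n::_"] by (elim exE conjE) (rule that; assumption)
 \<comment> \<open>One factor \<open>?N\<close> from the sum over the vertices, the square from
   \<open>norm_tau3_le\<close>, and \<open>K3\<close> from \<open>facet_extension\<close>.\<close>
 define Ka where "Ka = ?N * (?N / \<rho>^2)^2 * K3"
 have Ka: "Ka > 0" using K3 rho by (simp add: Ka_def)
 \<comment> \<open>What the lifting brings in besides the jumps: \<open>ecor\<close> on the
   \<open>?N\<close> facets of an element, and the volume term after Young's inequality.\<close>
 define C3 where "C3 = 2 * ?N * K + 2 * Ka * K"
 have C3: "C3 > 0" using K Ka by (simp add: C3_def add_pos_pos)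
 \<comment> \<open>Weight of the lifting: \<open>\<mu> * C3\<close> is \<open>c / 2\<close>, so its
   errors consume only half of the gain \<open>c\<close>.\<close>
 define \<mu> where "\<mu> = c / (2 * C3)"
 have \<mu>: "\<mu> > 0" using c C3 by (simp add: \<mu>_def)
 \<comment> \<open>The divergence test pays for the term with \<open>- K\<close> in
   \<open>element_bounds\<close> and still leaves \<open>c\<close> times the divergence.\<close>
 define \<kappa> where "\<kappa> = K + c"
 have \<kappa>: "\<kappa> > 0" using K c by (simp add: \<kappa>_def)
 define c' where "c' = min (c / 2) (\<mu> / 2)"
 have c': "c' > 0" using c \<mu> by (simp add: c'_def)
 define K' where "K' = (2 * K + 4 * \<mu>^2 * Ka) + \<kappa>^2 + (K + 2 + 4 * ?N * K)"
 have K': "2 * K <= K'" "4 * \<mu>^2 * Ka <= K'" "\<kappa>^2 <= K'" "K + 4 * ?N * K <= K'" "K <= K'" "2 <= K'" "K' > 0"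
 using K Ka by (simp_all add: K'_def add_nonneg_nonneg add_pos_nonneg del: of_nat_Suc)
 have main: "test_pair k D c' K' \<Omega> \<T> v \<gamma>"
 if ms: "mesh \<Omega> (\<T> :: (real^'n::_) set set) \<rho>" and v: "v : V_h k \<Omega> \<T>" and \<gamma>: "\<gamma> : W_h k \<T>" for \<Omega> \<T> v \<gamma>
 proof -
 interpret mesh \<Omega> \<T> \<rho> by (rule ms)
 have vT: "v T : raviart_thomas k" if "T : \<T>" for T by (rule V_h_polys[OF v that])
 have vk: "v T : polys (Suc k) UNIV" if "T : \<T>" for T by (rule raviart_thomas_split(1)[OF vT[OF that] k])
 have \<gamma>T: "\<gamma> T : polys k skew" if "T : \<T>" for T using \<gamma> that by (simp add: W_h_def broken_space_def)
 have \<gamma>U: "\<gamma> T : polys k UNIV" if "T : \<T>" for T using \<gamma>T[OF that] by (rule polys_UNIV)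
 define Z where "Z T x = jacobian (v T) (at x) - \<gamma> T x" for T x
 have Zk: "Z T : polys k UNIV" if "T : \<T>" for T
 unfolding Z_def[abs_def] using polys_jacobian[OF vk[OF that]] by (intro polys_diff sU \<gamma>U that) simp
 define p where "p T = pcor k (v T) (ctr T)" for T
 define e where "e T = ecor k (v T) (ctr T)" for T
 have p: "p T : polys k UNIV" if "T : \<T>" for T unfolding p_def by (rule pcor_polys[OF vT[OF that] k])
 have e: "e T : polys (Suc k) UNIV" if "T : \<T>" for T unfolding e_def by (rule ecor_polys[OF vT[OF that] k])
 have pe: "v T x = p T x + e T x" for T x by (simp add: p_def e_def pcor_def)
 define m where "m T = dev_sq k T (ctr T) (v T) (\<gamma> T)" for T
 define \<eta> where "\<eta> T = osc_sq T (ctr T) (\<gamma> T)" for T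
 define d where "d T = divergence_sq T (v T)" for T
 have pos: "0 <= m T" "0 <= \<eta> T" "0 <= d T" for T
 unfolding m_def \<eta>_def d_def dev_sq_def osc_sq_def divergence_sq_def by (intro integral_nonneg_all; simp)+
 have cT: "f integrable_on T" if "T : \<T>" "continuous_on T f" for T and f :: "real^'n::_ => real"
 using integrable_compact[OF full_simplex.compact_T[OF full[OF that(1)]], of f] that unfolding hull[OF that(1)] by blast
 define Q where "Q T \<sigma> \<delta> \<longleftrightarrow> \<sigma> : polys k UNIV & (ALL x. trace (\<sigma> x) = 0) &
 (ALL a:vertices T. ALL x:convex hull (vertices T - {a}). nt_trace (full_simplex.nu (vertices T) a) (\<sigma> x) = 0) & \<delta> : D T &
 (%x. \<sigma> x + \<delta> x) : polys (Suc k) UNIV &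
 (ALL a:vertices T. ALL x:convex hull (vertices T - {a}). nt_trace (full_simplex.nu (vertices T) a) (\<sigma> x + \<delta> x) = 0) &
 c * (m T + \<eta> T) - K * d T <= - integral T (%x. (\<sigma> x + \<delta> x) \<bullet> Z T x) &
 integral T (%x. (norm (\<sigma> x + \<delta> x))^2) <= K * (m T + \<eta> T)" for T \<sigma> \<delta>
 have el': "EX \<sigma> \<delta>. Q T \<sigma> \<delta>" and nZ: "integral T (%x. (norm (Z T x))^2) <= K * (m T + \<eta> T + d T)"
 and eF: "ALL a:vertices T. inverse h * FI (convex hull (vertices T - {a})) (%x. (norm (e T x))^2) <= K * d T"
 if T: "T : \<T>" for T
 proof -
 note E = mp[OF mp[OF mp[OF spec[OF spec[OF spec[OF spec[OF spec[OF el]]]]] shaped[OF T]] vT[OF T]] \<gamma>T[OF T], unfolded element_bounds_def hull[OF T]]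
 show "EX \<sigma> \<delta>. Q T \<sigma> \<delta>" unfolding Q_def m_def \<eta>_def d_def Z_def by (rule conjunct1[OF E])
 show "integral T (%x. (norm (Z T x))^2) <= K * (m T + \<eta> T + d T)"
 unfolding m_def \<eta>_def d_def Z_def by (rule conjunct1[OF conjunct2[OF E]])
 show "ALL a:vertices T. inverse h * FI (convex hull (vertices T - {a})) (%x. (norm (e T x))^2) <= K * d T"
 unfolding d_def e_def by (rule conjunct2[OF conjunct2[OF E]])
 qed
 obtain \<sigma> where "ALL T:\<T>. EX \<delta>. Q T (\<sigma> T) \<delta>" using bchoice[of \<T> "%T \<sigma>. EX \<delta>. Q T \<sigma> \<delta>"] el' by blast
 then obtain \<delta> where "ALL T:\<T>. Q T (\<sigma> T) (\<delta> T)" using bchoice[of \<T> "%T \<delta>. Q T (\<sigma> T) \<delta>"] by blast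
 then have Q: "Q T (\<sigma> T) (\<delta> T)" if "T : \<T>" for T using that by blast
 have \<sigma>k: "\<sigma> T : polys k UNIV" and \<sigma>t: "trace (\<sigma> T x) = 0" and \<delta>D: "\<delta> T : D T" and \<sigma>\<delta>: "(%x. \<sigma> T x + \<delta> T x) : polys (Suc k) UNIV"
 and qlow: "c * (m T + \<eta> T) - K * d T <= - integral T (%x. (\<sigma> T x + \<delta> T x) \<bullet> Z T x)"
 and qup: "integral T (%x. (norm (\<sigma> T x + \<delta> T x))^2) <= K * (m T + \<eta> T)" if "T : \<T>" for T x
 using Q[OF that] unfolding Q_def by simp_all
 have nt: "nt_trace (outer_normal T F) (\<sigma> T x) = 0 & nt_trace (outer_normal T F) (\<sigma> T x + \<delta> T x) = 0"
 if T: "T : \<T>" and F: "F facet_of T" and x: "x : F" for T F x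
 proof -
 obtain a where a: "a : vertices T" "F = convex hull (vertices T - {a})" using F facet_cases[OF T] by blast
 show ?thesis using Q[OF T] a(1) x facet_normal[OF T a(1)] unfolding Q_def a(2) by simp
 qed
 let ?t = "tau_jump p"
 note tj = tau_jump_props[OF p]
 \<comment> \<open>Zero off the mesh, as \<open>broken_space\<close> demands; the two summands are
   the \<open>Sigma_h\<close> part and the bubble part.\<close>
 define \<tau> where "\<tau> T x = (if T : \<T> then \<sigma> T x + \<mu> *R ?t T x else 0) + (if T : \<T> then \<delta> T x else 0)" for T x
 have \<tau>T: "\<tau> T x = (\<sigma> T x + \<delta> T x) + \<mu> *R ?t T x" if "T : \<T>" for T x using that by (simp add: \<tau>_def)
 have \<tau>k: "\<tau> T : polys (Suc k) UNIV" if T: "T : \<T>" for T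
 proof -
 have "(%x. (\<sigma> T x + \<delta> T x) + \<mu> *R ?t T x) : polys (Suc k) UNIV"
 by (intro polys_add[OF sU \<sigma>\<delta>[OF T]] polys_scaleR sU polys_mono[OF sU tj(1)[OF _ T]]) simp_all
 moreover have "\<tau> T = (%x. (\<sigma> T x + \<delta> T x) + \<mu> *R ?t T x)" using \<tau>T[OF T] by (rule ext)
 ultimately show ?thesis by (simp only:)
 qed
 have tj3: "nt_trace (outer_normal T F) (?t T x) = tjump p F T x" if "T : \<T>" "F facet_of T" "x : F" for T F x
 by (rule tau_jump_props(3)[OF p that])
 have nt\<tau>: "nt_trace (outer_normal T F) (\<tau> T x) = \<mu> *R tjump p F T x" if "T : \<T>" "F facet_of T" "x : F" for T F x
 unfolding \<tau>T[OF that(1)] linear_add[OF lin_nt, of _ "\<sigma> T x + \<delta> T x"] linear_scale[OF lin_nt] tj3[OF that] using nt[OF that] by simp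
 have \<tau>S: "\<tau> : broken_sum (Sigma_h k \<T>) (broken_space \<T> D)"
 proof -
 define s where "s T x = (if T : \<T> then \<sigma> T x + \<mu> *R ?t T x else 0)" for T x
 define dl where "dl T x = (if T : \<T> then \<delta> T x else 0)" for T x
 have "dl : broken_space \<T> D" using \<delta>D by (auto simp: broken_space_def dl_def[abs_def])
 moreover have "s : Sigma_h k \<T>" unfolding Sigma_h_def mem_Collect_eq
 proof (intro conjI ballI allI impI)
 have "(%x. \<sigma> T x + \<mu> *R ?t T x) : polys k UNIV" if "T : \<T>" for T
 by (intro polys_add polys_scaleR sU \<sigma>k tj(1) that p)
 then show "s : broken_space \<T> (%T. polys k UNIV)" by (auto simp: broken_space_def s_def[abs_def])
 show "trace (s T x) = 0" if "T : \<T>" for T x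
 using that \<sigma>t[OF that] tj(2)[OF _ that] by (simp add: s_def linear_add[OF linear_trace] linear_scale[OF linear_trace])
 have sn: "nt_trace (outer_normal T F) (s T x) = \<mu> *R tjump p F T x" if "T : \<T>" "F facet_of T" "x : F" for T F x
 using that(1) nt[OF that] tj(3)[OF _ that] by (simp add: s_def linear_add[OF lin_nt, of _ "\<sigma> T x"] linear_scale[OF lin_nt])
 fix T T' F x assume T: "T : \<T>" "T' : \<T>" and F: "T ~= T' & F facet_of T & F facet_of T'" and x: "x : F"
 have TF: "T ~= T'" "F facet_of T" "F facet_of T'" using F by auto
 have n: "outer_normal T F = - outer_normal T' F" using outer_normal_shared[OF T TF] by simp
 have "adj F = {T, T'}" using adj_obtain[of T F] T TF by (auto simp: adj_def)
 then have "tjump p F T' x = - tjump p F T x" using TF(1) by (intro tjump_flip) auto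
 moreover have "nt_trace (outer_normal T F) (s T' x) = - (\<mu> *R tjump p F T' x)"
 unfolding n nt_trace_uminus sn[OF T(2) TF(3) x] ..
 ultimately show "nt_trace (outer_normal T F) (s T x) = nt_trace (outer_normal T F) (s T' x)"
 unfolding sn[OF T(1) TF(2) x] by simp
 qed
 moreover have "\<tau> = (%T x. s T x + dl T x)" by (simp add: \<tau>_def s_def dl_def fun_eq_iff)
 ultimately show ?thesis unfolding broken_sum_def by blast
 qed
 define M where "M = (SUM T:\<T>. m T)"
 define H where "H = (SUM T:\<T>. \<eta> T)"
 define Dd where "Dd = (SUM T:\<T>. d T)"
 define J where "J = (SUM F:mesh_facets \<T>. jump_sq p F)"
 have P: "0 <= M" "0 <= H" "0 <= Dd" "0 <= J" unfolding M_def H_def Dd_def J_def by (intro sum_nonneg pos jump_sq_nonneg)+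
 define X where "X = M + H + Dd + J"
 have ct: "continuous_on A (?t T)" and cZ: "continuous_on A (Z T)" and cs: "continuous_on A (%x. \<sigma> T x + \<delta> T x)" if "T : \<T>" for T A
 by (rule polys_cont[OF tj(1)[OF _ that]], assumption) (rule polys_cont[OF Zk[OF that]], rule polys_cont[OF \<sigma>\<delta>[OF that]])
 have tn: "(SUM T:\<T>. integral T (%x. (norm (?t T x))^2)) <= 2 * Ka * J"
 proof -
 have "(SUM T:\<T>. integral T (%x. (norm (?t T x))^2)) <= (SUM T:\<T>. Ka * (SUM F:{F. F facet_of T}. jump_sq p F))"
 unfolding Ka_def by (intro sum_mono tau_jump_norm[OF _ p]) (use fe in blast)+
 also have "\<dots> = Ka * (SUM T:\<T>. SUM F:{F. F facet_of T}. jump_sq p F)" by (rule sum_distrib_left[symmetric])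
 also have "\<dots> <= Ka * (2 * J)" unfolding J_def using Ka by (intro mult_left_mono sum_adj_le jump_sq_nonneg) simp
 finally show ?thesis by simp
 qed
 have ZX: "(SUM T:\<T>. integral T (%x. (norm (Z T x))^2)) <= K * (M + H + Dd)"
 proof -
 have "(SUM T:\<T>. integral T (%x. (norm (Z T x))^2)) <= (SUM T:\<T>. K * (m T + \<eta> T + d T))" by (intro sum_mono nZ)
 then show ?thesis unfolding M_def H_def Dd_def sum.distrib[symmetric] sum_distrib_left .
 qed
 define ef where "ef = (SUM F:mesh_facets \<T>. SUM T:adj F. inverse h * FI F (%x. (norm (e T x))^2))"
 have ef: "ef <= ?N * K * Dd"
 proof -
 have "ef = (SUM T:\<T>. SUM F:{F. F facet_of T}. inverse h * FI F (%x. (norm (e T x))^2))"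
 unfolding ef_def by (rule sum_facets_swap[symmetric])
 also have "\<dots> <= (SUM T:\<T>. ?N * K * d T)"
 proof (rule sum_mono)
 fix T assume T: "T : \<T>"
 have "(SUM a:vertices T. inverse h * FI (convex hull (vertices T - {a})) (%x. (norm (e T x))^2)) <= (SUM a:vertices T. K * d T)"
 using eF[OF T] by (intro sum_mono) blast
 also have "\<dots> = ?N * K * d T" using full_simplex.card_C[OF full[OF T]] by (simp del: of_nat_Suc)
 finally show "(SUM F:{F. F facet_of T}. inverse h * FI F (%x. (norm (e T x))^2)) <= ?N * K * d T"
 unfolding sum_facets_T[OF T] .
 qed
 finally show ?thesis unfolding Dd_def sum_distrib_left .
 qed
 note fs = facet_sums[where p=p and e=e and v=v and k=k and l="Suc k", OF p e pe]
 define FT where "FT = (SUM T:\<T>. SUM F:{F. F facet_of T}. FI F (%x. tjump p F T x \<bullet> v T x))"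
 define ZT where "ZT = (SUM T:\<T>. integral T (%x. ?t T x \<bullet> Z T x))"
 have FT: "3/4 * J - 2 * ef <= FT"
 proof -
 have "3/4 * J - 2 * ef = (SUM F:mesh_facets \<T>. 3/4 * jump_sq p F - 2 * (SUM T:adj F. inverse h * FI F (%x. (norm (e T x))^2)))"
 unfolding J_def ef_def sum_subtractf sum_distrib_left ..
 also have "\<dots> <= (SUM F:mesh_facets \<T>. SUM T:adj F. FI F (%x. tjump p F T x \<bullet> v T x))" by (rule sum_mono[OF fs(1)])
 finally show ?thesis unfolding FT_def sum_facets_swap .
 qed
 \<comment> \<open>The weight \<open>1 / (4 * Ka)\<close> in Young's inequality is matched to the
   bound \<open>2 * Ka * J\<close> on the lifting, so a quarter of \<open>J\<close> is spent; with
   the quarter lost on the facets, half of it remains.\<close>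
 have ZT: "ZT <= 1/4 * J + 2 * Ka * K * (M + H + Dd)"
 proof -
 have "ZT <= (SUM T:\<T>. 1 / (8 * Ka) * integral T (%x. (norm (?t T x))^2) + 2 * Ka * integral T (%x. (norm (Z T x))^2))"
 unfolding ZT_def
 proof (rule sum_mono)
 fix T assume T: "T : \<T>"
 have i: "(%x. 1 / (8 * Ka) * (norm (?t T x))^2) integrable_on T" "(%x. 2 * Ka * (norm (Z T x))^2) integrable_on T"
 by (intro cT T continuous_on_mult_left continuous_on_power continuous_on_norm ct cZ)+
 have "integral T (%x. ?t T x \<bullet> Z T x) <= integral T (%x. 1 / (8 * Ka) * (norm (?t T x))^2 + 2 * Ka * (norm (Z T x))^2)"
 proof (rule integral_le[OF _ integrable_add[OF i]])
 show "(%x. ?t T x \<bullet> Z T x) integrable_on T" by (intro cT T continuous_on_inner ct cZ)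
 show "?t T x \<bullet> Z T x <= 1 / (8 * Ka) * (norm (?t T x))^2 + 2 * Ka * (norm (Z T x))^2" for x
 using Young[of "1 / (4 * Ka)" "?t T x" "Z T x"] Ka by simp
 qed
 then show "integral T (%x. ?t T x \<bullet> Z T x) <= 1 / (8 * Ka) * integral T (%x. (norm (?t T x))^2) + 2 * Ka * integral T (%x. (norm (Z T x))^2)"
 unfolding integral_add[OF i] integral_mult_right .
 qed
 also have "\<dots> = 1 / (8 * Ka) * (SUM T:\<T>. integral T (%x. (norm (?t T x))^2)) + 2 * Ka * (SUM T:\<T>. integral T (%x. (norm (Z T x))^2))"
 unfolding sum.distrib sum_distrib_left ..
 also have "\<dots> <= 1 / (8 * Ka) * (2 * Ka * J) + 2 * Ka * (K * (M + H + Dd))"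
 using tn ZX Ka by (intro add_mono mult_left_mono) simp_all
 also have "\<dots> = 1/4 * J + 2 * Ka * K * (M + H + Dd)" using Ka by simp
 finally show ?thesis .
 qed
 have b2: "b2 \<T> \<tau> (v, \<gamma>) = \<mu> * FT - ((SUM T:\<T>. integral T (%x. (\<sigma> T x + \<delta> T x) \<bullet> Z T x)) + \<mu> * ZT)"
 proof -
 have F: "(SUM F:{F. F facet_of T}. FI F (%x. nt_trace (outer_normal T F) (\<tau> T x) \<bullet> v T x))
 = \<mu> * (SUM F:{F. F facet_of T}. FI F (%x. tjump p F T x \<bullet> v T x))" if T: "T : \<T>" for T
 unfolding sum_distrib_left
 proof (rule sum.cong[OF refl])
 fix F assume "F : {F. F facet_of T}"
 then have F: "F facet_of T" by simp
 obtain a where a: "a : vertices T" "F = convex hull (vertices T - {a})" using F facet_cases[OF T] by blast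
 have "FI F (%x. nt_trace (outer_normal T F) (\<tau> T x) \<bullet> v T x) = FI F (%x. \<mu> * (tjump p F T x \<bullet> v T x))"
 unfolding a(2) by (rule full_simplex.FI_cong[OF full[OF T] a(1)]) (simp add: nt\<tau>[OF T F[unfolded a(2)]])
 then show "FI F (%x. nt_trace (outer_normal T F) (\<tau> T x) \<bullet> v T x) = \<mu> * FI F (%x. tjump p F T x \<bullet> v T x)"
 using full_simplex.FI_cmult[OF full[OF T] a(1)] unfolding a(2) by simp
 qed
 have V: "integral T (%x. \<tau> T x \<bullet> Z T x) = integral T (%x. (\<sigma> T x + \<delta> T x) \<bullet> Z T x) + \<mu> * integral T (%x. ?t T x \<bullet> Z T x)" if T: "T : \<T>" for T
 proof -
 have i: "(%x. (\<sigma> T x + \<delta> T x) \<bullet> Z T x) integrable_on T" "(%x. \<mu> * (?t T x \<bullet> Z T x)) integrable_on T"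
 by (intro cT T continuous_on_mult_left continuous_on_inner cs ct cZ)+
 show ?thesis unfolding \<tau>T[OF T] inner_add_left[of "\<sigma> T _ + \<delta> T _"] inner_scaleR_left integral_add[OF i] integral_mult_right ..
 qed
 have "b2 \<T> \<tau> (v, \<gamma>) = (SUM T:\<T>. (SUM F:{F. F facet_of T}. FI F (%x. nt_trace (outer_normal T F) (\<tau> T x) \<bullet> v T x))
 - integral T (%x. \<tau> T x \<bullet> Z T x))" unfolding Z_def by (rule b2_sum[OF \<tau>k vk \<gamma>U])
 also have "\<dots> = (SUM T:\<T>. \<mu> * (SUM F:{F. F facet_of T}. FI F (%x. tjump p F T x \<bullet> v T x))
 - (integral T (%x. (\<sigma> T x + \<delta> T x) \<bullet> Z T x) + \<mu> * integral T (%x. ?t T x \<bullet> Z T x)))"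
 by (intro sum.cong refl) (simp only: F V)
 also have "\<dots> = \<mu> * FT - ((SUM T:\<T>. integral T (%x. (\<sigma> T x + \<delta> T x) \<bullet> Z T x)) + \<mu> * ZT)"
 unfolding sum_subtractf sum.distrib FT_def ZT_def sum_distrib_left ..
 finally show ?thesis .
 qed
 have low: "c * (M + H) - K * Dd <= - (SUM T:\<T>. integral T (%x. (\<sigma> T x + \<delta> T x) \<bullet> Z T x))"
 proof -
 have "(SUM T:\<T>. c * (m T + \<eta> T) - K * d T) <= (SUM T:\<T>. - integral T (%x. (\<sigma> T x + \<delta> T x) \<bullet> Z T x))" by (rule sum_mono[OF qlow])
 moreover have "(SUM T:\<T>. c * (m T + \<eta> T) - K * d T) = c * (M + H) - K * Dd"
 unfolding sum_subtractf sum_distrib_left[symmetric] sum.distrib M_def H_def Dd_def ..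
 ultimately show ?thesis unfolding sum_negf by linarith
 qed
 define q where "q T x = (if T : \<T> then \<kappa> * div_vec (v T) x else 0)" for T x
 have qT: "q T = (%x. \<kappa> * div_vec (v T) x)" if "T : \<T>" for T using that by (simp add: q_def[abs_def])
 have qQ: "q : Q_h k \<T>"
 proof -
 have "(%x. \<kappa> *R div_vec (v T) x) : polys k UNIV" if "T : \<T>" for T
 by (intro polys_scaleR sU raviart_thomas_split(2)[OF vT[OF that] k])
 then have "q : broken_space \<T> (%T. polys k UNIV)" using qT by (auto simp: broken_space_def q_def[abs_def])
 moreover have "(SUM T:\<T>. integral T (q T)) = 0"
 proof -
 have "(SUM T:\<T>. integral T (q T)) = (SUM T:\<T>. \<kappa> * integral T (%x. div_vec (v T) x))" by (intro sum.cong refl) (simp add: qT)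
 then show ?thesis unfolding sum_distrib_left[symmetric] integral_div_zero[OF k v] by simp
 qed
 ultimately show ?thesis by (simp add: Q_h_def)
 qed
 have b1: "b1 \<T> v q = \<kappa> * Dd"
 proof -
 have "b1 \<T> v q = (SUM T:\<T>. \<kappa> * integral T (%x. (div_vec (v T) x)^2))"
 unfolding b1_def l2_inner_def integral_mult_right[symmetric] by (intro sum.cong refl) (simp add: qT power2_eq_square mult_ac)
 then show ?thesis unfolding Dd_def d_def divergence_sq_def sum_distrib_left .
 qed
 have qn: "(l2_norm \<T> q)^2 = \<kappa>^2 * Dd"
 proof -
 have "(l2_norm \<T> q)^2 = (SUM T:\<T>. \<kappa>^2 * integral T (%x. (div_vec (v T) x)^2))"
 unfolding l2_norm_sq integral_mult_right[symmetric] by (intro sum.cong refl) (simp add: qT power_mult_distrib)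
 then show ?thesis unfolding Dd_def d_def divergence_sq_def sum_distrib_left .
 qed
 have bound: "c' * X <= b1 \<T> v q + b2 \<T> \<tau> (v, \<gamma>)"
 proof -
 have "J / 2 - C3 * (M + H + Dd) <= FT - ZT"
 proof -
 have "2 * ?N * K * Dd <= 2 * ?N * K * (M + H + Dd)" using K P by (intro mult_left_mono) simp_all
 moreover have "C3 * (M + H + Dd) = 2 * ?N * K * (M + H + Dd) + 2 * Ka * K * (M + H + Dd)" unfolding C3_def by (rule distrib_right)
 ultimately show ?thesis using FT ZT ef by linarith
 qed
 then have "\<mu> * (J / 2 - C3 * (M + H + Dd)) <= \<mu> * (FT - ZT)" using \<mu> by (intro mult_left_mono) simp_all
 moreover have "\<mu> * (J / 2 - C3 * (M + H + Dd)) = \<mu> / 2 * J - c / 2 * (M + H + Dd)"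
 using C3 by (simp add: \<mu>_def field_simps)
 moreover have "\<mu> * (FT - ZT) = \<mu> * FT - \<mu> * ZT" by (rule right_diff_distrib)
 moreover have "c' * (M + H + Dd) <= c / 2 * (M + H + Dd)" "c' * J <= \<mu> / 2 * J" using P by (intro mult_right_mono; simp add: c'_def)+
 moreover have "c' * X = c' * (M + H + Dd) + c' * J" unfolding X_def by (rule distrib_left)
 moreover have "\<kappa> * Dd = K * Dd + c * Dd" unfolding \<kappa>_def by (rule distrib_right)
 moreover have "c * (M + H) + c * Dd = c / 2 * (M + H + Dd) + c / 2 * (M + H + Dd)" by (simp add: field_simps)
 ultimately show ?thesis using low unfolding b1 b2 by linarith
 qed
 have KX: "K' * (M + H + Dd) <= K' * X" "K' * Dd <= K' * X" using K' P by (intro mult_left_mono; simp add: X_def)+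
 have \<tau>n: "(l2_norm \<T> \<tau>)^2 <= K' * X"
 proof -
 have "(l2_norm \<T> \<tau>)^2 <= (SUM T:\<T>. 2 * integral T (%x. (norm (\<sigma> T x + \<delta> T x))^2) + 2 * \<mu>^2 * integral T (%x. (norm (?t T x))^2))"
 unfolding l2_norm_sq
 proof (rule sum_mono)
 fix T assume T: "T : \<T>"
 have i: "(%x. 2 * (norm (\<sigma> T x + \<delta> T x))^2) integrable_on T" "(%x. 2 * \<mu>^2 * (norm (?t T x))^2) integrable_on T"
 by (intro cT T continuous_on_mult_left continuous_on_power continuous_on_norm cs ct)+
 have "integral T (%x. (norm (\<tau> T x))^2) <= integral T (%x. 2 * (norm (\<sigma> T x + \<delta> T x))^2 + 2 * \<mu>^2 * (norm (?t T x))^2)"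
 proof (rule integral_le[OF _ integrable_add[OF i]])
 show "(%x. (norm (\<tau> T x))^2) integrable_on T" by (intro cT T continuous_on_power continuous_on_norm polys_cont[OF \<tau>k[OF T]])
 show "(norm (\<tau> T x))^2 <= 2 * (norm (\<sigma> T x + \<delta> T x))^2 + 2 * \<mu>^2 * (norm (?t T x))^2" for x
 using norm_add_sq_le[of "\<sigma> T x + \<delta> T x" "\<mu> *R ?t T x"] unfolding \<tau>T[OF T] by (simp add: power_mult_distrib)
 qed
 then show "integral T (%x. (norm (\<tau> T x))^2) <= 2 * integral T (%x. (norm (\<sigma> T x + \<delta> T x))^2) + 2 * \<mu>^2 * integral T (%x. (norm (?t T x))^2)"
 unfolding integral_add[OF i] integral_mult_right .
 qed
 also have "\<dots> = 2 * (SUM T:\<T>. integral T (%x. (norm (\<sigma> T x + \<delta> T x))^2)) + 2 * \<mu>^2 * (SUM T:\<T>. integral T (%x. (norm (?t T x))^2))"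
 unfolding sum.distrib sum_distrib_left ..
 also have "\<dots> <= 2 * (SUM T:\<T>. K * (m T + \<eta> T)) + 2 * \<mu>^2 * (2 * Ka * J)"
 using tn by (intro add_mono mult_left_mono sum_mono qup) simp_all
 also have "\<dots> = (2 * K) * (M + H) + (4 * \<mu>^2 * Ka) * J"
 unfolding M_def H_def sum_distrib_left[symmetric] sum.distrib by simp
 also have "\<dots> <= K' * (M + H) + K' * J" using K' P by (intro add_mono mult_right_mono) simp_all
 also have "\<dots> <= K' * X" using K' P by (simp add: X_def distrib_left)
 finally show ?thesis .
 qed
 have qn': "(l2_norm \<T> q)^2 <= K' * X" using mult_right_mono[OF K'(3) P(3)] KX(2) unfolding qn by linarith
 have Un: "(norm_U \<T> (v, \<gamma>))^2 <= K' * X"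
 proof -
 define JJ where "JJ = (SUM F:mesh_facets \<T>. inverse h * FI F (%x. (norm (tang_jump \<T> F v x))^2))"
 have JJ0: "0 <= JJ" unfolding JJ_def facet_integral_def using h_pos by (intro sum_nonneg mult_nonneg_nonneg integral_nonneg_all) simp_all
 have "(norm_U \<T> (v, \<gamma>))^2 = ((l2_norm \<T> (%T. sym_grad (v T)))^2 + JJ) + (l2_norm \<T> (%T x. kappa_curl (v T) x - \<gamma> T x))^2"
 using JJ0 by (simp add: norm_U_def norm_1h_eps_def JJ_def[symmetric])
 \<comment> \<open>Symmetric and skew matrices are orthogonal, so the two volume terms of the norm
   add up to the square of \<open>jacobian v - \<gamma>\<close>.\<close>
 moreover have "(l2_norm \<T> (%T. sym_grad (v T)))^2 + (l2_norm \<T> (%T x. kappa_curl (v T) x - \<gamma> T x))^2 = (SUM T:\<T>. integral T (%x. (norm (Z T x))^2))"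
 unfolding l2_norm_sq sum.distrib[symmetric]
 proof (rule sum.cong[OF refl])
 fix T assume T: "T : \<T>"
 have jv: "(%x. jacobian (v T) (at x)) : polys k UNIV" using polys_jacobian[OF vk[OF T]] by simp
 have lt: "linear (transpose :: real^'n::_^'n::_ => _)" by (simp add: linear_iff transpose_def vec_eq_iff)
 have s: "sym_grad (v T) : polys k UNIV" unfolding sym_grad_def[abs_def]
 by (intro polys_scaleR polys_add sU jv polys_lin_image[OF lt jv]) simp
 have kc: "(%x. kappa_curl (v T) x - \<gamma> T x) : polys k UNIV" unfolding kappa_curl_def
 by (intro polys_diff sU jv s \<gamma>U T)
 have zz: "(norm (Z T x))^2 = (norm (sym_grad (v T) x))^2 + (norm (kappa_curl (v T) x - \<gamma> T x))^2" for x
 proof -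
 have g: "\<gamma> T x : skew" by (rule polys_value[OF subspace_skew \<gamma>T[OF T]])
 have "kappa_curl (v T) x : skew" unfolding skew_def kappa_curl_def sym_grad_def by (simp add: transpose_def vec_eq_iff field_simps)
 then have "kappa_curl (v T) x - \<gamma> T x : skew" using g by (rule subspace_diff[OF subspace_skew])
 moreover have "transpose (sym_grad (v T) x) = sym_grad (v T) x" by (simp add: sym_grad_def transpose_def vec_eq_iff add.commute)
 ultimately have o: "sym_grad (v T) x \<bullet> (kappa_curl (v T) x - \<gamma> T x) = 0" using sym_skew_inner by blast
 have "Z T x = sym_grad (v T) x + (kappa_curl (v T) x - \<gamma> T x)" by (simp add: Z_def kappa_curl_def)
 then show ?thesis using o by (simp add: power2_norm_eq_inner inner_add_left inner_add_right inner_commute)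
 qed
 show "integral T (%x. (norm (sym_grad (v T) x))^2) + integral T (%x. (norm (kappa_curl (v T) x - \<gamma> T x))^2) = integral T (%x. (norm (Z T x))^2)"
 unfolding zz by (rule integral_add[symmetric]; intro cT T continuous_on_power continuous_on_norm polys_cont[OF s] polys_cont[OF kc])
 qed
 moreover have "JJ <= 2 * J + 4 * ef"
 proof -
 have "JJ <= (SUM F:mesh_facets \<T>. 2 * jump_sq p F + 4 * (SUM T:adj F. inverse h * FI F (%x. (norm (e T x))^2)))"
 unfolding JJ_def by (rule sum_mono[OF fs(2)])
 then show ?thesis unfolding J_def ef_def sum.distrib sum_distrib_left .
 qed
 moreover have "K * (M + H + Dd) + (2 * J + 4 * (?N * K * Dd)) <= K' * X"
 proof -
 have "K * (M + H) <= K' * (M + H)" "2 * J <= K' * J" "(K + 4 * ?N * K) * Dd <= K' * Dd" using K' P by (intro mult_right_mono; simp)+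
 moreover have "(K + 4 * ?N * K) * Dd = K * Dd + 4 * (?N * K * Dd)" by (simp add: distrib_right del: of_nat_Suc)
 moreover have "K * (M + H + Dd) = K * (M + H) + K * Dd" by (rule distrib_left)
 moreover have "K' * X = K' * (M + H) + K' * Dd + K' * J" by (simp add: X_def distrib_left)
 ultimately show ?thesis by linarith
 qed
 ultimately show ?thesis using ZX ef by linarith
 qed
 have V0: "b1 \<T> v q = 0" if "v : V0_h k \<Omega> \<T>"
 proof -
 have "integral T (%x. (div_vec (v T) x)^2) = integral T (%x. 0)" if "T : \<T>" for T
 using \<open>v : V0_h k \<Omega> \<T>\<close> that by (intro integral_cong) (auto simp: V0_h_def)
 then have "Dd = 0" unfolding Dd_def d_def divergence_sq_def by simp
 then show ?thesis unfolding b1 by simp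
 qed
 have "0 <= X" using P by (simp add: X_def)
 then show ?thesis unfolding test_pair_def
 by (intro exI[of _ X] exI[of _ \<tau>] exI[of _ q] conjI \<tau>S qQ ballI \<tau>k Un \<tau>n qn' bound impI V0)
 qed
 show ?thesis
 by (rule exI[of _ c'], rule conjI[OF c'], rule exI[of _ K'], rule conjI[OF K'(7)], intro allI impI, rule main; assumption)
qed

section \<open>Degenerate test functions and the supremum\<close>

lemma norm_U_nonneg: "0 <= norm_U \<T> (v, \<gamma>)"
 by (simp add: norm_U_def)

context mesh
begin

lemma l2_norm_eq_0:
 fixes u :: "(real^'n::_) set => real^'n::_ => 'v::euclidean_space"
 assumes u: "!!T. T : \<T> ==> u T : polys m UNIV" and z: "l2_norm \<T> u = 0" and T: "T : \<T>" and x: "x : T"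
 shows "u T x = 0"
proof -
 interpret S: shaped_simplex "vertices T" "ctr T" h \<rho> by (rule shaped[OF T])
 obtain c where c: "c > 0 & (ALL C z h p x. shaped_simplex C (z :: real^'n::_) h \<rho> --> p : polys m (UNIV :: 'v set) --> x : cball z h -->
 c * h ^ CARD('n) * (norm (p x))^2 <= integral (cball z (\<rho> * h / 2)) (%x. (norm (p x))^2))"
 using L2_lower_shaped[OF rho, where K=m and 'n='n and 'v='v] by blast
 have "(SUM T:\<T>. integral T (%x. (norm (u T x))^2)) = 0" using l2_norm_sq[of \<T> u] z by simp
 then have "integral T (%x. (norm (u T x))^2) = 0"
 using T finite_mesh by (subst (asm) sum_nonneg_eq_0_iff) (auto intro: integral_nonneg_all)
 moreover have "integral (cball (ctr T) (\<rho> * h / 2)) (%x. (norm (u T x))^2) <= integral T (%x. (norm (u T x))^2)"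
 using S.integral_T_ge_ball[of "%x. (norm (u T x))^2"] continuous_on_power[OF continuous_on_norm[OF polys_cont[OF u[OF T]]]] unfolding hull[OF T] by simp
 moreover have "x : cball (ctr T) h" using S.T_subset[OF S.z_in_T] x unfolding hull[OF T] by blast
 then have "c * h ^ CARD('n) * (norm (u T x))^2 <= integral (cball (ctr T) (\<rho> * h / 2)) (%x. (norm (u T x))^2)"
 using c shaped[OF T] u[OF T] by blast
 ultimately have "c * h ^ CARD('n) * (norm (u T x))^2 <= 0" by linarith
 moreover have "0 < c * h ^ CARD('n)" using c h_pos by simp
 ultimately have "(norm (u T x))^2 <= 0" using zero_less_mult_pos[of "c * h ^ CARD('n)" "(norm (u T x))^2"]
 by (metis mult_pos_pos not_le)
 then show ?thesis by simp
qed

lemma FI_vanish: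
 assumes "T : \<T>" "F facet_of T" "!!x. x : F ==> f x = 0" shows "FI F f = 0"
proof -
 obtain a where a: "a : vertices T" "F = convex hull (vertices T - {a})" using assms(2) facet_cases[OF assms(1)] by blast
 have "FI F f = FI F (%_. 0)"
 unfolding a(2) by (rule full_simplex.FI_cong[OF full[OF assms(1)] a(1)]) (use assms(3) a(2) in blast)
 also have "\<dots> = 0" unfolding a(2) by (rule full_simplex.FI_zero[OF full[OF assms(1)] a(1)])
 finally show ?thesis .
qed

text \<open>A positive value of the form thus forces a positive denominator, which keeps the
  quotient away from the conventional value 0 of a division by zero.\<close>

lemma b2_vanish:
 assumes \<tau>: "!!T. T : \<T> ==> \<tau> T : polys m UNIV" and v: "!!T. T : \<T> ==> v T : polys l UNIV" and \<eta>: "!!T. T : \<T> ==> \<eta> T : polys l' UNIV"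
 and z: "l2_norm \<T> \<tau> = 0"
 shows "b2 \<T> \<tau> (v, \<eta>) = 0"
proof -
 have "b2 \<T> \<tau> (v, \<eta>) = (SUM T:\<T>. (SUM F:{F. F facet_of T}. FI F (%x. nt_trace (outer_normal T F) (\<tau> T x) \<bullet> v T x))
 - integral T (%x. \<tau> T x \<bullet> (jacobian (v T) (at x) - \<eta> T x)))" by (rule b2_sum[OF \<tau> v \<eta>])
 also have "\<dots> = 0"
proof (rule sum.neutral, rule ballI)
 fix T assume T: "T : \<T>"
 have t0: "\<tau> T x = 0" if "x : T" for x by (rule l2_norm_eq_0[OF \<tau> z T that])
 have "FI F (%x. nt_trace (outer_normal T F) (\<tau> T x) \<bullet> v T x) = 0" if F: "F facet_of T" for F
 proof (rule FI_vanish[OF T F])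
 fix x assume "x : F"
 then have "\<tau> T x = 0" using t0 facet_of_imp_subset[OF F] by blast
 then show "nt_trace (outer_normal T F) (\<tau> T x) \<bullet> v T x = 0" by (simp add: linear_0[OF lin_nt])
 qed
 moreover have "integral T (%x. \<tau> T x \<bullet> (jacobian (v T) (at x) - \<eta> T x)) = integral T (%x. 0)"
 by (rule integral_cong) (simp add: t0)
 ultimately show "(SUM F:{F. F facet_of T}. FI F (%x. nt_trace (outer_normal T F) (\<tau> T x) \<bullet> v T x))
 - integral T (%x. \<tau> T x \<bullet> (jacobian (v T) (at x) - \<eta> T x)) = 0" by simp
qed
 finally show ?thesis .
qed

text \<open>The supremum ranges over nonzero functions, but when the norm of
  \<open>(v, \<eta>)\<close> vanishes the constructed pair may be zero. Some other function must
  then show that the supremum is nonnegative: a bubble on one element has no facet terms, and its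
  sign can be chosen.\<close>

lemma nonneg_test:
 assumes k: "k >= 1" and A: "A ~= 0" "trace (A :: real^'n::_^'n::_) = 0" and D: "!!T. (%_. 0) : D T"
 and v: "!!T. T : \<T> ==> v T : polys l UNIV" and \<eta>: "!!T. T : \<T> ==> \<eta> T : polys l' UNIV"
 shows "EX \<tau>:broken_sum (Sigma_h k \<T>) (broken_space \<T> D). \<tau> ~= (%_ _. 0) & 0 <= b2 \<T> \<tau> (v, \<eta>)"
proof -
 obtain T0 where T0: "T0 : \<T>" using mesh_nonempty by blast
 interpret S: shaped_simplex "vertices T0" "ctr T0" h \<rho> by (rule shaped[OF T0])
 define t where "t = S.tau1 (%_. A)"
 have "t : polys (Suc 0) UNIV" unfolding t_def by (intro S.tau1_polys polys_const sU UNIV_I)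
 then have tk: "t : polys k UNIV" by (rule polys_mono[OF sU]) (use k in simp)
 have nt: "nt_trace (outer_normal T0 F) (t x) = 0" if F: "F facet_of T0" and x: "x : F" for F x
 proof -
 obtain a where a: "a : vertices T0" "F = convex hull (vertices T0 - {a})" using F facet_cases[OF T0] by blast
 show ?thesis using S.tau1_nt[OF a(1)] x unfolding a(2) facet_normal[OF T0 a(1)] t_def by blast
 qed
 \<comment> \<open>This is \<open>tau1_test\<close> with \<open>M\<close> constant and
   \<open>R\<close> zero: if the bubble were zero, the integral of the square of the norm of
   \<open>A\<close> would be nonpositive.\<close>
 have tne: "EX x. t x ~= 0"
 proof (rule ccontr)
 assume "\<not> (EX x. t x ~= 0)"
 then have t0: "t x = 0" for x by blast
 obtain c1 K1 where c1: "c1 > 0" and t1: "ALL C z h M R. shaped_simplex C (z :: real^'n::_) h \<rho> --> M : polys 0 UNIV -->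
 (ALL x. trace (M x) = 0) --> continuous_on UNIV R --> (ALL x. trace (R x) = 0) -->
 c1 * integral (convex hull C) (%x. (norm (M x))^2) - K1 * integral (convex hull C) (%x. (norm (R x))^2)
 <= - integral (convex hull C) (%x. full_simplex.tau1 C M x \<bullet> (M x + R x)) &
 integral (convex hull C) (%x. (norm (full_simplex.tau1 C M x))^2) <= K1 * integral (convex hull C) (%x. (norm (M x))^2)"
 using tau1_test[OF rho, where k=0 and 'n='n] by (elim exE conjE) (rule that; assumption)
 have "c1 * integral S.T (%x. (norm A)^2) - K1 * integral S.T (%x. (norm (0 :: real^'n::_^'n::_))^2) <= - integral S.T (%x. t x \<bullet> (A + 0))"
 unfolding t_def
 by (rule conjunct1[OF t1[rule_format, OF shaped[OF T0], where M="%_. A" and R="%_. 0"]])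
 (simp_all add: A(2) polys_const sU linear_0[OF linear_trace])
 then have "c1 * integral S.T (%x. (norm A)^2) <= 0" by (simp add: t0)
 then have I: "integral S.T (%x. (norm A)^2) <= 0" using c1 by (simp add: mult_le_0_iff)
 obtain c where c: "c > 0 & (ALL C z h p x. shaped_simplex C (z :: real^'n::_) h \<rho> --> p : polys 0 (UNIV :: (real^'n::_^'n::_) set) --> x : cball z h -->
 c * h ^ CARD('n) * (norm (p x))^2 <= integral (cball z (\<rho> * h / 2)) (%x. (norm (p x))^2))"
 using L2_lower_shaped[OF rho, where K=0 and 'n='n and 'v="real^'n::_^'n::_"] by blast
 have pA: "(%_. A) : polys 0 UNIV" by (intro polys_const sU UNIV_I)
 have "ctr T0 : cball (ctr T0) h" using h_pos by simp
 then have "c * h ^ CARD('n) * (norm A)^2 <= integral (cball (ctr T0) (\<rho> * h / 2)) (%x. (norm A)^2)"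
 using c shaped[OF T0] pA by blast
 also have "\<dots> <= integral S.T (%x. (norm A)^2)" by (intro S.integral_T_ge_ball continuous_on_const) simp
 finally have "c * h ^ CARD('n) * (norm A)^2 <= 0" using I by linarith
 moreover have "0 < c * h ^ CARD('n) * (norm A)^2" using c h_pos A(1) by simp
 ultimately show False by linarith
 qed
 define I where "I = integral T0 (%x. t x \<bullet> (jacobian (v T0) (at x) - \<eta> T0 x))"
 define s :: real where "s = (if I <= 0 then 1 else -1)"
 define \<tau> where "\<tau> T x = (if T = T0 then s *R t x else 0)" for T x
 have s: "s ~= 0" "s * I <= 0" by (auto simp: s_def)
 have \<tau>0: "\<tau> T0 = (%x. s *R t x)" "T ~= T0 ==> \<tau> T = (%_. 0)" for T by (simp_all add: \<tau>_def fun_eq_iff)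
 have \<tau>k: "\<tau> T : polys k UNIV" for T
 proof (cases "T = T0")
 case True
 show ?thesis unfolding True \<tau>0(1) by (rule polys_scaleR[OF sU tk])
 next
 case False
 show ?thesis unfolding \<tau>0(2)[OF False] by (rule polys_zero[OF sU])
 qed
 have nt\<tau>: "nt_trace (outer_normal T F) (\<tau> T x) = 0" if "F facet_of T" "x : F" for T F x
 proof (cases "T = T0")
 case True
 have "nt_trace (outer_normal T0 F) (t x) = 0" using that True by (intro nt) simp_all
 then show ?thesis unfolding True \<tau>0(1) linear_scale[OF lin_nt] by simp
 next
 case False
 show ?thesis unfolding \<tau>0(2)[OF False] by (rule linear_0[OF lin_nt])
 qed
 have "\<tau> : Sigma_h k \<T>" unfolding Sigma_h_def mem_Collect_eq
 proof (intro conjI ballI allI impI)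
 show "\<tau> : broken_space \<T> (%T. polys k UNIV)" unfolding broken_space_def mem_Collect_eq
 proof (intro conjI ballI allI impI)
 show "\<tau> T : polys k UNIV" for T by (rule \<tau>k)
 fix T assume "T \<notin> \<T>"
 then have "T ~= T0" using T0 by blast
 then show "\<tau> T = (%_. 0)" by (rule \<tau>0(2))
 qed
 show "trace (\<tau> T x) = 0" for T x
 by (cases "T = T0") (simp_all add: \<tau>0 linear_scale[OF linear_trace] linear_0[OF linear_trace] t_def S.tau1_trace)
 fix T T' F x assume T: "T : \<T>" "T' : \<T>" and F: "T ~= T' & F facet_of T & F facet_of T'" and x: "x : F"
 have TF: "T ~= T'" "F facet_of T" "F facet_of T'" using F by auto
 have n: "outer_normal T F = - outer_normal T' F" using outer_normal_shared[OF T TF] by simp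
 have "nt_trace (outer_normal T F) (\<tau> T' x) = 0" unfolding n nt_trace_uminus nt\<tau>[OF TF(3) x] by simp
 then show "nt_trace (outer_normal T F) (\<tau> T x) = nt_trace (outer_normal T F) (\<tau> T' x)" using nt\<tau>[OF TF(2) x] by simp
 qed
 then have \<tau>S: "\<tau> : broken_sum (Sigma_h k \<T>) (broken_space \<T> D)"
 unfolding broken_sum_def mem_Collect_eq using D
 by (intro exI[of _ \<tau>] exI[of _ "%_ _. 0"] conjI) (simp_all add: broken_space_def)
 have "b2 \<T> \<tau> (v, \<eta>) = (SUM T:\<T>. (SUM F:{F. F facet_of T}. FI F (%x. nt_trace (outer_normal T F) (\<tau> T x) \<bullet> v T x))
 - integral T (%x. \<tau> T x \<bullet> (jacobian (v T) (at x) - \<eta> T x)))" by (rule b2_sum[OF \<tau>k v \<eta>])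
 also have "\<dots> = (SUM T:\<T>. if T = T0 then - (s * I) else 0)"
 proof (rule sum.cong[OF refl])
 fix T assume T: "T : \<T>"
 have "FI F (%x. nt_trace (outer_normal T F) (\<tau> T x) \<bullet> v T x) = 0" if F: "F facet_of T" for F
 by (rule FI_vanish[OF T F]) (simp add: nt\<tau>[OF F])
 moreover have "integral T (%x. \<tau> T x \<bullet> (jacobian (v T) (at x) - \<eta> T x)) = (if T = T0 then s * I else 0)"
 by (cases "T = T0") (simp_all add: \<tau>0 I_def)
 ultimately show "(SUM F:{F. F facet_of T}. FI F (%x. nt_trace (outer_normal T F) (\<tau> T x) \<bullet> v T x))
 - integral T (%x. \<tau> T x \<bullet> (jacobian (v T) (at x) - \<eta> T x)) = (if T = T0 then - (s * I) else 0)" by simp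
 qed
 also have "\<dots> = - (s * I)" using T0 finite_mesh by simp
 finally have "0 <= b2 \<T> \<tau> (v, \<eta>)" using s(2) by simp
 moreover have "\<tau> ~= (%_ _. 0)"
 proof
 assume "\<tau> = (%_ _. 0)"
 then have "\<tau> T0 x = 0" for x by simp
 then show False using tne s(1) by (simp add: \<tau>0)
 qed
 ultimately show ?thesis using \<tau>S by blast
qed

end

text \<open>The constant is chosen before domain and mesh. A nonzero trace-free matrix
  \<open>A\<close> exists from dimension two on; it feeds \<open>nonneg_test\<close>.\<close>

lemma inf_sup_general:
 fixes D :: "(real^'n::{finite,wellorder}) set => (real^'n::_ => real^'n::_^'n::_) set"
 assumes rho: "\<rho> > 0" and k: "k >= 1" and bp: "bubble_property k D \<rho>" and D: "!!T. (%_. 0) : D T"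
 and A: "A ~= 0" "trace (A :: real^'n::_^'n::_) = 0"
 shows "\<exists>C>0. ALL \<Omega> \<T>. mesh \<Omega> \<T> \<rho> -->
 (ALL v:V_h k \<Omega> \<T>. ALL \<gamma>:W_h k \<T>. ereal (C * norm_U \<T> (v, \<gamma>))
 <= (SUP (\<tau>, q) \<in> broken_sum (Sigma_h k \<T>) (broken_space \<T> D) \<times> Q_h k \<T> - {(%_ _. 0, %_ _. 0)}.
 ereal ((b1 \<T> v q + b2 \<T> \<tau> (v, \<gamma>)) / (l2_norm \<T> \<tau> + l2_norm \<T> q)))) &
 (ALL v:V0_h k \<Omega> \<T>. ALL \<gamma>:W_h k \<T>. ereal (C * norm_U \<T> (v, \<gamma>))
 <= (SUP \<tau> \<in> broken_sum (Sigma_h k \<T>) (broken_space \<T> D) - {%_ _. 0}. ereal (b2 \<T> \<tau> (v, \<gamma>) / l2_norm \<T> \<tau>)))"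
proof -
 obtain c K where c: "c > 0" and K: "K > 0" and pair: "ALL \<Omega> \<T> v \<gamma>. mesh \<Omega> (\<T> :: (real^'n::_) set set) \<rho> --> v : V_h k \<Omega> \<T> --> \<gamma> : W_h k \<T> -->
 test_pair k D c K \<Omega> \<T> v \<gamma>"
 using inf_sup_pair[OF rho k bp] by (elim exE conjE) (rule that; assumption)
 \<comment> \<open>The norm is at most \<open>sqrt (K * X)\<close> and the denominator at most twice
   that, while the form is at least \<open>c * X\<close>.\<close>
 define C where "C = c / (2 * K)"
 have C: "C > 0" using c K by (simp add: C_def)
 have ratio: "C * U <= b / N" if "0 <= U" "U^2 <= K * X" "0 < N" "N <= 2 * sqrt (K * X)" "c * X <= b" "0 <= X" for U b N X :: real
 proof -
 have KX: "0 <= K * X" using K that by simp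
 have "U <= sqrt (K * X)" using that(1,2) KX by (simp add: real_le_rsqrt)
 then have "U * N <= sqrt (K * X) * (2 * sqrt (K * X))" using that KX by (intro mult_mono) simp_all
 also have "\<dots> = 2 * (K * X)" using KX by simp
 finally have "C * (U * N) <= C * (2 * (K * X))" using C by (intro mult_left_mono) simp_all
 also have "\<dots> = c * X" using K by (simp add: C_def)
 also have "\<dots> <= b" by (rule that)
 finally show ?thesis using that(3) by (simp add: pos_le_divide_eq mult.assoc)
 qed
 have l2z: "l2_norm \<T> (%_ _. 0) = 0" for \<T> :: "(real^'n::_) set set" by (simp add: l2_norm_def l2_inner_def)
 have claims: "(EX \<tau>:broken_sum (Sigma_h k \<T>) (broken_space \<T> D). EX q:Q_h k \<T>. (\<tau>, q) ~= (%_ _. 0, %_ _. 0) &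
 C * norm_U \<T> (v, \<gamma>) <= (b1 \<T> v q + b2 \<T> \<tau> (v, \<gamma>)) / (l2_norm \<T> \<tau> + l2_norm \<T> q)) &
 (v : V0_h k \<Omega> \<T> --> (EX \<tau>:broken_sum (Sigma_h k \<T>) (broken_space \<T> D). \<tau> ~= (%_ _. 0) &
 C * norm_U \<T> (v, \<gamma>) <= b2 \<T> \<tau> (v, \<gamma>) / l2_norm \<T> \<tau>))"
 if ms: "mesh \<Omega> \<T> \<rho>" and v: "v : V_h k \<Omega> \<T>" and \<gamma>: "\<gamma> : W_h k \<T>" for \<Omega> \<T> v \<gamma>
 proof -
 interpret mesh \<Omega> \<T> \<rho> by (rule ms)
 have vk: "v T : polys (Suc k) UNIV" if "T : \<T>" for T by (rule raviart_thomas_split(1)[OF V_h_polys[OF v that] k])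
 have \<gamma>k: "\<gamma> T : polys k UNIV" if "T : \<T>" for T using \<gamma> that polys_UNIV by (auto simp: W_h_def broken_space_def)
 obtain X \<tau> q where X: "0 <= X" and \<tau>: "\<tau> : broken_sum (Sigma_h k \<T>) (broken_space \<T> D)" and q: "q : Q_h k \<T>"
 and \<tau>k: "ALL T:\<T>. \<tau> T : polys (Suc k) UNIV" and U: "(norm_U \<T> (v, \<gamma>))^2 <= K * X" and \<tau>n: "(l2_norm \<T> \<tau>)^2 <= K * X"
 and qn: "(l2_norm \<T> q)^2 <= K * X" and b: "c * X <= b1 \<T> v q + b2 \<T> \<tau> (v, \<gamma>)" and V0: "v : V0_h k \<Omega> \<T> --> b1 \<T> v q = 0"
 using pair[rule_format, OF ms v \<gamma>, unfolded test_pair_def] by (elim exE conjE) (rule that; assumption)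
 have U0: "0 <= norm_U \<T> (v, \<gamma>)" by (rule norm_U_nonneg)
 show ?thesis
 proof (cases "X = 0")
 case True
 then have "norm_U \<T> (v, \<gamma>) = 0" using U by simp
 moreover obtain t where t: "t : broken_sum (Sigma_h k \<T>) (broken_space \<T> D)" "t ~= (%_ _. 0)" "0 <= b2 \<T> t (v, \<gamma>)"
 using nonneg_test[where k=k and A=A and D=D and v=v and \<eta>=\<gamma>, OF k A D vk \<gamma>k] by blast
 moreover have "(%_ _. 0) : Q_h k \<T>" by (simp add: Q_h_def broken_space_def polys_zero sU)
 moreover have "b1 \<T> v (%_ _. 0) = 0" by (simp add: b1_def l2_inner_def)
 moreover have "0 <= b2 \<T> t (v, \<gamma>) / l2_norm \<T> t" using t(3) l2_norm_nonneg by (intro divide_nonneg_nonneg)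
 ultimately show ?thesis by (intro conjI impI bexI[of _ t] bexI[of _ "%_ _. 0"]) (simp_all add: l2z)
 next
 case False
 then have cX: "0 < c * X" using c X by simp
 have n\<tau>: "l2_norm \<T> \<tau> <= sqrt (K * X)" "l2_norm \<T> q <= sqrt (K * X)" using \<tau>n qn by (simp_all add: real_le_rsqrt)
 have b2z: "b2 \<T> \<tau> (v, \<gamma>) = 0" if "l2_norm \<T> \<tau> = 0" by (rule b2_vanish[OF \<tau>k[rule_format] vk \<gamma>k that])
 have b1z: "b1 \<T> v q = 0" if "l2_norm \<T> q = 0"
 proof -
 have "q T : polys k UNIV" if "T : \<T>" for T using q that by (simp add: Q_h_def broken_space_def)
 then have "q T x = 0" if "T : \<T>" "x : T" for T x using l2_norm_eq_0[OF _ \<open>l2_norm \<T> q = 0\<close> that] by blast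
 then have "integral T (%x. div_vec (v T) x \<bullet> q T x) = integral T (%x. 0)" if "T : \<T>" for T
 using that by (intro integral_cong) simp
 then show ?thesis by (simp add: b1_def l2_inner_def)
 qed
 have "l2_norm \<T> \<tau> + l2_norm \<T> q ~= 0"
 proof
 assume "l2_norm \<T> \<tau> + l2_norm \<T> q = 0"
 then have "l2_norm \<T> \<tau> = 0" "l2_norm \<T> q = 0" using l2_norm_nonneg[of \<T> \<tau>] l2_norm_nonneg[of \<T> q] by linarith+
 then show False using b1z b2z b cX by simp
 qed
 then have N: "0 < l2_norm \<T> \<tau> + l2_norm \<T> q" using l2_norm_nonneg[of \<T> \<tau>] l2_norm_nonneg[of \<T> q] by linarith
 have ne: "(\<tau>, q) ~= (%_ _. 0, %_ _. 0)"
 proof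
 assume "(\<tau>, q) = (%_ _. 0, %_ _. 0)"
 then have "\<tau> = (%_ _. 0)" "q = (%_ _. 0)" by simp_all
 then show False using N by (simp add: l2_norm_def l2_inner_def)
 qed
 have first: "C * norm_U \<T> (v, \<gamma>) <= (b1 \<T> v q + b2 \<T> \<tau> (v, \<gamma>)) / (l2_norm \<T> \<tau> + l2_norm \<T> q)"
 by (rule ratio[OF U0 U N _ b X]) (use n\<tau> in linarith)
 have second: "\<tau> ~= (%_ _. 0) & C * norm_U \<T> (v, \<gamma>) <= b2 \<T> \<tau> (v, \<gamma>) / l2_norm \<T> \<tau>" if v0: "v : V0_h k \<Omega> \<T>"
 proof -
 have b0: "c * X <= b2 \<T> \<tau> (v, \<gamma>)" using b V0 v0 by simp
 then have "l2_norm \<T> \<tau> ~= 0" using b2z cX by auto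
 then have N: "0 < l2_norm \<T> \<tau>" using l2_norm_nonneg[of \<T> \<tau>] by linarith
 have "l2_norm \<T> \<tau> <= 2 * sqrt (K * X)" using n\<tau>(1) l2_norm_nonneg[of \<T> \<tau>] by linarith
 then have "C * norm_U \<T> (v, \<gamma>) <= b2 \<T> \<tau> (v, \<gamma>) / l2_norm \<T> \<tau>" by (rule ratio[OF U0 U N _ b0 X])
 moreover have "\<tau> ~= (%_ _. 0)" using N by (auto simp: l2_norm_def l2_inner_def)
 ultimately show ?thesis by blast
 qed
 show ?thesis using \<tau> q ne first second by blast
 qed
 qed
 show ?thesis
 proof (rule exI[of _ C], rule conjI[OF C], intro allI impI conjI ballI)
 fix \<Omega> :: "(real^'n::_) set" and \<T> :: "(real^'n::_) set set" and v \<gamma> assume ms: "mesh \<Omega> \<T> \<rho>" and \<gamma>: "\<gamma> : W_h k \<T>"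
 show "ereal (C * norm_U \<T> (v, \<gamma>))
 <= (SUP (\<tau>, q) \<in> broken_sum (Sigma_h k \<T>) (broken_space \<T> D) \<times> Q_h k \<T> - {(%_ _. 0, %_ _. 0)}.
 ereal ((b1 \<T> v q + b2 \<T> \<tau> (v, \<gamma>)) / (l2_norm \<T> \<tau> + l2_norm \<T> q)))" if v: "v : V_h k \<Omega> \<T>"
 proof -
 obtain \<tau> q where t: "\<tau> : broken_sum (Sigma_h k \<T>) (broken_space \<T> D)" "q : Q_h k \<T>" "(\<tau>, q) ~= (%_ _. 0, %_ _. 0)"
 and r: "C * norm_U \<T> (v, \<gamma>) <= (b1 \<T> v q + b2 \<T> \<tau> (v, \<gamma>)) / (l2_norm \<T> \<tau> + l2_norm \<T> q)"
 using conjunct1[OF claims[OF ms v \<gamma>]] by blast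
 show ?thesis by (rule SUP_upper2[of "(\<tau>, q)"]) (use t r in simp_all)
 qed
 show "ereal (C * norm_U \<T> (v, \<gamma>))
 <= (SUP \<tau> \<in> broken_sum (Sigma_h k \<T>) (broken_space \<T> D) - {%_ _. 0}. ereal (b2 \<T> \<tau> (v, \<gamma>) / l2_norm \<T> \<tau>))" if v0: "v \<in> V0_h k \<Omega> \<T>"
 proof -
 have v: "v : V_h k \<Omega> \<T>" using v0 by (simp add: V0_h_def)
 obtain \<tau> where t: "\<tau> : broken_sum (Sigma_h k \<T>) (broken_space \<T> D)" "\<tau> ~= (%_ _. 0)"
 and r: "C * norm_U \<T> (v, \<gamma>) <= b2 \<T> \<tau> (v, \<gamma>) / l2_norm \<T> \<tau>"
 using conjunct2[OF claims[OF ms v \<gamma>]] v0 by blast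
 show ?thesis by (rule SUP_upper2[of \<tau>]) (use t r in simp_all)
 qed
 qed
qed

text \<open>\<open>nonneg_test\<close> puts a zero bubble part next to its \<open>Sigma_h\<close>
  part, so the zero function must be among the bubbles.\<close>

lemma zero_bubble2: "(%_. 0) : {%x. dev (rot2 (%y. bubble2 T y *R curl2_mat r y) x) |r. r : skew_polys_perp k T}"
proof -
 have c: "curl2_mat (%_. 0) y = 0" for y by (simp add: vec_eq_iff curl2_mat_nth pd_const)
 have "rot2 (%_. 0) x = 0" for x by (simp only: vec_eq_iff forall_2 rot2_nth pd_const) simp
 then have "(%_. 0) = (%x. dev (rot2 (%y. bubble2 T y *R curl2_mat (%_. 0) y) x))" by (simp add: c linear_0[OF linear_dev])
 moreover have "(%_. 0) : skew_polys_perp k T" by (simp add: skew_polys_perp_def polys_zero subspace_skew)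
 ultimately show ?thesis by blast
qed

lemma zero_bubble3: "(%_. 0) : {%x. dev (curl3_mat (%y. curl3_mat r y ** bubble3 T y) x) |r. r : skew_polys_perp k T}"
proof -
 have c: "curl3_mat (%_. 0) y = 0" for y by (simp only: vec_eq_iff forall_3 curl3_mat_nth[OF differentiable_const] pd_const) simp
 have "(%_. 0) = (%x. dev (curl3_mat (%y. curl3_mat (%_. 0) y ** bubble3 T y) x))"
 by (simp add: c linear_0[OF linear_mult_mat(2)] linear_0[OF linear_dev])
 moreover have "(%_. 0) : skew_polys_perp k T" by (simp add: skew_polys_perp_def polys_zero subspace_skew)
 ultimately show ?thesis by blast
qed

theorem theorem21:
  fixes k :: nat and \<rho> :: real
  assumes "k \<ge> 1" and "\<rho> > 0"
  shows
    "(\<forall>\<Omega> :: (real^2) set. bounded_lipschitz_domain \<Omega> \<longrightarrow>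
       (\<exists>C>0. \<forall>\<T>. simplicial_mesh \<Omega> \<T> \<and> quasi_uniform \<rho> \<T> \<longrightarrow>
         (\<forall>v\<in>V_h k \<Omega> \<T>. \<forall>\<gamma>\<in>W_h k \<T>.
            ereal (C * norm_U \<T> (v, \<gamma>))
              \<le> (SUP (\<tau>, q) \<in> Sigma_plus2 k \<T> \<times> Q_h k \<T> - {(\<lambda>_ _. 0, \<lambda>_ _. 0)}.
                   ereal ((b1 \<T> v q + b2 \<T> \<tau> (v, \<gamma>)) / (l2_norm \<T> \<tau> + l2_norm \<T> q)))) \<and>
         (\<forall>v\<in>V0_h k \<Omega> \<T>. \<forall>\<gamma>\<in>W_h k \<T>.
            ereal (C * norm_U \<T> (v, \<gamma>))
              \<le> (SUP \<tau> \<in> Sigma_plus2 k \<T> - {\<lambda>_ _. 0}.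
                   ereal (b2 \<T> \<tau> (v, \<gamma>) / l2_norm \<T> \<tau>))))) \<and>
     (\<forall>\<Omega> :: (real^3) set. bounded_lipschitz_domain \<Omega> \<longrightarrow>
       (\<exists>C>0. \<forall>\<T>. simplicial_mesh \<Omega> \<T> \<and> quasi_uniform \<rho> \<T> \<longrightarrow>
         (\<forall>v\<in>V_h k \<Omega> \<T>. \<forall>\<gamma>\<in>W_h k \<T>.
            ereal (C * norm_U \<T> (v, \<gamma>))
              \<le> (SUP (\<tau>, q) \<in> Sigma_plus3 k \<T> \<times> Q_h k \<T> - {(\<lambda>_ _. 0, \<lambda>_ _. 0)}.
                   ereal ((b1 \<T> v q + b2 \<T> \<tau> (v, \<gamma>)) / (l2_norm \<T> \<tau> + l2_norm \<T> q)))) \<and>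
         (\<forall>v\<in>V0_h k \<Omega> \<T>. \<forall>\<gamma>\<in>W_h k \<T>.
            ereal (C * norm_U \<T> (v, \<gamma>))
              \<le> (SUP \<tau> \<in> Sigma_plus3 k \<T> - {\<lambda>_ _. 0}.
                   ereal (b2 \<T> \<tau> (v, \<gamma>) / l2_norm \<T> \<tau>)))))"
proof -
 have ms2: "mesh \<Omega> \<T> \<rho>" if "bounded_lipschitz_domain \<Omega>" "simplicial_mesh \<Omega> \<T> & quasi_uniform \<rho> \<T>"
 for \<Omega> :: "(real^2) set" and \<T> using that assms(2) by (intro mesh.intro) auto
 have ms3: "mesh \<Omega> \<T> \<rho>" if "bounded_lipschitz_domain \<Omega>" "simplicial_mesh \<Omega> \<T> & quasi_uniform \<rho> \<T>"
 for \<Omega> :: "(real^3) set" and \<T> using that assms(2) by (intro mesh.intro) auto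
 define A2 :: "real^2^2" where "A2 = outer_prod (axis 1 1) (axis 2 1)"
 define A3 :: "real^3^3" where "A3 = outer_prod (axis 1 1) (axis 2 1)"
 have A2: "A2 ~= 0" "trace A2 = 0"
 using norm_outer_prod[of "axis 1 1 :: real^2" "axis 2 1"] by (auto simp: A2_def trace_outer_prod inner_axis_axis)
 have A3: "A3 ~= 0" "trace A3 = 0"
 using norm_outer_prod[of "axis 1 1 :: real^3" "axis 2 1"] by (auto simp: A3_def trace_outer_prod inner_axis_axis)
 \<comment> \<open>The constants are obtained before \<open>\<Omega>\<close> is fixed, so they serve
   all domains at once.\<close>
 obtain C2 where C2: "C2 > 0" and g2: "ALL \<Omega> \<T>. mesh \<Omega> (\<T> :: (real^2) set set) \<rho> -->
 (ALL v:V_h k \<Omega> \<T>. ALL \<gamma>:W_h k \<T>. ereal (C2 * norm_U \<T> (v, \<gamma>))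
 <= (SUP (\<tau>, q) \<in> Sigma_plus2 k \<T> \<times> Q_h k \<T> - {(%_ _. 0, %_ _. 0)}.
 ereal ((b1 \<T> v q + b2 \<T> \<tau> (v, \<gamma>)) / (l2_norm \<T> \<tau> + l2_norm \<T> q)))) &
 (ALL v:V0_h k \<Omega> \<T>. ALL \<gamma>:W_h k \<T>. ereal (C2 * norm_U \<T> (v, \<gamma>))
 <= (SUP \<tau> \<in> Sigma_plus2 k \<T> - {%_ _. 0}. ereal (b2 \<T> \<tau> (v, \<gamma>) / l2_norm \<T> \<tau>)))"
 using inf_sup_general[OF assms(2,1) bubble_property_2[OF assms(2,1)] zero_bubble2 A2]
 unfolding Sigma_plus2_def[symmetric] delta_Sigma2_def[symmetric] by (elim exE conjE) (rule that; assumption)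
 obtain C3 where C3: "C3 > 0" and g3: "ALL \<Omega> \<T>. mesh \<Omega> (\<T> :: (real^3) set set) \<rho> -->
 (ALL v:V_h k \<Omega> \<T>. ALL \<gamma>:W_h k \<T>. ereal (C3 * norm_U \<T> (v, \<gamma>))
 <= (SUP (\<tau>, q) \<in> Sigma_plus3 k \<T> \<times> Q_h k \<T> - {(%_ _. 0, %_ _. 0)}.
 ereal ((b1 \<T> v q + b2 \<T> \<tau> (v, \<gamma>)) / (l2_norm \<T> \<tau> + l2_norm \<T> q)))) &
 (ALL v:V0_h k \<Omega> \<T>. ALL \<gamma>:W_h k \<T>. ereal (C3 * norm_U \<T> (v, \<gamma>))
 <= (SUP \<tau> \<in> Sigma_plus3 k \<T> - {%_ _. 0}. ereal (b2 \<T> \<tau> (v, \<gamma>) / l2_norm \<T> \<tau>)))"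
 using inf_sup_general[OF assms(2,1) bubble_property_3[OF assms(2,1)] zero_bubble3 A3]
 unfolding Sigma_plus3_def[symmetric] delta_Sigma3_def[symmetric] by (elim exE conjE) (rule that; assumption)
 show ?thesis
 by (rule conjI, intro allI impI, rule exI[of _ C2], rule conjI[OF C2], rule allI, rule impI,
 rule mp[OF spec[OF spec[OF g2]]], rule ms2, assumption, assumption,
 intro allI impI, rule exI[of _ C3], rule conjI[OF C3], rule allI, rule impI,
 rule mp[OF spec[OF spec[OF g3]]], rule ms3, assumption, assumption)
qed

end
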